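(* Let $k$ be a fixed positive integer. If $G=(V,E)$ is a graph with $n$ vertices and $w : E \rightarrow \mathbb{R}$ is a weight function, then a maximum weight cycle with $k$ vertices in $G$ (if one exists) can be found, with high probability, in $O(n^3/\log n)$ time.
   Context: The weight of a cycle is the sum of the weights of its edges; the cycle need not be induced. Computation is in the addition-comparison model: real numbers may only be added and compared; the algorithm may be randomized. *)

theory Defs
  imports "HOL-Probability.Probability" "HOL-Library.Landau_Symbols" "HOL-Library.Log_Nat"
begin

section \<open>Graphs and cycles\<close>

text \<open>Finite simple undirected graphs on the vertex set \<open>{..<n}\<close>, given by their edge set.\<close>

definition simple_graph :: "nat \<Rightarrow> nat set set \<Rightarrow> bool" where
  "simple_graph n E \<longleftrightarrow> (\<forall>e\<in>E. e \<subseteq> {..<n} \<and> card e = 2)"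

definition cycle_edges :: "nat list \<Rightarrow> nat set set" where
  "cycle_edges xs = {{xs ! i, xs ! (Suc i mod length xs)} | i. i < length xs}"

text \<open>A cycle is given by its vertices in cyclic order. Chords are allowed.\<close>

definition is_cycle :: "nat set set \<Rightarrow> nat list \<Rightarrow> bool" where
  "is_cycle E xs \<longleftrightarrow> 3 \<le> length xs \<and> distinct xs \<and> cycle_edges xs \<subseteq> E"

definition cycle_weight :: "(nat set \<Rightarrow> real) \<Rightarrow> nat list \<Rightarrow> real" where
  "cycle_weight w xs = (\<Sum>e\<in>cycle_edges xs. w e)"

definition max_weight_cycle ::
    "nat \<Rightarrow> nat set set \<Rightarrow> (nat set \<Rightarrow> real) \<Rightarrow> nat list \<Rightarrow> bool" where
  "max_weight_cycle k E w xs \<longleftrightarrow>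
     is_cycle E xs \<and> length xs = k \<and>
     (\<forall>ys. is_cycle E ys \<and> length ys = k \<longrightarrow> cycle_weight w ys \<le> cycle_weight w xs)"

text \<open>The answer \<open>None\<close> asserts that there is no cycle with \<open>k\<close> vertices.\<close>

fun correct_answer ::
    "nat \<Rightarrow> nat set set \<Rightarrow> (nat set \<Rightarrow> real) \<Rightarrow> nat list option \<Rightarrow> bool" where
  "correct_answer k E w (Some xs) = max_weight_cycle k E w xs"
| "correct_answer k E w None = (\<nexists>xs. is_cycle E xs \<and> length xs = k)"


section \<open>The addition-comparison model\<close>

text \<open>
  A unit-cost random access machine, programmed in a structured language. A program owns
  finitely many named arrays of words and finitely many named arrays of reals; a scalar is
  the cell with index 0 of an array. Words carry the usual word arithmetic and serve as
  addresses. Real cells may only be copied, added and compared. Every cell that is not part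
  of the input is initially 0; for reals this adds no power, as \<open>x < 0\<close> can be
  decided by comparing \<open>x + y\<close> with \<open>y\<close>.
\<close>

type_synonym name = string

datatype wexp =
    Const nat
  | WLoad name wexp
  | WAdd wexp wexp
  | WSub wexp wexp
  | WMult wexp wexp
  | WDiv wexp wexp

datatype rexp =
    RLoad name wexp
  | RAdd rexp rexp

datatype bexp =
    WLess wexp wexp
  | RLess rexp rexp
  | Neg bexp
  | Conj bexp bexp

datatype com =
    Skip
  | WStore name wexp wexp
  | RStore name wexp rexp
  | Flip name wexp
  | Seq com com
  | Cond bexp com com
  | While bexp com

record state =
  words :: "name \<Rightarrow> nat \<Rightarrow> nat"
  reals :: "name \<Rightarrow> nat \<Rightarrow> real"
  coins :: "bool stream"

text \<open>
  The parameter \<open>b\<close> is the word length in bits: arithmetic is modulo \<open>2 ^ b\<close>, except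
  that subtraction is truncated at 0. Division by 0 yields 0.
\<close>

primrec wval :: "nat \<Rightarrow> state \<Rightarrow> wexp \<Rightarrow> nat" where
  "wval b s (Const m) = m mod 2 ^ b"
| "wval b s (WLoad x i) = words s x (wval b s i)"
| "wval b s (WAdd e f) = (wval b s e + wval b s f) mod 2 ^ b"
| "wval b s (WSub e f) = wval b s e - wval b s f"
| "wval b s (WMult e f) = (wval b s e * wval b s f) mod 2 ^ b"
| "wval b s (WDiv e f) = wval b s e div wval b s f"

primrec rval :: "nat \<Rightarrow> state \<Rightarrow> rexp \<Rightarrow> real" where
  "rval b s (RLoad x i) = reals s x (wval b s i)"
| "rval b s (RAdd e f) = rval b s e + rval b s f"

primrec bval :: "nat \<Rightarrow> state \<Rightarrow> bexp \<Rightarrow> bool" where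
  "bval b s (WLess e f) \<longleftrightarrow> wval b s e < wval b s f"
| "bval b s (RLess e f) \<longleftrightarrow> rval b s e < rval b s f"
| "bval b s (Neg p) \<longleftrightarrow> \<not> bval b s p"
| "bval b s (Conj p q) \<longleftrightarrow> bval b s p \<and> bval b s q"

primrec wcost :: "wexp \<Rightarrow> nat" where
  "wcost (Const m) = 1"
| "wcost (WLoad x i) = 1 + wcost i"
| "wcost (WAdd e f) = 1 + wcost e + wcost f"
| "wcost (WSub e f) = 1 + wcost e + wcost f"
| "wcost (WMult e f) = 1 + wcost e + wcost f"
| "wcost (WDiv e f) = 1 + wcost e + wcost f"

primrec rcost :: "rexp \<Rightarrow> nat" where
  "rcost (RLoad x i) = 1 + wcost i"
| "rcost (RAdd e f) = 1 + rcost e + rcost f"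

primrec bcost :: "bexp \<Rightarrow> nat" where
  "bcost (WLess e f) = 1 + wcost e + wcost f"
| "bcost (RLess e f) = 1 + rcost e + rcost f"
| "bcost (Neg p) = 1 + bcost p"
| "bcost (Conj p q) = 1 + bcost p + bcost q"

definition wstore :: "name \<Rightarrow> nat \<Rightarrow> nat \<Rightarrow> state \<Rightarrow> state" where
  "wstore x i v s = s\<lparr>words := (words s)(x := (words s x)(i := v))\<rparr>"

definition rstore :: "name \<Rightarrow> nat \<Rightarrow> real \<Rightarrow> state \<Rightarrow> state" where
  "rstore x i v s = s\<lparr>reals := (reals s)(x := (reals s x)(i := v))\<rparr>"

text \<open>
  \<open>exec b c s t s'\<close>: with word length \<open>b\<close>, program \<open>c\<close> started in \<open>s\<close> halts in \<open>s'\<close>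
  after \<open>t\<close> elementary operations. The outcomes of the coin tosses are part of the state,
  so this is deterministic.
\<close>

inductive exec :: "nat \<Rightarrow> com \<Rightarrow> state \<Rightarrow> nat \<Rightarrow> state \<Rightarrow> bool" for b where
  Skip: "exec b Skip s 1 s"
| WStore: "exec b (WStore x i e) s (1 + wcost i + wcost e)
    (wstore x (wval b s i) (wval b s e) s)"
| RStore: "exec b (RStore x i e) s (1 + wcost i + rcost e)
    (rstore x (wval b s i) (rval b s e) s)"
| Flip: "exec b (Flip x i) s (1 + wcost i)
    (wstore x (wval b s i) (if shd (coins s) then 1 mod 2 ^ b else 0)
      (s\<lparr>coins := stl (coins s)\<rparr>))"
| Seq: "exec b c s t s' \<Longrightarrow> exec b d s' u s'' \<Longrightarrow> exec b (Seq c d) s (t + u) s''"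
| CondTrue: "bval b s p \<Longrightarrow> exec b c s t s' \<Longrightarrow> exec b (Cond p c d) s (1 + bcost p + t) s'"
| CondFalse: "\<not> bval b s p \<Longrightarrow> exec b d s t s' \<Longrightarrow> exec b (Cond p c d) s (1 + bcost p + t) s'"
| WhileFalse: "\<not> bval b s p \<Longrightarrow> exec b (While p c) s (1 + bcost p) s"
| WhileTrue: "bval b s p \<Longrightarrow> exec b c s t s' \<Longrightarrow> exec b (While p c) s' u s'' \<Longrightarrow>
    exec b (While p c) s (1 + bcost p + t + u) s''"

lemma exec_deterministic:
  "exec b c s t s' \<Longrightarrow> exec b c s u s'' \<Longrightarrow> u = t \<and> s'' = s'"
proof (induction arbitrary: u s'' rule: exec.induct)
  case (Seq c s t s' d v s3)
  from Seq.prems show ?case by cases (use Seq.IH in blast)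
next
  case (CondTrue s p c t s' d)
  from CondTrue.prems show ?case by cases (use CondTrue.IH CondTrue.hyps in blast)+
next
  case (CondFalse s p d t s' c)
  from CondFalse.prems show ?case by cases (use CondFalse.IH CondFalse.hyps in blast)+
next
  case (WhileTrue s p c t s' v s3)
  from WhileTrue.prems show ?case by cases (use WhileTrue.IH WhileTrue.hyps in blast)+
qed (erule exec.cases; simp)+

text \<open>
  On inputs with \<open>n\<close> vertices the words have \<open>O(log n)\<close> bits; the factor \<open>q\<close> is
  fixed together with the program.
\<close>

definition word_length :: "nat \<Rightarrow> nat \<Rightarrow> nat" where
  "word_length q n = q * ceillog2 (n + 2)"

text \<open>
  The input consists of \<open>n\<close>, the adjacency matrix and the weight matrix in row-major order
  (entry 0 for pairs that are not edges), and an unbounded supply of coin tosses.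
\<close>

definition input :: "nat \<Rightarrow> nat set set \<Rightarrow> (nat set \<Rightarrow> real) \<Rightarrow> bool stream \<Rightarrow> state" where
  "input n E w \<omega> = \<lparr>
     words = (\<lambda>x m.
       if x = ''n'' \<and> m = 0 then n
       else if x = ''adj'' \<and> m < n * n \<and> {m div n, m mod n} \<in> E then 1
       else 0),
     reals = (\<lambda>x m.
       if x = ''weight'' \<and> m < n * n \<and> {m div n, m mod n} \<in> E then w {m div n, m mod n}
       else 0),
     coins = \<omega>\<rparr>"

definition answer :: "nat \<Rightarrow> state \<Rightarrow> nat list option" where
  "answer k s =
     (if words s ''found'' 0 = 0 then None else Some (map (words s ''cycle'') [0..<k]))"

definition fair_coins :: "bool stream measure" where
  "fair_coins = stream_space (measure_pmf (bernoulli_pmf (1 / 2)))"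

text \<open>
  \<open>T\<close> bounds the running time on all graphs with \<open>n\<close> vertices, for all outcomes of the coin
  tosses.
\<close>

definition runs_in_time :: "com \<Rightarrow> nat \<Rightarrow> (nat \<Rightarrow> nat) \<Rightarrow> bool" where
  "runs_in_time c q T \<longleftrightarrow>
     (\<forall>n\<ge>1. \<forall>E w \<omega>. simple_graph n E \<longrightarrow>
        (\<exists>t s. exec (word_length q n) c (input n E w \<omega>) t s \<and> t \<le> T n))"

definition success_probability ::
    "com \<Rightarrow> nat \<Rightarrow> nat \<Rightarrow> nat \<Rightarrow> nat set set \<Rightarrow> (nat set \<Rightarrow> real) \<Rightarrow> real" where
  "success_probability c q k n E w =
     \<P>(\<omega> in fair_coins. \<exists>t s. exec (word_length q n) c (input n E w \<omega>) t s \<and>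
        correct_answer k E w (answer k s))"

end

theory Submission
  imports Defs "HOL-Real_Asymp.Real_Asymp"
begin

text \<open>
  The algorithm is deterministic. For all vertices \<open>u\<close>, \<open>x\<close> and lengths \<open>j\<close> it maintains a family of at
  most \<open>C = (k + 1) ^ k\<close> simple paths with \<open>j\<close> vertices from \<open>u\<close> to \<open>x\<close> that represents all such paths:
  for every set \<open>X\<close> of at most \<open>k - j\<close> vertices, some member avoids \<open>X\<close> and is at least as heavy as any
  path that avoids \<open>X\<close>. Such a family is found by branching: take the heaviest path; if it meets
  \<open>X\<close>, guess at which of its positions, and continue with the heaviest path avoiding the vertices guessed so
  far. The families with \<open>k\<close> vertices yield a heaviest cycle.

  A pick for \<open>j + 1\<close> vertices from \<open>u\<close> to \<open>v\<close> maximises over the members of the families from \<open>u\<close> to \<open>x\<close>,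
  for all \<open>x\<close>, plus the edge from \<open>x\<close> to \<open>v\<close>. The vertices \<open>x\<close> are cut into blocks of size
  \<open>d = \<Theta>(log n)\<close>. Within a block the sequences of champions are found for all pairs \<open>(u, v)\<close> at once by
  Chan's dominance technique: for each of the polylogarithmically many candidate sequences, the pairs for which it is
  the right one are those where the row of \<open>u\<close> is dominated by the column of \<open>v\<close> in \<open>D = O(d)\<close>
  coordinates. As the right sequence is unique, reporting costs \<open>O(n^2)\<close> per block, hence \<open>O(n^3 / log n)\<close>
  in total; the recursion itself, run on chunks of \<open>m = 2 ^ mu\<close> columns with a small power \<open>m\<close> of \<open>n\<close>, is cheaper,
  because a row visits only leaves reached by at most \<open>D\<close> of the \<open>mu\<close> possible branchings. The block
  champions are then merged by scanning over the \<open>O(n / log n)\<close> blocks.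
\<close>

section \<open>Programs without overflow\<close>

text \<open>The forbidden vertices of a round depend on \<open>u\<close>, the earlier champions and
  the guessed positions; once the last two are fixed as a claim, they are a function of
  \<open>u\<close> alone. That the claimed champion is at least as good as a candidate then compares
  sums of a \<open>u\<close>-part and a \<open>v\<close>-part, hence is one dominance coordinate; a
  claim has one for each round and each candidate of the block. A candidate is inadmissible if its
  path is missing or meets the forbidden set, or if the edge to \<open>v\<close> is missing. Instead
  of infinite weights, a flag sum that is 2 exactly for admissible candidates is compared before the
  weight. Two exponentials fix the constants. As \<open>D\<close> is at most about
  \<open>mu / 16\<close>, there are \<open>O((3 / 2) ^ mu)\<close> words of \<open>mu\<close> bits
  with at most \<open>D\<close> ones. The factor \<open>(4 / 3) ^ mu\<close> missing to
  \<open>m = 2 ^ mu\<close> absorbs the number of claims and all other polylogarithmic factors, so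
  all claims of a block together stay within \<open>O(n ^ 2)\<close>. Machine words wrap around; the
  program logic reduces this to checking that every stored word is at most a fixed power of
  \<open>n + 2\<close>.\<close>

primrec wn :: "state \<Rightarrow> wexp \<Rightarrow> nat" where
  "wn s (Const m) = m"
| "wn s (WLoad x i) = words s x (wn s i)"
| "wn s (WAdd e f) = wn s e + wn s f"
| "wn s (WSub e f) = wn s e - wn s f"
| "wn s (WMult e f) = wn s e * wn s f"
| "wn s (WDiv e f) = wn s e div wn s f"

primrec rn :: "state \<Rightarrow> rexp \<Rightarrow> real" where
  "rn s (RLoad x i) = reals s x (wn s i)"
| "rn s (RAdd e f) = rn s e + rn s f"

primrec bn :: "state \<Rightarrow> bexp \<Rightarrow> bool" where
  "bn s (WLess e f) \<longleftrightarrow> wn s e < wn s f"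
| "bn s (RLess e f) \<longleftrightarrow> rn s e < rn s f"
| "bn s (Neg p) \<longleftrightarrow> \<not> bn s p"
| "bn s (Conj p q) \<longleftrightarrow> bn s p \<and> bn s q"

text \<open>If all stored words are at most \<open>V \<ge> 2\<close>, then \<open>e\<close> and its subexpressions evaluate to at
  most \<open>V ^ wdeg e\<close>.\<close>

primrec wdeg :: "wexp \<Rightarrow> nat" where
  "wdeg (Const m) = m + 1"
| "wdeg (WLoad x i) = 1 + wdeg i"
| "wdeg (WAdd e f) = wdeg e + wdeg f"
| "wdeg (WSub e f) = wdeg e + wdeg f"
| "wdeg (WMult e f) = wdeg e + wdeg f"
| "wdeg (WDiv e f) = wdeg e + wdeg f"

primrec rdeg :: "rexp \<Rightarrow> nat" where
  "rdeg (RLoad x i) = wdeg i"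
| "rdeg (RAdd e f) = rdeg e + rdeg f"

primrec bdeg :: "bexp \<Rightarrow> nat" where
  "bdeg (WLess e f) = wdeg e + wdeg f"
| "bdeg (RLess e f) = rdeg e + rdeg f"
| "bdeg (Neg p) = bdeg p"
| "bdeg (Conj p q) = bdeg p + bdeg q"

text \<open>A maximum over the commands suffices, whereas expressions need sums: every store brings
  the words back below \<open>V\<close>.\<close>

primrec cdeg :: "com \<Rightarrow> nat" where
  "cdeg Skip = 0"
| "cdeg (WStore x i e) = wdeg i + wdeg e"
| "cdeg (RStore x i e) = wdeg i + rdeg e"
| "cdeg (Flip x i) = wdeg i"
| "cdeg (Seq c d) = max (cdeg c) (cdeg d)"
| "cdeg (Cond p c d) = max (bdeg p) (max (cdeg c) (cdeg d))"
| "cdeg (While p c) = max (bdeg p) (cdeg c)"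

primrec modw :: "com \<Rightarrow> name set" where
  "modw Skip = {}"
| "modw (WStore x i e) = {x}"
| "modw (RStore x i e) = {}"
| "modw (Flip x i) = {x}"
| "modw (Seq c d) = modw c \<union> modw d"
| "modw (Cond p c d) = modw c \<union> modw d"
| "modw (While p c) = modw c"

primrec modr :: "com \<Rightarrow> name set" where
  "modr Skip = {}"
| "modr (WStore x i e) = {}"
| "modr (RStore x i e) = {x}"
| "modr (Flip x i) = {}"
| "modr (Seq c d) = modr c \<union> modr d"
| "modr (Cond p c d) = modr c \<union> modr d"
| "modr (While p c) = modr c"

primrec wnames :: "wexp \<Rightarrow> name set" where
  "wnames (Const m) = {}"
| "wnames (WLoad x i) = insert x (wnames i)"
| "wnames (WAdd e f) = wnames e \<union> wnames f"
| "wnames (WSub e f) = wnames e \<union> wnames f"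
| "wnames (WMult e f) = wnames e \<union> wnames f"
| "wnames (WDiv e f) = wnames e \<union> wnames f"

text \<open>The coin supply is left out of the comparison, since the program below tosses no
  coins.\<close>

definition agr :: "name set \<Rightarrow> name set \<Rightarrow> state \<Rightarrow> state \<Rightarrow> bool" where
  "agr W R s' s \<longleftrightarrow> (\<forall>x. x \<notin> W \<longrightarrow> words s' x = words s x) \<and> (\<forall>x. x \<notin> R \<longrightarrow> reals s' x = reals s x)"

lemma agr_refl [simp]: "agr W R s s"
  by (simp add: agr_def)

lemma agrw: "agr W R s' s \<Longrightarrow> x \<notin> W \<Longrightarrow> words s' x = words s x"
  and agrr: "agr W R s' s \<Longrightarrow> x \<notin> R \<Longrightarrow> reals s' x = reals s x"
  by (auto simp: agr_def)

lemma words_wstore [simp]: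
  "words (wstore x i v s) y = (if y = x then (words s x)(i := v) else words s y)"
  by (simp add: wstore_def)

lemma reals_wstore [simp]: "reals (wstore x i v s) = reals s"
  by (simp add: wstore_def)

lemma reals_rstore [simp]:
  "reals (rstore x i v s) y = (if y = x then (reals s x)(i := v) else reals s y)"
  by (simp add: rstore_def)

lemma words_rstore [simp]: "words (rstore x i v s) = words s"
  by (simp add: rstore_def)

lemma exec_agr: "exec b c s t s' \<Longrightarrow> agr (modw c) (modr c) s' s"
proof (induction rule: exec.induct)
  case (Flip x i s)
  then show ?case by (auto simp: agr_def wstore_def)
qed (auto simp: agr_def)

lemma wn_agr: "agr W R s' s \<Longrightarrow> wnames e \<inter> W = {} \<Longrightarrow> wn s' e = wn s e"
  by (induction e) (simp_all add: agr_def Int_Un_distrib2)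

abbreviation sv :: "name \<Rightarrow> wexp" where "sv x \<equiv> WLoad x (Const 0)"
abbreviation rsv :: "name \<Rightarrow> rexp" where "rsv x \<equiv> RLoad x (Const 0)"
abbreviation aset :: "name \<Rightarrow> wexp \<Rightarrow> com" (infix ":==" 62) where "x :== e \<equiv> WStore x (Const 0) e"
abbreviation seqs (infixr ";;" 60) where "c ;; d \<equiv> Seq c d"
abbreviation wadd (infixl "[+]" 65) where "e [+] f \<equiv> WAdd e f"
abbreviation wsub (infixl "[-]" 65) where "e [-] f \<equiv> WSub e f"
abbreviation wmul (infixl "[*]" 70) where "e [*] f \<equiv> WMult e f"
abbreviation wdiv (infixl "[div]" 70) where "e [div] f \<equiv> WDiv e f"
abbreviation weq (infix "[=]" 50) where "e [=] f \<equiv> Conj (Neg (WLess e f)) (Neg (WLess f e))"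
abbreviation wlt (infix "[<]" 50) where "e [<] f \<equiv> WLess e f"
abbreviation bor where "bor p q \<equiv> Neg (Conj (Neg p) (Neg q))"

text \<open>The bound \<open>e\<close> is evaluated anew at every test; the loop rules therefore
  demand that the body change neither the counter nor an array read by \<open>e\<close>.\<close>

definition For :: "name \<Rightarrow> wexp \<Rightarrow> com \<Rightarrow> com" where
  "For x e c = (x :== Const 0) ;; While (sv x [<] e) (c ;; x :== sv x [+] Const 1)"

lemma modw_For [simp]: "modw (For x e c) = insert x (modw c)"
  and modr_For [simp]: "modr (For x e c) = modr c"
  by (auto simp: For_def)

section \<open>Symbolic execution of straight-line code\<close>

primrec sl :: "com \<Rightarrow> bool" where
  "sl Skip = True"
| "sl (WStore x i e) = True"
| "sl (RStore x i e) = True"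
| "sl (Flip x i) = False"
| "sl (Seq c d) = (sl c \<and> sl d)"
| "sl (Cond p c d) = (sl c \<and> sl d)"
| "sl (While p c) = False"

text \<open>The clauses for \<open>Flip\<close> and \<open>While\<close> are dummies, here and in
  \<open>cst\<close>; the rules based on them require \<open>sl\<close>.\<close>

primrec sem :: "com \<Rightarrow> state \<Rightarrow> state" where
  "sem Skip = (\<lambda>s. s)"
| "sem (WStore x i e) = (\<lambda>s. wstore x (wn s i) (wn s e) s)"
| "sem (RStore x i e) = (\<lambda>s. rstore x (wn s i) (rn s e) s)"
| "sem (Flip x i) = (\<lambda>s. s)"
| "sem (Seq c d) = (\<lambda>s. sem d (sem c s))"
| "sem (Cond p c d) = (\<lambda>s. if bn s p then sem c s else sem d s)"
| "sem (While p c) = (\<lambda>s. s)"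

primrec cst :: "com \<Rightarrow> nat" where
  "cst Skip = 1"
| "cst (WStore x i e) = 1 + wcost i + wcost e"
| "cst (RStore x i e) = 1 + wcost i + rcost e"
| "cst (Flip x i) = 0"
| "cst (Seq c d) = cst c + cst d"
| "cst (Cond p c d) = 1 + bcost p + max (cst c) (cst d)"
| "cst (While p c) = 0"

text \<open>\<open>V\<close> bounds the stored words and \<open>G\<close> the degrees of the
  expressions. Together they keep every intermediate value below the modulus, so that overflow has
  to be excluded only where a word is stored, which is what \<open>safe\<close> expresses.\<close>

locale word =
  fixes b V G :: nat
  assumes V2: "V \<ge> 2" and VG: "V ^ G < 2 ^ b"
begin

primrec safe :: "com \<Rightarrow> state \<Rightarrow> bool" where
  "safe Skip s = True"
| "safe (WStore x i e) s = (wn s e \<le> V)"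
| "safe (RStore x i e) s = True"
| "safe (Flip x i) s = True"
| "safe (Seq c d) s = (safe c s \<and> safe d (sem c s))"
| "safe (Cond p c d) s = (if bn s p then safe c s else safe d s)"
| "safe (While p c) s = True"

definition bnd :: "state \<Rightarrow> bool" where
  "bnd s \<longleftrightarrow> (\<forall>x i. words s x i \<le> V)"

lemma bndD: "bnd s \<Longrightarrow> words s x i \<le> V"
  by (simp add: bnd_def)

lemma bnd_wstore: "bnd s \<Longrightarrow> v \<le> V \<Longrightarrow> bnd (wstore x i v s)"
  by (auto simp: bnd_def)

lemma bnd_rstore: "bnd s \<Longrightarrow> bnd (rstore x i v s)"
  by (auto simp: bnd_def)

lemma wdeg_pos: "wdeg e \<ge> 1"
  by (induction e) auto

text \<open>Both bounds are at least 2, because \<open>V >= 2\<close> and the exponents are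
  positive, and for such numbers the sum is at most the product. This lets \<open>wdeg\<close> treat
  addition like multiplication.\<close>

lemma add_le_mult: "x \<le> V ^ i \<Longrightarrow> y \<le> V ^ j \<Longrightarrow> i \<ge> 1 \<Longrightarrow> j \<ge> 1 \<Longrightarrow> x + y \<le> V ^ (i + j)"
proof -
  assume a: "x \<le> V ^ i" "y \<le> V ^ j" "i \<ge> 1" "j \<ge> 1"
  have 1: "V \<le> V ^ i" "V \<le> V ^ j"
    using a V2 by (auto intro: self_le_power)
  then obtain p q where "V ^ i = 2 + p" "V ^ j = 2 + q"
    using V2 by (meson le_trans nat_le_iff_add)
  then have "V ^ i + V ^ j \<le> V ^ i * V ^ j" by (simp add: algebra_simps)
  then show ?thesis using a by (simp add: power_add)
qed

lemma wn_le: "bnd s \<Longrightarrow> wn s e \<le> V ^ wdeg e"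
proof (induction e)
  case (Const m)
  have "m \<le> 2 ^ (m + 1)" using less_exp[of m] by (simp add: less_imp_le le_trans[of m "2 ^ m"])
  also have "\<dots> \<le> V ^ (m + 1)" using V2 by (intro power_mono) auto
  finally show ?case by simp
next
  case (WLoad x e)
  have "wn s (WLoad x e) \<le> V ^ 1" using bndD[OF WLoad.prems] by simp
  also have "\<dots> \<le> V ^ wdeg (WLoad x e)" using V2 by (intro power_increasing) auto
  finally show ?case .
next
  case (WAdd e1 e2)
  then show ?case using add_le_mult wdeg_pos by simp
next
  case (WSub e1 e2)
  then have "wn s (WSub e1 e2) \<le> V ^ wdeg e1" by simp
  also have "\<dots> \<le> V ^ wdeg (WSub e1 e2)" using V2 by (intro power_increasing) auto
  finally show ?case .
next
  case (WMult e1 e2)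
  then show ?case by (simp add: power_add mult_le_mono)
next
  case (WDiv e1 e2)
  then have "wn s (WDiv e1 e2) \<le> V ^ wdeg e1" using le_trans[OF div_le_dividend] by simp
  also have "\<dots> \<le> V ^ wdeg (WDiv e1 e2)" using V2 by (intro power_increasing) auto
  finally show ?case .
qed

lemma wn_less: "bnd s \<Longrightarrow> wdeg e \<le> G \<Longrightarrow> wn s e < 2 ^ b"
proof -
  assume a: "bnd s" "wdeg e \<le> G"
  have "wn s e \<le> V ^ wdeg e" using a wn_le by blast
  also have "\<dots> \<le> V ^ G" using a V2 by (intro power_increasing) auto
  finally show ?thesis using VG by simp
qed

lemma wval_wn: "bnd s \<Longrightarrow> wdeg e \<le> G \<Longrightarrow> wval b s e = wn s e"
proof (induction e)
  case (Const m) then show ?case using wn_less[of s "Const m"] by simp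
next
  case (WAdd e f) then show ?case using wn_less[of s "WAdd e f"] by simp
next
  case (WMult e f) then show ?case using wn_less[of s "WMult e f"] by simp
qed simp_all

lemma rval_rn: "bnd s \<Longrightarrow> rdeg e \<le> G \<Longrightarrow> rval b s e = rn s e"
  by (induction e) (auto simp: wval_wn)

lemma bval_bn: "bnd s \<Longrightarrow> bdeg e \<le> G \<Longrightarrow> bval b s e = bn s e"
  by (induction e) (auto simp: wval_wn rval_rn)

text \<open>A total-correctness triple with time bound \<open>t\<close> for a single initial state.
  The degree condition sits inside as a premise: it passes to subprograms by itself and is
  discharged only once, for the whole program.\<close>

definition H :: "nat \<Rightarrow> com \<Rightarrow> state \<Rightarrow> (state \<Rightarrow> bool) \<Rightarrow> bool" where
  "H t c s Q \<longleftrightarrow> (cdeg c \<le> G \<longrightarrow> bnd s \<longrightarrow> (\<exists>t' s'. exec b c s t' s' \<and> t' \<le> t \<and> bnd s' \<and> Q s'))"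

text \<open>Besides weakening, this rule hands over the frame: what the program text does not assign
  is unchanged, without any mention in \<open>Q\<close>.\<close>

lemma H_conseq: "H t c s Q \<Longrightarrow> t \<le> t' \<Longrightarrow>
    (\<And>s'. Q s' \<Longrightarrow> bnd s' \<Longrightarrow> agr (modw c) (modr c) s' s \<Longrightarrow> Q' s') \<Longrightarrow> H t' c s Q'"
  unfolding H_def by (blast intro: exec_agr le_trans)

lemma H_bnd: "(bnd s \<Longrightarrow> H t c s Q) \<Longrightarrow> H t c s Q"
  unfolding H_def by blast

lemma H_Seq: "H t c s R \<Longrightarrow>
    (\<And>s'. R s' \<Longrightarrow> bnd s' \<Longrightarrow> agr (modw c) (modr c) s' s \<Longrightarrow> H u d s' Q) \<Longrightarrow>
    t + u \<le> T \<Longrightarrow> H T (Seq c d) s Q"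
  unfolding H_def
proof (intro impI)
  assume 1: "cdeg c \<le> G \<longrightarrow> bnd s \<longrightarrow> (\<exists>t' s'. exec b c s t' s' \<and> t' \<le> t \<and> bnd s' \<and> R s')"
    and 2: "\<And>s'. R s' \<Longrightarrow> bnd s' \<Longrightarrow> agr (modw c) (modr c) s' s \<Longrightarrow>
      cdeg d \<le> G \<longrightarrow> bnd s' \<longrightarrow> (\<exists>t' s''. exec b d s' t' s'' \<and> t' \<le> u \<and> bnd s'' \<and> Q s'')"
    and 3: "t + u \<le> T" "cdeg (c ;; d) \<le> G" "bnd s"
  from 1 3 obtain t1 s1 where *: "exec b c s t1 s1" "t1 \<le> t" "bnd s1" "R s1" by auto
  with 2[OF *(4,3) exec_agr[OF *(1)]] 3 obtain t2 s2
    where **: "exec b d s1 t2 s2" "t2 \<le> u" "bnd s2" "Q s2" by auto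
  show "\<exists>t' s'. exec b (c ;; d) s t' s' \<and> t' \<le> T \<and> bnd s' \<and> Q s'"
    using exec.Seq[OF *(1) **(1)] *(2) **(2-4) 3(1) by (intro exI[of _ "t1 + t2"] exI[of _ s2]) auto
qed

lemma H_sl0: "sl c \<Longrightarrow> safe c s \<Longrightarrow> H (cst c) c s (\<lambda>s'. s' = sem c s)"
proof (induction c arbitrary: s)
  case Skip then show ?case by (auto simp: H_def intro!: exec.intros)
next
  case (WStore x i e)
  show ?case unfolding H_def
  proof (intro impI)
    assume a: "cdeg (WStore x i e) \<le> G" "bnd s"
    have "exec b (WStore x i e) s (1 + wcost i + wcost e) (wstore x (wval b s i) (wval b s e) s)"
      by (rule exec.intros)
    then show "\<exists>t' s'. exec b (WStore x i e) s t' s' \<and> t' \<le> cst (WStore x i e) \<and> bnd s' \<and> s' = sem (WStore x i e) s"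
      using a WStore by (intro exI[of _ "1 + wcost i + wcost e"] exI) (auto simp: wval_wn bnd_wstore)
  qed
next
  case (RStore x i e)
  show ?case unfolding H_def
  proof (intro impI)
    assume a: "cdeg (RStore x i e) \<le> G" "bnd s"
    have "exec b (RStore x i e) s (1 + wcost i + rcost e) (rstore x (wval b s i) (rval b s e) s)"
      by (rule exec.intros)
    then show "\<exists>t' s'. exec b (RStore x i e) s t' s' \<and> t' \<le> cst (RStore x i e) \<and> bnd s' \<and> s' = sem (RStore x i e) s"
      using a by (intro exI[of _ "1 + wcost i + rcost e"] exI) (auto simp: wval_wn rval_rn bnd_rstore)
  qed
next
  case (Flip x i) then show ?case by simp
next
  case (Seq c d)
  have "H (cst c) c s (\<lambda>s'. s' = sem c s)" using Seq by simp
  then show ?case by (rule H_Seq) (use Seq in auto)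
next
  case (Cond p c d)
  show ?case unfolding H_def
  proof (intro impI)
    assume a: "cdeg (Cond p c d) \<le> G" "bnd s"
    show "\<exists>t' s'. exec b (Cond p c d) s t' s' \<and> t' \<le> cst (Cond p c d) \<and> bnd s' \<and> s' = sem (Cond p c d) s"
    proof (cases "bn s p")
      case True
      then have "H (cst c) c s (\<lambda>s'. s' = sem c s)" using Cond by simp
      then obtain t' s' where "exec b c s t' s'" "t' \<le> cst c" "bnd s'" "s' = sem c s"
        using a by (auto simp: H_def)
      moreover then have "exec b (Cond p c d) s (1 + bcost p + t') s'"
        using True a bval_bn by (intro exec.intros) auto
      ultimately show ?thesis using True by (intro exI[of _ "1 + bcost p + t'"]) auto
    next
      case False
      then have "H (cst d) d s (\<lambda>s'. s' = sem d s)" using Cond by simp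
      then obtain t' s' where "exec b d s t' s'" "t' \<le> cst d" "bnd s'" "s' = sem d s"
        using a by (auto simp: H_def)
      moreover then have "exec b (Cond p c d) s (1 + bcost p + t') s'"
        using False a bval_bn by (intro exec.intros) auto
      ultimately show ?thesis using False by (intro exI[of _ "1 + bcost p + t'"]) auto
    qed
  qed
next
  case (While p c) then show ?case by simp
qed

lemma H_sl: "sl c \<Longrightarrow> (bnd s \<Longrightarrow> safe c s) \<Longrightarrow> Q (sem c s) \<Longrightarrow> cst c \<le> T \<Longrightarrow> H T c s Q"
  by (rule H_bnd, rule H_conseq[OF H_sl0]) auto

lemma H_Cond: "(bn s p \<Longrightarrow> H t c s Q) \<Longrightarrow> (\<not> bn s p \<Longrightarrow> H t d s Q) \<Longrightarrow> 1 + bcost p + t \<le> T \<Longrightarrow>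
   H T (Cond p c d) s Q"
  unfolding H_def
proof (intro impI)
  assume 1: "bn s p \<Longrightarrow> cdeg c \<le> G \<longrightarrow> bnd s \<longrightarrow> (\<exists>t' s'. exec b c s t' s' \<and> t' \<le> t \<and> bnd s' \<and> Q s')"
    and 2: "\<not> bn s p \<Longrightarrow> cdeg d \<le> G \<longrightarrow> bnd s \<longrightarrow> (\<exists>t' s'. exec b d s t' s' \<and> t' \<le> t \<and> bnd s' \<and> Q s')"
    and 3: "1 + bcost p + t \<le> T" and 4: "cdeg (Cond p c d) \<le> G" "bnd s"
  show "\<exists>t' s'. exec b (Cond p c d) s t' s' \<and> t' \<le> T \<and> bnd s' \<and> Q s'"
  proof (cases "bn s p")
    case True
    then obtain t' s' where *: "exec b c s t' s'" "t' \<le> t" "bnd s'" "Q s'" using 1 4 by auto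
    then have "exec b (Cond p c d) s (1 + bcost p + t') s'"
      using True 4 bval_bn by (intro exec.intros) auto
    with * 3 show ?thesis by (intro exI[of _ "1 + bcost p + t'"] exI[of _ s']) auto
  next
    case False
    then obtain t' s' where *: "exec b d s t' s'" "t' \<le> t" "bnd s'" "Q s'" using 2 4 by auto
    then have "exec b (Cond p c d) s (1 + bcost p + t') s'"
      using False 4 bval_bn by (intro exec.intros) auto
    with * 3 show ?thesis by (intro exI[of _ "1 + bcost p + t'"] exI[of _ s']) auto
  qed
qed

text \<open>The invariant is stated after the counter has been advanced, so that it may mention the
  counter cell only through \<open>i\<close>.\<close>

lemma H_For:
  assumes nm: "x \<notin> modw c" "wnames e \<inter> insert x (modw c) = {}"
    and N: "wn s e = N" "N \<le> V"
    and I0: "I 0 (wstore x 0 0 s)"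
    and step: "\<And>i s'. i < N \<Longrightarrow> I i s' \<Longrightarrow> words s' x 0 = i \<Longrightarrow> bnd s' \<Longrightarrow>
        agr (insert x (modw c)) (modr c) s' s \<Longrightarrow> H (t i) c s' (\<lambda>s''. I (Suc i) (wstore x 0 (Suc i) s''))"
    and Q: "\<And>s'. I N s' \<Longrightarrow> words s' x 0 = N \<Longrightarrow> bnd s' \<Longrightarrow> agr (insert x (modw c)) (modr c) s' s \<Longrightarrow> Q s'"
    and T: "(\<Sum>i<N. t i) + N * (wcost e + 10) + wcost e + 7 \<le> T"
  shows "H T (For x e c) s Q"
  unfolding H_def
proof (intro impI)
  assume G: "cdeg (For x e c) \<le> G" and bs: "bnd s"
  have Gc: "cdeg c \<le> G" and Ge: "wdeg e \<le> G" "wdeg (sv x) + wdeg e \<le> G" "wdeg (sv x) \<le> G" "1 + wdeg (sv x [+] Const 1) \<le> G" "wdeg (sv x [+] Const 1) \<le> G"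
    using G by (auto simp: For_def)
  let ?b = "c ;; x :== sv x [+] Const 1"
  \<comment> \<open>Induction on the number \<open>k\<close> of rounds left, so the counter is
    \<open>N - k\<close>. A round pays \<open>wcost e + 4\<close> for the test and 6 for advancing
    the counter; the initial store costs 3 and the failing test \<open>wcost e + 4\<close>. Hence
    the constants 10 and 7.\<close>
  have loop: "\<exists>t' s''. exec b (While (sv x [<] e) ?b) s' t' s'' \<and>
      t' \<le> (\<Sum>i=N-k..<N. t i) + k * (wcost e + 10) + wcost e + 4 \<and> bnd s'' \<and> I N s'' \<and> words s'' x 0 = N \<and>
      agr (insert x (modw c)) (modr c) s'' s"
    if "k \<le> N" "I (N - k) s'" "words s' x 0 = N - k" "bnd s'" "agr (insert x (modw c)) (modr c) s' s" for k s'
    using that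
  proof (induction k arbitrary: s')
    case 0
    have "wn s' e = N" using wn_agr[OF 0(5) nm(2)] N by simp
    then have "\<not> bval b s' (sv x [<] e)"
      using 0 Ge by (simp add: wval_wn)
    then have "exec b (While (sv x [<] e) ?b) s' (1 + bcost (sv x [<] e)) s'"
      by (rule exec.intros)
    with 0 show ?case by (intro exI[of _ "1 + bcost (sv x [<] e)"] exI[of _ s']) auto
  next
    case (Suc k)
    have e: "wn s' e = N" using wn_agr[OF Suc.prems(5) nm(2)] N by simp
    let ?i = "N - Suc k"
    have i: "?i < N" "Suc ?i = N - k" using Suc.prems by auto
    have "bval b s' (sv x [<] e)"
      using Suc.prems e Ge by (simp add: wval_wn)
    moreover
    obtain t1 s1 where 1: "exec b c s' t1 s1" "t1 \<le> t ?i" "bnd s1" "I (Suc ?i) (wstore x 0 (Suc ?i) s1)"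
      using step[OF i(1) Suc.prems(2-5)] Gc Suc.prems(4) unfolding H_def by blast
    have x1: "words s1 x 0 = ?i"
      using exec_agr[OF 1(1)] nm Suc.prems(3) by (auto simp: agr_def)
    let ?s2 = "wstore x 0 (Suc ?i) s1"
    have b2: "bnd ?s2" using 1 i N(2) by (intro bnd_wstore) auto
    have "wval b s1 (sv x [+] Const 1) = Suc ?i" "wval b s1 (Const 0) = 0"
      using wval_wn[OF 1(3) Ge(5)] x1 by simp_all
    then have "exec b (x :== sv x [+] Const 1) s1 6 ?s2"
      using exec.WStore[of b x "Const 0" "sv x [+] Const 1" s1] by (simp del: wval.simps add: eval_nat_numeral)
    then have "exec b ?b s' (t1 + 6) ?s2"
      by (rule exec.Seq[OF 1(1)])
    moreover
    have "agr (modw c) (modr c) s1 s'" by (rule exec_agr[OF 1(1)])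
    then have "agr (insert x (modw c)) (modr c) ?s2 s" using Suc.prems(5) by (auto simp: agr_def)
    then obtain t3 s3 where 3: "exec b (While (sv x [<] e) ?b) ?s2 t3 s3"
      "t3 \<le> (\<Sum>i=N-k..<N. t i) + k * (wcost e + 10) + wcost e + 4" "bnd s3" "I N s3" "words s3 x 0 = N"
      "agr (insert x (modw c)) (modr c) s3 s"
      using Suc.IH[of ?s2] Suc.prems b2 1 i by auto
    ultimately have "exec b (While (sv x [<] e) ?b) s' (1 + bcost (sv x [<] e) + (t1 + 6) + t3) s3"
      by (intro exec.WhileTrue)
    moreover have "(\<Sum>i=?i..<N. t i) = t ?i + (\<Sum>i=N-k..<N. t i)"
      using i by (metis sum.atLeast_Suc_lessThan)
    then have "1 + bcost (sv x [<] e) + (t1 + 6) + t3 \<le> (\<Sum>i=?i..<N. t i) + Suc k * (wcost e + 10) + wcost e + 4"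
      using 1(2) 3(2) by simp
    ultimately show ?case using 3 by blast
  qed
  let ?s0 = "wstore x 0 0 s"
  have "exec b (x :== Const 0) s (1 + wcost (Const 0) + wcost (Const 0)) (wstore x (wval b s (Const 0)) (wval b s (Const 0)) s)"
    by (rule exec.intros)
  then have e0: "exec b (x :== Const 0) s 3 ?s0" by (simp add: eval_nat_numeral)
  have "bnd ?s0" using bs by (simp add: bnd_wstore)
  moreover have "agr (insert x (modw c)) (modr c) ?s0 s" by (auto simp: agr_def)
  ultimately obtain t' s'' where L: "exec b (While (sv x [<] e) ?b) ?s0 t' s''"
     "t' \<le> (\<Sum>i=N-N..<N. t i) + N * (wcost e + 10) + wcost e + 4" "bnd s''" "I N s''" "words s'' x 0 = N"
      "agr (insert x (modw c)) (modr c) s'' s"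
    using loop[of N ?s0] I0 by auto
  have "exec b (For x e c) s (3 + t') s''"
    unfolding For_def by (rule exec.Seq[OF e0 L(1)])
  moreover have "3 + t' \<le> T" using L(2) T by (simp add: lessThan_atLeast0)
  ultimately show "\<exists>t' s'. exec b (For x e c) s t' s' \<and> t' \<le> T \<and> bnd s' \<and> Q s'"
    using Q L by blast
qed

lemma H_For_const:
  assumes "x \<notin> modw c" "wnames e \<inter> insert x (modw c) = {}"
    and "wn s e = N" "N \<le> V"
    and "I 0 (wstore x 0 0 s)"
    and "\<And>i s'. i < N \<Longrightarrow> I i s' \<Longrightarrow> words s' x 0 = i \<Longrightarrow> bnd s' \<Longrightarrow>
        agr (insert x (modw c)) (modr c) s' s \<Longrightarrow> H t c s' (\<lambda>s''. I (Suc i) (wstore x 0 (Suc i) s''))"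
    and "\<And>s'. I N s' \<Longrightarrow> words s' x 0 = N \<Longrightarrow> bnd s' \<Longrightarrow> agr (insert x (modw c)) (modr c) s' s \<Longrightarrow> Q s'"
    and T: "N * (t + wcost e + 10) + wcost e + 7 \<le> T"
  shows "H T (For x e c) s Q"
  by (rule H_For[where t = "\<lambda>_. t" and I = I and N = N]) (use assms in \<open>auto simp: algebra_simps\<close>)

end

section \<open>Walks through a ternary tree\<close>

text \<open>If \<open>r i j\<close>, the predecessors of \<open>i\<close> are predecessors of
  \<open>j\<close>, and \<open>i\<close> itself is a new one; so the rank is strictly monotone,
  hence injective on a finite set mapped into itself.\<close>

lemma rank_bij:
  fixes r :: "nat \<Rightarrow> nat \<Rightarrow> bool"
  assumes irr: "\<And>i. i < q \<Longrightarrow> \<not> r i i"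
    and tr: "\<And>i j l. i < q \<Longrightarrow> j < q \<Longrightarrow> l < q \<Longrightarrow> r i j \<Longrightarrow> r j l \<Longrightarrow> r i l"
    and tot: "\<And>i j. i < q \<Longrightarrow> j < q \<Longrightarrow> i \<noteq> j \<Longrightarrow> r i j \<or> r j i"
  shows "bij_betw (\<lambda>i. card {j. j < q \<and> r j i}) {..<q} {..<q}"
    and "\<And>i j. i < q \<Longrightarrow> j < q \<Longrightarrow>
      card {l. l < q \<and> r l i} < card {l. l < q \<and> r l j} \<longleftrightarrow> r i j"
proof -
  let ?f = "\<lambda>i. card {j. j < q \<and> r j i}"
  have lt: "?f i < ?f j" if "i < q" "j < q" "r i j" for i j
  proof (rule psubset_card_mono)
    have "{l. l < q \<and> r l i} \<subseteq> {l. l < q \<and> r l j}"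
      using tr[OF _ that(1,2) _ that(3)] by blast
    moreover have "i \<in> {l. l < q \<and> r l j}" "i \<notin> {l. l < q \<and> r l i}"
      using that irr[of i] by auto
    ultimately show "{l. l < q \<and> r l i} \<subset> {l. l < q \<and> r l j}" by blast
  qed simp
  show "?f i < ?f j \<longleftrightarrow> r i j" if "i < q" "j < q" for i j
  proof (cases "i = j")
    case True then show ?thesis using irr that by simp
  next
    case False
    then show ?thesis using lt[of i j] lt[of j i] that tot[of i j] by linarith
  qed
  have "inj_on ?f {..<q}"
  proof (rule inj_onI, rule ccontr)
    fix i j assume "i \<in> {..<q}" "j \<in> {..<q}" "?f i = ?f j" "i \<noteq> j"
    then show False using lt[of i j] lt[of j i] tot[of i j] by auto
  qed
  moreover have "?f ` {..<q} \<subseteq> {..<q}"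
  proof (clarsimp)
    fix i assume "i < q"
    then have "{j. j < q \<and> r j i} \<subset> {..<q}" using irr by auto
    then have "?f i < card {..<q}" by (intro psubset_card_mono) auto
    then show "?f i < q" by simp
  qed
  ultimately show "bij_betw ?f {..<q} {..<q}"
    by (simp add: bij_betw_def endo_inj_surj)
qed

text \<open>Supplies a code for every sequence of champions and for every sequence of guessed
  positions; \<open>digits_inj\<close> makes the code unique.\<close>

lemma ex_digits:
  fixes f :: "nat \<Rightarrow> nat"
  assumes "\<And>s. s < t \<Longrightarrow> f s < B"
  shows "\<exists>z<B ^ t. \<forall>s<t. z div B ^ s mod B = f s"
  using assms
proof (induction t arbitrary: f)
  case 0 then show ?case by auto
next
  case (Suc t)
  then have B: "B > 0" and f0: "f 0 < B" by force+
  obtain z where z: "z < B ^ t" "\<forall>s<t. z div B ^ s mod B = f (Suc s)"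
    using Suc.IH[of "\<lambda>s. f (Suc s)"] Suc.prems by auto
  have "z * B + f 0 < (z + 1) * B" using f0 by simp
  also have "\<dots> \<le> B ^ t * B" using z by (intro mult_right_mono) auto
  finally have "z * B + f 0 < B ^ Suc t" by (simp add: mult.commute)
  moreover have "(z * B + f 0) div B ^ s mod B = f s" if "s < Suc t" for s
  proof (cases s)
    case 0 then show ?thesis using f0 by simp
  next
    case (Suc s')
    have "(z * B + f 0) div B ^ s = (z * B + f 0) div B div B ^ s'"
      using Suc by (simp add: div_mult2_eq)
    also have "(z * B + f 0) div B = z" using f0 B by simp
    finally show ?thesis using z that Suc by simp
  qed
  ultimately show ?case by blast
qed

lemma digits_inj:
  fixes z :: nat
  assumes "z < B ^ t" "z' < B ^ t" "\<And>s. s < t \<Longrightarrow> z div B ^ s mod B = z' div B ^ s mod B"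
  shows "z = z'"
  using assms
proof (induction t arbitrary: z z')
  case 0 then show ?case by simp
next
  case (Suc t)
  have "z div B < B ^ t" "z' div B < B ^ t"
    using Suc.prems by (auto simp: less_mult_imp_div_less mult.commute)
  moreover have "z div B div B ^ s mod B = z' div B div B ^ s mod B" if "s < t" for s
    using Suc.prems(3)[of "Suc s"] that by (simp add: div_mult2_eq)
  ultimately have "z div B = z' div B" by (rule Suc.IH)
  moreover have "z mod B = z' mod B" using Suc.prems(3)[of 0] by simp
  ultimately show ?case by (metis div_mult_mod_eq)
qed

definition popc :: "nat \<Rightarrow> nat \<Rightarrow> nat" where
  "popc h J = (\<Sum>i<h. of_bool (odd (J div 2 ^ i)))"

lemma popc_Suc: "popc (Suc h) J = popc h J + of_bool (odd (J div 2 ^ h))"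
  by (simp add: popc_def)

lemma popc_div2: "popc (Suc h) J = of_bool (odd J) + popc h (J div 2)"
  unfolding popc_def by (subst sum.lessThan_Suc_shift) (simp add: div_mult2_eq)

type_synonym wstate = "bool \<times> nat \<times> nat \<times> nat"

text \<open>The columns of a node are split at the median of their keys. A test satisfied at the
  median settles coordinate \<open>ee\<close> for the whole upper half: bit 1 takes child
  \<open>3 * x + 2\<close>, the upper half with the next coordinate, and bit 0 keeps the undecided
  lower half. A failed test discards the lower half. Where nothing is to be chosen the bit must be
  0, or else the walk dies; this makes walks with different codes end in disjoint sets of
  columns.\<close>

definition wstep :: "nat \<Rightarrow> (nat \<Rightarrow> nat \<Rightarrow> nat) \<Rightarrow> (nat \<Rightarrow> nat \<Rightarrow> bool) \<Rightarrow> nat \<Rightarrow> bool \<Rightarrow> wstate \<Rightarrow> wstate" where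
  "wstep D med sat h bt = (\<lambda>(al, ee, hf, xx).
     if al then
       if ee < D then
         if sat ee (med h xx)
         then (if bt then (True, Suc ee, Suc h, 3 * xx + 2) else (True, ee, Suc h, 3 * xx))
         else (\<not> bt, ee, Suc h, 3 * xx + 1)
       else (\<not> bt, ee, hf, xx)
     else (False, ee, hf, xx))"

text \<open>The bits of \<open>J\<close> guess at which levels the walk moves on to the next coordinate.\<close>

primrec walk :: "nat \<Rightarrow> (nat \<Rightarrow> nat \<Rightarrow> nat) \<Rightarrow> (nat \<Rightarrow> nat \<Rightarrow> bool) \<Rightarrow> nat \<Rightarrow> nat \<Rightarrow> wstate" where
  "walk D med sat J 0 = (True, 0, 0, 0)"
| "walk D med sat J (Suc h) = wstep D med sat h (odd (J div 2 ^ h)) (walk D med sat J h)"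

lemma odd_div_mod: "i < h \<Longrightarrow> odd (J mod 2 ^ h div 2 ^ i) = odd ((J::nat) div 2 ^ i)"
  by (metis bit_iff_odd bit_take_bit_iff take_bit_eq_mod)

text \<open>A walk reads only the bits below its level, so a code can be truncated or extended by a
  top bit; the inductions on the level rest on this.\<close>

lemma walk_mod: "h \<le> h' \<Longrightarrow> walk D med sat (J mod 2 ^ h') h = walk D med sat J h"
  by (induction h) (auto simp: odd_div_mod)

text \<open>The tree is fixed before any row is known, so every row must find its outcome in it:
  child \<open>3 * x\<close> is the lower half, \<open>3 * x + 1\<close> the upper half for rows
  failing at the median, and \<open>3 * x + 2\<close> repeats the upper half with the next
  coordinate for rows passing there. Only \<open>sat\<close> depends on the row.\<close>

locale coltree =
  fixes mu D :: nat and cont :: "nat \<Rightarrow> nat \<Rightarrow> nat set" and ec :: "nat \<Rightarrow> nat \<Rightarrow> nat"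
    and med :: "nat \<Rightarrow> nat \<Rightarrow> nat" and sat :: "nat \<Rightarrow> nat \<Rightarrow> bool"
  assumes split: "\<And>h x. h < mu \<Longrightarrow> x < 3 ^ h \<Longrightarrow> cont (Suc h) (3 * x) \<union> cont (Suc h) (3 * x + 1) = cont h x"
    and disj: "\<And>h x. h < mu \<Longrightarrow> x < 3 ^ h \<Longrightarrow> cont (Suc h) (3 * x) \<inter> cont (Suc h) (3 * x + 1) = {}"
    and dup: "\<And>h x. h < mu \<Longrightarrow> x < 3 ^ h \<Longrightarrow> cont (Suc h) (3 * x + 2) = cont (Suc h) (3 * x + 1)"
    and ec0: "ec 0 0 = 0"
    and ec1: "\<And>h x. h < mu \<Longrightarrow> x < 3 ^ h \<Longrightarrow> ec (Suc h) (3 * x) = ec h x"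
    and ec2: "\<And>h x. h < mu \<Longrightarrow> x < 3 ^ h \<Longrightarrow> ec (Suc h) (3 * x + 1) = ec h x"
    and ec3: "\<And>h x. h < mu \<Longrightarrow> x < 3 ^ h \<Longrightarrow> ec (Suc h) (3 * x + 2) = Suc (ec h x)"
    and card: "\<And>h x. h \<le> mu \<Longrightarrow> x < 3 ^ h \<Longrightarrow> card (cont h x) = 2 ^ (mu - h)"
    and mono1: "\<And>h x v. h < mu \<Longrightarrow> x < 3 ^ h \<Longrightarrow> sat (ec h x) (med h x) \<Longrightarrow>
       v \<in> cont (Suc h) (3 * x + 1) \<Longrightarrow> sat (ec h x) v"
    and mono2: "\<And>h x v. h < mu \<Longrightarrow> x < 3 ^ h \<Longrightarrow> \<not> sat (ec h x) (med h x) \<Longrightarrow>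
       v \<in> cont (Suc h) (3 * x) \<Longrightarrow> \<not> sat (ec h x) v"
begin

abbreviation "wk \<equiv> walk D med sat"

lemma fin: "h \<le> mu \<Longrightarrow> x < 3 ^ h \<Longrightarrow> finite (cont h x)"
  using card[of h x] by (metis card.infinite power_not_zero zero_neq_numeral)

text \<open>Each bit 1 of a live walk settles one coordinate, whence \<open>ee = popc h J\<close>.
  The depth \<open>hf\<close> lags behind the level only once all coordinates are settled: the walk
  then rests at a node all of whose columns qualify.\<close>

lemma walk_inv:
  assumes "h \<le> mu" "wk J h = (True, ee, hf, xx)"
  shows "hf \<le> h \<and> xx < 3 ^ hf \<and> ec hf xx = ee \<and> ee \<le> D \<and> (ee < D \<longrightarrow> hf = h) \<and> ee = popc h J \<and>
     cont hf xx \<subseteq> cont 0 0 \<and> (\<forall>v\<in>cont hf xx. \<forall>e<ee. sat e v)"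
  using assms
proof (induction h arbitrary: ee hf xx)
  case 0 then show ?case by (auto simp: ec0 popc_def)
next
  case (Suc h)
  obtain al e0 h0 x0 where w: "wk J h = (al, e0, h0, x0)" by (metis prod_cases4)
  obtain bt where bt: "odd (J div 2 ^ h) = bt" by blast
  have ws: "wstep D med sat h bt (al, e0, h0, x0) = (True, ee, hf, xx)"
    using Suc.prems(2) w bt by simp
  then have al: "al = True" by (auto simp: wstep_def split: if_splits)
  have hm: "h < mu" using Suc.prems by simp
  have IH: "h0 \<le> h" "x0 < 3 ^ h0" "ec h0 x0 = e0" "e0 \<le> D" "e0 < D \<Longrightarrow> h0 = h" "e0 = popc h J"
     "cont h0 x0 \<subseteq> cont 0 0" "\<And>v e. v \<in> cont h0 x0 \<Longrightarrow> e < e0 \<Longrightarrow> sat e v"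
    using Suc.IH[of e0 h0 x0] hm w al by auto
  have pc: "popc (Suc h) J = e0 + of_bool bt" using IH(6) bt by (simp add: popc_Suc)
  show ?case
  proof (cases "e0 < D")
    case True
    then have h0: "h0 = h" "x0 < 3 ^ h" "ec h x0 = e0" using IH by auto
    note T = split[OF hm h0(2)] dup[OF hm h0(2)] ec1[OF hm h0(2)] ec2[OF hm h0(2)] ec3[OF hm h0(2)]
    have sub: "cont (Suc h) (3 * x0) \<subseteq> cont h x0" "cont (Suc h) (3 * x0 + 1) \<subseteq> cont h x0"
      using T(1) by auto
    have x3: "3 * x0 + 2 < 3 ^ Suc h" using h0(2) by simp
    show ?thesis
    proof (cases "sat e0 (med h x0)")
      case st: True
      show ?thesis
      proof (cases bt)
        case True
        have e: "ee = Suc e0" "hf = Suc h" "xx = 3 * x0 + 2"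
          using ws al st \<open>e0 < D\<close> True by (simp_all add: wstep_def)
        have "sat e v" if "v \<in> cont (Suc h) (3 * x0 + 1)" "e < Suc e0" for v e
        proof (cases "e = e0")
          case True then show ?thesis using mono1[OF hm h0(2)] st h0 that by simp
        next
          case False then show ?thesis using that IH(8) h0 sub by auto
        qed
        then show ?thesis
          unfolding e pc T(2) T(5) h0(3) using x3 True \<open>e0 < D\<close> IH(7) h0(1) sub(2) by auto
      next
        case False
        have e: "ee = e0" "hf = Suc h" "xx = 3 * x0"
          using ws al st \<open>e0 < D\<close> False by (simp_all add: wstep_def)
        show ?thesis
          unfolding e pc T(3) h0(3) using x3 False \<open>e0 < D\<close> IH(7,8) h0(1) sub(1) by auto
      qed
    next
      case False
      then have e: "ee = e0" "hf = Suc h" "xx = 3 * x0 + 1" "\<not> bt"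
        using ws al \<open>e0 < D\<close> by (simp_all add: wstep_def)
      show ?thesis
        unfolding e(1-3) pc T(4) h0(3) using e(4) x3 \<open>e0 < D\<close> IH(7,8) h0(1) sub(2) by auto
    qed
  next
    case False
    then have e: "ee = e0" "hf = h0" "xx = x0" "\<not> bt"
      using ws al by (simp_all add: wstep_def)
    show ?thesis unfolding e(1-3) pc using e(4) IH False by auto
  qed
qed

definition hits :: "nat \<Rightarrow> nat \<Rightarrow> nat set" where
  "hits h v = {J. J < 2 ^ h \<and> (case wk J h of (al, ee, hf, xx) \<Rightarrow> al \<and> v \<in> cont hf xx)}"

text \<open>Following a fixed column \<open>v\<close> leaves no freedom: the test at the median and
  the half that contains \<open>v\<close> force the bit.\<close>

lemma step_child:
  assumes "h < mu" "x < 3 ^ h" "ec h x = ee" "ee < D"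
    "wstep D med sat h bt (True, ee, h, x) = (True, ee', hf', xx')"
  shows "cont hf' xx' \<subseteq> cont h x \<and> (bt = (sat ee (med h x) \<and> v \<in> cont (Suc h) (3 * x + 1)) \<or> v \<notin> cont hf' xx')"
  using assms split[OF assms(1,2)] dup[OF assms(1,2)] disj[OF assms(1,2)]
  by (auto simp: wstep_def split: if_splits)

text \<open>The state before the last step is determined by the lower bits and, by
  \<open>step_child\<close>, forces the last bit. So dropping the last bit is injective on the codes
  that keep \<open>v\<close>.\<close>

lemma card_hits: "h \<le> mu \<Longrightarrow> card (hits h v) \<le> 1"
proof (induction h)
  case 0
  have "hits 0 v \<subseteq> {0}" by (auto simp: hits_def)
  then have "card (hits 0 v) \<le> card {0::nat}" by (intro card_mono) auto
  then show ?case by simp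
next
  case (Suc h)
  have wkm: "wk (J mod 2 ^ h) h = wk J h" for J by (simp add: walk_mod)
  have fact: "J mod 2 ^ h \<in> hits h v \<and> (odd (J div 2 ^ h) \<longleftrightarrow>
      (case wk J h of (al, ee, hf, xx) \<Rightarrow> ee < D \<and> sat ee (med h xx) \<and> v \<in> cont (Suc h) (3 * xx + 1)))"
    if J: "J \<in> hits (Suc h) v" for J
  proof -
    obtain e1 h1 x1 where 1: "wk J (Suc h) = (True, e1, h1, x1)" "v \<in> cont h1 x1"
      using J by (cases "wk J (Suc h)") (auto simp: hits_def simp del: walk.simps)
    obtain al ee hf xx where w: "wk J h = (al, ee, hf, xx)" by (metis prod_cases4)
    with 1 have al: "al = True" by (auto simp: wstep_def split: if_splits)
    have inv: "hf \<le> h \<and> xx < 3 ^ hf \<and> ec hf xx = ee \<and> ee \<le> D \<and> (ee < D \<longrightarrow> hf = h)"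
      using walk_inv[of h J ee hf xx] w al Suc.prems by auto
    show ?thesis
    proof (cases "ee < D")
      case True
      with inv have i: "h < mu" "xx < 3 ^ h" "ec h xx = ee" "hf = h" using Suc.prems by auto
      show ?thesis
        using step_child[OF i(1-3) True, of "odd (J div 2 ^ h)" e1 h1 x1 v] 1 w al i True
        by (auto simp: hits_def wkm)
    next
      case False
      then show ?thesis using 1 w al by (auto simp: hits_def wkm wstep_def)
    qed
  qed
  have "inj_on (\<lambda>J. J mod 2 ^ h) (hits (Suc h) v)"
  proof (rule inj_onI)
    fix J J' assume J: "J \<in> hits (Suc h) v" "J' \<in> hits (Suc h) v" "J mod 2 ^ h = J' mod 2 ^ h"
    then have "wk J h = wk J' h" by (metis wkm)
    then have "odd (J div 2 ^ h) = odd (J' div 2 ^ h)" using fact[OF J(1)] fact[OF J(2)] by simp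
    moreover have "J div 2 ^ h < 2" "J' div 2 ^ h < 2"
      using J by (auto simp: hits_def intro!: less_mult_imp_div_less)
    ultimately have "J div 2 ^ h = J' div 2 ^ h"
      by (auto simp: less_2_cases_iff)
    then show "J = J'" using J(3) by (metis div_mult_mod_eq)
  qed
  moreover have "(\<lambda>J. J mod 2 ^ h) ` hits (Suc h) v \<subseteq> hits h v" using fact by auto
  moreover have "finite (hits h v)" by (auto simp: hits_def)
  ultimately have "card (hits (Suc h) v) \<le> card (hits h v)" by (rule card_inj_on_le)
  then show ?case using Suc by simp
qed

lemma hits_complete:
  assumes "v \<in> cont 0 0" "\<And>e. e < D \<Longrightarrow> sat e v"
  shows "h \<le> mu \<Longrightarrow> hits h v \<noteq> {}"
proof (induction h)
  case 0 then show ?case using assms by (auto simp: hits_def)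
next
  case (Suc h)
  then obtain J where J: "J \<in> hits h v" by auto
  then obtain ee hf xx where w: "wk J h = (True, ee, hf, xx)" "v \<in> cont hf xx" "J < 2 ^ h"
    by (auto simp: hits_def)
  have inv: "hf \<le> h \<and> xx < 3 ^ hf \<and> ec hf xx = ee \<and> ee \<le> D \<and> (ee < D \<longrightarrow> hf = h)"
    using walk_inv[OF _ w(1)] Suc.prems by auto
  \<comment> \<open>The bit is 1 exactly if \<open>v\<close> lies in the upper half and the test at
    the median settles that half. If the test fails, \<open>mono2\<close> excludes the lower half,
    so \<open>v\<close> is kept with bit 0.\<close>
  define bt where "bt \<longleftrightarrow> ee < D \<and> sat ee (med h xx) \<and> v \<in> cont (Suc h) (3 * xx + 1)"
  define J' where "J' = J + (if bt then 2 ^ h else 0)"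
  have m: "J' mod 2 ^ h = J" "odd (J' div 2 ^ h) = bt" "J' < 2 ^ Suc h"
    using w(3) by (auto simp: J'_def)
  then have w': "wk J' h = (True, ee, hf, xx)" using walk_mod[of h h D med sat J'] w by simp
  have "J' \<in> hits (Suc h) v"
  proof (cases "ee < D")
    case True
    then have i: "h < mu" "xx < 3 ^ h" "ec h xx = ee" "hf = h" using inv Suc.prems by auto
    show ?thesis
      using split[OF i(1,2)] dup[OF i(1,2)] disj[OF i(1,2)] mono2[OF i(1,2), of v] assms(2)[OF True] True w w' m i
      by (auto simp: hits_def wstep_def bt_def)
  next
    case False
    then have "\<not> bt" by (simp add: bt_def)
    then show ?thesis using False w w' m by (auto simp: hits_def wstep_def)
  qed
  then show ?case by blast
qed

text \<open>A live walk has one bit 1 per settled coordinate, at most \<open>D\<close> in all; this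
  is why only the codes with few ones have to be tried. Coordinates still open at the bottom of the
  tree are tested directly.\<close>

lemma report_iff:
  "(\<exists>J<2 ^ mu. popc mu J \<le> D \<and> (case wk J mu of (al, ee, hf, xx) \<Rightarrow>
      al \<and> v \<in> cont hf xx \<and> (\<forall>e. ee \<le> e \<and> e < D \<longrightarrow> sat e v))) \<longleftrightarrow>
   v \<in> cont 0 0 \<and> (\<forall>e<D. sat e v)" (is "?L \<longleftrightarrow> ?R")
proof
  assume ?L
  then obtain J ee hf xx where "wk J mu = (True, ee, hf, xx)" "v \<in> cont hf xx"
    "\<forall>e. ee \<le> e \<and> e < D \<longrightarrow> sat e v" by auto
  then show ?R using walk_inv[of mu J ee hf xx] by (metis le_refl not_le subsetD)
next
  assume R: ?R
  then obtain J where "J \<in> hits mu v" using hits_complete[of v mu] by auto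
  then obtain ee hf xx where J: "J < 2 ^ mu" "wk J mu = (True, ee, hf, xx)" "v \<in> cont hf xx"
    by (auto simp: hits_def)
  moreover have "popc mu J \<le> D" using walk_inv[OF _ J(2)] by simp
  ultimately show ?L using R by auto
qed

text \<open>A node with open coordinates is reached only at full depth and holds a single column, so
  its cost is bounded by \<open>a + c * D\<close>. A node without open coordinates is output as a
  whole; by \<open>card_hits\<close> these nodes are disjoint, so their sizes are charged to the
  reported columns.\<close>

lemma report_cost:
  assumes "A \<subseteq> {..<2 ^ mu}"
  shows "(\<Sum>J\<in>A. case wk J mu of (al, ee, hf, xx) \<Rightarrow> if al then 2 ^ (mu - hf) * (a + c * (D - ee)) else 0)
    \<le> card A * (a + c * D) + a * card {v \<in> cont 0 0. \<forall>e<D. sat e v}"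
proof -
  \<comment> \<open>\<open>F J\<close> collects the columns reported without further tests.\<close>
  define F where "F J = (case wk J mu of (al, ee, hf, xx) \<Rightarrow> if al \<and> ee = D then cont hf xx else {})" for J
  have finA: "finite A" using assms finite_subset by blast
  have "(case wk J mu of (al, ee, hf, xx) \<Rightarrow> if al then 2 ^ (mu - hf) * (a + c * (D - ee)) else 0)
      \<le> (a + c * D) + a * card (F J)" for J
  proof -
    obtain al ee hf xx where w: "wk J mu = (al, ee, hf, xx)" by (metis prod_cases4)
    show ?thesis
    proof (cases al)
      case True
      then have i: "hf \<le> mu \<and> xx < 3 ^ hf \<and> ee \<le> D \<and> (ee < D \<longrightarrow> hf = mu)"
        using walk_inv[of mu J ee hf xx] w by auto
      show ?thesis
      proof (cases "ee = D")
        case True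
        with \<open>al\<close> i w show ?thesis by (simp add: F_def card algebra_simps)
      next
        case False
        with i have "hf = mu" by simp
        moreover have "c * (D - ee) \<le> c * D" by (rule mult_left_mono) auto
        ultimately show ?thesis using \<open>al\<close> w by (simp add: trans_le_add1)
      qed
    qed (simp add: w)
  qed
  then have "(\<Sum>J\<in>A. case wk J mu of (al, ee, hf, xx) \<Rightarrow> if al then 2 ^ (mu - hf) * (a + c * (D - ee)) else 0)
     \<le> (\<Sum>J\<in>A. (a + c * D) + a * card (F J))" by (intro sum_mono) auto
  also have "\<dots> = card A * (a + c * D) + a * (\<Sum>J\<in>A. card (F J))"
    by (simp add: sum.distrib sum_distrib_left)
  also have "(\<Sum>J\<in>A. card (F J)) = card (\<Union>J\<in>A. F J)"
  proof (rule card_UN_disjoint[symmetric])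
    show "\<forall>J\<in>A. finite (F J)"
    proof
      fix J assume "J \<in> A"
      obtain al ee hf xx where w: "wk J mu = (al, ee, hf, xx)" by (metis prod_cases4)
      then show "finite (F J)"
        using walk_inv[of mu J ee hf xx] fin by (auto simp: F_def)
    qed
    show "\<forall>J\<in>A. \<forall>J'\<in>A. J \<noteq> J' \<longrightarrow> F J \<inter> F J' = {}"
    proof (intro ballI impI)
      fix J J' assume J: "J \<in> A" "J' \<in> A" "J \<noteq> J'"
      show "F J \<inter> F J' = {}"
      proof (rule ccontr)
        assume "F J \<inter> F J' \<noteq> {}"
        then obtain v where "v \<in> F J" "v \<in> F J'" by auto
        then have "{J, J'} \<subseteq> hits mu v"
          using J assms by (auto simp: F_def hits_def split: prod.splits if_splits)
        then have "card {J, J'} \<le> 1"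
          using card_hits[of mu v] card_mono[of "hits mu v" "{J, J'}"] by (auto simp: hits_def)
        then show False using J by simp
      qed
    qed
  qed (use finA in auto)
  also have "\<dots> \<le> card {v \<in> cont 0 0. \<forall>e<D. sat e v}"
  proof (rule card_mono)
    show "finite {v \<in> cont 0 0. \<forall>e<D. sat e v}" using fin[of 0 0] by auto
    show "(\<Union>J\<in>A. F J) \<subseteq> {v \<in> cont 0 0. \<forall>e<D. sat e v}"
    proof clarify
      fix v J assume "J \<in> A" "v \<in> F J"
      obtain al ee hf xx where w: "wk J mu = (al, ee, hf, xx)" by (metis prod_cases4)
      then show "v \<in> cont 0 0 \<and> (\<forall>e<D. sat e v)"
        using \<open>v \<in> F J\<close> walk_inv[of mu J ee hf xx] by (auto simp: F_def split: if_splits)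
    qed
  qed
  finally show ?thesis by simp
qed

end

section \<open>Splitting at the median\<close>

lemma mr_eq: "(i::nat) < m \<Longrightarrow> i' < m \<Longrightarrow> a * m + i = a' * m + i' \<longleftrightarrow> a = a' \<and> i = i'"
  by (metis add.commute add_cancel_right_left div_less div_mult_self3 mod_less mod_mult_self1 mult.commute mult_eq_0_iff not_less_zero)

lemma mr_div: "(i::nat) < m \<Longrightarrow> (a * m + i) div m = a"
  by simp

lemma mr_less: "(i::nat) < m \<Longrightarrow> a < A \<Longrightarrow> a * m + i < A * m"
proof -
  assume "i < m" "a < A"
  then have "a * m + i < (a + 1) * m" by simp
  also have "\<dots> \<le> A * m" using \<open>a < A\<close> by (intro mult_right_mono) auto
  finally show ?thesis .
qed

text \<open>The key of a column is its pair of \<open>bf\<close> and \<open>bx\<close> at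
  \<open>pe e\<close> minus the pair at \<open>e\<close>, ordered lexicographically. The negative
  terms are moved to the other side, as reals cannot be subtracted and word subtraction is
  truncated.\<close>

definition klt :: "(nat \<Rightarrow> nat) \<Rightarrow> (nat \<Rightarrow> real) \<Rightarrow> (nat \<Rightarrow> nat) \<Rightarrow> nat \<Rightarrow> nat \<Rightarrow> nat \<Rightarrow> nat \<Rightarrow> bool" where
  "klt bf bx pe S e v v' \<longleftrightarrow>
     bf (pe e * S + v) + bf (e * S + v') < bf (pe e * S + v') + bf (e * S + v) \<or>
     (bf (pe e * S + v) + bf (e * S + v') = bf (pe e * S + v') + bf (e * S + v) \<and>
      bx (pe e * S + v) + bx (e * S + v') < bx (pe e * S + v') + bx (e * S + v))"

text \<open>Candidate \<open>e\<close> does not beat the claimed champion \<open>pe e\<close> in the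
  order by flag sum, weight and index, where a smaller index wins. The last comparison is not
  strict, so that the champion passes against itself.\<close>

definition satf :: "(nat \<Rightarrow> nat) \<Rightarrow> (nat \<Rightarrow> real) \<Rightarrow> (nat \<Rightarrow> nat) \<Rightarrow> (nat \<Rightarrow> real) \<Rightarrow> (nat \<Rightarrow> nat) \<Rightarrow>
    nat \<Rightarrow> nat \<Rightarrow> nat \<Rightarrow> nat \<Rightarrow> nat \<Rightarrow> bool" where
  "satf af ax bf bx pe S D u e v \<longleftrightarrow>
     af (u * D + e) + bf (e * S + v) < af (u * D + pe e) + bf (pe e * S + v) \<or>
     (af (u * D + e) + bf (e * S + v) = af (u * D + pe e) + bf (pe e * S + v) \<and>
      (ax (u * D + e) + bx (e * S + v) < ax (u * D + pe e) + bx (pe e * S + v) \<or>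
       (ax (u * D + e) + bx (e * S + v) = ax (u * D + pe e) + bx (pe e * S + v) \<and> pe e \<le> e)))"

text \<open>The row contributes constants to the two sides, so the test sees the column only through
  its key and survives when the key does not drop.\<close>

lemma satf_mono: "satf af ax bf bx pe S D u e v \<Longrightarrow> \<not> klt bf bx pe S e v' v \<Longrightarrow> satf af ax bf bx pe S D u e v'"
  unfolding satf_def klt_def by linarith

lemma klt_irrefl: "\<not> klt bf bx pe S e v v"
  by (simp add: klt_def)

lemma klt_trans: "klt bf bx pe S e u v \<Longrightarrow> klt bf bx pe S e v w \<Longrightarrow> klt bf bx pe S e u w"
  unfolding klt_def by linarith

lemma klt_ntrans: "\<not> klt bf bx pe S e u v \<Longrightarrow> \<not> klt bf bx pe S e v w \<Longrightarrow> \<not> klt bf bx pe S e u w"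
  unfolding klt_def by linarith

text \<open>Equal keys are ordered by position. This turns the weak order into a strict total one
  and the ranks into a permutation.\<close>

definition bef :: "(nat \<Rightarrow> nat \<Rightarrow> bool) \<Rightarrow> (nat \<Rightarrow> nat) \<Rightarrow> nat \<Rightarrow> nat \<Rightarrow> bool" where
  "bef K c l i \<longleftrightarrow> K (c l) (c i) \<or> (\<not> K (c i) (c l) \<and> l < i)"

definition rnk :: "(nat \<Rightarrow> nat \<Rightarrow> bool) \<Rightarrow> (nat \<Rightarrow> nat) \<Rightarrow> nat \<Rightarrow> nat \<Rightarrow> nat" where
  "rnk K c q i = card {l. l < q \<and> bef K c l i}"

locale weakord =
  fixes K :: "nat \<Rightarrow> nat \<Rightarrow> bool"
  assumes ir: "\<And>x. \<not> K x x" and tr: "\<And>x y z. K x y \<Longrightarrow> K y z \<Longrightarrow> K x z"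
    and nt: "\<And>x y z. \<not> K x y \<Longrightarrow> \<not> K y z \<Longrightarrow> \<not> K x z"
begin

lemma bef_ir: "\<not> bef K c i i"
  by (simp add: bef_def ir)

lemma bef_tr: "bef K c i j \<Longrightarrow> bef K c j l \<Longrightarrow> bef K c i l"
  unfolding bef_def using tr nt ir by (metis less_trans)

lemma bef_tot: "i \<noteq> j \<Longrightarrow> bef K c i j \<or> bef K c j i"
  unfolding bef_def by auto

lemma rnk_bij: "bij_betw (rnk K c q) {..<q} {..<q}"
  unfolding rnk_def
  by (rule rank_bij(1)) (use bef_ir[of c] bef_tr[of c] bef_tot[of _ _ c] in blast)+

lemma rnk_less:
  assumes "i < q" "j < q" "rnk K c q i < rnk K c q j"
  shows "\<not> K (c j) (c i)"
proof -
  have "rnk K c q i < rnk K c q j \<longleftrightarrow> bef K c i j"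
    unfolding rnk_def
    by (rule rank_bij(2)) (use bef_ir[of c] bef_tr[of c] bef_tot[of _ _ c] assms in blast)+
  then have "bef K c i j" using assms by simp
  then show ?thesis unfolding bef_def using tr ir by metis
qed

text \<open>Sorting the \<open>2 * hq\<close> values \<open>c i\<close> and cutting the sorted sequence in the middle.\<close>

definition cut :: "(nat \<Rightarrow> nat) \<Rightarrow> nat \<Rightarrow> (nat \<Rightarrow> nat) \<Rightarrow> (nat \<Rightarrow> nat) \<Rightarrow> bool" where
  "cut c hq A B \<longleftrightarrow> (\<forall>i<2 * hq. (rnk K c (2 * hq) i < hq \<longrightarrow> A (rnk K c (2 * hq) i) = c i) \<and>
     (hq \<le> rnk K c (2 * hq) i \<longrightarrow> B (rnk K c (2 * hq) i - hq) = c i))"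

text \<open>With \<open>g\<close> inverse to the rank, \<open>A j = c (g j)\<close> and
  \<open>B j = c (g (j + hq))\<close>, so every claim is about places in the sorted sequence. In
  particular \<open>B 0\<close> is a least element of the upper half; it serves as the
  median.\<close>

lemma halves:
  assumes inj: "inj_on c {..<2 * hq}"
    and cut: "cut c hq A B"
  shows "A ` {..<hq} \<union> B ` {..<hq} = c ` {..<2 * hq}"
    and "A ` {..<hq} \<inter> B ` {..<hq} = {}"
    and "inj_on A {..<hq}" and "inj_on B {..<hq}"
    and "\<And>i j. i < hq \<Longrightarrow> j < hq \<Longrightarrow> \<not> K (B j) (A i)"
    and "\<And>j. j < hq \<Longrightarrow> \<not> K (B j) (B 0)"
proof -
  let ?q = "2 * hq" let ?r = "rnk K c ?q"
  have A: "A (?r i) = c i" if "i < ?q" "?r i < hq" for i using cut that by (auto simp: cut_def)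
  have B: "B (?r i - hq) = c i" if "i < ?q" "?r i \<ge> hq" for i using cut that by (auto simp: cut_def)
  note bj = rnk_bij[of c ?q]
  define g where "g = inv_into {..<?q} ?r"
  have g: "g j < ?q" "?r (g j) = j" if "j < ?q" for j
    using bij_betw_inv_into_right[OF bj, of j] bij_betw_apply[OF bij_betw_inv_into[OF bj], of j] that
    unfolding g_def by simp_all
  have rr: "?r i < ?q" if "i < ?q" for i using bij_betw_apply[OF bj, of i] that by simp
  have Ag: "A j = c (g j)" if "j < hq" for j using A[of "g j"] g[of j] that by auto
  have Bg: "B j = c (g (j + hq))" if "j < hq" for j using B[of "g (j + hq)"] g[of "j + hq"] that by auto
  have cg: "c (g i) = c (g j) \<longleftrightarrow> i = j" if "i < ?q" "j < ?q" for i j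
  proof
    assume "c (g i) = c (g j)"
    then have "g i = g j" by (rule inj_onD[OF inj]) (use g that in simp_all)
    then have "?r (g i) = ?r (g j)" by (rule arg_cong)
    then show "i = j" by (simp only: g(2)[OF that(1)] g(2)[OF that(2)])
  qed simp
  show "A ` {..<hq} \<union> B ` {..<hq} = c ` {..<2 * hq}"
  proof (intro equalityI subsetI)
    fix v assume "v \<in> A ` {..<hq} \<union> B ` {..<hq}"
    then obtain j where "j < hq" "v = A j \<or> v = B j" by auto
    then have "v = c (g j) \<or> v = c (g (j + hq))" "j < ?q" "j + hq < ?q" using Ag[of j] Bg[of j] by auto
    moreover have "g j < ?q" "g (j + hq) < ?q" using g(1) \<open>j < ?q\<close> \<open>j + hq < ?q\<close> by blast+
    ultimately show "v \<in> c ` {..<2 * hq}" by blast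
  next
    fix v assume "v \<in> c ` {..<2 * hq}"
    then obtain i where i: "i < ?q" "v = c i" by auto
    show "v \<in> A ` {..<hq} \<union> B ` {..<hq}"
    proof (cases "?r i < hq")
      case True
      then have "v = A (?r i)" using A i by simp
      then show ?thesis using True by blast
    next
      case False
      then have "?r i - hq < hq" using rr[OF i(1)] by auto
      moreover have "v = B (?r i - hq)" using B i False by simp
      ultimately show ?thesis by blast
    qed
  qed
  show "A ` {..<hq} \<inter> B ` {..<hq} = {}"
  proof (intro equals0I, elim IntE imageE)
    fix v i j assume "v = A i" "i \<in> {..<hq}" "v = B j" "j \<in> {..<hq}"
    then show False using Ag[of i] Bg[of j] cg[of i "j + hq"] by simp
  qed
  show "inj_on A {..<hq}"
  proof (rule inj_onI)
    fix i j assume "i \<in> {..<hq}" "j \<in> {..<hq}" "A i = A j"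
    then show "i = j" using Ag[of i] Ag[of j] cg[of i j] by simp
  qed
  show "inj_on B {..<hq}"
  proof (rule inj_onI)
    fix i j assume "i \<in> {..<hq}" "j \<in> {..<hq}" "B i = B j"
    then show "i = j" using Bg[of i] Bg[of j] cg[of "i + hq" "j + hq"] by simp
  qed
  show "\<not> K (B j) (A i)" if "i < hq" "j < hq" for i j
    using rnk_less[of "g i" ?q "g (j + hq)" c] g[of i] g[of "j + hq"] that by (simp add: Ag Bg)
  show "\<not> K (B j) (B 0)" if "j < hq" for j
  proof (cases "j = 0")
    case False
    then show ?thesis
      using rnk_less[of "g hq" ?q "g (j + hq)" c] g[of hq] g[of "j + hq"] that Bg[of j] Bg[of 0] by simp
  qed (use ir in auto)
qed

end

lemma weakord_klt: "weakord (klt bf bx pe S e)"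
  by (rule weakord.intro, rule klt_irrefl, erule (1) klt_trans, erule (1) klt_ntrans)

text \<open>Node \<open>x\<close> of level \<open>h\<close> has number \<open>h * P + x\<close> and
  owns the \<open>m\<close> cells of \<open>T\<close> starting at \<open>(h * P + x) * m\<close>.
  The two cuts share the lower half and write the upper half to two children.\<close>

definition node_ok :: "nat \<Rightarrow> nat \<Rightarrow> nat \<Rightarrow> (nat \<Rightarrow> nat \<Rightarrow> nat \<Rightarrow> bool) \<Rightarrow> (nat \<Rightarrow> nat) \<Rightarrow> (nat \<Rightarrow> nat) \<Rightarrow> nat \<Rightarrow> nat \<Rightarrow> bool" where
  "node_ok mu m P K T E h x \<longleftrightarrow>
     weakord.cut (K (E (h * P + x))) (\<lambda>i. T ((h * P + x) * m + i)) (2 ^ (mu - Suc h))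
       (\<lambda>i. T ((Suc h * P + 3 * x) * m + i)) (\<lambda>i. T ((Suc h * P + 3 * x + 1) * m + i)) \<and>
     weakord.cut (K (E (h * P + x))) (\<lambda>i. T ((h * P + x) * m + i)) (2 ^ (mu - Suc h))
       (\<lambda>i. T ((Suc h * P + 3 * x) * m + i)) (\<lambda>i. T ((Suc h * P + 3 * x + 2) * m + i)) \<and>
     E (Suc h * P + 3 * x) = E (h * P + x) \<and> E (Suc h * P + 3 * x + 1) = E (h * P + x) \<and>
     E (Suc h * P + 3 * x + 2) = Suc (E (h * P + x))"

definition tcont :: "nat \<Rightarrow> nat \<Rightarrow> nat \<Rightarrow> (nat \<Rightarrow> nat) \<Rightarrow> nat \<Rightarrow> nat \<Rightarrow> nat set" where
  "tcont mu m P T h x = (\<lambda>i. T ((h * P + x) * m + i)) ` {..<2 ^ (mu - h)}"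

lemma less_3_pow_cases:
  assumes "x < 3 ^ Suc h"
  obtains y where "y < 3 ^ h" "x = 3 * y \<or> x = 3 * y + 1 \<or> x = 3 * y + (2::nat)"
proof -
  have "x = 3 * (x div 3) + x mod 3" by simp
  moreover have "x mod 3 < 3" by simp
  moreover have "x div 3 < 3 ^ h" using assms by (simp add: less_mult_imp_div_less)
  ultimately show ?thesis using that[of "x div 3"] by linarith
qed

text \<open>The value tested at a node is the first cell of child \<open>3 * x + 1\<close>, a least
  element of the upper half: if it passes, so does the whole upper half, and if it fails, so does
  the whole lower half, since \<open>sat\<close> is monotone in the order \<open>K\<close>.\<close>

lemma coltree_build:
  fixes K :: "nat \<Rightarrow> nat \<Rightarrow> nat \<Rightarrow> bool"
  assumes ok: "\<And>h x. h < mu \<Longrightarrow> x < 3 ^ h \<Longrightarrow> node_ok mu m P K T E h x"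
    and wo: "\<And>e. weakord (K e)"
    and E0: "E 0 = 0" and T0: "inj_on T {..<2 ^ mu}"
    and mono: "\<And>e v v'. sat e v \<Longrightarrow> \<not> K e v' v \<Longrightarrow> sat e v'"
  shows "coltree mu (tcont mu m P T) (\<lambda>h x. E (h * P + x)) (\<lambda>h x. T ((Suc h * P + 3 * x + 1) * m)) sat"
    and "\<And>h x. h \<le> mu \<Longrightarrow> x < 3 ^ h \<Longrightarrow> inj_on (\<lambda>i. T ((h * P + x) * m + i)) {..<2 ^ (mu - h)}"
proof -
  have NE: "E (Suc h * P + 3 * x) = E (h * P + x) \<and> E (Suc h * P + 3 * x + 1) = E (h * P + x) \<and>
      E (Suc h * P + 3 * x + 2) = Suc (E (h * P + x))" if "h < mu" "x < 3 ^ h" for h x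
    using ok[OF that] unfolding node_ok_def by blast
  have q: "2 ^ (mu - h) = (2::nat) * 2 ^ (mu - Suc h)" if "h < mu" for h
    using that by (metis Suc_diff_Suc power_Suc)
  show inj: "inj_on (\<lambda>i. T ((h * P + x) * m + i)) {..<2 ^ (mu - h)}" if "h \<le> mu" "x < 3 ^ h" for h x
    using that
  proof (induction h arbitrary: x)
    case 0 then show ?case using T0 by simp
  next
    case (Suc h)
    obtain y where y: "y < 3 ^ h" "x = 3 * y \<or> x = 3 * y + 1 \<or> x = 3 * y + 2"
      using less_3_pow_cases[OF Suc.prems(2)] by metis
    have hm: "h < mu" using Suc.prems by simp
    interpret weakord "K (E (h * P + y))" by (rule wo)
    have i: "inj_on (\<lambda>i. T ((h * P + y) * m + i)) {..<2 * 2 ^ (mu - Suc h)}"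
      using Suc.IH[of y] hm y q[OF hm] by simp
    note c = ok[OF hm y(1), unfolded node_ok_def]
    note h1 = halves(3,4)[OF i conjunct1[OF c]] and h2 = halves(4)[OF i conjunct1[OF conjunct2[OF c]]]
    show ?case using y(2) h1 h2 by (elim disjE) (simp_all only: add.assoc)
  qed
  have main: "tcont mu m P T (Suc h) (3 * x) \<union> tcont mu m P T (Suc h) (3 * x + 1) = tcont mu m P T h x
    \<and> tcont mu m P T (Suc h) (3 * x) \<inter> tcont mu m P T (Suc h) (3 * x + 1) = {}
    \<and> tcont mu m P T (Suc h) (3 * x + 2) = tcont mu m P T (Suc h) (3 * x + 1)
    \<and> (\<forall>v \<in> tcont mu m P T (Suc h) (3 * x). \<not> K (E (h * P + x)) (T ((Suc h * P + 3 * x + 1) * m)) v)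
    \<and> (\<forall>v \<in> tcont mu m P T (Suc h) (3 * x + 1). \<not> K (E (h * P + x)) v (T ((Suc h * P + 3 * x + 1) * m)))"
    if hx: "h < mu" "x < 3 ^ h" for h x
  proof -
    interpret weakord "K (E (h * P + x))" by (rule wo)
    let ?c = "\<lambda>i. T ((h * P + x) * m + i)" let ?hq = "2 ^ (mu - Suc h) :: nat"
    let ?A = "\<lambda>j. T ((Suc h * P + 3 * x) * m + j)" let ?B = "\<lambda>j. T ((Suc h * P + 3 * x + 1) * m + j)"
    let ?C = "\<lambda>j. T ((Suc h * P + 3 * x + 2) * m + j)"
    have i: "inj_on ?c {..<2 * ?hq}" using inj[of h x] hx q[OF hx(1)] by simp
    note c = ok[OF hx, unfolded node_ok_def]
    note hB = halves[OF i conjunct1[OF c]]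
    note hC = halves[OF i conjunct1[OF conjunct2[OF c]]]
    have t0: "tcont mu m P T (Suc h) (3 * x) = ?A ` {..<?hq}"
      and t1: "tcont mu m P T (Suc h) (3 * x + 1) = ?B ` {..<?hq}"
      and t2: "tcont mu m P T (Suc h) (3 * x + 2) = ?C ` {..<?hq}"
      and t: "tcont mu m P T h x = ?c ` {..<2 * ?hq}"
      using q[OF hx(1)] by (simp_all add: tcont_def add.assoc)
    have "?B ` {..<?hq} = ?C ` {..<?hq}"
    proof -
      \<comment> \<open>Both copies of the upper half are complements of the same lower
        half.\<close>
      have "X = Y" if "U \<union> X = W" "U \<inter> X = {}" "U \<union> Y = W" "U \<inter> Y = {}" for U X Y W :: "nat set"
        using that by blast
      then show ?thesis using hB(1,2) hC(1,2) by metis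
    qed
    moreover have "\<not> K (E (h * P + x)) (?B 0) v" if "v \<in> ?A ` {..<?hq}" for v
      using that hB(5)[of _ 0] by auto
    moreover have "\<not> K (E (h * P + x)) v (?B 0)" if "v \<in> ?B ` {..<?hq}" for v
      using that hB(6) by auto
    moreover have "?B 0 = T ((Suc h * P + 3 * x + 1) * m)" by simp
    ultimately show ?thesis unfolding t0 t1 t2 t using hB(1,2) by metis
  qed
  show "coltree mu (tcont mu m P T) (\<lambda>h x. E (h * P + x)) (\<lambda>h x. T ((Suc h * P + 3 * x + 1) * m)) sat"
  proof
    fix h x :: nat assume hx: "h \<le> mu" "x < 3 ^ h"
    show "card (tcont mu m P T h x) = 2 ^ (mu - h)"
      using card_image[OF inj[OF hx]] by (simp add: tcont_def)
  next
    fix h x :: nat assume hx: "h < mu" "x < 3 ^ h"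
    show "E (Suc h * P + 3 * x) = E (h * P + x)" "E (Suc h * P + (3 * x + 1)) = E (h * P + x)"
      "E (Suc h * P + (3 * x + 2)) = Suc (E (h * P + x))" using NE[OF hx] by (auto simp: add.assoc)
    show "tcont mu m P T (Suc h) (3 * x) \<union> tcont mu m P T (Suc h) (3 * x + 1) = tcont mu m P T h x"
      "tcont mu m P T (Suc h) (3 * x) \<inter> tcont mu m P T (Suc h) (3 * x + 1) = {}"
      "tcont mu m P T (Suc h) (3 * x + 2) = tcont mu m P T (Suc h) (3 * x + 1)"
      using main[OF hx] by blast+
    fix v
    show "sat (E (h * P + x)) v" if "sat (E (h * P + x)) (T ((Suc h * P + 3 * x + 1) * m))"
      "v \<in> tcont mu m P T (Suc h) (3 * x + 1)"
      using main[OF hx] mono that by blast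
    show "\<not> sat (E (h * P + x)) v" if "\<not> sat (E (h * P + x)) (T ((Suc h * P + 3 * x + 1) * m))"
      "v \<in> tcont mu m P T (Suc h) (3 * x)"
      using main[OF hx] mono that by blast
  qed (simp add: E0)
qed

section \<open>The dominance routine\<close>

text \<open>Whether \<open>af + bf\<close> and \<open>ax + bx\<close> at coordinate \<open>e\<close> lie lexicographically below the same sums
  at \<open>pe e\<close> is, after moving the column terms to one side, a comparison of a row key with a column
  key; \<open>KLT\<close> compares the column keys of two columns.\<close>

definition KLT :: "name \<Rightarrow> name \<Rightarrow> bexp" where
  "KLT a c = (let F = (\<lambda>p v. WLoad ''bf'' (sv p [*] sv ''S'' [+] sv v)); X = (\<lambda>p v. RLoad ''bx'' (sv p [*] sv ''S'' [+] sv v));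
       f1 = F ''kp'' a [+] F ''ke'' c; f2 = F ''kp'' c [+] F ''ke'' a in
     bor (f1 [<] f2) (Conj (f1 [=] f2) (RLess (RAdd (X ''kp'' a) (X ''ke'' c)) (RAdd (X ''kp'' c) (X ''ke'' a)))))"

definition klts :: "state \<Rightarrow> nat \<Rightarrow> nat \<Rightarrow> nat \<Rightarrow> bool" where
  "klts s = klt (words s ''bf'') (reals s ''bx'') (words s ''pe'') (words s ''S'' 0)"

lemma klts_agr: "agr W R s' s \<Longrightarrow> W \<inter> {''bf'', ''pe'', ''S''} = {} \<Longrightarrow> ''bx'' \<notin> R \<Longrightarrow> klts s' = klts s"
  unfolding klts_def by (simp add: agr_def)

lemma bn_KLT: "words s ''kp'' 0 = words s ''pe'' (words s ''ke'' 0) \<Longrightarrow>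
    bn s (KLT a c) = klts s (words s ''ke'' 0) (words s a 0) (words s c 0)"
  by (auto simp: KLT_def klts_def klt_def Let_def)

definition BEF :: bexp where
  "BEF = bor (KLT ''va'' ''vb'') (Conj (Neg (KLT ''vb'' ''va'')) (sv ''l'' [<] sv ''i''))"

lemma bn_BEF:
  assumes "words s ''kp'' 0 = words s ''pe'' (words s ''ke'' 0)"
    "words s ''va'' 0 = c (words s ''l'' 0)" "words s ''vb'' 0 = c (words s ''i'' 0)"
  shows "bn s BEF = bef (klts s (words s ''ke'' 0)) c (words s ''l'' 0) (words s ''i'' 0)"
  using assms by (simp add: BEF_def bn_KLT bef_def)

lemma bcost_BEF: "bcost BEF \<le> 420"
  by (simp add: BEF_def KLT_def Let_def)

section \<open>Building the column tree\<close>

definition RANK :: com where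
  "RANK = For ''l'' (sv ''q'') (''va'' :== WLoad ''tr'' (sv ''nd'' [*] sv ''m'' [+] sv ''l'') ;;
     Cond BEF (''rk'' :== sv ''rk'' [+] Const 1) Skip)"

lemma modw_RANK [simp]: "modw RANK = {''l'', ''va'', ''rk''}"
  and modr_RANK [simp]: "modr RANK = {}"
  by (auto simp: RANK_def)

text \<open>Sorting by counting predecessors takes quadratic time, which is affordable because a
  node has at most \<open>m\<close> columns and \<open>m\<close> is a small power of
  \<open>n\<close>.\<close>

definition SPREAD :: com where
  "SPREAD = For ''i'' (sv ''q'') (
     (''vb'' :== WLoad ''tr'' (sv ''nd'' [*] sv ''m'' [+] sv ''i'') ;; ''rk'' :== Const 0) ;;
     RANK ;;
     Cond (sv ''rk'' [<] sv ''hq'')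
       (WStore ''tr'' (sv ''cd'' [*] sv ''m'' [+] sv ''rk'') (sv ''vb''))
       (WStore ''tr'' ((sv ''cd'' [+] Const 1) [*] sv ''m'' [+] (sv ''rk'' [-] sv ''hq'')) (sv ''vb'') ;;
        WStore ''tr'' ((sv ''cd'' [+] Const 2) [*] sv ''m'' [+] (sv ''rk'' [-] sv ''hq'')) (sv ''vb'')))"

lemma modw_SPREAD [simp]: "modw SPREAD = {''i'', ''vb'', ''rk'', ''l'', ''va'', ''tr''}"
  and modr_SPREAD [simp]: "modr SPREAD = {}"
  by (auto simp: SPREAD_def)

definition NODE :: com where
  "NODE =
     (''nd'' :== sv ''h'' [*] sv ''P'' [+] sv ''x'' ;; ''cd'' :== (sv ''h'' [+] Const 1) [*] sv ''P'' [+] Const 3 [*] sv ''x'' ;;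
      ''q'' :== WLoad ''pw'' (sv ''mu'' [-] sv ''h'') ;; ''hq'' :== WLoad ''pw'' (sv ''mu'' [-] (sv ''h'' [+] Const 1)) ;;
      ''ke'' :== WLoad ''ec'' (sv ''nd'') ;; ''kp'' :== WLoad ''pe'' (sv ''ke'')) ;;
     SPREAD ;;
     (WStore ''ec'' (sv ''cd'') (sv ''ke'') ;; WStore ''ec'' (sv ''cd'' [+] Const 1) (sv ''ke'') ;;
      WStore ''ec'' (sv ''cd'' [+] Const 2) (sv ''ke'' [+] Const 1))"

lemma modw_NODE [simp]: "modw NODE = {''nd'', ''cd'', ''q'', ''hq'', ''ke'', ''kp'', ''i'', ''vb'', ''rk'', ''l'', ''va'', ''tr'', ''ec''}"
  and modr_NODE [simp]: "modr NODE = {}"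
  by (auto simp: NODE_def)

definition BUILD :: com where
  "BUILD = For ''i'' (sv ''m'') (WStore ''tr'' (sv ''i'') (sv ''ch'' [*] sv ''m'' [+] sv ''i'')) ;;
     WStore ''ec'' (Const 0) (Const 0) ;;
     For ''h'' (sv ''mu'') (For ''x'' (WLoad ''p3'' (sv ''h'')) NODE)"

lemma modw_BUILD [simp]: "modw BUILD = {''h'', ''x'', ''nd'', ''cd'', ''q'', ''hq'', ''ke'', ''kp'', ''i'', ''vb'', ''rk'', ''l'', ''va'', ''tr'', ''ec''}"
  and modr_BUILD [simp]: "modr BUILD = {}"
  by (auto simp: BUILD_def)

lemma rnk_cong: "(\<And>i. i < q \<Longrightarrow> c i = c' i) \<Longrightarrow> i < q \<Longrightarrow> rnk K c q i = rnk K c' q i"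
  unfolding rnk_def bef_def by (rule arg_cong[where f = card]) auto

lemma (in weakord) cut_cong:
  assumes c: "\<And>i. i < 2 * hq \<Longrightarrow> c i = c' i"
    and A: "\<And>i. i < hq \<Longrightarrow> A i = A' i" and B: "\<And>i. i < hq \<Longrightarrow> B i = B' i" and cut: "cut c hq A B"
  shows "cut c' hq A' B'"
  unfolding cut_def
proof (intro allI impI conjI, goal_cases)
  case (1 i)
  have r: "rnk K c' (2 * hq) i = rnk K c (2 * hq) i" using rnk_cong[of "2 * hq" c c' i] c 1 by simp
  show ?case using 1 cut A c unfolding cut_def r by simp
next
  case (2 i)
  have r: "rnk K c' (2 * hq) i = rnk K c (2 * hq) i" using rnk_cong[of "2 * hq" c c' i] c 2 by simp
  have "rnk K c (2 * hq) i - hq < hq" using bij_betw_apply[OF rnk_bij[of c "2 * hq"], of i] 2 r by auto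
  then have "B' (rnk K c (2 * hq) i - hq) = B (rnk K c (2 * hq) i - hq)" using B by simp
  moreover have "B (rnk K c (2 * hq) i - hq) = c i" using 2 cut unfolding cut_def r by simp
  ultimately show ?case using c 2 unfolding r by simp
qed

text \<open>A node, once processed, is not disturbed by writes outside its own cells and those of
  its three children.\<close>

lemma node_ok_cong:
  assumes ok: "node_ok mu m P K T E h x" and h: "h < mu" and m: "m = 2 ^ mu" and wo: "\<And>e. weakord (K e)"
    and T: "\<And>a. a div m \<in> {h * P + x, Suc h * P + 3 * x, Suc h * P + 3 * x + 1, Suc h * P + 3 * x + 2} \<Longrightarrow> T' a = T a"
    and E: "\<And>a. a \<in> {h * P + x, Suc h * P + 3 * x, Suc h * P + 3 * x + 1, Suc h * P + 3 * x + 2} \<Longrightarrow> E' a = E a"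
  shows "node_ok mu m P K T' E' h x"
proof -
  have q: "2 * 2 ^ (mu - Suc h) \<le> m" unfolding m using h by (simp flip: power_Suc)
  have T': "T (nd * m + i) = T' (nd * m + i)"
    if "nd \<in> {h * P + x, Suc h * P + 3 * x, Suc h * P + 3 * x + 1, Suc h * P + 3 * x + 2}" "i < m" for nd i
    using T[of "nd * m + i"] mr_div[OF that(2), of nd] that by metis
  have E': "E' (h * P + x) = E (h * P + x)" "E' (Suc h * P + 3 * x) = E (Suc h * P + 3 * x)"
     "E' (Suc h * P + 3 * x + 1) = E (Suc h * P + 3 * x + 1)" "E' (Suc h * P + 3 * x + 2) = E (Suc h * P + 3 * x + 2)"
    by (rule E, blast)+
  show ?thesis
    unfolding node_ok_def E'
  proof (intro conjI)
    show "weakord.cut (K (E (h * P + x))) (\<lambda>i. T' ((h * P + x) * m + i)) (2 ^ (mu - Suc h))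
       (\<lambda>i. T' ((Suc h * P + 3 * x) * m + i)) (\<lambda>i. T' ((Suc h * P + 3 * x + 1) * m + i))"
      by (rule weakord.cut_cong[OF wo _ _ _ conjunct1[OF ok[unfolded node_ok_def]]]; (rule T'; (use q in linarith | blast)))
    show "weakord.cut (K (E (h * P + x))) (\<lambda>i. T' ((h * P + x) * m + i)) (2 ^ (mu - Suc h))
       (\<lambda>i. T' ((Suc h * P + 3 * x) * m + i)) (\<lambda>i. T' ((Suc h * P + 3 * x + 2) * m + i))"
      by (rule weakord.cut_cong[OF wo _ _ _ conjunct1[OF conjunct2[OF ok[unfolded node_ok_def]]]]; (rule T'; (use q in linarith | blast)))
  qed (use ok[unfolded node_ok_def] in blast)+
qed

lemma card_less_Suc: "card {l. l < Suc k \<and> R l} = card {l. l < k \<and> R l} + (if R k then 1 else 0)"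
proof -
  have "{l. l < Suc k \<and> R l} = {l. l < k \<and> R l} \<union> (if R k then {k} else {})"
    by (auto simp: less_Suc_eq)
  then show ?thesis by simp
qed

context word
begin

lemma H_slS: "sl c \<Longrightarrow> (bnd s \<Longrightarrow> safe c s) \<Longrightarrow>
    (\<And>s'. s' = sem c s \<Longrightarrow> bnd s' \<Longrightarrow> agr (modw c) (modr c) s' s \<Longrightarrow> H u d s' Q) \<Longrightarrow> cst c + u \<le> T \<Longrightarrow> H T (Seq c d) s Q"
  by (rule H_bnd, rule H_Seq[OF H_sl0]) auto

lemma H_RANK:
  assumes s: "words s ''rk'' 0 = 0" "words s ''q'' 0 = q" "words s ''kp'' 0 = words s ''pe'' (words s ''ke'' 0)"
    and i: "words s ''i'' 0 = i" "words s ''vb'' 0 = words s ''tr'' (words s ''nd'' 0 * words s ''m'' 0 + i)"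
    and q: "q \<le> V"
  shows "H (600 * q + 100) RANK s (\<lambda>s'. words s' ''rk'' 0 =
     rnk (klts s (words s ''ke'' 0)) (\<lambda>l. words s ''tr'' (words s ''nd'' 0 * words s ''m'' 0 + l)) q i)"
proof -
  let ?c = "\<lambda>l. words s ''tr'' (words s ''nd'' 0 * words s ''m'' 0 + l)"
  let ?K = "klts s (words s ''ke'' 0)"
  show ?thesis unfolding RANK_def
  proof (rule H_For_const[where N = q and t = 500 and I = "\<lambda>k s'. words s' ''rk'' 0 = card {l. l < k \<and> bef ?K ?c l i}"], goal_cases)
    case (6 k s')
    note a = 6(5) and k = 6(1-4)
    note [simp] = agrw[OF a, simplified] agrr[OF a, simplified]
    have c: "card {l. l < k \<and> bef ?K ?c l i} \<le> k"
      using card_mono[of "{..<k}" "{l. l < k \<and> bef ?K ?c l i}"] by auto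
    have b: "bn (wstore ''va'' 0 (?c k) s') BEF \<longleftrightarrow> bef ?K ?c k i"
      using k s i by (subst bn_BEF[where c = ?c]) (simp_all add: klts_def)
    show ?case
      by (rule H_sl)
        (use k c q b bndD[OF k(4), of "''tr''"] bcost_BEF in \<open>simp_all add: card_less_Suc\<close>)
  qed (use s q in \<open>auto simp: rnk_def\<close>)
qed

end

text \<open>\<open>S\<close> is the row stride of the tables. The \<open>nc\<close> chunks of
  \<open>m\<close> columns may run past the last vertex, which \<open>nc * m <= S\<close> permits.
  \<open>jl\<close> lists the guess words tried for every row.\<close>

locale dompar = word +
  fixes n S mu m D P nc :: nat and jl :: "nat list"
  assumes m: "m = 2 ^ mu" and P: "P = 3 ^ mu"
    and bounds: "n \<le> V" "S \<le> V" "D \<le> V" "P * (mu + 2) \<le> V" "m \<le> V" "nc \<le> V" "mu + 2 \<le> V" "length jl \<le> V" "nc * m \<le> S"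
    and jl: "distinct jl" "set jl = {J. J < 2 ^ mu \<and> popc mu J \<le> D}"
begin

definition par :: "state \<Rightarrow> bool" where
  "par s \<longleftrightarrow> words s ''n'' 0 = n \<and> words s ''S'' 0 = S \<and> words s ''mu'' 0 = mu \<and> words s ''m'' 0 = m \<and>
     words s ''D'' 0 = D \<and> words s ''P'' 0 = P \<and> words s ''nc'' 0 = nc \<and> words s ''JN'' 0 = length jl \<and>
     (\<forall>h\<le>mu. words s ''pw'' h = 2 ^ h) \<and> (\<forall>h\<le>mu. words s ''p3'' h = 3 ^ h) \<and> (\<forall>i<length jl. words s ''jl'' i = jl ! i)"

definition "parnames = {''n'', ''S'', ''mu'', ''m'', ''D'', ''P'', ''nc'', ''JN'', ''pw'', ''p3'', ''jl''}"

lemma par_agr: "par s \<Longrightarrow> agr W R s' s \<Longrightarrow> W \<inter> parnames = {} \<Longrightarrow> par s'"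
  unfolding par_def parnames_def by (auto simp: agr_def)

lemma m_pos: "m > 0" and P_pos: "P > 0"
  by (auto simp: m P)

lemma pow3_le_P: "h \<le> mu \<Longrightarrow> 3 ^ h \<le> P"
  by (simp add: P power_increasing)

lemma pow2_le_m: "h \<le> mu \<Longrightarrow> 2 ^ h \<le> m"
  by (simp add: m power_increasing)

lemma node_le: "h \<le> mu \<Longrightarrow> x < P \<Longrightarrow> h * P + x < (mu + 1) * P"
  by (rule mr_less) auto

text \<open>As \<open>nd < cd\<close>, the source columns are never overwritten while the children
  are filled. Writes are tracked by the node number \<open>a div m\<close>; injectivity of the rank
  keeps cells already filled from being hit again.\<close>

lemma H_SPREAD:
  assumes s: "words s ''q'' 0 = 2 * hq" "words s ''hq'' 0 = hq" "words s ''kp'' 0 = words s ''pe'' (words s ''ke'' 0)"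
    "words s ''nd'' 0 = nd" "words s ''cd'' 0 = cd" "words s ''m'' 0 = m" and nd: "nd < cd"
    and q: "2 * hq \<le> m"
    and K: "K = klts s (words s ''ke'' 0)" and c: "c = (\<lambda>i. words s ''tr'' (nd * m + i))"
  shows "H (2000 * m * m + 100) SPREAD s (\<lambda>s'.
     weakord.cut K c hq (\<lambda>i. words s' ''tr'' (cd * m + i)) (\<lambda>i. words s' ''tr'' ((cd + 1) * m + i)) \<and>
     weakord.cut K c hq (\<lambda>i. words s' ''tr'' (cd * m + i)) (\<lambda>i. words s' ''tr'' ((cd + 2) * m + i)) \<and>
     (\<forall>a. a div m \<notin> {cd, cd + 1, cd + 2} \<longrightarrow> words s' ''tr'' a = words s ''tr'' a))"
proof -
  have wo: "weakord K" unfolding K klts_def by (rule weakord_klt)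
  let ?r = "rnk K c (2 * hq)"
  note bj = weakord.rnk_bij[OF wo, of c "2 * hq"]
  have r_lt: "?r i < 2 * hq" if "i < 2 * hq" for i using bij_betw_apply[OF bj, of i] that by simp
  have r_inj: "?r i = ?r j \<longleftrightarrow> i = j" if "i < 2 * hq" "j < 2 * hq" for i j
    using bij_betw_imp_inj_on[OF bj] that by (auto dest: inj_onD)
  have mV: "2 * hq \<le> V" using q bounds(5) by simp
  define I where "I k T \<longleftrightarrow> (\<forall>i<k. (?r i < hq \<longrightarrow> T (cd * m + ?r i) = c i) \<and>
      (hq \<le> ?r i \<longrightarrow> T ((cd + 1) * m + (?r i - hq)) = c i \<and> T ((cd + 2) * m + (?r i - hq)) = c i)) \<and>
      (\<forall>a. a div m \<notin> {cd, cd + 1, cd + 2} \<longrightarrow> T a = words s ''tr'' a)" for k and T :: "nat \<Rightarrow> nat"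
  show ?thesis unfolding SPREAD_def
  proof (rule H_For_const[where N = "2 * hq" and t = "600 * (2 * hq) + 300" and I = "\<lambda>k s'. I k (words s' ''tr'')"], goal_cases)
    case (6 k s')
    note a = 6(5) and k = 6(1,3,4) and I = 6(2)
    note ag = agrw[OF a, simplified] agrr[OF a, simplified]
    have ck: "words s' ''tr'' (nd * m + i) = c i" if "i < 2 * hq" for i
    proof -
      have "(nd * m + i) div m = nd" using that q by simp
      then show ?thesis using I nd unfolding I_def c by auto
    qed
    have rk: "rnk (klts s' (words s' ''ke'' 0)) (\<lambda>l. words s' ''tr'' (nd * m + l)) (2 * hq) k = ?r k"
    proof -
      have "klts s' (words s' ''ke'' 0) = K" using s by (simp add: K klts_def ag)
      moreover have "{l. l < 2 * hq \<and> bef K (\<lambda>l. words s' ''tr'' (nd * m + l)) l k} = {l. l < 2 * hq \<and> bef K c l k}"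
        using ck k(1) by (auto simp: bef_def)
      ultimately show ?thesis by (simp add: rnk_def)
    qed
    have bV: "words s' ''tr'' a \<le> V" for a using bndD[OF k(3)] .
    show ?case
    proof (rule H_slS[where u = "600 * (2 * hq) + 250"], simp, simp add: bV, goal_cases)
      case (1 s1)
      have s1: "words s1 ''vb'' 0 = c k" "words s1 ''rk'' 0 = 0" "words s1 ''i'' 0 = k"
        "\<And>x. x \<noteq> ''vb'' \<Longrightarrow> x \<noteq> ''rk'' \<Longrightarrow> words s1 x = words s' x" "reals s1 = reals s'"
        using ck k s ag by (simp_all add: 1(1))
      have ke: "klts s1 (words s1 ''ke'' 0) = klts s' (words s' ''ke'' 0)"
        using s1(4,5) by (simp add: klts_def)
      have "H (600 * (2 * hq) + 100) RANK s1 (\<lambda>s'. words s' ''rk'' 0 =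
         rnk (klts s1 (words s1 ''ke'' 0)) (\<lambda>l. words s1 ''tr'' (words s1 ''nd'' 0 * words s1 ''m'' 0 + l)) (2 * hq) k)"
        by (rule H_RANK) (use s1 s ag mV ck k in auto)
      then show ?case
      proof (rule H_Seq[where u = 150], goal_cases)
        case (1 s2)
        have r2: "words s2 ''rk'' 0 = ?r k" using 1(1) rk s1(4) s ag unfolding ke by simp
        have s2: "words s2 ''vb'' 0 = c k" "words s2 ''tr'' = words s' ''tr''" "words s2 ''hq'' 0 = hq"
          "words s2 ''cd'' 0 = cd" "words s2 ''m'' 0 = m"
          using agrw[OF 1(3), simplified] s1 s ag by simp_all
        have ckV: "c k \<le> V" using ck[OF k(1)] bV by metis
        have d: "(cd * m + i) div m = cd" "((cd + 1) * m + i) div m = cd + 1" "((cd + 2) * m + i) div m = cd + 2" if "i < m" for i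
          using mr_div[OF that] by blast+
        have rk2: "?r k < 2 * hq" using r_lt k by simp
        show ?case
        proof (rule H_sl, simp, goal_cases)
          case 1 show ?case using ckV s2 by simp
        next
          case 2
          show ?case
          proof (cases "?r k < hq")
            case True
            have "I (Suc k) ((words s' ''tr'')(cd * m + ?r k := c k))"
              unfolding I_def
            proof (intro conjI allI impI, goal_cases)
              case (1 i)
              then show ?case using I r_inj[of i k] k unfolding I_def by (auto simp: less_Suc_eq)
            next
              case (2 i)
              then have "?r i < 2 * hq" using r_lt k by simp
              then have "(cd + 1) * m + (?r i - hq) \<noteq> cd * m + ?r k"
                using mr_eq[of "?r i - hq" m "?r k" "cd + 1" cd] True q by auto
              then show ?case using 2 I True k unfolding I_def by (auto simp: less_Suc_eq)
            next
              case (3 i)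
              then have "?r i < 2 * hq" using r_lt k by simp
              then have "(cd + 2) * m + (?r i - hq) \<noteq> cd * m + ?r k"
                using mr_eq[of "?r i - hq" m "?r k" "cd + 2" cd] True q by auto
              then show ?case using 3 I True k unfolding I_def by (auto simp: less_Suc_eq)
            next
              case (4 a)
              then have "a \<noteq> cd * m + ?r k" using d(1)[of "?r k"] True q by auto
              then show ?case using 4 I unfolding I_def by auto
            qed
            then show ?thesis using True r2 s2 by simp
          next
            case False
            let ?j = "?r k - hq"
            have "I (Suc k) ((words s' ''tr'')((cd + 1) * m + ?j := c k, (cd + 2) * m + ?j := c k))"
              unfolding I_def
            proof (intro conjI allI impI, goal_cases)
              case (1 i)
              then have "cd * m + ?r i \<noteq> (cd + 1) * m + ?j" "cd * m + ?r i \<noteq> (cd + 2) * m + ?j"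
                using mr_eq[of "?r i" m ?j cd "cd + 1"] mr_eq[of "?r i" m ?j cd "cd + 2"] rk2 q by auto
              then show ?case using 1 I False k unfolding I_def by (auto simp: less_Suc_eq)
            next
              case (2 i)
              then have ri: "?r i < 2 * hq" using r_lt k by simp
              have e: "(cd + 1) * m + (?r i - hq) = (cd + 1) * m + ?j \<longleftrightarrow> i = k"
                using mr_eq[of "?r i - hq" m ?j "cd + 1" "cd + 1"] ri rk2 q 2 False r_inj[of i k] k by auto
              have "(cd + 1) * m + (?r i - hq) \<noteq> (cd + 2) * m + ?j"
                using mr_eq[of "?r i - hq" m ?j "cd + 1" "cd + 2"] ri rk2 q by auto
              then show ?case using 2 I k e unfolding I_def by (auto simp: less_Suc_eq)
            next
              case (3 i)
              then have ri: "?r i < 2 * hq" using r_lt k by simp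
              have e: "(cd + 2) * m + (?r i - hq) = (cd + 2) * m + ?j \<longleftrightarrow> i = k"
                using mr_eq[of "?r i - hq" m ?j "cd + 2" "cd + 2"] ri rk2 q 3 False r_inj[of i k] k by auto
              have "(cd + 2) * m + (?r i - hq) \<noteq> (cd + 1) * m + ?j"
                using mr_eq[of "?r i - hq" m ?j "cd + 2" "cd + 1"] ri rk2 q by auto
              then show ?case using 3 I k e unfolding I_def by (auto simp: less_Suc_eq)
            next
              case (4 a)
              have "?j < m" using rk2 q by linarith
              then have "a \<noteq> (cd + 1) * m + ?j" "a \<noteq> (cd + 2) * m + ?j"
                using 4 d(2,3)[of ?j] by (metis insertI1 insertI2)+
              then show ?case using 4 I unfolding I_def by auto
            qed
            then show ?thesis using False r2 s2 by simp
          qed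
        next
          case 3 show ?case by simp
        qed
      next
        case 2 show ?case by simp
      qed
    next
      case 2 show ?case by simp
    qed
  next
    case (7 s')
    from 7(1) show ?case by (auto simp: I_def weakord.cut_def[OF wo])
  next
    case 8
    have "2 * hq * (600 * (2 * hq) + 312) \<le> m * (600 * m + 312)"
      by (intro mult_mono add_mono) (use q in auto)
    also have "\<dots> \<le> 912 * (m * m)" using m_pos by (cases m) (auto simp: algebra_simps)
    finally show ?case by (simp add: algebra_simps)
  qed (use s mV in \<open>simp_all add: I_def\<close>)
qed

lemma weakord_klts: "weakord (klts s e)"
  unfolding klts_def by (rule weakord_klt)

lemma H_NODE:
  assumes ps: "par s" and h: "words s ''h'' 0 = h" "h < mu" and x: "words s ''x'' 0 = x" "x < 3 ^ h"
    and E: "words s ''ec'' (h * P + x) < V" and cd: "cd = Suc h * P + 3 * x"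
  shows "H (3000 * m * m) NODE s (\<lambda>s'. node_ok mu m P (klts s) (words s' ''tr'') (words s' ''ec'') h x \<and>
     (\<forall>a. a div m \<notin> {cd, cd + 1, cd + 2} \<longrightarrow> words s' ''tr'' a = words s ''tr'' a) \<and>
     (\<forall>a. a \<notin> {cd, cd + 1, cd + 2} \<longrightarrow> words s' ''ec'' a = words s ''ec'' a) \<and>
     words s' ''ec'' cd = words s ''ec'' (h * P + x) \<and> words s' ''ec'' (cd + 1) = words s ''ec'' (h * P + x) \<and>
     words s' ''ec'' (cd + 2) = Suc (words s ''ec'' (h * P + x)))"
proof -
  have xP: "3 * x + 2 < P" using x(2) h(2) pow3_le_P[of "Suc h"] by simp
  have nV: "h * P + x \<le> V" "cd + 2 \<le> V"
    using node_le[of h x] node_le[of "Suc h" "3 * x + 2"] xP h(2) bounds(4) by (auto simp: cd algebra_simps)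
  have ncd: "h * P + x < cd" unfolding cd using x(2) pow3_le_P[of h] h(2) by simp
  have q: "2 ^ (mu - h) = 2 * (2::nat) ^ (mu - Suc h)" using h(2) by (metis Suc_diff_Suc power_Suc)
  have qm: "2 * (2::nat) ^ (mu - Suc h) \<le> m" using pow2_le_m[of "mu - h"] q by simp
  have pw: "words s ''pw'' (mu - h) = 2 * 2 ^ (mu - Suc h)" "words s ''pw'' (mu - Suc h) = 2 ^ (mu - Suc h)"
    using ps q by (auto simp: par_def)
  have pp: "words s ''m'' 0 = m" "words s ''P'' 0 = P" "words s ''mu'' 0 = mu" using ps by (auto simp: par_def)
  have mm: "m * m \<ge> 1" using m_pos by simp
  have qV: "2 * (2::nat) ^ (mu - Suc h) \<le> V" using qm bounds(5) by simp
  show ?thesis unfolding NODE_def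
  proof (rule H_slS[where u = "2000 * m * m + 300"], simp, goal_cases)
    case 1
    show ?case using h x pp pw nV qV bndD[OF 1] by (simp add: cd algebra_simps)
  next
    case (2 s1)
    have s1: "words s1 ''nd'' 0 = h * P + x" "words s1 ''cd'' 0 = cd" "words s1 ''q'' 0 = 2 * 2 ^ (mu - Suc h)"
      "words s1 ''hq'' 0 = 2 ^ (mu - Suc h)" "words s1 ''ke'' 0 = words s ''ec'' (h * P + x)"
      "words s1 ''kp'' 0 = words s ''pe'' (words s ''ec'' (h * P + x))"
      using h x pp pw by (simp_all add: 2(1) cd algebra_simps)
    note ag = agrw[OF 2(3), simplified] agrr[OF 2(3), simplified]
    have kl: "klts s1 = klts s" using klts_agr[OF 2(3)] by simp
    show ?case
    proof (rule H_Seq[where u = 150 and t = "2000 * m * m + 100"], rule H_SPREAD[where hq = "2 ^ (mu - Suc h)" and nd = "h * P + x" and cd = cd and K = "klts s (words s ''ec'' (h * P + x))" and c = "\<lambda>i. words s ''tr'' ((h * P + x) * m + i)"], goal_cases)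
      case (11 s2)
      note a2 = agrw[OF 11(3), simplified] agrr[OF 11(3), simplified]
      have e2: "words s2 ''ec'' = words s ''ec''" "words s2 ''ke'' 0 = words s ''ec'' (h * P + x)" "words s2 ''cd'' 0 = cd"
        using a2 ag s1 by simp_all
      have tr: "words s2 ''tr'' ((h * P + x) * m + i) = words s ''tr'' ((h * P + x) * m + i)" if "i < m" for i
        using 11(1) ncd mr_div[OF that, of "h * P + x"] ag by simp
      have C: "weakord.cut (klts s (words s ''ec'' (h * P + x))) (\<lambda>i. words s2 ''tr'' ((h * P + x) * m + i)) (2 ^ (mu - Suc h))
         (\<lambda>i. words s2 ''tr'' (cd * m + i)) (\<lambda>i. words s2 ''tr'' ((cd + 1) * m + i))"
        "weakord.cut (klts s (words s ''ec'' (h * P + x))) (\<lambda>i. words s2 ''tr'' ((h * P + x) * m + i)) (2 ^ (mu - Suc h))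
         (\<lambda>i. words s2 ''tr'' (cd * m + i)) (\<lambda>i. words s2 ''tr'' ((cd + 2) * m + i))"
        by (rule weakord.cut_cong[OF weakord_klts _ _ _ conjunct1[OF 11(1)]], use tr qm in simp, simp, simp)
           (rule weakord.cut_cong[OF weakord_klts _ _ _ conjunct1[OF conjunct2[OF 11(1)]]], use tr qm in simp, simp, simp)
      show ?case
      proof (rule H_sl, simp, goal_cases)
        case 1 show ?case using e2 E by simp
      next
        case 2
        have n: "h * P + x \<noteq> cd" "h * P + x \<noteq> cd + 1" "h * P + x \<noteq> cd + 2" using ncd by auto
        show ?case using C 11(1) e2 n ag unfolding node_ok_def cd[symmetric] by (simp add: fun_upd_def)
      next
        case 3 show ?case by simp
      qed
    qed (use s1 ag pp ncd qm kl in \<open>simp_all\<close>)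
  next
    case 3 show ?case using m_pos by (cases m) (auto simp: algebra_simps)
  qed
qed

text \<open>The bounds on \<open>E\<close> keep the stored coordinates small. Coordinates from
  \<open>D\<close> on may occur in the tree, with arbitrary entries of \<open>pe\<close>; this does
  no harm, since \<open>klt\<close> is a weak order for every index and no walk descends from a node
  whose coordinate is \<open>D\<close>.\<close>

definition tree_inv :: "state \<Rightarrow> nat \<Rightarrow> nat \<Rightarrow> nat \<Rightarrow> (nat \<Rightarrow> nat) \<Rightarrow> (nat \<Rightarrow> nat) \<Rightarrow> bool" where
  "tree_inv s c0 h x T E \<longleftrightarrow>
     (\<forall>h' x'. x' < 3 ^ h' \<longrightarrow> h' < h \<or> (h' = h \<and> x' < x) \<longrightarrow> node_ok mu m P (klts s) T E h' x') \<and>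
     E 0 = 0 \<and> (\<forall>i<m. T i = c0 * m + i) \<and>
     (\<forall>y<3 ^ h. E (h * P + y) \<le> h) \<and> (\<forall>y<3 * x. E (Suc h * P + y) \<le> Suc h)"

text \<open>The three new nodes have larger numbers than all processed nodes and their children, so
  earlier work stays intact.\<close>

lemma tree_inv_step:
  assumes I: "tree_inv s c0 h x T E" and h: "h < mu" and x: "x < 3 ^ h" and cd: "cd = Suc h * P + 3 * x"
    and ok: "node_ok mu m P (klts s) T' E' h x"
    and T: "\<And>a. a div m \<notin> {cd, cd + 1, cd + 2} \<Longrightarrow> T' a = T a"
    and E: "\<And>a. a \<notin> {cd, cd + 1, cd + 2} \<Longrightarrow> E' a = E a"
    and Ecd: "E' cd = E (h * P + x)" "E' (cd + 1) = E (h * P + x)" "E' (cd + 2) = Suc (E (h * P + x))"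
  shows "tree_inv s c0 h (Suc x) T' E'"
proof -
  have xP: "3 * x + 2 < P" using x h pow3_le_P[of "Suc h"] by simp
  have x1: "x < P" using xP by simp
  have lt: "h' * P + y < cd" if "h' \<le> h" "y < P" for h' y
  proof -
    have "h' * P + y < (h + 1) * P" using that by (intro mr_less) auto
    then show ?thesis by (simp add: cd)
  qed
  have ok': "node_ok mu m P (klts s) T' E' h' x'" if "x' < 3 ^ h'" "h' < h \<or> (h' = h \<and> x' < x)" for h' x'
  proof (rule node_ok_cong)
    show "node_ok mu m P (klts s) T E h' x'" using I that unfolding tree_inv_def by blast
    have h': "h' < mu" using that h by auto
    have x': "3 * x' + 2 < P" using that(1) h' pow3_le_P[of "Suc h'"] by simp
    have nd: "nd \<notin> {cd, cd + 1, cd + 2}"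
      if "nd \<in> {h' * P + x', Suc h' * P + 3 * x', Suc h' * P + 3 * x' + 1, Suc h' * P + 3 * x' + 2}" for nd
    proof -
      have "nd < cd"
      proof (cases "h' < h")
        case True
        then show ?thesis using that lt[of h' x'] lt[of "Suc h'" "3 * x'"] lt[of "Suc h'" "3 * x' + 1"]
          lt[of "Suc h'" "3 * x' + 2"] x' by auto
      next
        case False
        then have "h' = h" "x' < x" using \<open>h' < h \<or> (h' = h \<and> x' < x)\<close> by auto
        then show ?thesis using that lt[of h' x'] x' by (auto simp: cd)
      qed
      then show ?thesis by simp
    qed
    show "T' a = T a" if "a div m \<in> {h' * P + x', Suc h' * P + 3 * x', Suc h' * P + 3 * x' + 1, Suc h' * P + 3 * x' + 2}" for a
      using T nd that by blast
    show "E' a = E a" if "a \<in> {h' * P + x', Suc h' * P + 3 * x', Suc h' * P + 3 * x' + 1, Suc h' * P + 3 * x' + 2}" for a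
      using E nd that by blast
  qed (use that h m weakord_klts in auto)
  have cd0: "cd > 0" using lt[of 0 0] P_pos by simp
  show ?thesis unfolding tree_inv_def
  proof (intro conjI allI impI, goal_cases)
    case (1 h' x')
    then show ?case using ok' ok by (metis less_Suc_eq)
  next
    case 2 show ?case using E[of 0] cd0 I unfolding tree_inv_def by simp
  next
    case (3 i)
    then show ?case using T[of i] cd0 I unfolding tree_inv_def by simp
  next
    case (4 y)
    then have "y < P" using pow3_le_P[of h] h by simp
    then show ?case using E[of "h * P + y"] lt[of h y] I 4 unfolding tree_inv_def by simp
  next
    case (5 y)
    have Ex: "E (h * P + x) \<le> h" using I x unfolding tree_inv_def by simp
    show ?case
    proof (cases "y < 3 * x")
      case True
      then show ?thesis using E[of "Suc h * P + y"] I unfolding tree_inv_def by (simp add: cd)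
    next
      case False
      then have "y = 3 * x \<or> y = 3 * x + 1 \<or> y = 3 * x + 2" using 5 by presburger
      then have "Suc h * P + y \<in> {cd, cd + 1, cd + 2}" unfolding cd by auto
      then show ?thesis using Ecd Ex by auto
    qed
  qed
qed

text \<open>There are \<open>mu\<close> levels with at most \<open>P\<close> nodes each, and every
  node is split in time \<open>O(m * m)\<close>.\<close>

lemma H_BUILD:
  assumes ps: "par s" and c0: "words s ''ch'' 0 = c0" "c0 < nc"
  shows "H (4000 * (mu + 1) * P * m * m) BUILD s (\<lambda>s'. tree_inv s c0 mu 0 (words s' ''tr'') (words s' ''ec''))"
proof -
  have mm: "m * m \<ge> 1" using m_pos by simp
  have c0m: "c0 * m + i < V" if "i < m" for i
    using mr_less[OF that c0(2)] bounds by simp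
  have "H (100 * m + 100) (For ''i'' (sv ''m'') (WStore ''tr'' (sv ''i'') (sv ''ch'' [*] sv ''m'' [+] sv ''i''))) s
    (\<lambda>s'. \<forall>i<m. words s' ''tr'' i = c0 * m + i)"
  proof (rule H_For_const[where N = m and t = 50 and I = "\<lambda>k s'. \<forall>i<k. words s' ''tr'' i = c0 * m + i"], goal_cases)
    case (6 k s')
    note ag = agrw[OF 6(5), simplified]
    have w: "words s' ''ch'' 0 = c0" "words s' ''m'' 0 = m" using ps c0 ag by (auto simp: par_def)
    show ?case by (rule H_sl) (use 6 c0m[of k] w in \<open>auto simp: less_Suc_eq\<close>)
  qed (use ps bounds in \<open>auto simp: par_def\<close>)
  then show ?thesis unfolding BUILD_def
  proof (rule H_Seq[where u = "3000 * mu * P * m * m + 100 * mu * P + 200 * mu + 200"], goal_cases)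
    case (1 s1)
    note a1 = agrw[OF 1(3), simplified] agrr[OF 1(3), simplified]
    have p1: "par s1" by (rule par_agr[OF ps 1(3)]) (simp add: parnames_def)
    show ?case
    proof (rule H_slS[where u = "3000 * mu * P * m * m + 100 * mu * P + 100 * mu + 100"], simp, simp, goal_cases)
      case (1 s2)
      note a2 = agrw[OF 1(3), simplified] agrr[OF 1(3), simplified]
      have p2: "par s2" by (rule par_agr[OF p1 1(3)]) (simp add: parnames_def)
      have kl2: "klts s2 = klts s"
        using klts_agr[OF 1(3)] klts_agr[OF \<open>agr _ _ s1 s\<close>] by simp
      have T2: "tree_inv s c0 0 0 (words s2 ''tr'') (words s2 ''ec'')"
        using \<open>\<forall>i<m. words s1 ''tr'' i = c0 * m + i\<close> unfolding tree_inv_def 1(1) by simp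
      show ?case
      proof (rule H_For_const[where N = mu and t = "3000 * P * m * m + 50 * P + 50" and
            I = "\<lambda>h s'. tree_inv s c0 h 0 (words s' ''tr'') (words s' ''ec'')"], goal_cases)
        case (6 h s3)
        note a3 = agrw[OF 6(5), simplified] agrr[OF 6(5), simplified] and a3' = 6(5)
        have p3: "par s3" by (rule par_agr[OF p2 6(5)]) (simp add: parnames_def)
        have p3h: "words s3 ''p3'' h = 3 ^ h" using p3 6(1) by (simp add: par_def)
        have hP: "3 ^ h \<le> P" using pow3_le_P 6(1) by simp
        have PV: "P \<le> V" using bounds(4) P_pos by (metis add_2_eq_Suc' dual_order.trans mult_Suc_right le_add1)
        show ?case
        proof (rule H_For_const[where N = "3 ^ h" and t = "3000 * m * m" and
              I = "\<lambda>x s'. tree_inv s c0 h x (words s' ''tr'') (words s' ''ec'')"], goal_cases)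
          case (6 x s4)
          note a4 = agrw[OF 6(5), simplified] agrr[OF 6(5), simplified]
          have p4: "par s4" by (rule par_agr[OF p3 6(5)]) (simp add: parnames_def)
          have h4: "words s4 ''h'' 0 = h" using a4 \<open>words s3 ''h'' 0 = h\<close> by simp
          have kl4: "klts s4 = klts s" using kl2 klts_agr[OF 6(5)] klts_agr[OF a3'] by simp
          have E4: "words s4 ''ec'' (h * P + x) < V"
            using 6(1,2) \<open>h < mu\<close> bounds(7) unfolding tree_inv_def by fastforce
          show ?case
            by (rule H_conseq[OF H_NODE[OF p4 h4 \<open>h < mu\<close> 6(3) 6(1) E4 refl] order_refl])
              (simp, rule tree_inv_step[OF 6(2) \<open>h < mu\<close> 6(1) refl], auto simp: kl4)
        next
          case (7 s4)
          then show ?case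
            unfolding tree_inv_def by (auto simp: less_Suc_eq)
        next
          case 8
          have "3 ^ h * (3000 * m * m + wcost (WLoad ''p3'' (sv ''h'')) + 10) \<le> P * (3000 * m * m + wcost (WLoad ''p3'' (sv ''h'')) + 10)"
            using hP by (rule mult_right_mono) simp
          then show ?case by (simp add: algebra_simps)
        qed (use 6 p3h hP PV in simp_all)
      qed (use p2 T2 bounds in \<open>simp_all add: par_def algebra_simps\<close>)
    qed (simp add: algebra_simps)
  next
    case 2
    have m1: "m \<le> m * m" by simp
    have "100 * m + 100 + 200 + 200 * mu + 100 * mu * P \<le> 1000 * (mu + 1) * P * (m * m)"
    proof -
      have "100 * m + 100 + 200 + 200 * mu + 100 * mu * P \<le> 1000 * (mu + 1) * (P * (m * m))"
      proof -
        have 1: "m \<le> P * (m * m)" using m1 P_pos by (metis dual_order.trans mult_le_mono1 nat_mult_1 Suc_leI One_nat_def)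
        have 2: "1 \<le> P * (m * m)" using P_pos mm by (simp add: Suc_leI)
        have 3: "P \<le> P * (m * m)" using mm by simp
        obtain y where y: "y = P * (m * m)" by simp
        have "mu * P \<le> mu * y" using 3 y by simp
        moreover have "mu \<le> mu * y" using 2 y by simp
        moreover have "1000 * (mu + 1) * y = 1000 * (mu * y) + 1000 * y" "100 * mu * P = 100 * (mu * P)"
          by (simp_all add: algebra_simps)
        ultimately show ?thesis using 1 2 unfolding y[symmetric] by linarith
      qed
      then show ?thesis by (simp add: mult.assoc)
    qed
    then show ?case by (simp add: algebra_simps)
  qed
qed

end

section \<open>Walking the tree and reporting dominating pairs\<close>

definition SATE :: bexp where
  "SATE = (let F = (\<lambda>e. WLoad ''af'' (sv ''u'' [*] sv ''D'' [+] sv e) [+] WLoad ''bf'' (sv e [*] sv ''S'' [+] sv ''sc''));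
       X = (\<lambda>e. RAdd (RLoad ''ax'' (sv ''u'' [*] sv ''D'' [+] sv e)) (RLoad ''bx'' (sv e [*] sv ''S'' [+] sv ''sc''))) in
     bor (F ''se'' [<] F ''sp'') (Conj (F ''se'' [=] F ''sp'')
       (bor (RLess (X ''se'') (X ''sp'')) (Conj (Neg (RLess (X ''sp'') (X ''se''))) (Neg (sv ''se'' [<] sv ''sp''))))))"

definition sats :: "state \<Rightarrow> nat \<Rightarrow> nat \<Rightarrow> nat \<Rightarrow> bool" where
  "sats s = satf (words s ''af'') (reals s ''ax'') (words s ''bf'') (reals s ''bx'') (words s ''pe'') (words s ''S'' 0) (words s ''D'' 0)"

lemma bn_SATE: "words s ''sp'' 0 = words s ''pe'' (words s ''se'' 0) \<Longrightarrow>
    bn s SATE = sats s (words s ''u'' 0) (words s ''se'' 0) (words s ''sc'' 0)"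
  by (auto simp: SATE_def sats_def satf_def Let_def)

lemma bcost_SATE: "bcost SATE \<le> 300"
  by (simp add: SATE_def Let_def)

lemma sats_agr: "agr W R s' s \<Longrightarrow> W \<inter> {''af'', ''bf'', ''pe'', ''S'', ''D''} = {} \<Longrightarrow> R \<inter> {''ax'', ''bx''} = {} \<Longrightarrow> sats s' = sats s"
  unfolding sats_def by (simp add: agr_def)

definition WALK :: com where
  "WALK = (''al'' :== Const 1 ;; ''ee'' :== Const 0 ;; ''hf'' :== Const 0 ;; ''xx'' :== Const 0 ;; ''rem'' :== WLoad ''jl'' (sv ''ji'')) ;;
     For ''h'' (sv ''mu'') (
       (''bt'' :== sv ''rem'' [-] (sv ''rem'' [div] Const 2) [*] Const 2 ;; ''rem'' :== sv ''rem'' [div] Const 2) ;;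
       Cond (Const 0 [<] sv ''al'')
         (Cond (sv ''ee'' [<] sv ''D'')
           ((''sc'' :== WLoad ''tr'' (((sv ''h'' [+] Const 1) [*] sv ''P'' [+] Const 3 [*] sv ''xx'' [+] Const 1) [*] sv ''m'') ;;
             ''se'' :== sv ''ee'' ;; ''sp'' :== WLoad ''pe'' (sv ''se'') ;; ''hf'' :== sv ''h'' [+] Const 1) ;;
            Cond SATE
              (Cond (Const 0 [<] sv ''bt'') (''xx'' :== Const 3 [*] sv ''xx'' [+] Const 2 ;; ''ee'' :== sv ''ee'' [+] Const 1)
                 (''xx'' :== Const 3 [*] sv ''xx''))
              (''xx'' :== Const 3 [*] sv ''xx'' [+] Const 1 ;; Cond (Const 0 [<] sv ''bt'') (''al'' :== Const 0) Skip))
           (Cond (Const 0 [<] sv ''bt'') (''al'' :== Const 0) Skip))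
         Skip)"

lemma modw_WALK [simp]: "modw WALK = {''al'', ''ee'', ''hf'', ''xx'', ''rem'', ''h'', ''bt'', ''sc'', ''se'', ''sp''}"
  and modr_WALK [simp]: "modr WALK = {}"
  by (auto simp: WALK_def)

definition CHECK :: com where
  "CHECK = For ''l'' (sv ''D'' [-] sv ''ee'') ((''se'' :== sv ''ee'' [+] sv ''l'' ;; ''sp'' :== WLoad ''pe'' (sv ''se'')) ;;
     Cond SATE Skip (''ok'' :== Const 0))"

lemma modw_CHECK [simp]: "modw CHECK = {''l'', ''se'', ''sp'', ''ok''}"
  and modr_CHECK [simp]: "modr CHECK = {}"
  by (auto simp: CHECK_def)

definition REPORT :: com where
  "REPORT = Cond (Const 0 [<] sv ''al'')
     (For ''i'' (WLoad ''pw'' (sv ''mu'' [-] sv ''hf'')) (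
       (''sc'' :== WLoad ''tr'' ((sv ''hf'' [*] sv ''P'' [+] sv ''xx'') [*] sv ''m'' [+] sv ''i'') ;; ''ok'' :== Const 1) ;;
       CHECK ;;
       Cond (Const 0 [<] sv ''ok'') (WStore ''oc'' (sv ''ob'' [+] sv ''u'' [*] sv ''S'' [+] sv ''sc'') (sv ''ov'')) Skip))
     Skip"

lemma modw_REPORT [simp]: "modw REPORT = {''i'', ''sc'', ''ok'', ''l'', ''se'', ''sp'', ''oc''}"
  and modr_REPORT [simp]: "modr REPORT = {}"
  by (auto simp: REPORT_def)

definition DOM :: com where
  "DOM = For ''ch'' (sv ''nc'') (BUILD ;; For ''u'' (sv ''n'') (For ''ji'' (sv ''JN'') (WALK ;; REPORT)))"

lemma modw_DOM [simp]: "modw DOM = {''ch'', ''u'', ''ji'', ''h'', ''x'', ''nd'', ''cd'', ''q'', ''hq'', ''ke'', ''kp'', ''i'', ''vb'', ''rk'', ''l'', ''va'', ''tr'', ''ec'',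
     ''al'', ''ee'', ''hf'', ''xx'', ''rem'', ''bt'', ''sc'', ''se'', ''sp'', ''ok'', ''oc''}"
  and modr_DOM [simp]: "modr DOM = {}"
  by (auto simp: DOM_def)

context dompar
begin

lemma H_CHECK:
  assumes s: "words s ''D'' 0 = D" "words s ''ee'' 0 = ee" "words s ''ok'' 0 = 1" "ee \<le> D"
  shows "H (400 * (D - ee) + 100) CHECK s (\<lambda>s'. (0 < words s' ''ok'' 0) = (\<forall>e. ee \<le> e \<and> e < D \<longrightarrow> sats s (words s ''u'' 0) e (words s ''sc'' 0)))"
  unfolding CHECK_def
proof (rule H_For_const[where N = "D - ee" and t = 350 and
      I = "\<lambda>k s'. (0 < words s' ''ok'' 0) = (\<forall>e. ee \<le> e \<and> e < ee + k \<longrightarrow> sats s (words s ''u'' 0) e (words s ''sc'' 0))"], goal_cases)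
  case (6 k s')
  note ag = agrw[OF 6(5), simplified] agrr[OF 6(5), simplified]
  have sa: "sats s' = sats s" using sats_agr[OF 6(5)] by simp
  have eV: "ee + k \<le> V" using 6(1) bounds(3) by simp
  show ?case
  proof (rule H_slS[where u = 320], simp, goal_cases)
    case 1
    show ?case using 6(3) s ag eV bndD[OF 1, of "''pe''"] by simp
  next
    case (2 s1)
    have b: "bn s1 SATE \<longleftrightarrow> sats s (words s ''u'' 0) (ee + k) (words s ''sc'' 0)"
    proof -
      have "sats s1 = sats s" using sats_agr[OF 2(3)] sa by simp
      then show ?thesis
        using 2(1) 6(3) s ag by (subst bn_SATE) simp_all
    qed
    have ok: "words s1 ''ok'' 0 = words s' ''ok'' 0" by (simp add: 2(1))
    have all: "(\<forall>e. ee \<le> e \<and> e < ee + Suc k \<longrightarrow> Z e) \<longleftrightarrow> (\<forall>e. ee \<le> e \<and> e < ee + k \<longrightarrow> Z e) \<and> Z (ee + k)" for Z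
      by (auto simp: less_Suc_eq)
    show ?case unfolding all
      by (rule H_sl) (use b ok 6(2) bcost_SATE in auto)
  qed simp
qed (use s bounds in auto)

text \<open>These bounds hold for dead walks too, for which \<open>walk_inv\<close> says nothing;
  the program carries their registers along, and they must not overflow either.\<close>

lemma walk_bounds: "walk D' md st J h = (al, ee, hf, xx) \<Longrightarrow> xx < 3 ^ h \<and> hf \<le> h \<and> ee \<le> h"
proof (induction h arbitrary: al ee hf xx)
  case (Suc h)
  obtain al0 e0 h0 x0 where "walk D' md st J h = (al0, e0, h0, x0)" by (metis prod_cases4)
  with Suc show ?case by (fastforce simp: wstep_def split: if_splits)
qed auto

lemma H_WALK:
  assumes ps: "par s" and ji: "words s ''ji'' 0 = ji" "ji < length jl"
    and md: "md = (\<lambda>h x. words s ''tr'' ((Suc h * P + 3 * x + 1) * m))" and st: "st = sats s (words s ''u'' 0)"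
  shows "H (700 * mu + 100) WALK s (\<lambda>s'. (0 < words s' ''al'' 0, words s' ''ee'' 0, words s' ''hf'' 0, words s' ''xx'' 0) = walk D md st (jl ! ji) mu)"
proof -
  let ?J = "jl ! ji"
  have PV: "P \<le> V" using bounds(4) by (simp add: algebra_simps)
  have V1: "1 \<le> V" using V2 by simp
  show ?thesis unfolding WALK_def
  proof (rule H_slS[where u = "700 * mu + 50"], simp, goal_cases)
    case 1 then show ?case using V1 bndD[OF 1] by simp
  next
    case (2 s1)
    have r1: "words s1 ''rem'' 0 = ?J" using ps ji by (simp add: 2(1) par_def)
    note a1 = agrw[OF 2(3), simplified] agrr[OF 2(3), simplified]
    have p1: "par s1" by (rule par_agr[OF ps 2(3)]) (simp add: parnames_def)
    have sa1: "sats s1 = sats s" using sats_agr[OF 2(3)] by simp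
    have u1: "words s1 ''u'' = words s ''u''" "words s1 ''tr'' = words s ''tr''" using a1 by simp_all
    show ?case
    proof (rule H_For_const[where N = mu and t = 650 and I = "\<lambda>h s'. (0 < words s' ''al'' 0, words s' ''ee'' 0, words s' ''hf'' 0, words s' ''xx'' 0) = walk D md st ?J h
         \<and> words s' ''rem'' 0 = ?J div 2 ^ h"], goal_cases)
      case (6 h s2)
      note a2 = agrw[OF 6(5), simplified] agrr[OF 6(5), simplified]
      have p2: "par s2" by (rule par_agr[OF p1 6(5)]) (simp add: parnames_def)
      have pp: "words s2 ''D'' 0 = D" "words s2 ''P'' 0 = P" "words s2 ''m'' 0 = m" using p2 by (auto simp: par_def)
      have sa2: "sats s2 = sats s" using sats_agr[OF 6(5)] sa1 by simp
      obtain al ee hf xx where w: "walk D md st ?J h = (al, ee, hf, xx)" by (metis prod_cases4)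
      have wb: "xx < 3 ^ h" "hf \<le> h" "ee \<le> h" using walk_bounds[OF w] by auto
      have s2: "(0 < words s2 ''al'' 0) = al" "words s2 ''ee'' 0 = ee" "words s2 ''hf'' 0 = hf" "words s2 ''xx'' 0 = xx"
        "words s2 ''rem'' 0 = ?J div 2 ^ h"
        using 6(2) w by auto
      have hV: "Suc h \<le> V" "Suc ee \<le> V" "3 * xx + 2 \<le> V"
        using 6(1) bounds(7) wb pow3_le_P[of "Suc h"] PV by auto
      define bt where "bt = odd (?J div 2 ^ h)"
      show ?case
      proof (rule H_slS[where u = 600], simp, goal_cases)
        case 1 show ?case using bndD[OF 1] by (simp add: le_trans[OF diff_le_self] le_trans[OF div_le_dividend])
      next
        case (2 s3)
        note a3 = agrw[OF 2(3), simplified] agrr[OF 2(3), simplified]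
        have s3: "(0 < words s3 ''al'' 0) = al" "words s3 ''ee'' 0 = ee" "words s3 ''hf'' 0 = hf" "words s3 ''xx'' 0 = xx"
          "words s3 ''h'' 0 = h" "words s3 ''D'' 0 = D" "words s3 ''P'' 0 = P" "words s3 ''m'' 0 = m"
          "words s3 ''tr'' = words s ''tr''" "words s3 ''u'' 0 = words s ''u'' 0"
          using a3 s2 pp 6(3) a2 u1 by simp_all
        have rem3: "words s3 ''rem'' 0 = ?J div 2 ^ Suc h"
          using s2(5) by (simp add: 2(1) div_mult2_eq[symmetric] mult.commute)
        have bt3: "(0 < words s3 ''bt'' 0) = bt"
          using s2(5) by (simp add: 2(1) bt_def odd_iff_mod_2_eq_one minus_div_mult_eq_mod)
        have sa3: "sats s3 = sats s" using sats_agr[OF 2(3)] sa2 by simp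
        have bV: "words s3 ''tr'' a \<le> V" "words s3 ''pe'' a \<le> V" for a using bndD[OF 2(2)] by auto
        let ?Q = "\<lambda>s''. (0 < words (wstore ''h'' 0 (Suc h) s'') ''al'' 0, words (wstore ''h'' 0 (Suc h) s'') ''ee'' 0, words (wstore ''h'' 0 (Suc h) s'') ''hf'' 0, words (wstore ''h'' 0 (Suc h) s'') ''xx'' 0) = walk D md st ?J (Suc h)
         \<and> words (wstore ''h'' 0 (Suc h) s'') ''rem'' 0 = ?J div 2 ^ Suc h"
        have WS: "walk D md st ?J (Suc h) = wstep D md st h bt (al, ee, hf, xx)" using w by (simp add: bt_def)
        show ?case
        proof (cases "al \<and> ee < D")
          case True
          show ?thesis
          proof (rule H_Cond[where t = 560], rule H_Cond[where t = 540], rule H_slS[where u = 450], simp, goal_cases)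
            case 1 then show ?case using bV hV s3 bndD[OF 1(3)] by simp
          next
            case (2 s4)
            note a4 = agrw[OF 2(5), simplified] agrr[OF 2(5), simplified]
            have "words s4 ''sp'' 0 = words s4 ''pe'' (words s4 ''se'' 0)" by (simp add: 2(3))
            then have b: "bn s4 SATE = st ee (md h xx)"
            proof (subst bn_SATE)
              have "words s4 ''sc'' 0 = md h xx" using s3 by (simp add: 2(3) md algebra_simps)
              moreover have "words s4 ''se'' 0 = ee" using s3 by (simp add: 2(3))
              moreover have "sats s4 = sats s" using sats_agr[OF 2(5)] sa3 by simp
              ultimately show "sats s4 (words s4 ''u'' 0) (words s4 ''se'' 0) (words s4 ''sc'' 0) = st ee (md h xx)"
                using st s3 a4 by simp
            qed
            have s4: "(0 < words s4 ''al'' 0) = al" "words s4 ''ee'' 0 = ee" "words s4 ''hf'' 0 = Suc h" "words s4 ''xx'' 0 = xx"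
              "(0 < words s4 ''bt'' 0) = bt" "words s4 ''rem'' 0 = ?J div 2 ^ Suc h"
              using s3 bt3 rem3 by (simp_all add: 2(3))
            show ?case unfolding WS
              by (rule H_sl) (use s4 b True bcost_SATE hV in \<open>simp_all add: wstep_def\<close>)
          next
            case 3 then show ?case by simp
          qed (use True s3 in simp_all)
        next
          case False
          have "\<not> al \<or> \<not> ee < D" using False by simp
          show ?thesis unfolding WS
          proof (rule H_Cond[where t = 560], rule H_Cond[where t = 540], goal_cases)
            case 2 then show ?case
              by (intro H_sl) (use s3 bt3 rem3 in \<open>simp_all add: wstep_def\<close>)
          next
            case 4 then show ?case
              by (intro H_sl) (use s3 bt3 rem3 in \<open>simp_all add: wstep_def\<close>)
          qed (use False s3 in simp_all)
        qed
      next
        case 3 show ?case by simp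
      qed
    next
      case (7 s') then show ?case by simp
    qed (use p1 r1 2(1) bounds in \<open>simp_all add: par_def\<close>)
  qed simp
qed

lemma H_REPORT:
  assumes ps: "par s" and w: "(0 < words s ''al'' 0, words s ''ee'' 0, words s ''hf'' 0, words s ''xx'' 0) = (al, ee, hf, xx)"
    and b: "al \<Longrightarrow> ee \<le> D \<and> hf \<le> mu"
    and st: "st = sats s (words s ''u'' 0)"
  shows "H (100 + (if al then 2 ^ (mu - hf) * (400 + 400 * (D - ee)) else 0)) REPORT s (\<lambda>s'. words s' ''oc'' =
     (\<lambda>a. if al \<and> (\<exists>v\<in>tcont mu m P (words s ''tr'') hf xx. a = words s ''ob'' 0 + words s ''u'' 0 * S + v \<and> (\<forall>e. ee \<le> e \<and> e < D \<longrightarrow> st e v))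
        then words s ''ov'' 0 else words s ''oc'' a))"
proof (cases al)
  case False
  then show ?thesis unfolding REPORT_def
    by (intro H_Cond[where t = 1] H_sl) (use w in auto)
next
  case True
  have pp: "words s ''D'' 0 = D" "words s ''P'' 0 = P" "words s ''m'' 0 = m" "words s ''S'' 0 = S" "words s ''mu'' 0 = mu"
    "words s ''pw'' (mu - hf) = 2 ^ (mu - hf)" using ps by (auto simp: par_def)
  have qV: "(2::nat) ^ (mu - hf) \<le> V" using pow2_le_m[of "mu - hf"] bounds(5) by simp
  let ?c = "\<lambda>i. words s ''tr'' ((hf * P + xx) * m + i)"
  let ?R = "\<lambda>k a. \<exists>i<k. a = words s ''ob'' 0 + words s ''u'' 0 * S + ?c i \<and> (\<forall>e. ee \<le> e \<and> e < D \<longrightarrow> st e (?c i))"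
  show ?thesis unfolding REPORT_def
  proof (rule H_Cond[where t = "2 ^ (mu - hf) * (400 + 400 * (D - ee)) + 50"], goal_cases)
    case 1
    show ?case
    proof (rule H_For_const[where N = "2 ^ (mu - hf)" and t = "400 * (D - ee) + 350" and
          I = "\<lambda>k s'. words s' ''oc'' = (\<lambda>a. if ?R k a then words s ''ov'' 0 else words s ''oc'' a)"], goal_cases)
      case (6 k s1)
      note a1 = agrw[OF 6(5), simplified] agrr[OF 6(5), simplified]
      have sa1: "sats s1 = sats s" using sats_agr[OF 6(5)] by simp
      have s1: "words s1 ''hf'' 0 = hf" "words s1 ''xx'' 0 = xx" "words s1 ''ee'' 0 = ee" using w a1 by simp_all
      show ?case
      proof (rule H_slS[where u = "400 * (D - ee) + 200"], simp, goal_cases)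
        case 1 show ?case using bndD[OF 1] V2 by simp
      next
        case (2 s2)
        note a2 = agrw[OF 2(3), simplified] agrr[OF 2(3), simplified]
        have sa2: "sats s2 = sats s" using sats_agr[OF 2(3)] sa1 by simp
        have s2: "words s2 ''sc'' 0 = ?c k" "words s2 ''ok'' 0 = 1" "words s2 ''ee'' 0 = ee" "words s2 ''D'' 0 = D" "words s2 ''u'' 0 = words s ''u'' 0"
          using s1 pp a1 6(3) by (simp_all add: 2(1))
        show ?case
        proof (rule H_Seq[OF H_CHECK[OF s2(4,3,2)], where u = 90], goal_cases)
          case 1 show ?case using b True by simp
        next
          case (2 s3)
          note a3 = agrw[OF 2(3), simplified] agrr[OF 2(3), simplified]
          have s3: "(0 < words s3 ''ok'' 0) = (\<forall>e. ee \<le> e \<and> e < D \<longrightarrow> st e (?c k))" "words s3 ''sc'' 0 = ?c k" "words s3 ''oc'' = words s1 ''oc''"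
             "words s3 ''ob'' 0 = words s ''ob'' 0" "words s3 ''ov'' 0 = words s ''ov'' 0" "words s3 ''S'' 0 = S" "words s3 ''u'' 0 = words s ''u'' 0"
            using 2(1) s2 sa2 a3 a2 a1 pp by (simp_all add: st)
          have ovV: "words s ''ov'' 0 \<le> V" using bndD[OF 2(2), of "''ov''" 0] s3 by simp
          show ?case
            by (rule H_sl) (use s3 ovV 6(2) in \<open>auto simp: fun_eq_iff less_Suc_eq algebra_simps\<close>)
        next
          case 3 show ?case by simp
        qed
      next
        case 3 show ?case by simp
      qed
    next
      case (7 s')
      from 7(1) show ?case using True by (auto simp: tcont_def fun_eq_iff)
    next
      case 8
      show ?case by (simp add: algebra_simps)
    qed (use pp w qV in simp_all)
  next
    case 2 then show ?case using w True by simp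
  next
    case 3 show ?case using True by simp
  qed
qed

definition allsat :: "state \<Rightarrow> nat \<Rightarrow> nat \<Rightarrow> bool" where
  "allsat s u v \<longleftrightarrow> (\<forall>e<D. sats s u e v)"

lemma sum_nth_distinct: "distinct xs \<Longrightarrow> (\<Sum>i<length xs. f (xs ! i)) = sum f (set xs)"
  by (simp add: sum.distinct_set_conv_list sum_list_sum_nth atLeast0LessThan)

text \<open>The work proportional to node sizes is charged to the reported columns, so the bound
  splits into a part for the guess words and a part for the output of row \<open>u\<close>.\<close>

lemma H_ROW:
  assumes ps: "par s" and T: "tree_inv s c0 mu 0 (words s ''tr'') (words s ''ec'')"
  shows "H (length jl * (700 * mu + 800 + 400 * D) + 100 + 400 * card {v \<in> {c0 * m..<c0 * m + m}. allsat s (words s ''u'' 0) v})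
    (For ''ji'' (sv ''JN'') (WALK ;; REPORT)) s
    (\<lambda>s'. words s' ''oc'' = (\<lambda>a. if \<exists>v\<in>{c0 * m..<c0 * m + m}. a = words s ''ob'' 0 + words s ''u'' 0 * S + v \<and> allsat s (words s ''u'' 0) v
      then words s ''ov'' 0 else words s ''oc'' a))"
proof -
  define u st md where "u = words s ''u'' 0" and "st = sats s u" and "md = (\<lambda>h x. words s ''tr'' ((Suc h * P + 3 * x + 1) * m))"
  let ?tc = "tcont mu m P (words s ''tr'')"
  have T0: "words s ''tr'' i = c0 * m + i" if "i < m" for i using T that by (simp add: tree_inv_def)
  have root: "?tc 0 0 = {c0 * m..<c0 * m + m}"
  proof -
    have "?tc 0 0 = (\<lambda>i. c0 * m + i) ` {..<m}" using T0 by (auto simp: tcont_def m)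
    also have "\<dots> = {c0 * m..<c0 * m + m}" by (simp add: lessThan_atLeast0 image_add_atLeastLessThan add.commute)
    finally show ?thesis .
  qed
  \<comment> \<open>One tree serves all rows: the row enters only through \<open>st\<close>, which
    is monotone in the keys by \<open>satf_mono\<close>.\<close>
  interpret ct: coltree mu D ?tc "\<lambda>h x. words s ''ec'' (h * P + x)" md st
    unfolding md_def
  proof (rule coltree_build(1)[where K = "klts s"])
    show "node_ok mu m P (klts s) (words s ''tr'') (words s ''ec'') h x" if "h < mu" "x < 3 ^ h" for h x
      using T that by (auto simp: tree_inv_def)
    show "words s ''ec'' 0 = 0" using T by (simp add: tree_inv_def)
    show "inj_on (words s ''tr'') {..<2 ^ mu}" using T0 by (auto simp: inj_on_def m)
    show "st e v'" if "st e v" "\<not> klts s e v' v" for e v v'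
      using that satf_mono unfolding st_def sats_def klts_def by blast
  qed (rule weakord_klts)
  define R where "R J v \<longleftrightarrow> (case walk D md st J mu of (al, ee, hf, xx) \<Rightarrow>
      al \<and> v \<in> ?tc hf xx \<and> (\<forall>e. ee \<le> e \<and> e < D \<longrightarrow> st e v))" for J v
  define cR where "cR J = (case walk D md st J mu of (al, ee, hf, xx) \<Rightarrow> if al then 2 ^ (mu - hf) * (400 + 400 * (D - ee)) else 0)" for J
  let ?I = "\<lambda>k s'. words s' ''oc'' = (\<lambda>a. if \<exists>i<k. \<exists>v. R (jl ! i) v \<and> a = words s ''ob'' 0 + u * S + v then words s ''ov'' 0 else words s ''oc'' a)"
  have allR: "(\<exists>i<length jl. R (jl ! i) v) \<longleftrightarrow> v \<in> {c0 * m..<c0 * m + m} \<and> allsat s u v" for v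
  proof -
    have "(\<exists>i<length jl. R (jl ! i) v) \<longleftrightarrow> (\<exists>J\<in>set jl. R J v)" by (simp only: set_conv_nth) blast
    also have "\<dots> \<longleftrightarrow> (\<exists>J<2 ^ mu. popc mu J \<le> D \<and> R J v)" by (auto simp only: jl(2))
    also have "\<dots> \<longleftrightarrow> v \<in> ?tc 0 0 \<and> (\<forall>e<D. st e v)"
      unfolding R_def by (rule ct.report_iff)
    finally show ?thesis unfolding root allsat_def st_def .
  qed
  \<comment> \<open>\<open>report_cost\<close> with \<open>a = c = 400\<close>, applied to all words
    of \<open>jl\<close> together; no useful bound holds for a single word.\<close>
  have cost: "(\<Sum>i<length jl. 700 * mu + 220 + cR (jl ! i)) + length jl * (2 + 10) + 2 + 7
     \<le> length jl * (700 * mu + 800 + 400 * D) + 100 + 400 * card {v \<in> {c0 * m..<c0 * m + m}. allsat s u v}"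
  proof -
    have "(\<Sum>i<length jl. cR (jl ! i)) = sum cR (set jl)" by (rule sum_nth_distinct[OF jl(1)])
    also have "\<dots> \<le> card (set jl) * (400 + 400 * D) + 400 * card {v \<in> ?tc 0 0. \<forall>e<D. st e v}"
      unfolding cR_def by (rule ct.report_cost) (use jl(2) in auto)
    also have "card (set jl) = length jl" using jl(1) by (rule distinct_card)
    finally show ?thesis unfolding root allsat_def st_def by (simp add: sum.distrib algebra_simps)
  qed
  show ?thesis
  proof (rule H_For[where N = "length jl" and t = "\<lambda>i. 700 * mu + 220 + cR (jl ! i)" and I = ?I], goal_cases)
    case (6 k s1)
    note a1 = agrw[OF 6(5), simplified] agrr[OF 6(5), simplified]
    have p1: "par s1" by (rule par_agr[OF ps 6(5)]) (simp add: parnames_def)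
    have sa1: "sats s1 = sats s" using sats_agr[OF 6(5)] by simp
    have md1: "md = (\<lambda>h x. words s1 ''tr'' ((Suc h * P + 3 * x + 1) * m))" using a1 by (simp add: md_def)
    have st1: "st = sats s1 (words s1 ''u'' 0)" using sa1 a1 by (simp add: st_def u_def)
    show ?case
    proof (rule H_Seq[OF H_WALK[OF p1 6(3,1) md1 st1], where u = "100 + cR (jl ! k)"], goal_cases)
      case (1 s2)
      note a2 = agrw[OF 1(3), simplified] agrr[OF 1(3), simplified]
      have p2: "par s2" by (rule par_agr[OF p1 1(3)]) (simp add: parnames_def)
      have sa2: "sats s2 = sats s" using sats_agr[OF 1(3)] sa1 by simp
      have st2: "st = sats s2 (words s2 ''u'' 0)" using sa2 a2 a1 by (simp add: st_def u_def)
      obtain al ee hf xx where w: "walk D md st (jl ! k) mu = (al, ee, hf, xx)" by (metis prod_cases4)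
      have b: "ee \<le> D \<and> hf \<le> mu" if al using ct.walk_inv[of mu "jl ! k" ee hf xx] w that by simp
      show ?case
      proof (rule H_conseq[OF H_REPORT[where al = al and ee = ee and hf = hf and xx = xx, OF p2 _ _ st2]], goal_cases)
        case 1 show ?case using \<open>_ = walk D md st (jl ! k) mu\<close> w by simp
      next
        case 2 then show ?case by (rule b)
      next
        case 3 show ?case by (simp add: cR_def w)
      next
        case (4 s3)
        have e: "words s2 ''tr'' = words s ''tr''" "words s2 ''ob'' 0 = words s ''ob'' 0" "words s2 ''u'' 0 = u"
          "words s2 ''ov'' 0 = words s ''ov'' 0" "words s2 ''oc'' = words s1 ''oc''"
          using a2 a1 by (simp_all add: u_def)
        have *: "(\<exists>i<Suc k. \<exists>v. R (jl ! i) v \<and> a = words s ''ob'' 0 + u * S + v) \<longleftrightarrow>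
          (al \<and> (\<exists>v\<in>?tc hf xx. a = words s ''ob'' 0 + u * S + v \<and> (\<forall>e. ee \<le> e \<and> e < D \<longrightarrow> st e v)))
          \<or> (\<exists>i<k. \<exists>v. R (jl ! i) v \<and> a = words s ''ob'' 0 + u * S + v)" for a
          unfolding less_Suc_eq R_def using w by auto
        have "words s3 ''oc'' a = (if \<exists>i<Suc k. \<exists>v. R (jl ! i) v \<and> a = words s ''ob'' 0 + u * S + v
            then words s ''ov'' 0 else words s ''oc'' a)" for a
          unfolding 4(1)[unfolded e] 6(2) * by (simp only: split: if_split) blast
        then show ?case by (simp add: fun_eq_iff)
      qed
    next
      case 2 show ?case by simp
    qed
  next
    case (7 s')
    have "(\<exists>i<length jl. \<exists>v. R (jl ! i) v \<and> a = words s ''ob'' 0 + u * S + v) \<longleftrightarrow>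
       (\<exists>v\<in>{c0 * m..<c0 * m + m}. a = words s ''ob'' 0 + u * S + v \<and> allsat s u v)" for a
      using allR by blast
    then show ?case using 7(1) by (simp add: u_def)
  next
    case 8 show ?case using cost by (simp add: u_def)
  qed (use ps bounds in \<open>simp_all add: par_def\<close>)
qed

lemma allsat_agr: "agr W R s' s \<Longrightarrow> W \<inter> {''af'', ''bf'', ''pe'', ''S'', ''D''} = {} \<Longrightarrow> R \<inter> {''ax'', ''bx''} = {} \<Longrightarrow> allsat s' = allsat s"
  unfolding allsat_def fun_eq_iff using sats_agr by metis

text \<open>The number of reported pairs stays visible in the time bound. For a single claim it may
  be quadratic; only its sum over all claims is estimated later.\<close>

lemma H_DOM:
  assumes ps: "par s"
  shows "H (nc * (4000 * (mu + 1) * P * m * m + n * (length jl * (700 * mu + 800 + 400 * D) + 150) + 150) + 100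
      + 400 * card {(u, v). u < n \<and> v < nc * m \<and> allsat s u v})
    DOM s (\<lambda>s'. words s' ''oc'' = (\<lambda>a. if \<exists>u<n. \<exists>v<nc * m. a = words s ''ob'' 0 + u * S + v \<and> allsat s u v
      then words s ''ov'' 0 else words s ''oc'' a))"
proof -
  define ob ov where "ob = words s ''ob'' 0" and "ov = words s ''ov'' 0"
  define cd where "cd c u = card {v \<in> {c * m..<c * m + m}. allsat s u v}" for c u
  have sumcd: "(\<Sum>c<nc. \<Sum>u<n. cd c u) = card {(u, v). u < n \<and> v < nc * m \<and> allsat s u v}"
  proof -
    have "(\<Sum>c<N. cd c u) = card {v. v < N * m \<and> allsat s u v}" for u N
    proof (induction N)
      case (Suc N)
      have "{v. v < Suc N * m \<and> allsat s u v} = {v. v < N * m \<and> allsat s u v} \<union> {v \<in> {N * m..<N * m + m}. allsat s u v}"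
        by auto
      moreover have "card \<dots> = card {v. v < N * m \<and> allsat s u v} + card {v \<in> {N * m..<N * m + m}. allsat s u v}"
        by (rule card_Un_disjoint) auto
      ultimately show ?case using Suc by (simp add: cd_def)
    qed simp
    then have "(\<Sum>c<nc. \<Sum>u<n. cd c u) = (\<Sum>u<n. card {v. v < nc * m \<and> allsat s u v})"
      by (subst sum.swap) simp
    also have "\<dots> = card (SIGMA u:{..<n}. {v. v < nc * m \<and> allsat s u v})" by simp
    also have "(SIGMA u:{..<n}. {v. v < nc * m \<and> allsat s u v}) = {(u, v). u < n \<and> v < nc * m \<and> allsat s u v}" by auto
    finally show ?thesis .
  qed
  let ?W = "length jl * (700 * mu + 800 + 400 * D)"
  let ?I = "\<lambda>k s'. words s' ''oc'' = (\<lambda>a. if \<exists>u<n. \<exists>v<k * m. a = ob + u * S + v \<and> allsat s u v then ov else words s ''oc'' a)"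
  show ?thesis unfolding DOM_def
  proof (rule H_For[where N = nc and t = "\<lambda>c. 4000 * (mu + 1) * P * m * m + n * (?W + 120) + 100 + 400 * (\<Sum>u<n. cd c u)" and I = ?I], goal_cases)
    case (6 c s1)
    note a1 = agrw[OF 6(5), simplified] agrr[OF 6(5), simplified]
    have p1: "par s1" by (rule par_agr[OF ps 6(5)]) (simp add: parnames_def)
    have sa1: "allsat s1 = allsat s" using allsat_agr[OF 6(5)] by simp
    show ?case
    proof (rule H_Seq[OF H_BUILD[OF p1 6(3) 6(1)], where u = "n * (?W + 120) + 100 + 400 * (\<Sum>u<n. cd c u)"], goal_cases)
      case (1 s2)
      note a2 = agrw[OF 1(3), simplified] agrr[OF 1(3), simplified]
      have p2: "par s2" by (rule par_agr[OF p1 1(3)]) (simp add: parnames_def)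
      have sa2: "allsat s2 = allsat s" using allsat_agr[OF 1(3)] sa1 by simp
      have kl2: "klts s2 = klts s1" using klts_agr[OF 1(3)] by simp
      note tree2 = 1(1)
      show ?case
      proof (rule H_For[where N = n and t = "\<lambda>u. ?W + 100 + 400 * cd c u" and
          I = "\<lambda>k s'. words s' ''oc'' = (\<lambda>a. if \<exists>u<k. \<exists>v\<in>{c * m..<c * m + m}. a = ob + u * S + v \<and> allsat s u v then ov else words s1 ''oc'' a)"], goal_cases)
        case (6 u s3)
        note a3 = agrw[OF 6(5), simplified] agrr[OF 6(5), simplified]
        have p3: "par s3" by (rule par_agr[OF p2 6(5)]) (simp add: parnames_def)
        have sa3: "allsat s3 = allsat s" using allsat_agr[OF 6(5)] sa2 by simp
        have kl3: "klts s3 = klts s1" using klts_agr[OF 6(5)] kl2 by simp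
        have tree3: "tree_inv s3 c mu 0 (words s3 ''tr'') (words s3 ''ec'')"
          using tree2 kl3 a3 unfolding tree_inv_def by simp
        show ?case
        proof (rule H_conseq[OF H_ROW[OF p3 tree3]], goal_cases)
          case 1 show ?case using 6(3) sa3 by (simp add: cd_def)
        next
          case (2 s4)
          have "words s3 ''ob'' 0 = ob" "words s3 ''ov'' 0 = ov" using a3 a2 a1 by (simp_all add: ob_def ov_def)
          then have "words s4 ''oc'' a = (if \<exists>u'<Suc u. \<exists>v\<in>{c * m..<c * m + m}. a = ob + u' * S + v \<and> allsat s u' v then ov else words s1 ''oc'' a)" for a
            unfolding 2(1) sa3 6(3) 6(2) less_Suc_eq by (simp only: split: if_split) blast
          then show ?case by (simp add: fun_eq_iff)
        qed
      next
        case (7 s3)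
        have e: "v < Suc c * m \<longleftrightarrow> v < c * m \<or> v \<in> {c * m..<c * m + m}" for v by auto
        have "words s3 ''oc'' a = (if \<exists>u<n. \<exists>v<Suc c * m. a = ob + u * S + v \<and> allsat s u v then ov else words s ''oc'' a)" for a
          unfolding 7(1) \<open>?I c s1\<close> e by (simp only: split: if_split) blast
        then show ?case by (simp add: fun_eq_iff)
      next
        case 8 show ?case by (simp add: sum.distrib sum_distrib_right[symmetric] algebra_simps)
      qed (use p2 a2 bounds in \<open>simp_all add: par_def\<close>)
    next
      case 2 show ?case by simp
    qed
  next
    case 8
    show ?case unfolding sumcd[symmetric] by (simp add: sum.distrib sum_distrib_right[symmetric] algebra_simps)
  next
    case 7 then show ?case unfolding ob_def ov_def by blast
  qed (use ps bounds in \<open>simp_all add: par_def\<close>)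
qed

end

section \<open>Representative families\<close>

primrec chx :: "(nat set \<Rightarrow> nat) \<Rightarrow> (nat \<Rightarrow> nat \<Rightarrow> nat) \<Rightarrow> (nat \<Rightarrow> nat) \<Rightarrow> nat set \<Rightarrow> nat \<Rightarrow> nat set" where
  "chx pick Pt ii A0 0 = A0"
| "chx pick Pt ii A0 (Suc t) = insert (Pt (pick (chx pick Pt ii A0 t)) (ii t)) (chx pick Pt ii A0 t)"

lemma chx_cong: "(\<And>s. s < t \<Longrightarrow> ii s = ii' s) \<Longrightarrow> chx pick Pt ii A0 t = chx pick Pt ii' A0 t"
  by (induction t) auto

lemma chx_mono: "A0 \<subseteq> chx pick Pt ii A0 t"
  by (induction t) auto

text \<open>Repeatedly picking the best candidate that avoids \<open>A\<close> and adding to \<open>A\<close> a forbidden vertex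
  of the pick leads to the best candidate avoiding all of \<open>X\<close> after at most \<open>|X|\<close> rounds;
  position \<open>k\<close> holds a vertex \<open>J\<close> that lies on no candidate and serves to wait.\<close>

lemma chain_complete:
  fixes k :: nat and Pt :: "nat \<Rightarrow> nat \<Rightarrow> nat" and val :: "nat \<Rightarrow> real"
  defines "avoid \<equiv> \<lambda>c A. \<forall>p<k. Pt c p \<notin> A"
  assumes pick: "\<And>A c. c \<in> Cd \<Longrightarrow> ok c \<Longrightarrow> avoid c A \<Longrightarrow>
      pick A \<in> Cd \<and> ok (pick A) \<and> avoid (pick A) A \<and> val c \<le> val (pick A)"
    and pickJ: "\<And>A. pick (insert J A) = pick A"
    and J: "\<And>c. c \<in> Cd \<Longrightarrow> ok c \<Longrightarrow> Pt c k = J \<and> (\<forall>p<k. Pt c p \<noteq> J)"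
    and X: "finite X" "card X \<le> k" and c: "c \<in> Cd" "ok c" "avoid c (X \<union> A0)"
  shows "\<exists>ii. (\<forall>t. ii t \<le> k) \<and> (let c' = pick (chx pick Pt ii A0 k) in
     c' \<in> Cd \<and> ok c' \<and> avoid c' (X \<union> A0) \<and> avoid c' (chx pick Pt ii A0 k) \<and> val c \<le> val c')"
proof -
  let ?A = "\<lambda>ii t. chx pick Pt ii A0 t"
  have pk: "pick A \<in> Cd \<and> ok (pick A) \<and> avoid (pick A) A \<and> val c \<le> val (pick A)" if "A \<subseteq> X \<union> A0 \<union> {J}" for A
  proof (rule pick[OF c(1,2)])
    show "avoid c A" using that c J[OF c(1,2)] unfolding avoid_def by blast
  qed
  \<comment> \<open>Progress measure: after \<open>t\<close> rounds either the pick already avoids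
    everything forbidden, or \<open>t\<close> members of \<open>X\<close> outside \<open>A0\<close>
    have been collected.\<close>
  have "\<exists>ii. (\<forall>t. ii t \<le> k) \<and> ?A ii t \<subseteq> X \<union> A0 \<union> {J} \<and>
    (avoid (pick (?A ii t)) (X \<union> A0) \<or> card (?A ii t \<inter> (X - A0)) \<ge> t)" for t
  proof (induction t)
    case 0 then show ?case by (intro exI[of _ "\<lambda>_. 0"]) auto
  next
    case (Suc t)
    then obtain ii where ii: "\<forall>t. ii t \<le> k" "?A ii t \<subseteq> X \<union> A0 \<union> {J}"
      "avoid (pick (?A ii t)) (X \<union> A0) \<or> card (?A ii t \<inter> (X - A0)) \<ge> t" by blast
    let ?c = "pick (?A ii t)"
    note p = pk[OF ii(2)]
    show ?case
    proof (cases "avoid ?c (X \<union> A0)")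
      case True
      \<comment> \<open>The pick is already right: guessing position \<open>k\<close> adds only
        \<open>J\<close>, and by \<open>pickJ\<close> the pick stays the same.\<close>
      define ij where "ij = ii(t := k)"
      have e: "?A ij t = ?A ii t" unfolding ij_def by (rule chx_cong) auto
      have ij: "ij t = k" "\<forall>t. ij t \<le> k" using ii(1) by (auto simp: ij_def)
      have PJ: "Pt ?c k = J" using J p by blast
      have "?A ij (Suc t) = insert J (?A ii t)" unfolding chx.simps e ij(1) using PJ by simp
      then show ?thesis
        using ij(2) ii(2) True by (intro exI[of _ ij]) (auto simp: pickJ simp del: chx.simps)
    next
      case False
      then obtain q where q: "q < k" "Pt ?c q \<in> X \<union> A0" by (auto simp: avoid_def)
      moreover have "Pt ?c q \<notin> ?A ii t" using p q(1) by (auto simp: avoid_def)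
      ultimately have x: "Pt ?c q \<in> X - A0" "Pt ?c q \<notin> ?A ii t \<inter> (X - A0)" using chx_mono[of A0 pick Pt ii t] by auto
      \<comment> \<open>Guess a position \<open>q\<close> at which the pick meets \<open>X\<close>.
        Its vertex is new, because the pick avoids the vertices collected so far.\<close>
      define ij where "ij = ii(t := q)"
      have e: "?A ij t = ?A ii t" unfolding ij_def by (rule chx_cong) auto
      have ij: "ij t = q" "\<forall>t. ij t \<le> k" using ii(1) q(1) by (auto simp: ij_def)
      have "insert (Pt ?c q) (?A ii t) \<inter> (X - A0) = insert (Pt ?c q) (?A ii t \<inter> (X - A0))" using x by auto
      then have "card (insert (Pt ?c q) (?A ii t) \<inter> (X - A0)) = Suc (card (?A ii t \<inter> (X - A0)))"
        using x X by simp
      moreover have "?A ij (Suc t) = insert (Pt ?c q) (?A ii t)" unfolding chx.simps e ij(1) by simp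
      ultimately show ?thesis
        using ij(2) ii False q x(1) by (intro exI[of _ ij]) (simp del: chx.simps)
    qed
  qed
  then obtain ii where ii: "\<forall>t. ii t \<le> k" "?A ii k \<subseteq> X \<union> A0 \<union> {J}"
    "avoid (pick (?A ii k)) (X \<union> A0) \<or> card (?A ii k \<inter> (X - A0)) \<ge> k" by blast
  note p = pk[OF ii(2)]
  \<comment> \<open>If \<open>k\<close> members of \<open>X\<close> have been collected, these are
    all of \<open>X\<close> because \<open>card X <= k\<close>, and the pick avoids them by
    construction.\<close>
  have "avoid (pick (?A ii k)) (X \<union> A0)"
  proof (cases "avoid (pick (?A ii k)) (X \<union> A0)")
    case False
    then have "card (?A ii k \<inter> (X - A0)) \<ge> card (X - A0)"
      using ii(3) X card_mono[of X "X - A0"] by auto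
    then have "?A ii k \<inter> (X - A0) = X - A0" using X by (intro card_seteq) auto
    then have "X \<union> A0 \<subseteq> ?A ii k" using chx_mono[of A0 pick Pt ii k] by auto
    then show ?thesis using p unfolding avoid_def by blast
  qed
  then show ?thesis using ii(1) p unfolding Let_def by blast
qed

section \<open>Lexicographic maxima with ties broken by index\<close>

definition lge :: "(nat \<Rightarrow> nat) \<Rightarrow> (nat \<Rightarrow> real) \<Rightarrow> nat \<Rightarrow> nat \<Rightarrow> bool" where
  "lge f x c c' \<longleftrightarrow> f c' < f c \<or> (f c' = f c \<and> (x c' < x c \<or> (x c' = x c \<and> c \<le> c')))"

definition lmax :: "nat \<Rightarrow> (nat \<Rightarrow> nat) \<Rightarrow> (nat \<Rightarrow> real) \<Rightarrow> nat" where
  "lmax N f x = (THE c. c < N \<and> (\<forall>c'<N. lge f x c c'))"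

lemma lge_trans: "lge f x a b \<Longrightarrow> lge f x b c \<Longrightarrow> lge f x a c"
  unfolding lge_def by linarith

lemma lge_antisym: "lge f x a b \<Longrightarrow> lge f x b a \<Longrightarrow> a = b"
  unfolding lge_def by linarith

lemma lge_total: "lge f x a b \<or> lge f x b a"
  unfolding lge_def by linarith

text \<open>Breaking ties by index makes \<open>lge\<close> a linear order. The uniqueness gained
  here ends up bounding the output of the dominance runs.\<close>

lemma lmax_ex: "N > 0 \<Longrightarrow> \<exists>!c. c < N \<and> (\<forall>c'<N. lge f x c c')"
proof (rule ex_ex1I)
  show "\<exists>c. c < N \<and> (\<forall>c'<N. lge f x c c')" if "N > 0"
    using that
  proof (induction N)
    case (Suc N)
    show ?case
    proof (cases "N = 0")
      case True then show ?thesis using lge_total by auto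
    next
      case False
      then obtain c where c: "c < N" "\<forall>c'<N. lge f x c c'" using Suc by auto
      show ?thesis
      proof (cases "lge f x c N")
        case True then show ?thesis using c by (intro exI[of _ c]) (auto simp: less_Suc_eq)
      next
        case False
        then have "lge f x N c" "lge f x N N" using lge_total by blast+
        then have "lge f x N c'" if "c' < Suc N" for c'
          using that c(2) lge_trans[of f x N c c'] by (cases "c' = N") auto
        then show ?thesis by blast
      qed
    qed
  qed simp
qed (use lge_antisym in blast)

lemma lmax_iff: "N > 0 \<Longrightarrow> c < N \<Longrightarrow> (\<forall>c'<N. lge f x c c') \<longleftrightarrow> c = lmax N f x"
  unfolding lmax_def using the1_equality[OF lmax_ex] theI'[OF lmax_ex[of N f x]] by blast

lemma lmax_props: "N > 0 \<Longrightarrow> lmax N f x < N \<and> (\<forall>c'<N. lge f x (lmax N f x) c')"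
  unfolding lmax_def by (rule theI'[OF lmax_ex])

text \<open>A stored path owns \<open>k + 1\<close> cells. The first \<open>k\<close> hold its
  vertices with padding; cell \<open>k\<close> holds a sentinel and is not tested.\<close>

definition hitf :: "nat \<Rightarrow> (nat \<Rightarrow> nat) \<Rightarrow> nat \<Rightarrow> nat set \<Rightarrow> bool" where
  "hitf k PT fi A \<longleftrightarrow> (\<exists>p<k. PT (fi * (k + 1) + p) \<in> A)"

definition HIT :: "nat \<Rightarrow> com" where
  "HIT k = ''hit'' :== Const 0 ;;
     For ''hx'' (sv ''hc'') (For ''hp'' (Const k)
       (Cond (WLoad ''pth'' (sv ''fi'' [*] Const (k + 1) [+] sv ''hp'') [=] WLoad ''X'' (sv ''hx'')) (''hit'' :== Const 1) Skip))"

lemma modw_HIT [simp]: "modw (HIT k) = {''hit'', ''hx'', ''hp''}"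
  and modr_HIT [simp]: "modr (HIT k) = {}"
  by (auto simp: HIT_def)

context word
begin

lemma H_HIT:
  assumes s: "words s ''hc'' 0 = t" "words s ''fi'' 0 = fi" "t \<le> V" "k \<le> V"
  shows "H (t * (100 * k + 100) + 100) (HIT k) s (\<lambda>s'. words s' ''hit'' 0 = (if hitf k (words s ''pth'') fi (words s ''X'' ` {..<t}) then 1 else 0))"
proof -
  let ?R = "\<lambda>a p. words s ''pth'' (fi * (k + 1) + p) = words s ''X'' a"
  show ?thesis unfolding HIT_def
  proof (rule H_slS[where u = "t * (100 * k + 100) + 50"], simp, simp, goal_cases)
    case (1 s1)
    note a1 = agrw[OF 1(3), simplified]
    show ?case
    proof (rule H_For_const[where N = t and t = "90 * k + 50" and I = "\<lambda>i s'. words s' ''hit'' 0 = (if \<exists>a<i. \<exists>p<k. ?R a p then 1 else 0)"], goal_cases)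
      case (6 i s2)
      note a2 = agrw[OF 6(5), simplified]
      show ?case
      proof (rule H_For_const[where N = k and t = 70 and I = "\<lambda>p s'. words s' ''hit'' 0 = (if (\<exists>a<i. \<exists>p<k. ?R a p) \<or> (\<exists>p'<p. ?R i p') then 1 else 0)"], goal_cases)
        case (6 p s3)
        note a3 = agrw[OF 6(5), simplified]
        have "words s3 ''fi'' 0 = fi" "words s3 ''hx'' 0 = i" "words s3 ''pth'' = words s ''pth''" "words s3 ''X'' = words s ''X''"
          using a1 a2 a3 s \<open>words s2 ''hx'' 0 = i\<close> by simp_all
        then show ?case
          by (intro H_sl) (use 6 V2 in \<open>auto simp: less_Suc_eq\<close>)
      next
        case (7 s3)
        then show ?case by (auto simp: less_Suc_eq)
      qed (use 6 s in auto)
    next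
      case (7 s2)
      then show ?case by (auto simp: hitf_def)
    next
      case 8 show ?case by (simp add: algebra_simps)
    qed (use s a1 1(1) in auto)
  qed simp
qed

end

section \<open>Champions of a block of last vertices\<close>

text \<open>The base-\<open>N\<close> digits of the chain code \<open>zc\<close> name the champions \<open>cs\<close>, the base-\<open>(k + 1)\<close> digits of \<open>io\<close>
  the position \<open>ix\<close> on each champion whose vertex the next one has to avoid.\<close>

definition DECODE :: "nat \<Rightarrow> com" where
  "DECODE k = (''t1'' :== sv ''zc'' ;; ''t2'' :== sv ''io'') ;;
     For ''s'' (Const (k + 1)) (
       WStore ''cs'' (sv ''s'') (sv ''t1'' [-] (sv ''t1'' [div] sv ''N'') [*] sv ''N'') ;; ''t1'' :== sv ''t1'' [div] sv ''N'' ;;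
       WStore ''ix'' (sv ''s'') (sv ''t2'' [-] (sv ''t2'' [div] Const (k + 1)) [*] Const (k + 1)) ;; ''t2'' :== sv ''t2'' [div] Const (k + 1))"

lemma modw_DECODE [simp]: "modw (DECODE k) = {''t1'', ''t2'', ''s'', ''cs'', ''ix''}"
  and modr_DECODE [simp]: "modr (DECODE k) = {}"
  by (auto simp: DECODE_def)

text \<open>Coordinate \<open>e = s * N + c\<close> stands for the assertion that in round
  \<open>s\<close> the claimed champion, kept as \<open>pe e\<close>, is at least as good as
  candidate \<open>c\<close>. The column part of a candidate is the presence and the weight of the
  edge from its last vertex to \<open>v\<close>.\<close>

definition COLS :: "nat \<Rightarrow> com" where
  "COLS C = For ''e'' (sv ''D'') (
     (''s'' :== sv ''e'' [div] sv ''N'' ;; ''c'' :== sv ''e'' [-] sv ''s'' [*] sv ''N'' ;;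
      WStore ''pe'' (sv ''e'') (sv ''s'' [*] sv ''N'' [+] WLoad ''cs'' (sv ''s'')) ;;
      ''ww'' :== sv ''be'' [*] sv ''d'' [+] sv ''c'' [div] Const C) ;;
     For ''v'' (sv ''S'') (
       WStore ''bf'' (sv ''e'' [*] sv ''S'' [+] sv ''v'') (WLoad ''aw'' (sv ''ww'' [*] sv ''S'' [+] sv ''v'')) ;;
       RStore ''bx'' (sv ''e'' [*] sv ''S'' [+] sv ''v'') (RLoad ''wt'' (sv ''ww'' [*] sv ''S'' [+] sv ''v''))))"

lemma modw_COLS [simp]: "modw (COLS C) = {''e'', ''s'', ''c'', ''pe'', ''ww'', ''v'', ''bf''}"
  and modr_COLS [simp]: "modr (COLS C) = {''bx''}"
  by (auto simp: COLS_def)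

definition FI :: "nat \<Rightarrow> wexp \<Rightarrow> wexp" where
  "FI C c = (sv ''j'' [*] sv ''S'' [+] sv ''u'') [*] (sv ''S'' [*] Const C) [+] sv ''be'' [*] sv ''N'' [+] c"

text \<open>The row part of a candidate is its weight and a flag, cleared if the path meets the
  vertices forbidden in round \<open>s\<close>. Those are read off the claimed champions at the
  positions \<open>ix\<close>, all of them on paths from \<open>u\<close>, so they do not depend on
  \<open>v\<close>. This independence makes the comparisons separable.\<close>

definition ROWS :: "nat \<Rightarrow> com" where
  "ROWS k = For ''u'' (sv ''n'') (For ''s'' (Const (k + 1)) (
     For ''c'' (sv ''N'') (
       (''fi'' :== FI ((k + 1) ^ k) (sv ''c'') ;; ''hc'' :== sv ''s'') ;; HIT k ;;
       (Cond (sv ''hit'' [<] Const 1)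
          (WStore ''af'' (sv ''u'' [*] sv ''D'' [+] (sv ''s'' [*] sv ''N'' [+] sv ''c'')) (WLoad ''fv'' (sv ''fi'')))
          (WStore ''af'' (sv ''u'' [*] sv ''D'' [+] (sv ''s'' [*] sv ''N'' [+] sv ''c'')) (Const 0)) ;;
        RStore ''ax'' (sv ''u'' [*] sv ''D'' [+] (sv ''s'' [*] sv ''N'' [+] sv ''c'')) (RLoad ''fw'' (sv ''fi'')))) ;;
     WStore ''X'' (sv ''s'') (WLoad ''pth'' (FI ((k + 1) ^ k) (WLoad ''cs'' (sv ''s'')) [*] Const (k + 1) [+] WLoad ''ix'' (sv ''s'')))))"

lemma modw_ROWS [simp]: "modw (ROWS k) = {''u'', ''s'', ''c'', ''fi'', ''hc'', ''hit'', ''hx'', ''hp'', ''af'', ''X''}"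
  and modr_ROWS [simp]: "modr (ROWS k) = {''ax''}"
  by (auto simp: ROWS_def)

lemma div_eq_0_iff': "(e::nat) < N * t \<Longrightarrow> e div N < t"
  by (simp add: less_mult_imp_div_less mult.commute)

text \<open>A block has \<open>N\<close> candidates and a chain has \<open>k + 1\<close> picks, the
  first one and one after each of \<open>k\<close> guesses. Hence \<open>D\<close> coordinates and
  \<open>Zc\<close> possible claims. Blocks and chunks may overrun the vertices, within the stride
  \<open>S\<close>.\<close>

locale algo = dompar +
  fixes k d N C Zc nb :: nat
  assumes k1: "k \<ge> 1" and C: "C = (k + 1) ^ k" and N: "N = d * C" and D: "D = (k + 1) * N" and Zc: "Zc = N ^ (k + 1)"
    and d0: "d > 0"
    and Vb: "Zc \<le> V" "C \<le> V" "k + 1 \<le> V" "nb * C \<le> V" "(k + 2) * S * S * S * C \<le> V"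
    and sz: "nb * d \<le> S" "n \<le> nb * d" "n \<le> nc * m" "n < S"
begin

lemma C0: "C > 0" and N0: "N > 0" and S0: "S > 0"
  using d0 sz by (auto simp: C N)

definition par2 :: "state \<Rightarrow> bool" where
  "par2 s \<longleftrightarrow> par s \<and> words s ''d'' 0 = d \<and> words s ''N'' 0 = N \<and> words s ''Zc'' 0 = Zc \<and> words s ''nb'' 0 = nb"

definition "parnames2 = parnames \<union> {''d'', ''N'', ''Zc'', ''nb''}"

lemma par2_agr: "par2 s \<Longrightarrow> agr W R s' s \<Longrightarrow> W \<inter> parnames2 = {} \<Longrightarrow> par2 s'"
  unfolding par2_def parnames2_def
proof (elim conjE, intro conjI)
  assume "par s" "agr W R s' s" "W \<inter> (parnames \<union> {''d'', ''N'', ''Zc'', ''nb''}) = {}"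
  then show "par s'" using par_agr[of s W R s'] by auto
qed (auto simp: agr_def)

lemma par2D: "par2 s \<Longrightarrow> words s ''n'' 0 = n" "par2 s \<Longrightarrow> words s ''S'' 0 = S" "par2 s \<Longrightarrow> words s ''D'' 0 = D"
  "par2 s \<Longrightarrow> words s ''d'' 0 = d" "par2 s \<Longrightarrow> words s ''N'' 0 = N" "par2 s \<Longrightarrow> words s ''Zc'' 0 = Zc" "par2 s \<Longrightarrow> words s ''nb'' 0 = nb"
  "par2 s \<Longrightarrow> par s"
  by (auto simp: par2_def par_def)

text \<open>Candidate \<open>c\<close> of block \<open>be\<close> is entry \<open>c mod C\<close> of the family of paths with \<open>j\<close> vertices from \<open>u\<close>
  to vertex \<open>be * d + c div C\<close>.\<close>

definition fidx :: "nat \<Rightarrow> nat \<Rightarrow> nat \<Rightarrow> nat \<Rightarrow> nat" where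
  "fidx j be u c = (j * S + u) * (S * C) + be * N + c"

lemma wn_FI: "par2 s \<Longrightarrow> wn s (FI (Suc k ^ k) e) = fidx (words s ''j'' 0) (words s ''be'' 0) (words s ''u'' 0) (wn s e)"
  unfolding fidx_def by (simp add: FI_def par2D C)

lemma NV: "N \<le> V"
proof -
  have "N ^ 1 \<le> Zc" unfolding Zc by (rule power_increasing) (use N0 in auto)
  then show ?thesis using Vb by simp
qed

lemma be_le: "be < nb \<Longrightarrow> c < N \<Longrightarrow> be * N + c < S * C"
proof -
  assume "be < nb" "c < N"
  then have "be * N + c < nb * N" by (intro mr_less)
  also have "nb * N = (nb * d) * C" by (simp add: N)
  also have "\<dots> \<le> S * C" using sz by (intro mult_right_mono) auto
  finally show ?thesis .
qed

lemma fidx_le: "j \<le> k \<Longrightarrow> be < nb \<Longrightarrow> u < n \<Longrightarrow> c < N \<Longrightarrow> fidx j be u c < V"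
proof -
  assume a: "j \<le> k" "be < nb" "u < n" "c < N"
  have "fidx j be u c < ((k + 1) * S) * (S * C)"
    unfolding fidx_def add.assoc by (intro mr_less be_le) (use a sz mr_less[of u S j "k + 1"] in auto)
  also have "\<dots> \<le> (k + 2) * S * (S * C) * S" using S0 by (simp add: mult_le_mono)
  also have "\<dots> = (k + 2) * S * S * S * C" by simp
  finally show ?thesis using Vb by linarith
qed

lemma H_DECODE:
  assumes ps: "par2 s" and zc: "words s ''zc'' 0 = zc" "words s ''io'' 0 = io"
  shows "H (200 * (k + 1) + 100) (DECODE k) s (\<lambda>s'. \<forall>t\<le>k. words s' ''cs'' t = zc div N ^ t mod N \<and> words s' ''ix'' t = io div (k + 1) ^ t mod (k + 1))"
  unfolding DECODE_def
proof (rule H_slS[where u = "200 * (k + 1) + 50"], simp, goal_cases)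
  case 1 then show ?case using bndD[OF 1] by simp
next
  case (2 s1)
  note a1 = agrw[OF 2(3), simplified]
  show ?case
  proof (rule H_For_const[where N = "k + 1" and t = "150" and I = "\<lambda>t s'. (\<forall>a<t. words s' ''cs'' a = zc div N ^ a mod N \<and> words s' ''ix'' a = io div (k + 1) ^ a mod (k + 1))
       \<and> words s' ''t1'' 0 = zc div N ^ t \<and> words s' ''t2'' 0 = io div (k + 1) ^ t"], goal_cases)
    case (6 t s2)
    note a2 = agrw[OF 6(5), simplified]
    have N2: "words s2 ''N'' 0 = N" using a1 a2 ps by (simp add: par2D)
    have t: "words s2 ''t1'' 0 = zc div N ^ t" "words s2 ''t2'' 0 = io div (k + 1) ^ t" using 6(2) by auto
    have le: "zc div N ^ t \<le> V" "io div (k + 1) ^ t \<le> V" using bndD[OF 6(4)] t by metis+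
    have tV: "t \<le> V" using 6(1) Vb by simp
    have m: "x - x div y * y = x mod y" for x y :: nat by (simp add: minus_div_mult_eq_mod)
    have q: "x div y ^ Suc t = x div y ^ t div y" for x y :: nat by (simp add: div_mult2_eq mult.commute[of y])
    show ?case
    proof (rule H_sl, simp, goal_cases)
      case 1
      then show ?case using le t N2 6(3) by (simp add: m le_trans[OF mod_less_eq_dividend] le_trans[OF div_le_dividend])
    next
      case 2
      have "\<forall>a<t. words s2 ''cs'' a = zc div N ^ a mod N \<and> words s2 ''ix'' a = io div (k + 1) ^ a mod (k + 1)"
        using 6(2) by blast
      then show ?case using 6(3) t N2 unfolding q by (simp add: m All_less_Suc del: mult_Suc_right)
    next
      case 3 show ?case by simp
    qed
  next
    case (7 s2) then show ?case by (auto simp: less_Suc_eq_le)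
  qed (use zc Vb in \<open>auto simp: 2(1)\<close>)
qed simp

lemma H_COLS:
  assumes ps: "par2 s" and be: "words s ''be'' 0 = be" "be < nb" and cs: "\<forall>t\<le>k. words s ''cs'' t < N"
  shows "H (D * (100 * S + 200) + 100) (COLS C) s (\<lambda>s'. \<forall>e<D. words s' ''pe'' e = e div N * N + words s ''cs'' (e div N) \<and>
     (\<forall>v<S. words s' ''bf'' (e * S + v) = words s ''aw'' ((be * d + e mod N div C) * S + v) \<and>
            reals s' ''bx'' (e * S + v) = reals s ''wt'' ((be * d + e mod N div C) * S + v)))"
  unfolding COLS_def
proof (rule H_For_const[where N = D and t = "100 * S + 150" and I = "\<lambda>E s'. \<forall>e<E. words s' ''pe'' e = e div N * N + words s ''cs'' (e div N) \<and>
     (\<forall>v<S. words s' ''bf'' (e * S + v) = words s ''aw'' ((be * d + e mod N div C) * S + v) \<and>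
            reals s' ''bx'' (e * S + v) = reals s ''wt'' ((be * d + e mod N div C) * S + v))"], goal_cases)
  case (6 e s1)
  note a1 = agrw[OF 6(5), simplified] agrr[OF 6(5), simplified]
  have p1: "par2 s1" by (rule par2_agr[OF ps 6(5)]) (simp add: parnames_def parnames2_def)
  have ek: "e div N \<le> k" using 6(1) div_eq_0_iff'[of e N "k + 1"] D by (simp add: mult.commute)
  have eN: "e div N * N + words s ''cs'' (e div N) < (k + 1) * N"
    by (rule mr_less) (use cs ek in auto)
  then have eNV: "e div N * N + words s ''cs'' (e div N) \<le> V" using bounds(3) unfolding D by simp
  have eV: "e mod N \<le> V" "e div N \<le> V"
    using 6(1) bounds(3) mod_less_eq_dividend[of e N] div_le_dividend[of e N] by linarith+
  have wS: "be * d + e mod N div C < S"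
  proof -
    have "e mod N div C < d" using N0 by (intro div_eq_0_iff') (simp add: N mult.commute)
    then have "be * d + e mod N div C < nb * d" using be by (intro mr_less)
    then show ?thesis using sz by simp
  qed
  have m: "e - e div N * N = e mod N" by (simp add: minus_div_mult_eq_mod)
  have SV: "S \<le> V" by (rule bounds)
  show ?case
  proof (rule H_slS[where u = "100 * S + 50"], simp, goal_cases)
    case 1
    show ?case using par2D[OF ps] 6(3) be(1) eNV eV wS SV a1 by (simp add: m)
  next
    case (2 s2)
    note a2 = agrw[OF 2(3), simplified] agrr[OF 2(3), simplified]
    have p2: "par2 s2" by (rule par2_agr[OF p1 2(3)]) (simp add: parnames_def parnames2_def)
    have s2: "words s2 ''ww'' 0 = be * d + e mod N div C" "words s2 ''e'' 0 = e" "words s2 ''pe'' e = e div N * N + words s ''cs'' (e div N)"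
      "\<And>e'. e' \<noteq> e \<Longrightarrow> words s2 ''pe'' e' = words s1 ''pe'' e'" "words s2 ''bf'' = words s1 ''bf''" "reals s2 ''bx'' = reals s1 ''bx''"
      "words s2 ''aw'' = words s ''aw''" "reals s2 ''wt'' = reals s ''wt''"
      using par2D[OF ps] 6(3) be(1) a1 by (simp_all add: 2(1) m)
    show ?case
    proof (rule H_For_const[where N = S and t = 60 and I = "\<lambda>v s'. (\<forall>v'<v. words s' ''bf'' (e * S + v') = words s ''aw'' ((be * d + e mod N div C) * S + v') \<and>
            reals s' ''bx'' (e * S + v') = reals s ''wt'' ((be * d + e mod N div C) * S + v')) \<and>
         (\<forall>a. a < e * S \<longrightarrow> words s' ''bf'' a = words s1 ''bf'' a \<and> reals s' ''bx'' a = reals s1 ''bx'' a)"], goal_cases)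
      case (6 v s3)
      note a3 = agrw[OF 6(5), simplified] agrr[OF 6(5), simplified]
      have p3: "par2 s3" by (rule par2_agr[OF p2 6(5)]) (simp add: parnames_def parnames2_def)
      have "words s3 ''e'' 0 = e" "words s3 ''ww'' 0 = be * d + e mod N div C" "words s3 ''aw'' = words s ''aw''" "reals s3 ''wt'' = reals s ''wt''"
        using a3 s2 by simp_all
      then show ?case
        by (intro H_sl) (use p3 6(2,3) bndD[OF 6(4), of "''aw''"] in \<open>auto simp: par2D less_Suc_eq\<close>)
    next
      case (7 s3)
      note a3 = agrw[OF 7(4), simplified] agrr[OF 7(4), simplified]
      show ?case
      proof (intro allI impI, goal_cases)
        case (1 e')
        show ?case
        proof (cases "e' = e")
          case True then show ?thesis using 7(1) s2 a3 by simp
        next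
          case False
          then have e': "e' < e" using 1 by simp
          have lt: "e' * S + v < e * S" if "v < S" for v using mr_less[OF that e'] .
          show ?thesis using 7(1) lt False e' \<open>\<forall>e'<e. _ e'\<close> s2(4) a3 by simp
        qed
      qed
    next
      case 8 show ?case by simp
    qed (use p2 s2 bounds in \<open>simp_all add: par2D\<close>)
  qed simp
next
  case 8 show ?case by (simp add: algebra_simps)
qed (use ps bounds in \<open>simp_all add: par2D\<close>)

definition xpos :: "(nat \<Rightarrow> nat) \<Rightarrow> (nat \<Rightarrow> nat) \<Rightarrow> (nat \<Rightarrow> nat) \<Rightarrow> nat \<Rightarrow> nat \<Rightarrow> nat \<Rightarrow> nat \<Rightarrow> nat" where
  "xpos PT cs ix j be u a = PT (fidx j be u (cs a) * (k + 1) + ix a)"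

lemma H_ROWS:
  assumes ps: "par2 s" and be: "words s ''be'' 0 = be" "be < nb" and j: "words s ''j'' 0 = j" "j \<le> k"
    and cs: "\<forall>t\<le>k. words s ''cs'' t < N" 
    and x: "x = xpos (words s ''pth'') (words s ''cs'') (words s ''ix'') j be"
  shows "H (n * ((k + 1) * (N * ((k + 1) * (100 * k + 100) + 500) + 300) + 100) + 100) (ROWS k) s (\<lambda>s'. \<forall>u<n. \<forall>e<D.
     words s' ''af'' (u * D + e) = (if hitf k (words s ''pth'') (fidx j be u (e mod N)) (x u ` {..<e div N}) then 0 else words s ''fv'' (fidx j be u (e mod N))) \<and>
     reals s' ''ax'' (u * D + e) = reals s ''fw'' (fidx j be u (e mod N)))"
proof -
  define val where "val u e = (if hitf k (words s ''pth'') (fidx j be u (e mod N)) (x u ` {..<e div N}) then 0 else words s ''fv'' (fidx j be u (e mod N)))" for u e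
  define rv where "rv u e = reals s ''fw'' (fidx j be u (e mod N))" for u e
  let ?ok = "\<lambda>s' u e. words s' ''af'' (u * D + e) = val u e \<and> reals s' ''ax'' (u * D + e) = rv u e"
  have D0: "D > 0" using N0 by (simp add: D)
  have lt: "u' * D + e' < u * D" if "u' < u" "e' < D" for u' u e' using mr_less[OF that(2,1)] .
  show ?thesis unfolding ROWS_def
  proof (rule H_For_const[where N = n and t = "(k + 1) * (N * ((k + 1) * (100 * k + 100) + 500) + 300) + 50" and I = "\<lambda>u s'. \<forall>u'<u. \<forall>e<D. ?ok s' u' e"], goal_cases)
    case (6 u s1)
    note a1 = agrw[OF 6(5), simplified] agrr[OF 6(5), simplified]
    note u = 6(1,3) and I1 = 6(2)
    have p1: "par2 s1" by (rule par2_agr[OF ps 6(5)]) (simp add: parnames_def parnames2_def)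
    show ?case
    proof (rule H_For_const[where N = "k + 1" and t = "N * ((k + 1) * (100 * k + 100) + 500) + 250" and
         I = "\<lambda>t s'. (\<forall>u'<u. \<forall>e<D. ?ok s' u' e) \<and> (\<forall>e<t * N. ?ok s' u e) \<and> (\<forall>a<t. words s' ''X'' a = x u a)"], goal_cases)
      case (6 t s2)
      note a2 = agrw[OF 6(5), simplified] agrr[OF 6(5), simplified]
      note t = 6(1,3) and I2 = 6(2)
      have p2: "par2 s2" by (rule par2_agr[OF p1 6(5)]) (simp add: parnames_def parnames2_def)
      have pth2: "words s2 ''pth'' = words s ''pth''" "words s2 ''cs'' = words s ''cs''" "words s2 ''ix'' = words s ''ix''" using a1 a2 by simp_all
      have X2: "words s2 ''X'' ` {..<t} = x u ` {..<t}" using I2 by (intro image_cong) auto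
      show ?case
      proof (rule H_Seq[where t = "N * ((k + 1) * (100 * k + 100) + 500) + 100" and u = 120 and
           R = "\<lambda>s'. (\<forall>u'<u. \<forall>e<D. ?ok s' u' e) \<and> (\<forall>e<t * N + N. ?ok s' u e)"], goal_cases)
        case 1
        show ?case
        proof (rule H_For_const[where N = N and t = "(k + 1) * (100 * k + 100) + 450" and
           I = "\<lambda>c s'. (\<forall>u'<u. \<forall>e<D. ?ok s' u' e) \<and> (\<forall>e<t * N + c. ?ok s' u e)"], goal_cases)
          case (6 c s3)
          note a3 = agrw[OF 6(5), simplified] agrr[OF 6(5), simplified]
          note c = 6(1,3) and I3 = 6(2)
          have p3: "par2 s3" by (rule par2_agr[OF p2 6(5)]) (simp add: parnames_def parnames2_def)
          have v3: "words s3 ''j'' 0 = j" "words s3 ''u'' 0 = u" "words s3 ''be'' 0 = be" "words s3 ''s'' 0 = t"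
            using a1 a2 a3 j be u t by simp_all
          have fV: "fidx j be u c \<le> V" using fidx_le[OF j(2) be(2) u(1) c(1)] by simp
          show ?case
          proof (rule H_slS[where u = "(k + 1) * (100 * k + 100) + 350"], simp, goal_cases)
            case 1
            show ?case using p3 v3 c fV t Vb(3) by (simp add: wn_FI)
          next
            case (2 s4)
            note a4 = agrw[OF 2(3), simplified] agrr[OF 2(3), simplified]
            have p4: "par2 s4" by (rule par2_agr[OF p3 2(3)]) (simp add: parnames_def parnames2_def)
            have v4: "words s4 ''fi'' 0 = fidx j be u c" "words s4 ''hc'' 0 = t" "words s4 ''X'' = words s2 ''X''" "words s4 ''pth'' = words s ''pth''"
              using p3 v3 c a3 pth2 by (simp_all add: 2(1) wn_FI)
            have tV: "t \<le> V" using t Vb by simp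
            have "t * (100 * k + 100) \<le> (k + 1) * (100 * k + 100)" using t by (intro mult_right_mono) auto
            then show ?case
            proof (intro H_Seq[OF H_HIT[OF v4(2,1) tV], where u = 220], goal_cases)
              case 1 show ?case using Vb by simp
            next
              case (2 s5)
              note a5 = agrw[OF 2(4), simplified] agrr[OF 2(4), simplified]
              have p5: "par2 s5" by (rule par2_agr[OF p4 2(4)]) (simp add: parnames_def parnames2_def)
              have em: "(t * N + c) mod N = c" "(t * N + c) div N = t" using c by auto
              have h5: "words s5 ''hit'' 0 = (if hitf k (words s ''pth'') (fidx j be u c) (x u ` {..<t}) then 1 else 0)"
                using 2(2) v4 X2 by simp
              have v5: "words s5 ''fi'' 0 = fidx j be u c" "words s5 ''u'' 0 = u" "words s5 ''s'' 0 = t" "words s5 ''c'' 0 = c"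
                "words s5 ''fv'' = words s ''fv''" "reals s5 ''fw'' = reals s ''fw''" "words s5 ''af'' = words s3 ''af''" "reals s5 ''ax'' = reals s3 ''ax''"
                using a5 a4 v4 v3 a3 a2 a1 c by simp_all
              have bV: "words s ''fv'' a \<le> V" for a using bndD[OF 2(3), of "''fv''" a] v5 by simp
              have "t * N + c < D" unfolding D by (rule mr_less) (use t c in auto)
              then have ne: "u' * D + e \<noteq> u * D + (t * N + c)" if "u' < u" "e < D" for u' e
                using lt[OF that] by simp
              show ?case
              proof (rule H_sl, simp, goal_cases)
                case 1 show ?case using v5 bV by simp
              next
                case 2
                have "val u (t * N + c) = (if words s5 ''hit'' 0 < 1 then words s ''fv'' (fidx j be u c) else 0)"
                  "rv u (t * N + c) = reals s ''fw'' (fidx j be u c)"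
                  using h5 c(1) by (simp_all add: val_def rv_def)
                then show ?case using I3 v5 ne par2D[OF p5] by (simp add: All_less_Suc)
              next
                case 3 show ?case by simp
              qed
            next
              case 3 then show ?case by simp
            qed
          next
            case 3 show ?case by (simp add: FI_def)
          qed
        next
          case 8 show ?case by (simp add: algebra_simps)
        qed (use p2 NV I2 in \<open>simp_all add: par2D\<close>)
      next
        case (2 s3)
        note a3 = agrw[OF 2(3), simplified] agrr[OF 2(3), simplified]
        have p3: "par2 s3" by (rule par2_agr[OF p2 2(3)]) (simp add: parnames_def parnames2_def)
        have v3: "words s3 ''j'' 0 = j" "words s3 ''u'' 0 = u" "words s3 ''be'' 0 = be" "words s3 ''s'' 0 = t" "words s3 ''X'' = words s2 ''X''"
            "words s3 ''pth'' = words s ''pth''" "words s3 ''cs'' = words s ''cs''" "words s3 ''ix'' = words s ''ix''"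
          using a1 a2 a3 j be u t pth2 by simp_all
        have bV: "words s ''pth'' a \<le> V" for a using bndD[OF 2(2), of "''pth''" a] v3 by simp
        show ?case
        proof (rule H_sl, simp, goal_cases)
          case 1 show ?case using v3 bV by simp
        next
          case 2
          have "x u t = words s ''pth'' (fidx j be u (words s ''cs'' t) * (k + 1) + words s ''ix'' t)"
            by (simp add: x xpos_def)
          then show ?case using \<open>_ \<and> (\<forall>e<t * N + N. _ e)\<close> v3 I2 p3
            by (simp add: All_less_Suc wn_FI add.commute)
        next
          case 3 show ?case by (simp add: FI_def)
        qed
      next
        case 3 show ?case by simp
      qed
    next
      case (7 s2)
      then show ?case by (auto simp: All_less_Suc D)
    next
      case 8 show ?case by (simp add: algebra_simps)
    qed (use I1 Vb in simp_all)
  next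
    case (7 s1)
    then show ?case by (simp add: val_def rv_def)
  next
    case 8 show ?case by (simp add: algebra_simps)
  qed (use ps bounds in \<open>simp_all add: par2D\<close>)
qed

end

text \<open>The forbidden sets on the left come from the claimed sequence itself. By strong
  induction, if all earlier claims are right, so is the next forbidden set; consistency with itself
  therefore already means being the true chain.\<close>

lemma chain_eq_chx:
  assumes x: "\<And>a. x a = Pt (cs a) (ii a)"
  shows "(\<forall>t\<le>k. cs t = pick (x ` {..<t})) \<longleftrightarrow> (\<forall>t\<le>k. cs t = pick (chx pick Pt ii {} t))"
proof -
  have A: "x ` {..<t} = chx pick Pt ii {} t" if "\<And>a. a < t \<Longrightarrow> cs a = pick (chx pick Pt ii {} a)" for t
    using that by (induction t) (auto simp: lessThan_Suc x)
  show ?thesis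
  proof
    assume *: "\<forall>t\<le>k. cs t = pick (x ` {..<t})"
    have "t \<le> k \<Longrightarrow> cs t = pick (chx pick Pt ii {} t)" for t
    proof (induction t rule: less_induct)
      case (less t)
      then have "x ` {..<t} = chx pick Pt ii {} t" by (intro A) auto
      then show ?case using * less by simp
    qed
    then show "\<forall>t\<le>k. cs t = pick (chx pick Pt ii {} t)" by blast
  next
    assume "\<forall>t\<le>k. cs t = pick (chx pick Pt ii {} t)"
    then show "\<forall>t\<le>k. cs t = pick (x ` {..<t})" using A by simp
  qed
qed

section \<open>Running through all claims for one block\<close>

definition PREP :: "nat \<Rightarrow> com" where
  "PREP k = DECODE k ;; COLS ((k + 1) ^ k) ;; ROWS k ;;
     (''ob'' :== (((sv ''j'' [*] sv ''S'' [+] sv ''be'') [*] Const ((k + 1) ^ k) [+] sv ''io'') [*] sv ''S'') [*] sv ''S'' ;;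
      ''ov'' :== WLoad ''cs'' (Const k))"

lemma modw_PREP [simp]: "modw (PREP k) = {''t1'', ''t2'', ''s'', ''cs'', ''ix'', ''e'', ''c'', ''pe'', ''ww'', ''v'', ''bf'', ''u'', ''fi'', ''hc'', ''hit'', ''hx'', ''hp'', ''af'', ''X'', ''ob'', ''ov''}"
  and modr_PREP [simp]: "modr (PREP k) = {''bx'', ''ax''}"
  by (auto simp: PREP_def)

definition BLOCK :: "nat \<Rightarrow> com" where
  "BLOCK k = For ''io'' (Const ((k + 1) ^ k)) (For ''zc'' (sv ''Zc'') (PREP k ;; DOM))"

lemma modw_BLOCK [simp]: "modw (BLOCK k) = {''io'', ''zc'', ''t1'', ''t2'', ''s'', ''cs'', ''ix'', ''e'', ''c'', ''pe'', ''ww'', ''v'', ''bf'', ''u'', ''fi'', ''hc'', ''hit'', ''hx'', ''hp'', ''af'', ''X'', ''ob'', ''ov'',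
   ''ch'', ''ji'', ''h'', ''x'', ''nd'', ''cd'', ''q'', ''hq'', ''ke'', ''kp'', ''i'', ''vb'', ''rk'', ''l'', ''va'', ''tr'', ''ec'',
     ''al'', ''ee'', ''hf'', ''xx'', ''rem'', ''bt'', ''sc'', ''se'', ''sp'', ''ok'', ''oc''}"
  and modr_BLOCK [simp]: "modr (BLOCK k) = {''bx'', ''ax''}"
  by (auto simp: BLOCK_def)

context algo
begin

text \<open>The flag sum is 2 exactly for a stored path that avoids \<open>A\<close> and whose last
  vertex is adjacent to \<open>v\<close>. If there is no such candidate, the maximum is meaningless;
  the merge tests admissibility again.\<close>

definition cpick :: "state \<Rightarrow> nat \<Rightarrow> nat \<Rightarrow> nat \<Rightarrow> nat \<Rightarrow> nat set \<Rightarrow> nat" where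
  "cpick s j be u v A = lmax N
     (\<lambda>c. (if hitf k (words s ''pth'') (fidx j be u c) A then 0 else words s ''fv'' (fidx j be u c)) + words s ''aw'' ((be * d + c div C) * S + v))
     (\<lambda>c. reals s ''fw'' (fidx j be u c) + reals s ''wt'' ((be * d + c div C) * S + v))"

definition cpos :: "state \<Rightarrow> nat \<Rightarrow> nat \<Rightarrow> nat \<Rightarrow> nat \<Rightarrow> nat \<Rightarrow> nat" where
  "cpos s j be u c p = words s ''pth'' (fidx j be u c * (k + 1) + p)"

definition cch :: "state \<Rightarrow> nat \<Rightarrow> nat \<Rightarrow> nat \<Rightarrow> nat \<Rightarrow> nat \<Rightarrow> nat \<Rightarrow> nat" where
  "cch s j be u v io t = cpick s j be u v (chx (cpick s j be u v) (cpos s j be u) (\<lambda>t. io div (k + 1) ^ t mod (k + 1)) {} t)"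

definition goodz :: "state \<Rightarrow> nat \<Rightarrow> nat \<Rightarrow> nat \<Rightarrow> nat \<Rightarrow> nat \<Rightarrow> nat \<Rightarrow> bool" where
  "goodz s j be io u v zc \<longleftrightarrow> (\<forall>t\<le>k. zc div N ^ t mod N = cch s j be u v io t)"

lemma cch_less: "cch s j be u v io t < N"
  unfolding cch_def cpick_def using lmax_props[OF N0] by blast

text \<open>Guarantees that every pair receives an entry; \<open>goodz_unique\<close> guarantees
  that it is reported for one claim only.\<close>

lemma goodz_ex: "\<exists>zc<Zc. goodz s j be io u v zc"
  using ex_digits[of "k + 1" "cch s j be u v io" N] cch_less unfolding goodz_def Zc by (metis Suc_eq_plus1 less_Suc_eq_le)

lemma goodz_unique: "goodz s j be io u v z \<Longrightarrow> goodz s j be io u v z' \<Longrightarrow> z < Zc \<Longrightarrow> z' < Zc \<Longrightarrow> z = z'"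
  unfolding goodz_def Zc by (rule digits_inj[of z N "k + 1" z']) auto

lemma all_grid: "(\<forall>e<D. R e) \<longleftrightarrow> (\<forall>t\<le>k. \<forall>c<N. R (t * N + c))"
proof
  assume "\<forall>e<D. R e"
  then show "\<forall>t\<le>k. \<forall>c<N. R (t * N + c)" unfolding D by (simp add: mr_less del: mult_Suc)
next
  assume *: "\<forall>t\<le>k. \<forall>c<N. R (t * N + c)"
  show "\<forall>e<D. R e"
  proof (intro allI impI)
    fix e assume "e < D"
    then have "e div N \<le> k" using div_eq_0_iff'[of e N "k + 1"] D by (simp add: mult.commute)
    moreover have "e mod N < N" using N0 by simp
    ultimately have "R (e div N * N + e mod N)" using * by blast
    then show "R e" by simp
  qed
qed

text \<open>Ties dominance to champions: moving the terms of row and column back together,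
  coordinate \<open>t * N + c\<close> says that the claimed champion of round \<open>t\<close> is
  lexicographically at least candidate \<open>c\<close>. For all \<open>c\<close> this makes it the
  maximum for the claimed forbidden set, and \<open>chain_eq_chx\<close> turns this into the true
  chain.\<close>

lemma allsat_goodz:
  assumes cs: "\<forall>t\<le>k. words s' ''cs'' t = zc div N ^ t mod N \<and> words s' ''ix'' t = io div (k + 1) ^ t mod (k + 1)"
    and pe: "\<forall>e<D. words s' ''pe'' e = e div N * N + words s' ''cs'' (e div N) \<and>
     (\<forall>v<S. words s' ''bf'' (e * S + v) = words s ''aw'' ((be * d + e mod N div C) * S + v) \<and>
            reals s' ''bx'' (e * S + v) = reals s ''wt'' ((be * d + e mod N div C) * S + v))"
    and af: "\<forall>e<D. words s' ''af'' (u * D + e) = (if hitf k (words s ''pth'') (fidx j be u (e mod N)) (xpos (words s ''pth'') (words s' ''cs'') (words s' ''ix'') j be u ` {..<e div N}) then 0 else words s ''fv'' (fidx j be u (e mod N))) \<and>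
     reals s' ''ax'' (u * D + e) = reals s ''fw'' (fidx j be u (e mod N))"
    and v: "v < S" and SD: "words s' ''S'' 0 = S" "words s' ''D'' 0 = D"
  shows "allsat s' u v \<longleftrightarrow> goodz s j be io u v zc"
proof -
  let ?cs = "\<lambda>t. zc div N ^ t mod N" let ?ix = "\<lambda>t. io div (k + 1) ^ t mod (k + 1)"
  let ?x = "xpos (words s ''pth'') ?cs ?ix j be u"
  have csN: "?cs t < N" for t using N0 by simp
  define f where "f t = (\<lambda>c. (if hitf k (words s ''pth'') (fidx j be u c) (?x ` {..<t}) then 0 else words s ''fv'' (fidx j be u c)) + words s ''aw'' ((be * d + c div C) * S + v))" for t
  define g where "g = (\<lambda>c. reals s ''fw'' (fidx j be u c) + reals s ''wt'' ((be * d + c div C) * S + v))"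
  have sat: "sats s' u (t * N + c) v \<longleftrightarrow> lge (f t) g (?cs t) c" if t: "t \<le> k" "c < N" for t c
  proof -
    have eD: "t * N + c' < D" if "c' < N" for c' unfolding D by (rule mr_less) (use t that in auto)
    have em: "(t * N + c') div N = t" "(t * N + c') mod N = c'" if "c' < N" for c' using that by auto
    have xx: "xpos (words s ''pth'') (words s' ''cs'') (words s' ''ix'') j be u ` {..<t} = ?x ` {..<t}"
      using cs t by (intro image_cong) (auto simp: xpos_def)
    have pe': "words s' ''pe'' (t * N + c) = t * N + ?cs t" using pe eD[OF t(2)] em[OF t(2)] cs t(1) by simp
    have fa: "words s' ''af'' (u * D + (t * N + c')) + words s' ''bf'' ((t * N + c') * S + v) = f t c'"
      "reals s' ''ax'' (u * D + (t * N + c')) + reals s' ''bx'' ((t * N + c') * S + v) = g c'" if "c' < N" for c'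
      using pe af eD[OF that] v em[OF that] xx by (simp_all add: f_def g_def del: div_mult_self3 div_mult_self4 mod_mult_self3 mod_mult_self4)
    show ?thesis unfolding sats_def satf_def SD pe' lge_def
      unfolding fa[OF t(2)] fa[OF csN] by simp
  qed
  have "allsat s' u v \<longleftrightarrow> (\<forall>t\<le>k. \<forall>c<N. lge (f t) g (?cs t) c)"
    unfolding allsat_def all_grid using sat by simp
  also have "\<dots> \<longleftrightarrow> (\<forall>t\<le>k. ?cs t = cpick s j be u v (?x ` {..<t}))"
    using lmax_iff[OF N0 csN] by (simp add: cpick_def f_def g_def)
  also have "\<dots> \<longleftrightarrow> goodz s j be io u v zc"
    unfolding goodz_def cch_def by (rule chain_eq_chx) (simp add: xpos_def cpos_def)
  finally show ?thesis .
qed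

definition TP :: nat where
  "TP = 200 * (k + 1) + D * (100 * S + 200) + n * ((k + 1) * (N * ((k + 1) * (100 * k + 100) + 500) + 300) + 100) + 500"

definition TD :: nat where
  "TD = nc * (4000 * (mu + 1) * P * m * m + n * (length jl * (700 * mu + 800 + 400 * D) + 150) + 150) + 100"

definition oidx :: "nat \<Rightarrow> nat \<Rightarrow> nat \<Rightarrow> nat" where
  "oidx q u v = (q * S + u) * S + v"

lemma oidx_eq: "u < S \<Longrightarrow> v < S \<Longrightarrow> u' < S \<Longrightarrow> v' < S \<Longrightarrow> oidx q u v = oidx q' u' v' \<longleftrightarrow> q = q' \<and> u = u' \<and> v = v'"
  unfolding oidx_def by (auto simp: mr_eq)

lemma oidx_less: "u < S \<Longrightarrow> v < S \<Longrightarrow> q < q' \<Longrightarrow> oidx q u v < oidx q' 0 0"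
  unfolding oidx_def using mr_less[of v S "q * S + u" "q' * S"] mr_less[of u S q q'] by simp

lemma oidx_add: "oidx q 0 0 + u * S + v = oidx q u v"
  unfolding oidx_def by (simp add: algebra_simps)

lemma q_bound: "j \<le> k \<Longrightarrow> be < nb \<Longrightarrow> io < C \<Longrightarrow> oidx ((j * S + be) * C + io) 0 0 \<le> V"
proof -
  assume a: "j \<le> k" "be < nb" "io < C"
  have "nb \<le> S" using sz(1) d0 by (metis le_trans mult_le_mono2 nat_mult_1_right Suc_leI One_nat_def)
  then have "j * S + be < (k + 1) * S" using a by (intro mr_less) auto
  then have "(j * S + be) * C + io < (k + 1) * S * C" by (rule mr_less[OF a(3)])
  then have "((j * S + be) * C + io) * S * S \<le> (k + 2) * S * C * S * S"
    by (intro mult_right_mono) (auto simp: algebra_simps intro: less_imp_le order.trans)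
  also have "\<dots> = (k + 2) * S * S * S * C" by simp
  also have "\<dots> \<le> V" by (rule Vb(5))
  finally show ?thesis unfolding oidx_def by simp
qed

lemma H_PREP:
  assumes ps: "par2 s" and be: "words s ''be'' 0 = be" "be < nb" and j: "words s ''j'' 0 = j" "j \<le> k"
    and io: "words s ''io'' 0 = io" "io < C" and zc: "words s ''zc'' 0 = zc"
  shows "H TP (PREP k) s (\<lambda>s'. (\<forall>u<n. \<forall>v<S. allsat s' u v \<longleftrightarrow> goodz s j be io u v zc) \<and>
     words s' ''ob'' 0 = oidx ((j * S + be) * C + io) 0 0 \<and> words s' ''ov'' 0 = zc div N ^ k mod N)"
  unfolding PREP_def
proof (rule H_Seq[OF H_DECODE[OF ps zc io(1)], where u = "D * (100 * S + 200) + n * ((k + 1) * (N * ((k + 1) * (100 * k + 100) + 500) + 300) + 100) + 350"], goal_cases)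
  case (1 s1)
  note a1 = agrw[OF 1(3), simplified] agrr[OF 1(3), simplified] and c1 = 1(1)
  have p1: "par2 s1" by (rule par2_agr[OF ps 1(3)]) (simp add: parnames_def parnames2_def)
  have be1: "words s1 ''be'' 0 = be" using a1 be by simp
  have cN1: "\<forall>t\<le>k. words s1 ''cs'' t < N" using c1 N0 by simp
  show ?case
  proof (rule H_Seq[OF H_COLS[OF p1 be1 be(2) cN1, unfolded C], where u = "n * ((k + 1) * (N * ((k + 1) * (100 * k + 100) + 500) + 300) + 100) + 220"], goal_cases)
    case (1 s2)
    note a2 = agrw[OF 1(3), simplified] agrr[OF 1(3), simplified] and c2 = 1(1)[folded C]
    have p2: "par2 s2" by (rule par2_agr[OF p1 1(3)]) (simp add: parnames_def parnames2_def)
    have be2: "words s2 ''be'' 0 = be" and j2: "words s2 ''j'' 0 = j" using a1 a2 be j by simp_all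
    have cs2: "words s2 ''cs'' = words s1 ''cs''" "words s2 ''ix'' = words s1 ''ix''" using a2 by simp_all
    have cN2: "\<forall>t\<le>k. words s2 ''cs'' t < N" using cN1 a2 by simp
    show ?case
    proof (rule H_Seq[OF H_ROWS[OF p2 be2 be(2) j2 j(2) cN2 refl], where u = 110], goal_cases)
      case (1 s3)
      note a3 = agrw[OF 1(3), simplified] agrr[OF 1(3), simplified] and c3 = 1(1)
      have p3: "par2 s3" by (rule par2_agr[OF p2 1(3)]) (simp add: parnames_def parnames2_def)
      have w3: "words s3 ''be'' 0 = be" "words s3 ''j'' 0 = j" "words s3 ''io'' 0 = io" "words s3 ''cs'' = words s1 ''cs''" "words s3 ''ix'' = words s1 ''ix''"
        using a1 a2 a3 be j io by simp_all
      have wv: "wn s3 ((((sv ''j'' [*] sv ''S'' [+] sv ''be'') [*] Const ((k + 1) ^ k) [+] sv ''io'') [*] sv ''S'') [*] sv ''S'') =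
          oidx ((j * S + be) * C + io) 0 0"
        unfolding oidx_def using w3 par2D[OF p3] by (simp add: C)
      have csV: "words s3 ''cs'' k \<le> V" if "bnd s3" using bndD[OF that] .
      show ?case
      proof (rule H_sl[where T = 110], simp, goal_cases)
        case 1
        then show ?case using wv q_bound[OF j(2) be(2) io(2)] csV by (simp del: wn.simps add: wn.simps(1,2))
      next
        case 2
        let ?s = "sem (''ob'' :== (((sv ''j'' [*] sv ''S'' [+] sv ''be'') [*] Const ((k + 1) ^ k) [+] sv ''io'') [*] sv ''S'') [*] sv ''S'' ;;
          ''ov'' :== WLoad ''cs'' (Const k)) s3"
        have "allsat ?s = allsat s3" by (rule allsat_agr[of "{''ob'', ''ov''}" "{}"]) (auto simp: agr_def)
        moreover have "allsat s3 u v \<longleftrightarrow> goodz s j be io u v zc" if "u < n" "v < S" for u v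
        proof (rule allsat_goodz)
          show "\<forall>t\<le>k. words s3 ''cs'' t = zc div N ^ t mod N \<and> words s3 ''ix'' t = io div (k + 1) ^ t mod (k + 1)"
            using c1 w3 by simp
          show "\<forall>e<D. words s3 ''pe'' e = e div N * N + words s3 ''cs'' (e div N) \<and>
             (\<forall>v<S. words s3 ''bf'' (e * S + v) = words s ''aw'' ((be * d + e mod N div C) * S + v) \<and>
            reals s3 ''bx'' (e * S + v) = reals s ''wt'' ((be * d + e mod N div C) * S + v))"
            using c2 w3 a3 a2 a1 by simp
          show "\<forall>e<D. words s3 ''af'' (u * D + e) = (if hitf k (words s ''pth'') (fidx j be u (e mod N)) (xpos (words s ''pth'') (words s3 ''cs'') (words s3 ''ix'') j be u ` {..<e div N}) then 0 else words s ''fv'' (fidx j be u (e mod N))) \<and>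
             reals s3 ''ax'' (u * D + e) = reals s ''fw'' (fidx j be u (e mod N))"
          proof -
            have "words s2 ''pth'' = words s ''pth''" "words s2 ''fv'' = words s ''fv''" "reals s2 ''fw'' = reals s ''fw''"
              using a1 a2 by simp_all
            then show ?thesis using c3 that(1) w3 cs2 by simp
          qed
        qed (use that par2D[OF p3] in auto)
        moreover have "words ?s ''ob'' 0 = oidx ((j * S + be) * C + io) 0 0" using wv by (simp del: wn.simps add: wn.simps(1,2))
        moreover have "words ?s ''ov'' 0 = zc div N ^ k mod N" using c1 w3 by simp
        ultimately show ?case by simp
      next
        case 3 show ?case by simp
      qed
    next
      case 2 show ?case by simp
    qed
  next
    case 2 show ?case by simp
  qed
next
  case 2 show ?case by (simp add: TP_def)
qed

text \<open>The sets of pairs reported for different claims are disjoint, so all \<open>Zc\<close>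
  dominance runs together report each pair at most once.\<close>

lemma sum_goodz: "(\<Sum>zc<Zc. card {(u, v). u < n \<and> v < nc * m \<and> goodz s j be io u v zc}) \<le> n * (nc * m)"
proof -
  let ?A = "\<lambda>zc. {(u, v). u < n \<and> v < nc * m \<and> goodz s j be io u v zc}"
  have sub: "?A zc \<subseteq> {..<n} \<times> {..<nc * m}" for zc by auto
  then have fin: "finite (?A zc)" for zc by (meson finite_SigmaI finite_lessThan finite_subset)
  have "(\<Sum>zc<Zc. card (?A zc)) = card (\<Union>zc<Zc. ?A zc)"
  proof (rule card_UN_disjoint[symmetric])
    show "\<forall>i\<in>{..<Zc}. \<forall>i'\<in>{..<Zc}. i \<noteq> i' \<longrightarrow> ?A i \<inter> ?A i' = {}"
      using goodz_unique[of s j be io] by (fastforce simp del: mult_eq_0_iff)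
  qed (use fin in auto)
  also have "\<dots> \<le> card ({..<n} \<times> {..<nc * m})"
    using sub by (intro card_mono) auto
  finally show ?thesis by simp
qed

definition TB :: nat where
  "TB = C * (Zc * (TP + TD + 20) + 400 * (n * (nc * m)) + 100) + 100"

text \<open>A pair has its final entry as soon as its good code has been passed, because no other
  code reports it. Entries of earlier guess words and earlier blocks lie at lower addresses and are
  not touched.\<close>

lemma H_BLOCK:
  assumes ps: "par2 s" and be: "words s ''be'' 0 = be" "be < nb" and j: "words s ''j'' 0 = j" "j \<le> k"
  shows "H TB (BLOCK k) s (\<lambda>s'. (\<forall>io<C. \<forall>u<n. \<forall>v<n. words s' ''oc'' (oidx ((j * S + be) * C + io) u v) = cch s j be u v io k) \<and>
     (\<forall>a < oidx ((j * S + be) * C) 0 0. words s' ''oc'' a = words s ''oc'' a))"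
proof -
  let ?q = "\<lambda>io. (j * S + be) * C + io"
  define ok where "ok s' io u v \<longleftrightarrow> words s' ''oc'' (oidx (?q io) u v) = cch s j be u v io k" for s' :: state and io u v
  have ncmS: "nc * m \<le> S" by (rule bounds)
  show ?thesis unfolding BLOCK_def
  proof (rule H_For_const[where N = C and t = "Zc * (TP + TD + 20) + 400 * (n * (nc * m)) + 50" and
      I = "\<lambda>io s'. (\<forall>io'<io. \<forall>u<n. \<forall>v<n. ok s' io' u v) \<and> (\<forall>a < oidx (?q 0) 0 0. words s' ''oc'' a = words s ''oc'' a)"], goal_cases)
    case (6 io s1)
    note a1 = agrw[OF 6(5), simplified] agrr[OF 6(5), simplified] and io = 6(1,3) and I1 = 6(2)
    have p1: "par2 s1" by (rule par2_agr[OF ps 6(5)]) (simp add: parnames_def parnames2_def)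
    show ?case
    proof (rule H_For[where N = Zc and t = "\<lambda>zc. TP + TD + 400 * card {(u, v). u < n \<and> v < nc * m \<and> goodz s j be io u v zc}" and
        I = "\<lambda>zc s'. (\<forall>u<n. \<forall>v<nc * m. (\<exists>z<zc. goodz s j be io u v z) \<longrightarrow> ok s' io u v) \<and>
          (\<forall>a < oidx (?q io) 0 0. words s' ''oc'' a = words s1 ''oc'' a)"], goal_cases)
      case (6 zc s2)
      note a2 = agrw[OF 6(5), simplified] agrr[OF 6(5), simplified] and zc = 6(1,3) and I2 = 6(2)
      have p2: "par2 s2" by (rule par2_agr[OF p1 6(5)]) (simp add: parnames_def parnames2_def)
      have w2: "words s2 ''be'' 0 = be" "words s2 ''j'' 0 = j" "words s2 ''io'' 0 = io" using a1 a2 be j io by simp_all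
      have gz: "goodz s2 = goodz s"
      proof -
        have "words s2 ''pth'' = words s ''pth''" "words s2 ''fv'' = words s ''fv''" "words s2 ''aw'' = words s ''aw''"
          "reals s2 ''fw'' = reals s ''fw''" "reals s2 ''wt'' = reals s ''wt''" using a1 a2 by simp_all
        then show ?thesis unfolding goodz_def cch_def cpick_def cpos_def by (simp cong: if_cong)
      qed
      show ?case
      proof (rule H_Seq[OF H_PREP[OF p2 w2(1) be(2) w2(2) j(2) w2(3) io(1) zc(2)], where u = "TD + 400 * card {(u, v). u < n \<and> v < nc * m \<and> goodz s j be io u v zc}"], goal_cases)
        case (1 s3)
        note a3 = agrw[OF 1(3), simplified] agrr[OF 1(3), simplified] and c3 = 1(1)
        have p3: "par s3" using par2_agr[OF p2 1(3)] by (simp add: parnames_def parnames2_def par2_def)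
        have eq: "{(u, v). u < n \<and> v < nc * m \<and> allsat s3 u v} = {(u, v). u < n \<and> v < nc * m \<and> goodz s j be io u v zc}"
          using c3 ncmS gz by (auto dest: less_le_trans)
        show ?case
        proof (rule H_conseq[OF H_DOM[OF p3]], goal_cases)
          case 1 show ?case unfolding eq TD_def by simp
        next
          case (2 s4)
          have oc4: "words s4 ''oc'' a = (if \<exists>u<n. \<exists>v<nc * m. a = oidx (?q io) u v \<and> goodz s j be io u v zc then zc div N ^ k mod N else words s2 ''oc'' a)" for a
          proof -
            have 1: "(\<exists>u<n. \<exists>v<nc * m. a = words s3 ''ob'' 0 + u * S + v \<and> allsat s3 u v) \<longleftrightarrow>
                (\<exists>u<n. \<exists>v<nc * m. a = oidx (?q io) u v \<and> goodz s j be io u v zc)"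
              using c3 ncmS unfolding gz by (metis (no_types, lifting) less_le_trans oidx_add)
            have 2: "words s3 ''oc'' a = words s2 ''oc'' a" "words s3 ''ov'' 0 = zc div N ^ k mod N"
              using a3 c3 by simp_all
            show ?thesis unfolding \<open>words s4 ''oc'' = _\<close> 1 2 by (rule refl)
          qed
          have ok4: "ok s4 io u v" if "u < n" "v < nc * m" "\<exists>z<Suc zc. goodz s j be io u v z" for u v
          proof (cases "goodz s j be io u v zc")
            case True
            then show ?thesis unfolding ok_def oc4 using that True by (auto simp: goodz_def)
          next
            case False
            have "\<not> (\<exists>u'<n. \<exists>v'<nc * m. oidx (?q io) u v = oidx (?q io) u' v' \<and> goodz s j be io u' v' zc)"
              using False oidx_eq[of u v _ _ "?q io" "?q io"] that ncmS sz(4) by (metis (no_types, lifting) less_le_trans less_trans)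
            then have "words s4 ''oc'' (oidx (?q io) u v) = words s2 ''oc'' (oidx (?q io) u v)"
              unfolding oc4 by (rule if_not_P)
            moreover have "\<exists>z<zc. goodz s j be io u v z" using that(3) False by (auto simp: less_Suc_eq)
            then have "ok s2 io u v" using I2 that(1,2) by blast
            ultimately show ?thesis unfolding ok_def by simp
          qed
          have "words s4 ''oc'' a = words s1 ''oc'' a" if "a < oidx (?q io) 0 0" for a
          proof -
            have "a \<noteq> oidx (?q io) u v" for u v using that oidx_add[of "?q io" u v] by linarith
            then have "words s4 ''oc'' a = words s2 ''oc'' a" unfolding oc4 by (intro if_not_P) blast
            then show ?thesis using I2 that by simp
          qed
          then show ?case using ok4 by (simp add: ok_def)
        qed
      next
        case 2 show ?case by simp
      qed
    next
      case (7 s2)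
      have "ok s2 io u v" if "u < n" "v < n" for u v
      proof -
        have "v < nc * m" using that(2) sz(3) by linarith
        then show ?thesis using 7(1) that(1) goodz_ex[of s j be io u v] by blast
      qed
      moreover have "ok s2 io' u v" if "io' < io" "u < n" "v < n" for io' u v
      proof -
        have "oidx (?q io') u v < oidx (?q io) 0 0" using that sz(4) by (intro oidx_less) auto
        then show ?thesis using 7(1) I1 that by (simp add: ok_def)
      qed
      moreover have "words s2 ''oc'' a = words s ''oc'' a" if "a < oidx (?q 0) 0 0" for a
      proof -
        have "oidx (?q 0) 0 0 \<le> oidx (?q io) 0 0" by (simp add: oidx_def mult_le_mono1)
        then show ?thesis using 7(1) I1 that by simp
      qed
      ultimately have "(\<forall>io'<Suc io. \<forall>u<n. \<forall>v<n. ok s2 io' u v) \<and> (\<forall>a<oidx (?q 0) 0 0. words s2 ''oc'' a = words s ''oc'' a)"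
        by (metis less_Suc_eq)
      then show ?case by (simp add: ok_def)
    next
      case 8
      have "(\<Sum>zc<Zc. TP + TD + 400 * card {(u, v). u < n \<and> v < nc * m \<and> goodz s j be io u v zc}) =
         Zc * (TP + TD) + 400 * (\<Sum>zc<Zc. card {(u, v). u < n \<and> v < nc * m \<and> goodz s j be io u v zc})"
        by (simp only: sum.distrib sum_distrib_left[symmetric] sum_constant card_lessThan of_nat_id distrib_left)
      moreover have "Zc * (TP + TD + 20) = Zc * (TP + TD) + 20 * Zc" by (simp add: algebra_simps)
      moreover have "Zc * (wcost (sv ''Zc'') + 10) = 12 * Zc" "wcost (sv ''Zc'') = 2" by simp_all
      ultimately show ?case using sum_goodz[of s j be io] by linarith
    qed (use p1 Vb in \<open>simp_all add: par2D\<close>)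
  next
    case (7 s1) then show ?case by (auto simp: ok_def)
  next
    case 8 show ?case unfolding TB_def by (simp add: algebra_simps)
  qed (use Vb C in \<open>simp_all\<close>)
qed

end

section \<open>Extending paths by one vertex\<close>

primrec scan :: "(nat \<Rightarrow> nat) \<Rightarrow> (nat \<Rightarrow> bool) \<Rightarrow> (nat \<Rightarrow> real) \<Rightarrow> nat \<Rightarrow> nat option" where
  "scan g R val 0 = None"
| "scan g R val (Suc q) = (if R (g q) \<and> (case scan g R val q of None \<Rightarrow> True | Some i \<Rightarrow> val i < val (g q)) then Some (g q) else scan g R val q)"

lemma scan_None: "scan g R val q = None \<longleftrightarrow> (\<forall>p<q. \<not> R (g p))"
  by (induction q) (auto simp: less_Suc_eq)

lemma scan_Some: "scan g R val q = Some i \<Longrightarrow> (\<exists>p<q. i = g p) \<and> R i \<and> (\<forall>p<q. R (g p) \<longrightarrow> val (g p) \<le> val i)"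
proof (induction q arbitrary: i)
  case (Suc q)
  show ?case
  proof (cases "scan g R val q")
    case None
    then have "\<forall>p<q. \<not> R (g p)" by (simp add: scan_None)
    then show ?thesis using Suc.prems None by (auto simp: less_Suc_eq split: if_splits)
  next
    case (Some i')
    note IH = Suc.IH[OF Some]
    show ?thesis
    proof (cases "R (g q) \<and> val i' < val (g q)")
      case True
      then have i: "i = g q" using Suc.prems Some by simp
      have "val (g p) \<le> val i" if "p < Suc q" "R (g p)" for p
      proof (cases "p = q")
        case False
        then have "val (g p) \<le> val i'" using IH that by simp
        then show ?thesis using True i by simp
      qed (use i in simp)
      then show ?thesis using True i by blast
    next
      case False
      then have i: "i = i'" using Suc.prems Some by (auto split: if_splits)
      have "val (g p) \<le> val i" if "p < Suc q" "R (g p)" for p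
        using that False IH i by (cases "p = q") auto
      then show ?thesis using IH i by (auto simp: less_Suc_eq)
    qed
  qed
qed simp

definition PICKT :: bexp where
  "PICKT = Conj (sv ''hit'' [<] Const 1) (Conj (Const 0 [<] WLoad ''fv'' (sv ''fi'')) (Conj (Const 0 [<] WLoad ''aw'' (sv ''ww'' [*] sv ''S'' [+] sv ''v''))
     (bor (sv ''bo'' [<] Const 1) (RLess (rsv ''bw'') (RAdd (RLoad ''fw'' (sv ''fi'')) (RLoad ''wt'' (sv ''ww'' [*] sv ''S'' [+] sv ''v'')))))))"

definition SCAN :: "nat \<Rightarrow> com" where
  "SCAN k = For ''qq'' (sv ''nb'' [*] Const ((k + 1) ^ k)) (
     (''be'' :== sv ''qq'' [div] Const ((k + 1) ^ k) ;;
      ''cc'' :== WLoad ''oc'' (((sv ''j'' [*] sv ''S'' [*] Const ((k + 1) ^ k) [+] sv ''qq'') [*] sv ''S'' [+] sv ''u'') [*] sv ''S'' [+] sv ''v'') ;;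
      ''fi'' :== FI ((k + 1) ^ k) (sv ''cc'') ;;
      ''ww'' :== sv ''be'' [*] sv ''d'' [+] sv ''cc'' [div] Const ((k + 1) ^ k)) ;;
     HIT k ;;
     Cond PICKT (''bo'' :== Const 1 ;; ''bi'' :== sv ''fi'' ;; RStore ''bw'' (Const 0) (RAdd (RLoad ''fw'' (sv ''fi'')) (RLoad ''wt'' (sv ''ww'' [*] sv ''S'' [+] sv ''v'')))) Skip)"

lemma modw_SCAN [simp]: "modw (SCAN k) = {''qq'', ''be'', ''cc'', ''fi'', ''ww'', ''hit'', ''hx'', ''hp'', ''bo'', ''bi''}"
  and modr_SCAN [simp]: "modr (SCAN k) = {''bw''}"
  by (auto simp: SCAN_def)

text \<open>The branching for one guess word, now among the champions of all blocks. Forbidding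
  \<open>v\<close> from the start keeps the path simple when \<open>v\<close> is appended; the
  result is the pick of the last of the \<open>k + 1\<close> rounds.\<close>

definition CHAIN :: "nat \<Rightarrow> com" where
  "CHAIN k = (WStore ''X'' (Const 0) (sv ''v'') ;; ''t2'' :== sv ''io'') ;;
     For ''s'' (Const (k + 1)) (
       (''bo'' :== Const 0 ;; ''bi'' :== Const 0 ;; ''hc'' :== sv ''s'' [+] Const 1) ;;
       SCAN k ;;
       (WStore ''X'' (sv ''s'' [+] Const 1) (WLoad ''pth'' (sv ''bi'' [*] Const (k + 1) [+] (sv ''t2'' [-] sv ''t2'' [div] Const (k + 1) [*] Const (k + 1)))) ;;
        ''t2'' :== sv ''t2'' [div] Const (k + 1)))"

lemma modw_CHAIN [simp]: "modw (CHAIN k) = {''X'', ''t2'', ''s'', ''bo'', ''bi'', ''hc'', ''qq'', ''be'', ''cc'', ''fi'', ''ww'', ''hit'', ''hx'', ''hp''}"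
  and modr_CHAIN [simp]: "modr (CHAIN k) = {''bw''}"
  by (auto simp: CHAIN_def)

text \<open>Copying all \<open>k + 1\<close> cells carries the padding and the sentinel along, so
  only cell \<open>j\<close> has to be changed.\<close>

definition WRITE :: "nat \<Rightarrow> com" where
  "WRITE k = Cond (Const 0 [<] sv ''bo'')
     ((''nw'' :== ((sv ''j'' [+] Const 1) [*] sv ''S'' [+] sv ''u'') [*] (sv ''S'' [*] Const ((k + 1) ^ k)) [+] sv ''v'' [*] Const ((k + 1) ^ k) [+] sv ''io'' ;;
       WStore ''fv'' (sv ''nw'') (Const 1) ;; RStore ''fw'' (sv ''nw'') (rsv ''bw'')) ;;
      For ''p'' (Const (k + 1)) (WStore ''pth'' (sv ''nw'' [*] Const (k + 1) [+] sv ''p'') (WLoad ''pth'' (sv ''bi'' [*] Const (k + 1) [+] sv ''p''))) ;;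
      WStore ''pth'' (sv ''nw'' [*] Const (k + 1) [+] sv ''j'') (sv ''v''))
     Skip"

lemma modw_WRITE [simp]: "modw (WRITE k) = {''nw'', ''fv'', ''p'', ''pth''}"
  and modr_WRITE [simp]: "modr (WRITE k) = {''fw''}"
  by (auto simp: WRITE_def)

definition LEVEL :: "nat \<Rightarrow> com" where
  "LEVEL k = For ''u'' (sv ''n'') (For ''v'' (sv ''n'') (For ''io'' (Const ((k + 1) ^ k)) (CHAIN k ;; WRITE k)))"

lemma modw_LEVEL [simp]: "modw (LEVEL k) = {''u'', ''v'', ''io'', ''X'', ''t2'', ''s'', ''bo'', ''bi'', ''hc'', ''qq'', ''be'', ''cc'', ''fi'', ''ww'', ''hit'', ''hx'', ''hp'', ''nw'', ''fv'', ''p'', ''pth''}"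
  and modr_LEVEL [simp]: "modr (LEVEL k) = {''bw'', ''fw''}"
  by (auto simp: LEVEL_def)

context algo
begin

definition gq :: "state \<Rightarrow> nat \<Rightarrow> nat \<Rightarrow> nat \<Rightarrow> nat \<Rightarrow> nat" where
  "gq s j u v q = fidx j (q div C) u (words s ''oc'' (oidx (j * S * C + q) u v))"

text \<open>Recovers the last vertex of a path from the address of its entry.\<close>

definition wwi :: "nat \<Rightarrow> nat" where "wwi i = i mod (S * C) div C"

definition okA :: "state \<Rightarrow> nat \<Rightarrow> nat set \<Rightarrow> nat \<Rightarrow> bool" where
  "okA s v A i \<longleftrightarrow> \<not> hitf k (words s ''pth'') i A \<and> 0 < words s ''fv'' i \<and> 0 < words s ''aw'' (wwi i * S + v)"

definition vali :: "state \<Rightarrow> nat \<Rightarrow> nat \<Rightarrow> real" where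
  "vali s v i = reals s ''fw'' i + reals s ''wt'' (wwi i * S + v)"

definition sres :: "state \<Rightarrow> nat \<Rightarrow> nat \<Rightarrow> nat \<Rightarrow> nat set \<Rightarrow> nat option" where
  "sres s j u v A = scan (gq s j u v) (okA s v A) (vali s v) (nb * C)"

text \<open>The default 0 is an address below \<open>lvl (Suc j)\<close>, so what is read there is
  not changed by the writes of the level.\<close>

definition pk :: "state \<Rightarrow> nat \<Rightarrow> nat \<Rightarrow> nat \<Rightarrow> nat set \<Rightarrow> nat" where
  "pk s j u v A = (case sres s j u v A of None \<Rightarrow> 0 | Some i \<Rightarrow> i)"

definition posi :: "state \<Rightarrow> nat \<Rightarrow> nat \<Rightarrow> nat" where
  "posi s i p = words s ''pth'' (i * (k + 1) + p)"

definition Ach :: "state \<Rightarrow> nat \<Rightarrow> nat \<Rightarrow> nat \<Rightarrow> nat \<Rightarrow> nat \<Rightarrow> nat set" where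
  "Ach s j u v io t = chx (pk s j u v) (posi s) (\<lambda>t. io div (k + 1) ^ t mod (k + 1)) {v} t"

definition eres :: "state \<Rightarrow> nat \<Rightarrow> nat \<Rightarrow> nat \<Rightarrow> nat \<Rightarrow> nat option" where
  "eres s j u v io = sres s j u v (Ach s j u v io k)"

definition occ :: "state \<Rightarrow> nat \<Rightarrow> bool" where
  "occ s j \<longleftrightarrow> (\<forall>q<nb * C. \<forall>u<n. \<forall>v<n. words s ''oc'' (oidx (j * S * C + q) u v) < N)"

lemma wwi_fidx: "be < nb \<Longrightarrow> c < N \<Longrightarrow> wwi (fidx j be u c) = be * d + c div C"
proof -
  assume a: "be < nb" "c < N"
  have "fidx j be u c mod (S * C) = be * N + c"
    unfolding fidx_def add.assoc using be_le[OF a] by simp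
  also have "\<dots> = c + (be * d) * C" by (simp add: N)
  finally show ?thesis using C0 by (simp add: wwi_def)
qed

definition lvl :: "nat \<Rightarrow> nat" where "lvl j = (j * S) * (S * C)"

text \<open>\<open>s\<close> is the state before the level is processed; the writes only concern entries of length \<open>j + 1\<close>.\<close>

definition same :: "nat \<Rightarrow> state \<Rightarrow> state \<Rightarrow> bool" where
  "same j s' s \<longleftrightarrow> (\<forall>i<lvl (Suc j). words s' ''fv'' i = words s ''fv'' i \<and> reals s' ''fw'' i = reals s ''fw'' i \<and>
     (\<forall>p\<le>k. posi s' i p = posi s i p)) \<and> words s' ''oc'' = words s ''oc'' \<and> words s' ''aw'' = words s ''aw'' \<and> reals s' ''wt'' = reals s ''wt''"

lemma fidx_lvl: "be < nb \<Longrightarrow> u < n \<Longrightarrow> c < N \<Longrightarrow> fidx j be u c < lvl (Suc j)"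
  unfolding fidx_def lvl_def add.assoc by (intro mr_less be_le) (use mr_less[of u S j "Suc j"] sz in auto)

lemma lvl_pos: "0 < lvl (Suc j)"
  using S0 C0 by (simp add: lvl_def)

lemma gq_lt: "occ s j \<Longrightarrow> q < nb * C \<Longrightarrow> u < n \<Longrightarrow> v < n \<Longrightarrow> gq s j u v q < lvl (Suc j)"
  unfolding gq_def occ_def by (intro fidx_lvl) (auto simp: less_mult_imp_div_less)

lemma same_okA: "same j s' s \<Longrightarrow> i < lvl (Suc j) \<Longrightarrow> okA s' v A i = okA s v A i"
  by (auto simp: same_def okA_def hitf_def posi_def)

lemma same_vali: "same j s' s \<Longrightarrow> i < lvl (Suc j) \<Longrightarrow> vali s' v i = vali s v i"
  by (auto simp: same_def vali_def)

definition TH :: nat where "TH = (k + 1) * (100 * k + 100) + 100"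

lemma H_SCAN:
  assumes ps: "par2 s" and j: "words s ''j'' 0 = j" "j \<le> k" and u: "words s ''u'' 0 = u" "u < n" and v: "words s ''v'' 0 = v" "v < n"
    and b: "words s ''bo'' 0 = 0" "words s ''bi'' 0 = 0" and hc: "words s ''hc'' 0 = t" "t \<le> k + 1"
    and A: "words s ''X'' ` {..<t} = A" and sm: "same j s s0" and oc: "occ s0 j"
  shows "H (nb * C * (TH + 500) + 100) (SCAN k) s (\<lambda>s'. (0 < words s' ''bo'' 0) = (sres s0 j u v A \<noteq> None) \<and>
     words s' ''bi'' 0 = pk s0 j u v A \<and> (sres s0 j u v A \<noteq> None \<longrightarrow> reals s' ''bw'' 0 = vali s0 v (pk s0 j u v A)))"
proof -
  define sc where "sc q = scan (gq s0 j u v) (okA s0 v A) (vali s0 v) q" for q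
  define I where "I q s' \<longleftrightarrow> (0 < words s' ''bo'' 0) = (sc q \<noteq> None) \<and>
     words s' ''bi'' 0 = (case sc q of None \<Rightarrow> 0 | Some i \<Rightarrow> i) \<and> (sc q \<noteq> None \<longrightarrow> reals s' ''bw'' 0 = vali s0 v (the (sc q)))" for q and s' :: state
  show ?thesis unfolding SCAN_def
  proof (rule H_For_const[where N = "nb * C" and t = "TH + 400" and I = I], goal_cases)
    case (6 q s1)
    note a1 = agrw[OF 6(5), simplified] agrr[OF 6(5), simplified] and q = 6(1,3) and I1 = 6(2)
    have p1: "par2 s1" by (rule par2_agr[OF ps 6(5)]) (simp add: parnames_def parnames2_def)
    have w1: "words s1 ''j'' 0 = j" "words s1 ''u'' 0 = u" "words s1 ''v'' 0 = v" using a1 j u v by simp_all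
    have oc1: "words s1 ''oc'' = words s0 ''oc''" using a1 sm by (simp add: same_def)
    define be cc where "be = q div C" and "cc = words s0 ''oc'' (oidx (j * S * C + q) u v)"
    have be: "be < nb" using q(1) by (simp add: be_def less_mult_imp_div_less)
    have cc: "cc < N" using oc q(1) u v unfolding occ_def cc_def by blast
    have g: "fidx j be u cc = gq s0 j u v q" by (simp add: gq_def be_def cc_def)
    have fV: "fidx j be u cc \<le> V" using fidx_le[OF j(2) be u(2) cc] by simp
    have wwS: "be * d + cc div C < S"
    proof -
      have "cc div C < d" by (intro div_eq_0_iff') (use cc in \<open>simp add: N mult.commute\<close>)
      then have "be * d + cc div C < nb * d" using be by (intro mr_less)
      then show ?thesis using sz by simp
    qed
    have nbV: "nb \<le> V" using Vb(4) C0 by (metis le_trans nat_mult_le_cancel_disj mult.right_neutral Suc_leI One_nat_def mult_le_mono2)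
    let ?pre = "''be'' :== sv ''qq'' [div] Const ((k + 1) ^ k) ;;
      ''cc'' :== WLoad ''oc'' (((sv ''j'' [*] sv ''S'' [*] Const ((k + 1) ^ k) [+] sv ''qq'') [*] sv ''S'' [+] sv ''u'') [*] sv ''S'' [+] sv ''v'') ;;
      ''fi'' :== FI ((k + 1) ^ k) (sv ''cc'') ;;
      ''ww'' :== sv ''be'' [*] sv ''d'' [+] sv ''cc'' [div] Const ((k + 1) ^ k)"
    have beC: "q div (k + 1) ^ k = be" "cc div (k + 1) ^ k = cc div C" by (simp_all add: be_def C)
    define t1 where "t1 = wstore ''cc'' 0 cc (wstore ''be'' 0 be s1)"
    have pt1: "par2 t1" unfolding t1_def
      by (rule par2_agr[OF p1, of "{''be'', ''cc''}" "{}"]) (auto simp: agr_def parnames_def parnames2_def)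
    have fi1: "wn t1 (FI (Suc k ^ k) (sv ''cc'')) = fidx j be u cc"
      using wn_FI[OF pt1, of "sv ''cc''"] w1 by (simp add: t1_def)
    have ct1: "words s1 ''oc'' (((j * S * Suc k ^ k + q) * S + u) * S + v) = cc"
      unfolding cc_def oidx_def using oc1 by (simp add: C)
    have sem: "sem ?pre s1 = wstore ''ww'' 0 (be * d + cc div C) (wstore ''fi'' 0 (fidx j be u cc) t1)"
      using q(2) beC ct1 fi1 w1 par2D[OF p1] by (simp add: t1_def)
    show ?case
    proof (rule H_slS[where u = "TH + 200"], simp, goal_cases)
      case 1
      then show ?case
        using q(2) beC ct1 fi1 w1 par2D[OF p1] fV wwS bounds(2) nbV be cc NV by (simp add: t1_def)
    next
      case (2 s2)
      note a2 = agrw[OF 2(3), simplified] agrr[OF 2(3), simplified]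
      have p2: "par2 s2" by (rule par2_agr[OF p1 2(3)]) (simp add: parnames_def parnames2_def)
      have w2: "words s2 ''fi'' 0 = fidx j be u cc" "words s2 ''ww'' 0 = be * d + cc div C" "words s2 ''hc'' 0 = t" "words s2 ''v'' 0 = v"
        "words s2 ''bo'' 0 = words s1 ''bo'' 0" "words s2 ''bi'' 0 = words s1 ''bi'' 0" "reals s2 = reals s1"
        using a1 hc w1 unfolding 2(1) sem by (simp_all add: t1_def)
      have X2: "words s2 ''X'' ` {..<t} = A" using a1 a2 A by simp
      have tV: "t \<le> V" using hc Vb by simp
      have th: "t * (100 * k + 100) \<le> (k + 1) * (100 * k + 100)" using hc by (intro mult_right_mono) auto
      show ?case
      proof (rule H_Seq[OF H_HIT[OF w2(3,1) tV], where u = 200], goal_cases)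
        case 1 show ?case using Vb by simp
      next
        case (2 s3)
        note a3 = agrw[OF 2(3), simplified] agrr[OF 2(3), simplified]
        let ?i = "gq s0 j u v q"
        have il: "?i < lvl (Suc j)" by (rule gq_lt[OF oc q(1) u(2) v(2)])
        have wi: "wwi ?i = be * d + cc div C" using wwi_fidx[OF be cc, of j u] g by simp
        have dat: "words s3 ''fv'' = words s ''fv''" "words s3 ''pth'' = words s ''pth''" "words s3 ''aw'' = words s ''aw''"
          "reals s3 ''fw'' = reals s ''fw''" "reals s3 ''wt'' = reals s ''wt''" "words s2 ''pth'' = words s ''pth''" using a1 a2 a3 by simp_all
        have w3: "words s3 ''fi'' 0 = ?i" "words s3 ''ww'' 0 = wwi ?i" "words s3 ''v'' 0 = v" "words s3 ''S'' 0 = S"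
          "words s3 ''bo'' 0 = words s1 ''bo'' 0" "words s3 ''bi'' 0 = words s1 ''bi'' 0" "reals s3 ''bw'' 0 = reals s1 ''bw'' 0"
          using a3 w2 g wi par2D[OF p2] by simp_all
        have hit: "(words s3 ''hit'' 0 < 1) = (\<not> hitf k (words s ''pth'') ?i A)" using 2(1) X2 dat g by simp
        have ok: "okA s v A ?i = okA s0 v A ?i" "vali s v ?i = vali s0 v ?i" using same_okA[OF sm il] same_vali[OF sm il] by auto
        have val: "reals s ''fw'' ?i + reals s ''wt'' (wwi ?i * S + v) = vali s0 v ?i" using ok(2) by (simp add: vali_def)
        have pt: "bn s3 PICKT \<longleftrightarrow> okA s0 v A ?i \<and> (case sc q of None \<Rightarrow> True | Some i \<Rightarrow> vali s0 v i < vali s0 v ?i)"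
          using hit w3 dat I1 val ok(1) by (auto simp: PICKT_def okA_def I_def split: option.splits)
        have scS: "sc (Suc q) = (if bn s3 PICKT then Some ?i else sc q)"
          using pt unfolding sc_def by simp
        have cPT: "bcost PICKT \<le> 100" by (simp add: PICKT_def)
        have iV: "?i \<le> V" using fV g by simp
        show ?case
        proof (rule H_sl, simp, goal_cases)
          case 1 show ?case using w3 iV V2 by simp
        next
          case 2 show ?case using w3 dat val I1 scS by (auto simp: I_def)
        next
          case 3 show ?case using cPT by simp
        qed
      next
        case 3 show ?case using th by (simp add: TH_def)
      qed
    next
      case 3 show ?case by (simp add: FI_def)
    qed
  next
    case (7 s1)
    then show ?case by (auto simp: I_def sc_def[symmetric] sres_def pk_def split: option.splits)
  next
    case 8 show ?case by (simp add: algebra_simps)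
  next
    case 3 show ?case using ps by (simp add: par2D C)
  qed (use Vb b in \<open>simp_all add: I_def sc_def C\<close>)
qed

lemma pk_lt: "occ s j \<Longrightarrow> u < n \<Longrightarrow> v < n \<Longrightarrow> pk s j u v A < lvl (Suc j)"
  unfolding pk_def sres_def using gq_lt lvl_pos scan_Some[of "gq s j u v" "okA s v A" "vali s v" "nb * C"]
  by (fastforce split: option.splits)

lemma H_CHAIN:
  assumes ps: "par2 s" and j: "words s ''j'' 0 = j" "j \<le> k" and u: "words s ''u'' 0 = u" "u < n" and v: "words s ''v'' 0 = v" "v < n"
    and io: "words s ''io'' 0 = io" and sm: "same j s s0" and oc: "occ s0 j"
  shows "H ((k + 1) * (nb * C * (TH + 500) + 400) + 100) (CHAIN k) s (\<lambda>s'. (0 < words s' ''bo'' 0) = (eres s0 j u v io \<noteq> None) \<and>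
     (eres s0 j u v io \<noteq> None \<longrightarrow> words s' ''bi'' 0 = the (eres s0 j u v io) \<and> reals s' ''bw'' 0 = vali s0 v (the (eres s0 j u v io))))"
  unfolding CHAIN_def
proof (rule H_slS[where u = "(k + 1) * (nb * C * (TH + 500) + 400) + 60"], simp, goal_cases)
  case 1 then show ?case using bndD[OF 1] by simp
next
  case (2 s1)
  note a1 = agrw[OF 2(3), simplified] agrr[OF 2(3), simplified]
  have p1: "par2 s1" by (rule par2_agr[OF ps 2(3)]) (simp add: parnames_def parnames2_def)
  define I where "I t s' \<longleftrightarrow> words s' ''X'' ` {..<t + 1} = Ach s0 j u v io t \<and> words s' ''t2'' 0 = io div (k + 1) ^ t \<and>
     (t > 0 \<longrightarrow> (0 < words s' ''bo'' 0) = (sres s0 j u v (Ach s0 j u v io (t - 1)) \<noteq> None) \<and>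
     words s' ''bi'' 0 = pk s0 j u v (Ach s0 j u v io (t - 1)) \<and>
     (sres s0 j u v (Ach s0 j u v io (t - 1)) \<noteq> None \<longrightarrow> reals s' ''bw'' 0 = vali s0 v (pk s0 j u v (Ach s0 j u v io (t - 1)))))" for t and s' :: state
  show ?case
  proof (rule H_For_const[where N = "k + 1" and t = "nb * C * (TH + 500) + 350" and I = I], goal_cases)
    case (6 t s2)
    note a2 = agrw[OF 6(5), simplified] agrr[OF 6(5), simplified] and t = 6(1,3) and I2 = 6(2)
    have p2: "par2 s2" by (rule par2_agr[OF p1 6(5)]) (simp add: parnames_def parnames2_def)
    show ?case
    proof (rule H_slS[where u = "nb * C * (TH + 500) + 300"], simp, goal_cases)
      case 1 show ?case using t Vb V2 by simp
    next
      case (2 s3)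
      note a3 = agrw[OF 2(3), simplified] agrr[OF 2(3), simplified]
      have p3: "par2 s3" by (rule par2_agr[OF p2 2(3)]) (simp add: parnames_def parnames2_def)
      have w3: "words s3 ''j'' 0 = j" "words s3 ''u'' 0 = u" "words s3 ''v'' 0 = v" "words s3 ''bo'' 0 = 0" "words s3 ''bi'' 0 = 0" "words s3 ''hc'' 0 = t + 1"
        using a1 a2 a3 j u v t by (simp_all add: 2(1))
      have X3: "words s3 ''X'' ` {..<t + 1} = Ach s0 j u v io t" using I2 a3 unfolding I_def by simp
      have d3: "words s3 ''fv'' = words s ''fv''" "words s3 ''pth'' = words s ''pth''" "words s3 ''aw'' = words s ''aw''" "words s3 ''oc'' = words s ''oc''"
          "reals s3 ''fw'' = reals s ''fw''" "reals s3 ''wt'' = reals s ''wt''" using a1 a2 a3 by simp_all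
      have sm3: "same j s3 s0" using sm d3 by (simp add: same_def posi_def)
      have tk: "t + 1 \<le> k + 1" using t by simp
      show ?case
      proof (rule H_Seq[OF H_SCAN[OF p3 w3(1) j(2) w3(2) u(2) w3(3) v(2) w3(4,5,6) tk X3 sm3 oc], where u = 150], goal_cases)
        case (1 s4)
        note a4 = agrw[OF 1(3), simplified] agrr[OF 1(3), simplified]
        let ?A = "Ach s0 j u v io t" let ?i = "pk s0 j u v ?A"
        have il: "?i < lvl (Suc j)" by (rule pk_lt[OF oc u(2) v(2)])
        have t2: "words s4 ''t2'' 0 = io div (k + 1) ^ t" using I2 a4 a3 unfolding I_def by simp
        let ?dg = "io div (k + 1) ^ t mod (k + 1)"
        have dg: "io div (k + 1) ^ t - io div (k + 1) ^ t div (k + 1) * (k + 1) = ?dg" by (simp only: minus_div_mult_eq_mod)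
        have "?dg \<le> k" using mod_less_divisor[of "k + 1" "io div (k + 1) ^ t"] by linarith
        then have pos: "words s4 ''pth'' (?i * (k + 1) + ?dg) = posi s0 ?i ?dg"
          using sm3 il a4 d3 unfolding same_def posi_def by simp
        have s4: "words s4 ''s'' 0 = t" using a4 a3 t by simp
        have bV: "words s4 ''pth'' a \<le> V" "words s4 ''t2'' 0 \<le> V" for a using bndD[OF 1(2)] by auto
        have bi: "words s4 ''bi'' 0 = ?i" using 1(1) by simp
        have xw: "wn s4 (WLoad ''pth'' (sv ''bi'' [*] Const (k + 1) [+] (sv ''t2'' [-] sv ''t2'' [div] Const (k + 1) [*] Const (k + 1)))) = posi s0 ?i ?dg"
          using bi t2 dg pos by simp
        have tw: "wn (wstore ''X'' (Suc t) a s4) (sv ''t2'' [div] Const (k + 1)) = io div (k + 1) ^ Suc t" for a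
          using t2 by (simp add: div_mult2_eq[symmetric] mult.commute)
        have X4: "words s4 ''X'' ` {..<t + 1} = ?A" using X3 a4 by simp
        show ?case
        proof (rule H_sl, simp, goal_cases)
          case 1
          have "posi s0 ?i ?dg \<le> V" using bV(1) pos by metis
          moreover have "io div (k + 1) ^ Suc t \<le> io div (k + 1) ^ t" by (intro div_le_mono2) auto
          moreover note le_trans[OF this]
          ultimately show ?case using xw s4 tw bV(2) t2 by (simp del: wn.simps add: wn.simps(1,2,3) div_mult2_eq le_trans[OF div_le_dividend])
        next
          case 2
          have sem: "sem (WStore ''X'' (sv ''s'' [+] Const 1) (WLoad ''pth'' (sv ''bi'' [*] Const (k + 1) [+] (sv ''t2'' [-] sv ''t2'' [div] Const (k + 1) [*] Const (k + 1)))) ;;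
             ''t2'' :== sv ''t2'' [div] Const (k + 1)) s4 = wstore ''t2'' 0 (io div (k + 1) ^ Suc t) (wstore ''X'' (Suc t) (posi s0 ?i ?dg) s4)"
            using xw s4 tw by (simp only: sem.simps) (simp add: wn.simps(1,3))
          have im: "((words s4 ''X'')(Suc t := posi s0 ?i ?dg)) ` {..<Suc t + 1} = Ach s0 j u v io (Suc t)"
          proof -
            have "{..<Suc t + 1} = insert (Suc t) {..<t + 1}" by auto
            then have "((words s4 ''X'')(Suc t := posi s0 ?i ?dg)) ` {..<Suc t + 1} = insert (posi s0 ?i ?dg) (words s4 ''X'' ` {..<t + 1})"
              by auto
            then show ?thesis unfolding X4 by (simp add: Ach_def)
          qed
          show ?case unfolding sem I_def using 1(1) im by simp
        next
          case 3 show ?case by simp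
        qed
      next
        case 2 show ?case by simp
      qed
    next
      case 3 show ?case by simp
    qed
  next
    case (7 s2)
    then show ?case unfolding I_def eres_def pk_def by (auto split: option.splits)
  next
    case 8 show ?case by (simp add: algebra_simps)
  next
    case 5
    have "words s1 ''X'' 0 = v" "words s1 ''t2'' 0 = io" using v io by (simp_all add: 2(1))
    then show ?case by (simp add: I_def Ach_def lessThan_Suc)
  qed (use Vb in simp_all)
next
  case 3 show ?case by simp
qed

definition nwx :: "nat \<Rightarrow> nat \<Rightarrow> nat \<Rightarrow> nat \<Rightarrow> nat" where
  "nwx j u v io = (Suc j * S + u) * (S * C) + v * C + io"

lemma nwx_ge: "lvl (Suc j) \<le> nwx j u v io"
  by (simp add: lvl_def nwx_def add_mult_distrib)

lemma nwx_lt: "u < n \<Longrightarrow> v < n \<Longrightarrow> io < C \<Longrightarrow> nwx j u v io < lvl (Suc (Suc j))"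
  unfolding nwx_def lvl_def add.assoc
  by (intro mr_less) (use sz mr_less[of io C v S] mr_less[of u S "Suc j" "Suc (Suc j)"] in auto)

lemma nwx_V: "u < n \<Longrightarrow> v < n \<Longrightarrow> io < C \<Longrightarrow> j < k \<Longrightarrow> nwx j u v io \<le> V"
proof -
  assume a: "u < n" "v < n" "io < C" "j < k"
  have "nwx j u v io < lvl (Suc (Suc j))" by (rule nwx_lt[OF a(1-3)])
  also have "\<dots> \<le> (k + 2) * S * (S * C)" unfolding lvl_def using a by (intro mult_right_mono) auto
  also have "\<dots> \<le> (k + 2) * S * (S * C) * S" using S0 by simp
  also have "\<dots> = (k + 2) * S * S * S * C" by simp
  finally show ?thesis using Vb(5) by linarith
qed

definition wrote :: "nat \<Rightarrow> nat \<Rightarrow> nat \<Rightarrow> real \<Rightarrow> nat option \<Rightarrow> state \<Rightarrow> state \<Rightarrow> bool" where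
  "wrote j v nw x e s' s \<longleftrightarrow> (case e of None \<Rightarrow> words s' ''fv'' = words s ''fv'' \<and> reals s' ''fw'' = reals s ''fw'' \<and> (\<forall>i. \<forall>p\<le>k. posi s' i p = posi s i p)
     | Some i \<Rightarrow> words s' ''fv'' = (words s ''fv'')(nw := 1) \<and> reals s' ''fw'' = (reals s ''fw'')(nw := x) \<and>
        (\<forall>i'. \<forall>p\<le>k. posi s' i' p = (if i' = nw then if p = j then v else posi s i p else posi s i' p)))"

lemma H_WRITE:
  assumes ps: "par2 s" and j: "words s ''j'' 0 = j" "j < k" and u: "words s ''u'' 0 = u" "u < n" and v: "words s ''v'' 0 = v" "v < n"
    and io: "words s ''io'' 0 = io" "io < C"
    and e: "(0 < words s ''bo'' 0) = (e \<noteq> None)" "e \<noteq> None \<longrightarrow> words s ''bi'' 0 = the e \<and> reals s ''bw'' 0 = x \<and> the e < lvl (Suc j)"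
  shows "H (200 * (k + 1) + 400) (WRITE k) s (\<lambda>s'. wrote j v (nwx j u v io) x e s' s)"
proof (cases e)
  case None
  then show ?thesis unfolding WRITE_def
    by (intro H_Cond[where t = 1] H_sl) (use e in \<open>auto simp: wrote_def\<close>)
next
  case (Some i)
  let ?nw = "nwx j u v io"
  have i: "i < lvl (Suc j)" "words s ''bi'' 0 = i" "reals s ''bw'' 0 = x" using e Some by auto
  have ne: "i \<noteq> ?nw" using i(1) nwx_ge[of j u v io] by linarith
  have nV: "?nw \<le> V" by (rule nwx_V[OF u(2) v(2) io(2) j(2)])
  have nw: "wn s (((sv ''j'' [+] Const 1) [*] sv ''S'' [+] sv ''u'') [*] (sv ''S'' [*] Const ((k + 1) ^ k)) [+] sv ''v'' [*] Const ((k + 1) ^ k) [+] sv ''io'') = ?nw"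
    unfolding nwx_def using j u v io par2D[OF ps] by (simp add: C)
  have cell: "a * (k + 1) + p = b * (k + 1) + p' \<longleftrightarrow> a = b \<and> p = p'" if "p \<le> k" "p' \<le> k" for a b p p'
    by (rule mr_eq) (use that in auto)
  show ?thesis unfolding WRITE_def
  proof (rule H_Cond[where t = "200 * (k + 1) + 380"], goal_cases)
    case 1
    show ?case
    proof (rule H_slS[where u = "200 * (k + 1) + 200"], simp, goal_cases)
      case 1 show ?case using nw nV V2 by (simp del: wn.simps add: wn.simps(1,2))
    next
      case (2 s1)
      note a1 = agrw[OF 2(3), simplified] agrr[OF 2(3), simplified]
      have w1: "words s1 ''nw'' 0 = ?nw" "words s1 ''bi'' 0 = i" "words s1 ''j'' 0 = j" "words s1 ''v'' 0 = v" "words s1 ''pth'' = words s ''pth''"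
        "words s1 ''fv'' = (words s ''fv'')(?nw := 1)" "reals s1 ''fw'' = (reals s ''fw'')(?nw := x)"
        using nw i j v by (simp_all add: 2(1) del: wn.simps add: wn.simps(1,2))
      let ?f = "\<lambda>p a. if \<exists>p'<p. a = ?nw * (k + 1) + p' then words s ''pth'' (i * (k + 1) + (a - ?nw * (k + 1))) else words s ''pth'' a"
      show ?case
      proof (rule H_Seq[where t = "200 * (k + 1) + 50" and u = 100 and R = "\<lambda>s'. words s' ''pth'' = ?f (k + 1)"], goal_cases)
        case 1
        show ?case
        proof (rule H_For_const[where N = "k + 1" and t = 100 and I = "\<lambda>p s'. words s' ''pth'' = ?f p"], goal_cases)
          case (6 p s2)
          note a2 = agrw[OF 6(5), simplified] agrr[OF 6(5), simplified]
          have r: "words s2 ''pth'' (i * (k + 1) + p) = words s ''pth'' (i * (k + 1) + p)"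
          proof -
            have "\<not> (\<exists>p'<p. i * (k + 1) + p = ?nw * (k + 1) + p')" using 6(1) cell[of p _ i ?nw] ne by auto
            then show ?thesis unfolding 6(2) by (rule if_not_P)
          qed
          have w2: "words s2 ''nw'' 0 = ?nw" "words s2 ''bi'' 0 = i" "words s2 ''p'' 0 = p" using a2 w1 6(3) by simp_all
          have f: "?f (Suc p) = (?f p)(?nw * (k + 1) + p := words s ''pth'' (i * (k + 1) + p))"
            by (rule ext) (auto simp: less_Suc_eq)
          show ?case
          proof (rule H_sl, simp, goal_cases)
            case 1 show ?case using bndD[OF 1] by simp
          next
            case 2
            have "wn s2 (sv ''nw'' [*] Const (k + 1) [+] sv ''p'') = ?nw * (k + 1) + p"
              "wn s2 (WLoad ''pth'' (sv ''bi'' [*] Const (k + 1) [+] sv ''p'')) = words s ''pth'' (i * (k + 1) + p)"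
              using w2 r by simp_all
            then show ?case unfolding f using 6(2) by (simp del: wn.simps)
          next
            case 3 show ?case by simp
          qed
        qed (use Vb w1 in \<open>simp_all\<close>)
      next
        case (2 s2)
        note a2 = agrw[OF 2(3), simplified] agrr[OF 2(3), simplified]
        have w2: "words s2 ''nw'' 0 = ?nw" "words s2 ''j'' 0 = j" "words s2 ''v'' 0 = v" "words s2 ''fv'' = (words s ''fv'')(?nw := 1)" "reals s2 ''fw'' = (reals s ''fw'')(?nw := x)"
          using a2 w1 by simp_all
        have pos: "words s2 ''pth'' (i' * (k + 1) + p) = (if i' = ?nw then posi s i p else posi s i' p)" if "p \<le> k" for i' p
        proof (cases "i' = ?nw")
          case True
          then have "\<exists>p'<k + 1. i' * (k + 1) + p = ?nw * (k + 1) + p'" using that by (intro exI[of _ p]) auto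
          then have "words s2 ''pth'' (i' * (k + 1) + p) = words s ''pth'' (i * (k + 1) + (i' * (k + 1) + p - ?nw * (k + 1)))"
            unfolding 2(1) by (rule if_P)
          also have "i' * (k + 1) + p - ?nw * (k + 1) = p" using True by simp
          finally show ?thesis using True by (simp add: posi_def)
        next
          case False
          then have "\<not> (\<exists>p'<k + 1. i' * (k + 1) + p = ?nw * (k + 1) + p')" using cell[of p _ i' ?nw] that by auto
          then have "words s2 ''pth'' (i' * (k + 1) + p) = words s ''pth'' (i' * (k + 1) + p)"
            unfolding 2(1) by (rule if_not_P)
          then show ?thesis using False by (simp add: posi_def)
        qed
        show ?case
        proof (rule H_sl, simp, goal_cases)
          case 1 show ?case using bndD[OF 1] by simp
        next
          case 2
          have "posi (sem (WStore ''pth'' (sv ''nw'' [*] Const (k + 1) [+] sv ''j'') (sv ''v'')) s2) i' p =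
             (if i' = ?nw then if p = j then v else posi s i p else posi s i' p)" if "p \<le> k" for i' p
          proof -
            have "i' * (k + 1) + p = ?nw * (k + 1) + j \<longleftrightarrow> i' = ?nw \<and> p = j" by (rule cell) (use that j in auto)
            then show ?thesis using pos[OF that, of i'] w2 by (cases "i' = ?nw") (simp_all add: posi_def)
          qed
          then show ?case using w2 by (simp add: wrote_def Some)
        next
          case 3 show ?case by simp
        qed
      next
        case 3 show ?case by simp
      qed
    next
      case 3 show ?case by simp
    qed
  next
    case 2 then show ?case using e Some by simp
  next
    case 3 show ?case by simp
  qed
qed

definition entok :: "state \<Rightarrow> state \<Rightarrow> nat \<Rightarrow> nat \<Rightarrow> nat \<Rightarrow> nat \<Rightarrow> bool" where
  "entok s s' j u v io \<longleftrightarrow> (case eres s j u v io of None \<Rightarrow> words s' ''fv'' (nwx j u v io) = 0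
     | Some i \<Rightarrow> words s' ''fv'' (nwx j u v io) = 1 \<and> reals s' ''fw'' (nwx j u v io) = vali s v i \<and>
        (\<forall>p\<le>k. posi s' (nwx j u v io) p = (if p = j then v else posi s i p)))"

text \<open>Entries are written in increasing order of their addresses, and \<open>T\<close> is the
  watermark: everything above is still empty, every entry below is final. The third clause excludes
  flags at addresses that belong to no entry.\<close>

definition Linv :: "state \<Rightarrow> nat \<Rightarrow> state \<Rightarrow> nat \<Rightarrow> bool" where
  "Linv s j s' T \<longleftrightarrow> same j s' s \<and> (\<forall>i\<ge>T. words s' ''fv'' i = 0) \<and>
     (\<forall>i. words s' ''fv'' i = words s ''fv'' i \<or> (words s' ''fv'' i = 1 \<and> (\<exists>u<n. \<exists>v<n. \<exists>io<C. i = nwx j u v io))) \<and>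
     (\<forall>u<n. \<forall>v<n. \<forall>io<C. nwx j u v io < T \<longrightarrow> entok s s' j u v io)"

lemma Linv_cong:
  assumes "words s2 ''fv'' = words s1 ''fv''" "words s2 ''pth'' = words s1 ''pth''" "words s2 ''oc'' = words s1 ''oc''"
    "words s2 ''aw'' = words s1 ''aw''" "reals s2 ''fw'' = reals s1 ''fw''" "reals s2 ''wt'' = reals s1 ''wt''"
  shows "Linv s j s2 T = Linv s j s1 T"
proof -
  have "posi s2 = posi s1" using assms by (simp add: posi_def fun_eq_iff)
  note eqs = this assms
  show ?thesis unfolding Linv_def same_def entok_def eqs by (rule refl)
qed

lemma nwx_less_Suc: "io < C \<Longrightarrow> v < S \<Longrightarrow> u < S \<Longrightarrow> io' < C \<Longrightarrow> v' < S \<Longrightarrow> u' < S \<Longrightarrow> nwx j u v io = nwx j u' v' io' \<longleftrightarrow> u = u' \<and> v = v' \<and> io = io'"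
  unfolding nwx_def add.assoc by (auto simp: mr_eq mr_less)

lemma eres_lt: "occ s j \<Longrightarrow> u < n \<Longrightarrow> v < n \<Longrightarrow> eres s j u v io \<noteq> None \<Longrightarrow> the (eres s j u v io) < lvl (Suc j)"
  using pk_lt[of s j u v "Ach s j u v io k"] unfolding eres_def pk_def by auto

lemma Linv_step:
  assumes L: "Linv s j s1 (nwx j u v io)" and uv: "u < n" "v < n" "io < C" and oc: "occ s j"
    and w: "wrote j v (nwx j u v io) (vali s v (the (eres s j u v io))) (eres s j u v io) s2 s1"
    and ag: "words s2 ''oc'' = words s1 ''oc''" "words s2 ''aw'' = words s1 ''aw''" "reals s2 ''wt'' = reals s1 ''wt''"
  shows "Linv s j s2 (Suc (nwx j u v io))"
proof -
  let ?nw = "nwx j u v io"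
  have other: "words s2 ''fv'' i = words s1 ''fv'' i" "reals s2 ''fw'' i = reals s1 ''fw'' i" "p \<le> k \<Longrightarrow> posi s2 i p = posi s1 i p" if "i \<noteq> ?nw" for i p
    using w that by (auto simp: wrote_def split: option.splits)
  have "same j s2 s"
    using L other nwx_ge[of j u v io] ag unfolding Linv_def same_def by (metis not_less)
  moreover have "words s2 ''fv'' i = 0" if "i \<ge> Suc ?nw" for i
    using L other(1)[of i] that unfolding Linv_def by auto
  moreover have "entok s s2 j u' v' io'" if a: "u' < n" "v' < n" "io' < C" "nwx j u' v' io' < Suc ?nw" for u' v' io'
  proof (cases "nwx j u' v' io' = ?nw")
    case True
    then have eq: "u' = u" "v' = v" "io' = io" using nwx_less_Suc[of io' v' u' io v u j] a uv sz by auto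
    have sm: "same j s1 s" "words s1 ''fv'' ?nw = 0" using L by (auto simp: Linv_def)
    show ?thesis
    proof (cases "eres s j u v io")
      case None
      then show ?thesis using w sm eq by (simp add: entok_def wrote_def)
    next
      case (Some i)
      then have "i < lvl (Suc j)" using eres_lt[OF oc uv(1,2), of io] by simp
      then have "\<forall>p\<le>k. posi s1 i p = posi s i p" using sm(1) by (simp add: same_def)
      then show ?thesis using w Some eq by (simp add: entok_def wrote_def)
    qed
  next
    case False
    then have "entok s s1 j u' v' io'" using L a unfolding Linv_def by simp
    then show ?thesis using other[OF False] unfolding entok_def by (auto split: option.splits)
  qed
  moreover have "words s2 ''fv'' i = words s ''fv'' i \<or> (words s2 ''fv'' i = 1 \<and> (\<exists>u<n. \<exists>v<n. \<exists>io<C. i = nwx j u v io))" for i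
  proof (cases "i = ?nw \<and> words s2 ''fv'' i = 1")
    case True then show ?thesis using uv by blast
  next
    case False
    then have "words s2 ''fv'' i = words s1 ''fv'' i"
      using w by (auto simp: wrote_def split: option.splits)
    then show ?thesis using L unfolding Linv_def by metis
  qed
  ultimately show ?thesis unfolding Linv_def by blast
qed

lemma Linv_mono:
  assumes "Linv s j s' T" "T \<le> T'" "\<And>u v io. u < n \<Longrightarrow> v < n \<Longrightarrow> io < C \<Longrightarrow> nwx j u v io < T' \<Longrightarrow> nwx j u v io < T"
  shows "Linv s j s' T'"
  using assms unfolding Linv_def by (auto dest: le_trans)

definition TE :: nat where "TE = (k + 1) * (nb * C * (TH + 500) + 400) + 200 * (k + 1) + 600"

definition TL :: nat where "TL = n * (n * (C * TE + 100) + 100) + 100"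

lemma H_LEVEL:
  assumes ps: "par2 s" and j: "words s ''j'' 0 = j" "j < k" and oc: "occ s j" and z: "\<And>i. i \<ge> lvl (Suc j) \<Longrightarrow> words s ''fv'' i = 0"
  shows "H TL (LEVEL k) s (\<lambda>s'. Linv s j s' (nwx j n 0 0))"
  unfolding LEVEL_def
proof (rule H_For_const[where N = n and t = "n * (C * TE + 100) + 80" and I = "\<lambda>u s'. Linv s j s' (nwx j u 0 0)"], goal_cases)
  case 5
  have "nwx j 0 0 0 = lvl (Suc j)" by (simp add: nwx_def lvl_def)
  moreover have "\<not> nwx j u v io < lvl (Suc j)" for u v io using nwx_ge[of j u v io] by simp
  ultimately show ?case using z unfolding Linv_def same_def posi_def by simp
next
  case (6 u s1)
  note a1 = agrw[OF 6(5), simplified] agrr[OF 6(5), simplified] and u = 6(1,3) and I1 = 6(2)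
  have p1: "par2 s1" by (rule par2_agr[OF ps 6(5)]) (simp add: parnames_def parnames2_def)
  show ?case
  proof (rule H_For_const[where N = n and t = "C * TE + 80" and I = "\<lambda>v s'. Linv s j s' (nwx j u v 0)"], goal_cases)
    case 5 show ?case using I1 by (subst Linv_cong[of _ s1]) simp_all
  next
    case (6 v s2)
    note a2 = agrw[OF 6(5), simplified] agrr[OF 6(5), simplified] and v = 6(1,3) and I2 = 6(2)
    have p2: "par2 s2" by (rule par2_agr[OF p1 6(5)]) (simp add: parnames_def parnames2_def)
    show ?case
    proof (rule H_For_const[where N = C and t = "TE - 20" and I = "\<lambda>io s'. Linv s j s' (nwx j u v io)"], goal_cases)
      case 5 show ?case using I2 by (subst Linv_cong[of _ s2]) simp_all
    next
      case (6 io s3)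
      note a3 = agrw[OF 6(5), simplified] agrr[OF 6(5), simplified] and io = 6(1,3) and I3 = 6(2)
      have p3: "par2 s3" by (rule par2_agr[OF p2 6(5)]) (simp add: parnames_def parnames2_def)
      have w3: "words s3 ''j'' 0 = j" "words s3 ''u'' 0 = u" "words s3 ''v'' 0 = v" using a1 a2 a3 j u v by simp_all
      have sm3: "same j s3 s" using I3 by (simp add: Linv_def)
      have jk: "j \<le> k" using j by simp
      show ?case
      proof (rule H_Seq[OF H_CHAIN[OF p3 w3(1) jk w3(2) u(1) w3(3) v(1) io(2) sm3 oc], where u = "200 * (k + 1) + 400"], goal_cases)
        case (1 s4)
        note a4 = agrw[OF 1(3), simplified] agrr[OF 1(3), simplified]
        have p4: "par2 s4" by (rule par2_agr[OF p3 1(3)]) (simp add: parnames_def parnames2_def)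
        have w4: "words s4 ''j'' 0 = j" "words s4 ''u'' 0 = u" "words s4 ''v'' 0 = v" "words s4 ''io'' 0 = io" using w3 a4 io by simp_all
        have L4: "Linv s j s4 (nwx j u v io)" using I3 a4 by (subst Linv_cong[of _ s3]) simp_all
        have e4: "(0 < words s4 ''bo'' 0) = (eres s j u v io \<noteq> None)"
          "eres s j u v io \<noteq> None \<longrightarrow> words s4 ''bi'' 0 = the (eres s j u v io) \<and> reals s4 ''bw'' 0 = vali s v (the (eres s j u v io)) \<and> the (eres s j u v io) < lvl (Suc j)"
          using 1(1) eres_lt[OF oc u(1) v(1)] by auto
        show ?case
        proof (rule H_conseq[OF H_WRITE[OF p4 w4(1) j(2) w4(2) u(1) w4(3) v(1) w4(4) io(1) e4]], goal_cases)
          case 1 show ?case by simp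
        next
          case (2 s5)
          note a5 = agrw[OF 2(3), simplified] agrr[OF 2(3), simplified]
          have "Linv s j s5 (Suc (nwx j u v io))" by (rule Linv_step[OF L4 u(1) v(1) io(1) oc 2(1)]) (simp_all add: a5)
          moreover have "nwx j u v (Suc io) = Suc (nwx j u v io)" by (simp add: nwx_def)
          ultimately show ?case by (subst Linv_cong[of _ s5]) simp_all
        qed
      next
        case 2 show ?case by (simp add: TE_def)
      qed
    next
      case (7 s3)
      have "nwx j u v C = nwx j u (Suc v) 0" by (simp add: nwx_def)
      then show ?case using 7(1) by (subst Linv_cong[of _ s3]) simp_all
    next
      case 8
      \<comment> \<open>The loop body is charged \<open>TE - 20\<close> to leave room for the loop
        overhead; the truncated subtraction needs this bound.\<close>
      have "TE \<ge> 20" by (simp add: TE_def)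
      then have "C * (TE - 20 + wcost (Const ((k + 1) ^ k)) + 10) \<le> C * TE" by (intro mult_left_mono) auto
      moreover have "wcost (Const ((k + 1) ^ k)) = 1" by simp
      ultimately show ?case by linarith
    qed (use Vb in \<open>simp_all add: C\<close>)
  next
    case (7 s2)
    \<comment> \<open>As \<open>n < S\<close>, there is a gap between the last entry for
      \<open>u\<close> and the first one for \<open>Suc u\<close>; no entry lies in it, so the
      watermark may jump.\<close>
    have "Linv s j s2 (nwx j (Suc u) 0 0)"
    proof (rule Linv_mono[OF 7(1)])
      have nS: "n * C \<le> S * C" using sz by (intro mult_right_mono) auto
      then show "nwx j u n 0 \<le> nwx j (Suc u) 0 0" by (simp add: nwx_def)
      fix u' v' io assume a: "u' < n" "v' < n" "io < C" "nwx j u' v' io < nwx j (Suc u) 0 0"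
      have vi: "v' * C + io < n * C" using a by (intro mr_less)
      have "u' \<le> u"
      proof (rule ccontr)
        assume "\<not> u' \<le> u"
        then have "nwx j (Suc u) 0 0 \<le> nwx j u' 0 0" unfolding nwx_def by (intro add_mono mult_right_mono) auto
        also have "\<dots> \<le> nwx j u' v' io" by (simp add: nwx_def)
        finally show False using a by simp
      qed
      then have "(Suc j * S + u') * (S * C) \<le> (Suc j * S + u) * (S * C)" by (intro mult_right_mono) auto
      then show "nwx j u' v' io < nwx j u n 0" using vi unfolding nwx_def add.assoc by linarith
    qed
    then show ?case by (subst Linv_cong[of _ s2]) simp_all
  next
    case 8 show ?case by (simp add: algebra_simps)
  qed (use p1 bounds in \<open>simp_all add: par2D\<close>)
next
  case 8 show ?case by (simp add: TL_def algebra_simps)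
qed (use ps bounds in \<open>simp_all add: par2D\<close>)

end

lemma lmax_cong:
  assumes "\<And>c. c < N \<Longrightarrow> f c = f' c"
  shows "lmax N f x = lmax N f' x"
proof -
  have "(c < N \<and> (\<forall>c'<N. lge f x c c')) \<longleftrightarrow> (c < N \<and> (\<forall>c'<N. lge f' x c c'))" for c
  proof (cases "c < N")
    case True
    have "lge f x c c' = lge f' x c c'" if "c' < N" for c'
      using assms[OF True] assms[OF that] by (simp add: lge_def)
    then show ?thesis using True by blast
  qed simp
  then show ?thesis unfolding lmax_def by simp
qed

lemma scan_cong: "(\<And>p. p < q \<Longrightarrow> R (g p) = R' (g p)) \<Longrightarrow> scan g R val q = scan g R' val q"
  by (induction q) auto

section \<open>Simple paths and their weights\<close>

definition isp :: "nat \<Rightarrow> nat set set \<Rightarrow> nat \<Rightarrow> nat \<Rightarrow> nat \<Rightarrow> nat list \<Rightarrow> bool" where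
  "isp n E j u v xs \<longleftrightarrow> length xs = j \<and> xs \<noteq> [] \<and> distinct xs \<and> hd xs = u \<and> last xs = v \<and> set xs \<subseteq> {..<n} \<and>
     (\<forall>i. Suc i < j \<longrightarrow> {xs ! i, xs ! Suc i} \<in> E)"

definition pwt :: "(nat set \<Rightarrow> real) \<Rightarrow> nat list \<Rightarrow> real" where
  "pwt w xs = (\<Sum>i<length xs - 1. w {xs ! i, xs ! Suc i})"

lemma pwt_snoc: "xs \<noteq> [] \<Longrightarrow> pwt w (xs @ [v]) = pwt w xs + w {last xs, v}"
proof -
  assume a: "xs \<noteq> []"
  then obtain l where l: "length xs = Suc l" by (cases xs) auto
  have "pwt w (xs @ [v]) = (\<Sum>i<Suc l. w {(xs @ [v]) ! i, (xs @ [v]) ! Suc i})" by (simp add: pwt_def l)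
  also have "\<dots> = (\<Sum>i<l. w {xs ! i, xs ! Suc i}) + w {xs ! l, v}"
    using l by (simp add: nth_append)
  finally show ?thesis using l a by (simp add: pwt_def last_conv_nth)
qed

lemma isp_snoc:
  assumes "xs \<noteq> []"
  shows "isp n E (Suc j) u v (xs @ [y]) \<longleftrightarrow> isp n E j u (last xs) xs \<and> y = v \<and> v \<notin> set xs \<and> v < n \<and> {last xs, v} \<in> E"
proof -
  have "(\<forall>i. Suc i < Suc j \<longrightarrow> {(xs @ [y]) ! i, (xs @ [y]) ! Suc i} \<in> E) \<longleftrightarrow>
        (\<forall>i. Suc i < j \<longrightarrow> {xs ! i, xs ! Suc i} \<in> E) \<and> {last xs, y} \<in> E" if len: "length xs = j"
  proof -
    obtain l where l: "j = Suc l" using len assms by (cases xs) auto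
    have "(\<forall>i. Suc i < Suc j \<longrightarrow> R i) \<longleftrightarrow> (\<forall>i. Suc i < j \<longrightarrow> R i) \<and> R l" for R
      unfolding l by (auto simp: less_Suc_eq)
    then show ?thesis using len l assms by (simp add: nth_append last_conv_nth)
  qed
  then show ?thesis using assms by (auto simp: isp_def)
qed

section \<open>From paths with \<open>j\<close> vertices to paths with \<open>j + 1\<close>
  vertices\<close>

definition STAGE :: "nat \<Rightarrow> com" where
  "STAGE k = For ''be'' (sv ''nb'') (BLOCK k) ;; LEVEL k"

lemma modw_STAGE [simp]: "modw (STAGE k) = modw (BLOCK k) \<union> modw (LEVEL k)"
  and modr_STAGE [simp]: "modr (STAGE k) = {''bx'', ''ax'', ''bw'', ''fw''}"
  by (auto simp: STAGE_def)

definition STAGES :: "nat \<Rightarrow> com" where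
  "STAGES k = For ''jj'' (Const (k - 1)) (''j'' :== sv ''jj'' [+] Const 1 ;; STAGE k)"

lemma modw_STAGES [simp]: "modw (STAGES k) = {''jj'', ''j''} \<union> modw (BLOCK k) \<union> modw (LEVEL k)"
  and modr_STAGES [simp]: "modr (STAGES k) = {''bx'', ''ax'', ''bw'', ''fw''}"
  by (auto simp: STAGES_def)

locale galgo = algo +
  fixes E :: "nat set set" and w :: "nat set \<Rightarrow> real"
  assumes sg: "simple_graph n E"
begin

lemma edge_n: "{x, y} \<in> E \<Longrightarrow> x < n \<and> y < n \<and> x \<noteq> y"
proof -
  assume "{x, y} \<in> E"
  then have "{x, y} \<subseteq> {..<n} \<and> card {x, y} = 2" using bspec[OF sg[unfolded simple_graph_def]] by blast
  moreover have "x \<noteq> y" using calculation by auto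
  ultimately show ?thesis by simp
qed

definition gr :: "state \<Rightarrow> bool" where
  "gr s \<longleftrightarrow> (\<forall>a<S. \<forall>b<S. words s ''aw'' (a * S + b) = (if {a, b} \<in> E then 1 else 0)) \<and>
     (\<forall>a<S. \<forall>b<S. {a, b} \<in> E \<longrightarrow> reals s ''wt'' (a * S + b) = w {a, b})"

definition eidx :: "nat \<Rightarrow> nat \<Rightarrow> nat \<Rightarrow> nat \<Rightarrow> nat" where
  "eidx j u x t = (j * S + u) * (S * C) + x * C + t"

definition pl :: "state \<Rightarrow> nat \<Rightarrow> nat \<Rightarrow> nat list" where
  "pl s j i = map (posi s i) [0..<j]"

text \<open>The padding repeats the start vertex, so scanning the first \<open>k\<close> cells sees
  exactly the vertices of the path. The sentinel \<open>n\<close> is no vertex; it is the waiting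
  element \<open>J\<close> of \<open>chain_complete\<close>.\<close>

definition valid :: "state \<Rightarrow> nat \<Rightarrow> nat \<Rightarrow> nat \<Rightarrow> nat \<Rightarrow> bool" where
  "valid s j u x i \<longleftrightarrow> isp n E j u x (pl s j i) \<and> reals s ''fw'' i = pwt w (pl s j i) \<and>
     (\<forall>p. j \<le> p \<and> p < k \<longrightarrow> posi s i p = u) \<and> posi s i k = n"

definition sound :: "state \<Rightarrow> nat \<Rightarrow> bool" where
  "sound s j \<longleftrightarrow> (\<forall>u<n. \<forall>x<S. \<forall>t<C. words s ''fv'' (eidx j u x t) \<le> 1 \<and>
     (words s ''fv'' (eidx j u x t) = 1 \<longrightarrow> x < n \<and> valid s j u x (eidx j u x t)))"

lemma soundD: "sound s j \<Longrightarrow> u < n \<Longrightarrow> x < S \<Longrightarrow> t < C \<Longrightarrow> words s ''fv'' (eidx j u x t) \<le> 1"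
  and soundD': "sound s j \<Longrightarrow> u < n \<Longrightarrow> x < S \<Longrightarrow> t < C \<Longrightarrow> words s ''fv'' (eidx j u x t) = 1 \<Longrightarrow> x < n \<and> valid s j u x (eidx j u x t)"
  unfolding sound_def by blast+

lemma awD: "gr s \<Longrightarrow> x < S \<Longrightarrow> y < S \<Longrightarrow> words s ''aw'' (x * S + y) = (if {x, y} \<in> E then 1 else 0)"
  and wtD: "gr s \<Longrightarrow> x < S \<Longrightarrow> y < S \<Longrightarrow> {x, y} \<in> E \<Longrightarrow> reals s ''wt'' (x * S + y) = w {x, y}"
  unfolding gr_def by blast+

text \<open>A path with \<open>j\<close> vertices has to avoid only the \<open>k - j\<close>
  vertices that may still follow. Each extension uses up one of them, namely the appended
  vertex.\<close>

definition repr :: "state \<Rightarrow> nat \<Rightarrow> bool" where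
  "repr s j \<longleftrightarrow> (\<forall>u<n. \<forall>x<n. \<forall>X xs. finite X \<longrightarrow> card X \<le> k - j \<longrightarrow> isp n E j u x xs \<longrightarrow> set xs \<inter> X = {} \<longrightarrow>
     (\<exists>t<C. words s ''fv'' (eidx j u x t) = 1 \<and> set (pl s j (eidx j u x t)) \<inter> X = {} \<and> pwt w xs \<le> reals s ''fw'' (eidx j u x t)))"

lemma fidx_eidx: "fidx j be u c = eidx j u (be * d + c div C) (c mod C)"
proof -
  have "be * N + c = (be * d + c div C) * C + c mod C" by (simp add: N algebra_simps)
  then show ?thesis by (simp add: fidx_def eidx_def)
qed

lemma nwx_eidx: "nwx j u v io = eidx (Suc j) u v io"
  by (simp add: nwx_def eidx_def)

lemma blk_S: "be < nb \<Longrightarrow> c < N \<Longrightarrow> be * d + c div C < S"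
proof -
  assume a: "be < nb" "c < N"
  have "c div C < d" by (intro div_eq_0_iff') (use a in \<open>simp add: N mult.commute\<close>)
  then have "be * d + c div C < nb * d" using a by (intro mr_less)
  then show ?thesis using sz by simp
qed

lemma valid_pos: "valid s j u x i \<Longrightarrow> 1 \<le> j \<Longrightarrow> j \<le> k \<Longrightarrow> u < n \<Longrightarrow> posi s i k = n \<and> (\<forall>p<k. posi s i p < n)"
proof -
  assume a: "valid s j u x i" "1 \<le> j" "j \<le> k" "u < n"
  have "posi s i p < n" if "p < k" for p
  proof (cases "p < j")
    case True
    then have "posi s i p \<in> set (pl s j i)" by (simp add: pl_def)
    then show ?thesis using a by (auto simp: valid_def isp_def)
  qed (use a that in \<open>auto simp: valid_def\<close>)
  then show ?thesis using a by (simp add: valid_def)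
qed

lemma valid_hit: "valid s j u x i \<Longrightarrow> 1 \<le> j \<Longrightarrow> j \<le> k \<Longrightarrow> hitf k (words s ''pth'') i A \<longleftrightarrow> set (pl s j i) \<inter> A \<noteq> {}"
proof -
  assume a: "valid s j u x i" "1 \<le> j" "j \<le> k"
  have u: "u \<in> set (pl s j i)" using a unfolding valid_def isp_def by (metis hd_in_set)
  have "(\<lambda>p. posi s i p) ` {..<k} = set (pl s j i)"
  proof (intro equalityI subsetI)
    fix y assume "y \<in> (\<lambda>p. posi s i p) ` {..<k}"
    then obtain p where p: "p < k" "y = posi s i p" by auto
    show "y \<in> set (pl s j i)"
    proof (cases "p < j")
      case True then show ?thesis using p by (auto simp: pl_def)
    next
      case False then show ?thesis using p a u by (auto simp: valid_def)
    qed
  next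
    fix y assume "y \<in> set (pl s j i)"
    then show "y \<in> (\<lambda>p. posi s i p) ` {..<k}" using a by (auto simp: pl_def)
  qed
  moreover have "hitf k (words s ''pth'') i A \<longleftrightarrow> posi s i ` {..<k} \<inter> A \<noteq> {}"
    by (auto simp: hitf_def posi_def)
  ultimately show ?thesis by simp
qed

lemma digits_io:
  assumes "\<forall>t. ii t \<le> k"
  obtains io where "io < C" "\<forall>t<k. io div (k + 1) ^ t mod (k + 1) = ii t"
proof -
  have "\<exists>io<(k + 1) ^ k. \<forall>t<k. io div (k + 1) ^ t mod (k + 1) = ii t"
    by (rule ex_digits) (use assms in \<open>simp add: less_Suc_eq_le\<close>)
  then show ?thesis using that unfolding C by blast
qed

text \<open>An instance of \<open>chain_complete\<close> with all candidates of the block: some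
  guess word leads to an admissible champion that avoids \<open>X\<close> and is no lighter, after
  the edge to \<open>v\<close> is added, than the given candidate. Waiting is possible since the
  sentinel \<open>n\<close> lies on no stored path.\<close>

lemma block_champ:
  assumes gr: "gr s" and so: "sound s j" and j: "1 \<le> j" "j \<le> k" and uv: "u < n" "v < n" and be: "be < nb" and c: "c < N"
    and X: "finite X" "card X \<le> k"
    and ok: "words s ''fv'' (fidx j be u c) = 1" "words s ''aw'' ((be * d + c div C) * S + v) = 1" "\<not> hitf k (words s ''pth'') (fidx j be u c) X"
  shows "\<exists>io<C. let c' = cch s j be u v io k in c' < N \<and> words s ''fv'' (fidx j be u c') = 1 \<and>
     words s ''aw'' ((be * d + c' div C) * S + v) = 1 \<and> \<not> hitf k (words s ''pth'') (fidx j be u c') X \<and>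
     reals s ''fw'' (fidx j be u c) + reals s ''wt'' ((be * d + c div C) * S + v) \<le>
     reals s ''fw'' (fidx j be u c') + reals s ''wt'' ((be * d + c' div C) * S + v)"
proof -
  let ?ok = "\<lambda>c. words s ''fv'' (fidx j be u c) = 1 \<and> words s ''aw'' ((be * d + c div C) * S + v) = 1"
  let ?val = "\<lambda>c. reals s ''fw'' (fidx j be u c) + reals s ''wt'' ((be * d + c div C) * S + v)"
  have vS: "v < S" using uv sz by simp
  have le1: "words s ''fv'' (fidx j be u c) \<le> 1" "words s ''aw'' ((be * d + c div C) * S + v) \<le> 1"
    "words s ''fv'' (fidx j be u c) = 1 \<Longrightarrow> valid s j u (be * d + c div C) (fidx j be u c)" if "c < N" for c
    using soundD[OF so uv(1) blk_S[OF be that], of "c mod C"] soundD'[OF so uv(1) blk_S[OF be that], of "c mod C"]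
      awD[OF gr blk_S[OF be that] vS] C0 unfolding fidx_eidx by auto
  have av: "(\<forall>p<k. cpos s j be u c p \<notin> A) \<longleftrightarrow> \<not> hitf k (words s ''pth'') (fidx j be u c) A" for c A
    by (simp add: cpos_def hitf_def)
  have pos: "cpos s j be u c p = posi s (fidx j be u c) p" for c p by (simp add: cpos_def posi_def)
  have "\<exists>ii. (\<forall>t. ii t \<le> k) \<and> (let c' = cpick s j be u v (chx (cpick s j be u v) (cpos s j be u) ii {} k) in
     c' \<in> {..<N} \<and> ?ok c' \<and> (\<forall>p<k. cpos s j be u c' p \<notin> X \<union> {}) \<and> (\<forall>p<k. cpos s j be u c' p \<notin> chx (cpick s j be u v) (cpos s j be u) ii {} k) \<and> ?val c \<le> ?val c')"
  proof (rule chain_complete[where J = n])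
    fix A c assume a: "c \<in> {..<N}" "?ok c" "\<forall>p<k. cpos s j be u c p \<notin> A"
    define f where "f = (\<lambda>c. (if hitf k (words s ''pth'') (fidx j be u c) A then 0 else words s ''fv'' (fidx j be u c)) + words s ''aw'' ((be * d + c div C) * S + v))"
    let ?c = "cpick s j be u v A"
    have cp: "?c = lmax N f ?val" by (simp add: cpick_def f_def)
    have c1: "?c < N" "lge f ?val ?c c" using lmax_props[OF N0, of f ?val] a(1) unfolding cp by auto
    \<comment> \<open>An admissible candidate has the maximal flag sum 2, so the lexicographic
      maximum is admissible as well and wins by weight.\<close>
    have fc: "f c = 2" using a av by (simp add: f_def)
    then have "f ?c \<ge> 2" using c1(2) unfolding lge_def by linarith
    moreover have "f ?c \<le> (if hitf k (words s ''pth'') (fidx j be u ?c) A then 0 else 1) + words s ''aw'' ((be * d + ?c div C) * S + v)"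
      using le1(1)[OF c1(1)] by (simp add: f_def)
    ultimately have nh: "\<not> hitf k (words s ''pth'') (fidx j be u ?c) A" "f ?c = 2" "?ok ?c"
      using le1(1,2)[OF c1(1)] by (auto simp: f_def split: if_splits)
    moreover have "?val c \<le> ?val ?c" using c1(2) fc nh(2) unfolding lge_def by linarith
    ultimately show "?c \<in> {..<N} \<and> ?ok ?c \<and> (\<forall>p<k. cpos s j be u ?c p \<notin> A) \<and> ?val c \<le> ?val ?c"
      using c1(1) av by simp
  next
    fix A
    show "cpick s j be u v (insert n A) = cpick s j be u v A"
      unfolding cpick_def
    proof (rule lmax_cong)
      fix c assume "c < N"
      show "(if hitf k (words s ''pth'') (fidx j be u c) (insert n A) then 0 else words s ''fv'' (fidx j be u c)) + words s ''aw'' ((be * d + c div C) * S + v) =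
        (if hitf k (words s ''pth'') (fidx j be u c) A then 0 else words s ''fv'' (fidx j be u c)) + words s ''aw'' ((be * d + c div C) * S + v)"
      proof (cases "words s ''fv'' (fidx j be u c) = 1")
        case True
        then have "\<forall>p<k. posi s (fidx j be u c) p < n" using valid_pos[OF le1(3)[OF \<open>c < N\<close>] j uv(1)] by simp
        then have "hitf k (words s ''pth'') (fidx j be u c) (insert n A) = hitf k (words s ''pth'') (fidx j be u c) A"
          unfolding hitf_def posi_def by auto
        then show ?thesis by simp
      next
        case False
        then have "words s ''fv'' (fidx j be u c) = 0" using le1(1)[OF \<open>c < N\<close>] by linarith
        then show ?thesis by simp
      qed
    qed
  next
    fix c assume "c \<in> {..<N}" "?ok c"
    then show "cpos s j be u c k = n \<and> (\<forall>p<k. cpos s j be u c p \<noteq> n)"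
      using valid_pos[OF le1(3)[of c] j uv(1)] unfolding pos by auto
  qed (use X c ok av in auto)
  then obtain ii where ii: "\<forall>t. ii t \<le> k" and H: "let c' = cpick s j be u v (chx (cpick s j be u v) (cpos s j be u) ii {} k) in
     c' \<in> {..<N} \<and> ?ok c' \<and> (\<forall>p<k. cpos s j be u c' p \<notin> X \<union> {}) \<and> (\<forall>p<k. cpos s j be u c' p \<notin> chx (cpick s j be u v) (cpos s j be u) ii {} k) \<and> ?val c \<le> ?val c'"
    by blast
  obtain io where io: "io < C" "\<forall>t<k. io div (k + 1) ^ t mod (k + 1) = ii t" by (rule digits_io[OF ii])
  have "chx (cpick s j be u v) (cpos s j be u) ii {} k = chx (cpick s j be u v) (cpos s j be u) (\<lambda>t. io div (k + 1) ^ t mod (k + 1)) {} k"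
    by (rule chx_cong) (use io(2) in metis)
  then have e: "cpick s j be u v (chx (cpick s j be u v) (cpos s j be u) ii {} k) = cch s j be u v io k"
    by (simp only: cch_def)
  show ?thesis using H io(1) unfolding e Let_def av by (intro exI[of _ io]) simp
qed

lemma gq_props:
  assumes oc: "occ s j" and so: "sound s j" and uv: "u < n" "v < n" and q: "q < nb * C"
  shows "words s ''fv'' (gq s j u v q) \<le> 1 \<and> wwi (gq s j u v q) < S \<and>
    (0 < words s ''fv'' (gq s j u v q) \<longrightarrow> wwi (gq s j u v q) < n \<and> valid s j u (wwi (gq s j u v q)) (gq s j u v q))"
proof -
  define be c where "be = q div C" and "c = words s ''oc'' (oidx (j * S * C + q) u v)"
  have be: "be < nb" using q by (simp add: be_def less_mult_imp_div_less)
  have c: "c < N" using oc uv q unfolding occ_def c_def by blast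
  have g: "gq s j u v q = eidx j u (be * d + c div C) (c mod C)" by (simp add: gq_def be_def c_def fidx_eidx)
  have ww: "wwi (gq s j u v q) = be * d + c div C" using wwi_fidx[OF be c, of j u] by (simp add: g fidx_eidx)
  have f: "words s ''fv'' (gq s j u v q) \<le> 1 \<and> (words s ''fv'' (gq s j u v q) = 1 \<longrightarrow> be * d + c div C < n \<and> valid s j u (be * d + c div C) (gq s j u v q))"
    using soundD[OF so uv(1) blk_S[OF be c], of "c mod C"] soundD'[OF so uv(1) blk_S[OF be c], of "c mod C"] C0
    unfolding g by auto
  moreover have "0 < y \<Longrightarrow> y \<le> 1 \<Longrightarrow> y = 1" for y :: nat by linarith
  ultimately show ?thesis using blk_S[OF be c] unfolding ww by blast
qed

text \<open>A flag set during the level belongs to an entry for which the scan found a path avoiding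
  \<open>v\<close>, as \<open>v\<close> is in every forbidden set, and ending in a neighbour of
  \<open>v\<close>. Appending \<open>v\<close> gives a simple path; addresses with last vertex
  beyond \<open>n\<close> keep flag 0.\<close>

lemma level_sound:
  assumes gr: "gr s" and so: "sound s j" and j: "1 \<le> j" "j < k" and oc: "occ s j" and L: "Linv s j s' (nwx j n 0 0)"
    and z: "\<And>i. i \<ge> lvl (Suc j) \<Longrightarrow> words s ''fv'' i = 0"
  shows "sound s' (Suc j)"
  unfolding sound_def
proof (intro allI impI)
  fix u x t assume a: "u < n" "x < S" "t < C"
  let ?i = "eidx (Suc j) u x t"
  have ge: "lvl (Suc j) \<le> ?i" using nwx_ge[of j u x t] by (simp add: nwx_eidx)
  have fvi: "words s' ''fv'' ?i = 0 \<or> (words s' ''fv'' ?i = 1 \<and> (\<exists>u'<n. \<exists>v<n. \<exists>io<C. ?i = nwx j u' v io))"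
    using L z[OF ge] unfolding Linv_def by (elim conjE) metis
  have "x < n \<and> valid s' (Suc j) u x ?i" if f1: "words s' ''fv'' ?i = 1"
  proof -
    obtain u' v io where e: "u' < n" "v < n" "io < C" "?i = nwx j u' v io" using fvi f1 by auto
    have "nwx j u x t = nwx j u' v io" using e(4) by (simp add: nwx_eidx)
    then have eq: "u' = u" "v = x" "io = t" using nwx_less_Suc[of t x u io v u' j] a e sz by auto
    have xn: "x < n" using e eq by simp
    have "nwx j u x t < nwx j n 0 0"
    proof -
      have "nwx j u x t < (Suc j * S + u + 1) * (S * C)" unfolding nwx_def add.assoc
        by (rule mr_less[OF mr_less[OF a(3,2)]]) simp
      also have "\<dots> \<le> (Suc j * S + n) * (S * C)" using a by (intro mult_right_mono) auto
      finally show ?thesis by (simp add: nwx_def)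
    qed
    then have en: "entok s s' j u x t" using L a xn unfolding Linv_def by blast
    then obtain i where i: "eres s j u x t = Some i" using f1 by (auto simp: entok_def nwx_eidx split: option.splits)
    note en' = en[unfolded entok_def i option.case nwx_eidx]
    have sc: "scan (gq s j u x) (okA s x (Ach s j u x t k)) (vali s x) (nb * C) = Some i" using i by (simp add: eres_def sres_def)
    from scan_Some[OF sc] obtain q where q: "q < nb * C" "i = gq s j u x q" "okA s x (Ach s j u x t k) i" by blast
    have g: "wwi i < S" "wwi i < n" "valid s j u (wwi i) i" using gq_props[OF oc so a(1) xn q(1)] q unfolding okA_def by auto
    have ed: "{wwi i, x} \<in> E" using q(3) awD[OF gr g(1) a(2)] unfolding okA_def by (auto split: if_splits)
    have jk: "1 \<le> j" "j \<le> k" using j by auto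
    have xp: "x \<notin> set (pl s j i)"
    proof -
      have "x \<in> Ach s j u x t k"
        unfolding Ach_def using chx_mono[of "{x}" "pk s j u x" "posi s" "\<lambda>ta. t div (k + 1) ^ ta mod (k + 1)" k] by simp
      moreover have "set (pl s j i) \<inter> Ach s j u x t k = {}" using q(3) valid_hit[OF g(3) jk] by (simp add: okA_def)
      ultimately show ?thesis by blast
    qed
    have pl': "pl s' (Suc j) ?i = pl s j i @ [x]" using en' j by (simp add: pl_def)
    have ip: "isp n E j u (wwi i) (pl s j i)" using g(3) by (simp add: valid_def)
    then have ne: "pl s j i \<noteq> []" "last (pl s j i) = wwi i" by (auto simp: isp_def)
    have "isp n E (Suc j) u x (pl s' (Suc j) ?i)"
      unfolding pl' isp_snoc[OF ne(1)] using ip ne xp xn ed by simp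
    moreover have "reals s' ''fw'' ?i = pwt w (pl s' (Suc j) ?i)"
    proof -
      have "vali s x i = pwt w (pl s j i) + w {wwi i, x}"
        using g(3) wtD[OF gr g(1) a(2) ed] by (simp add: vali_def valid_def)
      then show ?thesis unfolding pl' pwt_snoc[OF ne(1)] ne(2) using en' by simp
    qed
    moreover have "posi s' ?i p = u" if "Suc j \<le> p \<and> p < k" for p
      using en' g(3) that by (simp add: valid_def)
    moreover have "posi s' ?i k = n" using en' g(3) j by (simp add: valid_def)
    ultimately show ?thesis using xn by (simp add: valid_def)
  qed
  then show "words s' ''fv'' ?i \<le> 1 \<and> (words s' ''fv'' ?i = 1 \<longrightarrow> x < n \<and> valid s' (Suc j) u x ?i)"
    using fvi by auto
qed

text \<open>Two applications of the branching argument: within the block of the last but one vertex,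
  a champion avoids \<open>X\<close> and \<open>v\<close> and is as good as the represented path;
  then, among the champions of all blocks, the chain of the level reaches one at least as good that
  avoids the same vertices.\<close>

lemma level_repr:
  assumes gr: "gr s" and so: "sound s j" and re: "repr s j" and j: "1 \<le> j" "j < k" and oc: "occ s j" and L: "Linv s j s' (nwx j n 0 0)"
    and ch: "\<And>be io u v. be < nb \<Longrightarrow> io < C \<Longrightarrow> u < n \<Longrightarrow> v < n \<Longrightarrow> words s ''oc'' (oidx (j * S * C + (be * C + io)) u v) = cch s j be u v io k"
  shows "repr s' (Suc j)"
  unfolding repr_def
proof (intro allI impI)
  fix u v X xs assume uv: "u < n" "v < n" and X: "finite X" "card X \<le> k - Suc j" and xs: "isp n E (Suc j) u v xs" "set xs \<inter> X = {}"
  have jk: "1 \<le> j" "j \<le> k" using j by auto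
  have "xs \<noteq> []" using xs by (auto simp: isp_def)
  then obtain ys y where ys: "xs = ys @ [y]" by (metis rev_exhaust)
  have "length ys = j" using xs ys by (simp add: isp_def)
  then have yne: "ys \<noteq> []" using j by auto
  define x where "x = last ys"
  have yp: "isp n E j u x ys" "y = v" "v \<notin> set ys" "{x, v} \<in> E" using xs(1) unfolding ys isp_snoc[OF yne] x_def by auto
  have xn: "x < n" using edge_n[OF yp(4)] by simp
  \<comment> \<open>The budget \<open>k - Suc j\<close> plus the appended vertex \<open>v\<close> is
    exactly the budget \<open>k - j\<close> of the shorter path.\<close>
  let ?X = "insert v X"
  have X': "finite ?X" "card ?X \<le> k - j" using X card_insert_le_m1[of "k - j" X v] j by (auto simp: card_insert_if)
  have "set ys \<inter> ?X = {}" using xs(2) yp(3) ys by auto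
  then obtain t where t: "t < C" "words s ''fv'' (eidx j u x t) = 1" "set (pl s j (eidx j u x t)) \<inter> ?X = {}" "pwt w ys \<le> reals s ''fw'' (eidx j u x t)"
    using re uv(1) xn X' yp(1) unfolding repr_def by metis
  have xS: "x < S" "v < S" using xn uv sz by auto
  have va: "valid s j u x (eidx j u x t)" using soundD'[OF so uv(1) xS(1) t(1,2)] by blast
  \<comment> \<open>The block that contains \<open>x\<close>, and the number within it of entry
    \<open>t\<close> of the family at \<open>x\<close>.\<close>
  define be c where "be = x div d" and "c = x mod d * C + t"
  have be: "be < nb" using xn sz(2) unfolding be_def by (intro div_eq_0_iff') (simp add: mult.commute)
  have c: "c < N" unfolding c_def N using t(1) d0 by (intro mr_less) auto
  have cx: "be * d + c div C = x" "c mod C = t" using t(1) by (simp_all add: be_def c_def)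
  have fi: "fidx j be u c = eidx j u x t" by (simp add: fidx_eidx cx)
  have h: "\<not> hitf k (words s ''pth'') (fidx j be u c) ?X" using valid_hit[OF va jk] t(3) fi by simp
  have aw: "words s ''aw'' ((be * d + c div C) * S + v) = 1" using awD[OF gr xS] yp(4) unfolding cx by simp
  have ck: "card ?X \<le> k" using X'(2) by simp
  have fv: "words s ''fv'' (fidx j be u c) = 1" using t(2) fi by simp
  obtain io1 where io1: "io1 < C" "let c' = cch s j be u v io1 k in c' < N \<and> words s ''fv'' (fidx j be u c') = 1 \<and>
     words s ''aw'' ((be * d + c' div C) * S + v) = 1 \<and> \<not> hitf k (words s ''pth'') (fidx j be u c') ?X \<and>
     reals s ''fw'' (fidx j be u c) + reals s ''wt'' ((be * d + c div C) * S + v) \<le>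
     reals s ''fw'' (fidx j be u c') + reals s ''wt'' ((be * d + c' div C) * S + v)"
    using block_champ[OF gr so jk uv be c X'(1) ck fv aw h] by blast
  define q i1 where "q = be * C + io1" and "i1 = gq s j u v q"
  have q: "q < nb * C" unfolding q_def by (rule mr_less[OF io1(1) be])
  have i1: "i1 = fidx j be u (cch s j be u v io1 k)"
  proof -
    have "q div C = be" using io1(1) by (simp add: q_def)
    then show ?thesis unfolding i1_def gq_def using ch[OF be io1(1) uv] by (simp add: q_def)
  qed
  have w1: "wwi i1 = be * d + cch s j be u v io1 k div C" unfolding i1 by (rule wwi_fidx[OF be cch_less])
  have i1p: "words s ''fv'' i1 = 1" "words s ''aw'' (wwi i1 * S + v) = 1" "\<not> hitf k (words s ''pth'') i1 ?X"
    "reals s ''fw'' (eidx j u x t) + reals s ''wt'' (x * S + v) \<le> vali s v i1"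
    using io1(2) unfolding Let_def i1[symmetric] w1[symmetric] fi cx vali_def by auto
  let ?Cd = "gq s j u v ` {..<nb * C}" let ?ok = "\<lambda>i. 0 < words s ''fv'' i \<and> 0 < words s ''aw'' (wwi i * S + v)"
  have av: "(\<forall>p<k. posi s i p \<notin> A) \<longleftrightarrow> \<not> hitf k (words s ''pth'') i A" for i A by (simp add: posi_def hitf_def)
  have cand: "valid s j u (wwi i) i" if "i \<in> ?Cd" "?ok i" for i
    using gq_props[OF oc so uv] that by auto
  have pkp: "pk s j u v A \<in> ?Cd \<and> ?ok (pk s j u v A) \<and> \<not> hitf k (words s ''pth'') (pk s j u v A) A \<and> vali s v i \<le> vali s v (pk s j u v A) \<and> sres s j u v A = Some (pk s j u v A)"
    if i: "i \<in> ?Cd" "?ok i" "\<not> hitf k (words s ''pth'') i A" for i A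
  proof -
    obtain q' where q': "q' < nb * C" "i = gq s j u v q'" using i by auto
    have okq: "okA s v A (gq s j u v q')" using i q' by (simp add: okA_def)
    then obtain i' where i': "sres s j u v A = Some i'" using q' unfolding sres_def by (metis scan_None option.exhaust)
    from scan_Some[OF this[unfolded sres_def]] have "(\<exists>p<nb * C. i' = gq s j u v p) \<and> okA s v A i' \<and> vali s v (gq s j u v q') \<le> vali s v i'"
      using okq q' by blast
    then show ?thesis using i' q' by (auto simp: pk_def okA_def)
  qed
  have "\<exists>ii. (\<forall>t. ii t \<le> k) \<and> (let c' = pk s j u v (chx (pk s j u v) (posi s) ii {v} k) in
     c' \<in> ?Cd \<and> ?ok c' \<and> (\<forall>p<k. posi s c' p \<notin> X \<union> {v}) \<and> (\<forall>p<k. posi s c' p \<notin> chx (pk s j u v) (posi s) ii {v} k) \<and> vali s v i1 \<le> vali s v c')"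
  \<comment> \<open>Second application: the candidates are the champions of all blocks, and the
    initial forbidden set is \<open>{v}\<close>.\<close>
  proof (rule chain_complete[where J = n])
    show "pk s j u v A \<in> ?Cd \<and> ?ok (pk s j u v A) \<and> (\<forall>p<k. posi s (pk s j u v A) p \<notin> A) \<and> vali s v c \<le> vali s v (pk s j u v A)"
      if "c \<in> ?Cd" "?ok c" "\<forall>p<k. posi s c p \<notin> A" for A c
      using pkp[OF that(1,2)] that(3) av by blast
    show "pk s j u v (insert n A) = pk s j u v A" for A
    proof -
      have "sres s j u v (insert n A) = sres s j u v A" unfolding sres_def
      proof (rule scan_cong)
        fix p assume p: "p < nb * C"
        show "okA s v (insert n A) (gq s j u v p) = okA s v A (gq s j u v p)"
        proof (cases "?ok (gq s j u v p)")
          case True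
          then have "\<forall>p'<k. posi s (gq s j u v p) p' < n" using valid_pos[OF cand jk uv(1)] p by blast
          then have "hitf k (words s ''pth'') (gq s j u v p) (insert n A) = hitf k (words s ''pth'') (gq s j u v p) A"
            unfolding hitf_def posi_def by auto
          then show ?thesis by (simp add: okA_def)
        qed (auto simp: okA_def)
      qed
      then show ?thesis by (simp add: pk_def)
    qed
    show "posi s c k = n \<and> (\<forall>p<k. posi s c p \<noteq> n)" if "c \<in> ?Cd" "?ok c" for c
      using valid_pos[OF cand[OF that] jk uv(1)] by auto
    show "i1 \<in> ?Cd" using q by (auto simp: i1_def)
    show "\<forall>p<k. posi s i1 p \<notin> X \<union> {v}" using iffD2[OF av i1p(3)] by simp
  qed (use X i1p in auto)
  then obtain ii where ii: "\<forall>t. ii t \<le> k" and Hh: "let c' = pk s j u v (chx (pk s j u v) (posi s) ii {v} k) in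
     c' \<in> ?Cd \<and> ?ok c' \<and> (\<forall>p<k. posi s c' p \<notin> X \<union> {v}) \<and> (\<forall>p<k. posi s c' p \<notin> chx (pk s j u v) (posi s) ii {v} k) \<and> vali s v i1 \<le> vali s v c'"
    by blast
  obtain io where io: "io < C" "\<forall>t<k. io div (k + 1) ^ t mod (k + 1) = ii t" by (rule digits_io[OF ii])
  have A: "chx (pk s j u v) (posi s) ii {v} k = Ach s j u v io k"
    unfolding Ach_def by (rule chx_cong) (use io(2) in metis)
  define i2 where "i2 = pk s j u v (Ach s j u v io k)"
  have H2: "i2 \<in> ?Cd" "?ok i2" "\<not> hitf k (words s ''pth'') i2 ?X" "\<not> hitf k (words s ''pth'') i2 (Ach s j u v io k)" "vali s v i1 \<le> vali s v i2"
    using Hh unfolding Let_def A i2_def[symmetric] av by simp_all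
  have er: "eres s j u v io = Some i2" using pkp[OF H2(1,2,4)] unfolding eres_def i2_def by blast
  have v2: "valid s j u (wwi i2) i2" by (rule cand[OF H2(1,2)])
  have "nwx j u v io < nwx j n 0 0"
  proof -
    have "nwx j u v io < (Suc j * S + u + 1) * (S * C)" unfolding nwx_def add.assoc
      by (rule mr_less[OF mr_less[OF io(1) xS(2)]]) simp
    also have "\<dots> \<le> (Suc j * S + n) * (S * C)" using uv by (intro mult_right_mono) auto
    finally show ?thesis by (simp add: nwx_def)
  qed
  then have "entok s s' j u v io" using L uv io(1) unfolding Linv_def by blast
  note en = this[unfolded entok_def er option.case nwx_eidx]
  have pl': "pl s' (Suc j) (eidx (Suc j) u v io) = pl s j i2 @ [v]" using en j by (simp add: pl_def)
  have "set (pl s j i2) \<inter> ?X = {}" using valid_hit[OF v2 jk] H2(3) by blast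
  moreover have "v \<notin> X" using xs(2) ys yp(2) by auto
  ultimately have "set (pl s' (Suc j) (eidx (Suc j) u v io)) \<inter> X = {}" unfolding pl' by auto
  moreover have "pwt w xs \<le> reals s' ''fw'' (eidx (Suc j) u v io)"
  proof -
    have "pwt w xs = pwt w ys + w {x, v}" unfolding ys pwt_snoc[OF yne] yp(2) x_def ..
    also have "\<dots> \<le> reals s ''fw'' (eidx j u x t) + reals s ''wt'' (x * S + v)"
      using t(4) wtD[OF gr xS yp(4)] by simp
    also have "\<dots> \<le> vali s v i2" using i1p(4) H2(5) by linarith
    finally show ?thesis using en by simp
  qed
  ultimately show "\<exists>t<C. words s' ''fv'' (eidx (Suc j) u v t) = 1 \<and> set (pl s' (Suc j) (eidx (Suc j) u v t)) \<inter> X = {} \<and> pwt w xs \<le> reals s' ''fw'' (eidx (Suc j) u v t)"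
    using io(1) en by blast
qed

lemma data_cong:
  assumes "words s2 ''fv'' = words s1 ''fv''" "words s2 ''pth'' = words s1 ''pth''" "words s2 ''aw'' = words s1 ''aw''"
    "reals s2 ''fw'' = reals s1 ''fw''" "reals s2 ''wt'' = reals s1 ''wt''"
  shows "gr s2 = gr s1" "sound s2 = sound s1" "repr s2 = repr s1" "cch s2 = cch s1"
proof -
  have p: "posi s2 = posi s1" "cpos s2 = cpos s1" using assms by (simp_all add: posi_def cpos_def fun_eq_iff)
  have cp: "cpick s2 = cpick s1" unfolding cpick_def assms by (rule refl)
  have pls: "pl s2 = pl s1" unfolding pl_def p by (rule refl)
  show "gr s2 = gr s1" unfolding gr_def assms by (rule refl)
  have v: "valid s2 = valid s1" unfolding valid_def pls p assms by (rule refl)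
  show "sound s2 = sound s1" unfolding sound_def fun_eq_iff v assms by simp
  show "repr s2 = repr s1" unfolding repr_def fun_eq_iff pls assms by simp
  show "cch s2 = cch s1" unfolding cch_def cp p by (rule refl)
qed

definition TST :: nat where "TST = nb * (TB + 30) + TL + 100"

lemma H_STAGE:
  assumes ps: "par2 s" and j: "words s ''j'' 0 = j" "1 \<le> j" "j < k" and gr: "gr s" and so: "sound s j" and re: "repr s j"
    and z: "\<forall>i\<ge>lvl (Suc j). words s ''fv'' i = 0"
  shows "H TST (STAGE k) s (\<lambda>s'. gr s' \<and> sound s' (Suc j) \<and> repr s' (Suc j) \<and> (\<forall>i\<ge>lvl (Suc (Suc j)). words s' ''fv'' i = 0))"
proof -
  have jk: "j \<le> k" using j by simp
  let ?q = "\<lambda>be io. (j * S + be) * C + io"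
  have nbV: "nb \<le> V"
  proof -
    have "nb \<le> nb * C" using C0 by simp
    then show ?thesis using Vb(4) by (rule le_trans)
  qed
  show ?thesis unfolding STAGE_def
  proof (rule H_Seq[where t = "nb * (TB + 30) + 50" and u = TL and
      R = "\<lambda>s'. \<forall>be<nb. \<forall>io<C. \<forall>u<n. \<forall>v<n. words s' ''oc'' (oidx (?q be io) u v) = cch s j be u v io k"], goal_cases)
    case 1
    show ?case
    proof (rule H_For_const[where N = nb and t = "TB" and
        I = "\<lambda>B s'. \<forall>be<B. \<forall>io<C. \<forall>u<n. \<forall>v<n. words s' ''oc'' (oidx (?q be io) u v) = cch s j be u v io k"], goal_cases)
      case (6 be s1)
      note a1 = agrw[OF 6(5), simplified] agrr[OF 6(5), simplified]
      have p1: "par2 s1" by (rule par2_agr[OF ps 6(5)]) (simp add: parnames_def parnames2_def)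
      have j1: "words s1 ''j'' 0 = j" using a1 j by simp
      have cc: "cch s1 = cch s" by (rule data_cong(4)) (simp_all add: a1)
      show ?case
      proof (rule H_conseq[OF H_BLOCK[OF p1 6(3,1) j1 jk]], goal_cases)
        case 1 show ?case by simp
      next
        case (2 s2)
        have "words s2 ''oc'' (oidx (?q be' io) u v) = cch s j be' u v io k" if a: "be' < Suc be" "io < C" "u < n" "v < n" for be' io u v
        proof (cases "be' = be")
          case True then show ?thesis using 2(1) a cc by simp
        next
          case False
          then have "be' < be" using a by simp
          \<comment> \<open>The results of earlier blocks lie below those of block
            \<open>be\<close>, in the range that \<open>H_BLOCK\<close> leaves unchanged.\<close>
          then have "?q be' io < ?q be 0"
            using mr_less[of io C "j * S + be'" "j * S + be"] a by simp
          then have "oidx (?q be' io) u v < oidx (?q be 0) 0 0" using a sz by (intro oidx_less) auto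
          then have "words s2 ''oc'' (oidx (?q be' io) u v) = words s1 ''oc'' (oidx (?q be' io) u v)" using 2(1) by simp
          then show ?thesis using 6(2) \<open>be' < be\<close> a by simp
        qed
        then show ?case by simp
      qed
    qed (use ps nbV in \<open>simp_all add: par2D algebra_simps\<close>)
  next
    case (2 s1)
    note a1 = agrw[OF 2(3), simplified] agrr[OF 2(3), simplified]
    have p1: "par2 s1" by (rule par2_agr[OF ps 2(3)]) (simp add: parnames_def parnames2_def)
    have j1: "words s1 ''j'' 0 = j" using a1 j by simp
    have cg: "gr s1" "sound s1 j" "repr s1 j" "cch s1 = cch s"
      using data_cong[of s1 s] gr so re by (simp_all add: a1)
    have ch: "words s1 ''oc'' (oidx (j * S * C + (be * C + io)) u v) = cch s1 j be u v io k" if "be < nb" "io < C" "u < n" "v < n" for be io u v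
    proof -
      have eq: "j * S * C + (be * C + io) = ?q be io" by (simp add: algebra_simps)
      show ?thesis unfolding cg(4) eq using 2(1) that by blast
    qed
    have oc: "occ s1 j" unfolding occ_def
    proof (intro allI impI)
      fix q u v assume a: "q < nb * C" "u < n" "v < n"
      have "q = q div C * C + q mod C" "q div C < nb" "q mod C < C" using a C0 by (simp_all add: less_mult_imp_div_less)
      then show "words s1 ''oc'' (oidx (j * S * C + q) u v) < N" using ch[of "q div C" "q mod C" u v] a cch_less by metis
    qed
    have z1: "\<And>i. lvl (Suc j) \<le> i \<Longrightarrow> words s1 ''fv'' i = 0" using z a1 by simp
    show ?case
    proof (rule H_conseq[OF H_LEVEL[OF p1 j1 j(3) oc z1]], goal_cases)
      case 1 then show ?case by simp
    next
      case 2 show ?case by simp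
    next
      case (3 s2)
      have "sound s2 (Suc j)" by (rule level_sound[OF cg(1,2) j(2,3) oc 3(1) z1])
      moreover have "repr s2 (Suc j)" by (rule level_repr[OF cg(1,2,3) j(2,3) oc 3(1) ch])
      moreover have "gr s2" using cg(1) agrw[OF 3(3), simplified] agrr[OF 3(3), simplified] unfolding gr_def by simp
      moreover have "nwx j n 0 0 \<le> lvl (Suc (Suc j))" unfolding nwx_def lvl_def using sz by (simp add: mult_le_mono1)
      ultimately show ?case using 3(1) unfolding Linv_def by simp
    qed
  next
    case 3 show ?case by (simp add: TST_def)
  qed
qed

lemma H_STAGES:
  assumes ps: "par2 s" and gr: "gr s" and so: "sound s 1" and re: "repr s 1" and z: "\<forall>i\<ge>lvl 2. words s ''fv'' i = 0"
  shows "H (k * (TST + 50) + 100) (STAGES k) s (\<lambda>s'. gr s' \<and> sound s' k \<and> repr s' k)"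
  unfolding STAGES_def
proof (rule H_For_const[where N = "k - 1" and t = "TST + 20" and
    I = "\<lambda>j s'. gr s' \<and> sound s' (Suc j) \<and> repr s' (Suc j) \<and> (\<forall>i\<ge>lvl (Suc (Suc j)). words s' ''fv'' i = 0)"], goal_cases)
  case (6 j s1)
  note a1 = agrw[OF 6(5), simplified] agrr[OF 6(5), simplified]
  have p1: "par2 s1" by (rule par2_agr[OF ps 6(5)]) (simp add: parnames_def parnames2_def)
  have jV: "Suc j \<le> V" using 6(1) Vb by simp
  show ?case
  proof (rule H_slS[where u = TST], simp, goal_cases)
    case 1 show ?case using 6(3) jV by simp
  next
    case (2 s2)
    note a2 = agrw[OF 2(3), simplified] agrr[OF 2(3), simplified]
    have p2: "par2 s2" by (rule par2_agr[OF p1 2(3)]) (simp add: parnames_def parnames2_def)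
    have j2: "words s2 ''j'' 0 = Suc j" using 6(3) by (simp add: 2(1))
    have cg: "gr s2" "sound s2 (Suc j)" "repr s2 (Suc j)"
      using data_cong[of s2 s1] 6(2) by (simp_all add: a2)
    show ?case
    proof (rule H_conseq[OF H_STAGE[OF p2 j2 _ _ cg]], goal_cases)
      case 1 show ?case by simp
    next
      case 2 show ?case using 6(1) by simp
    next
      case 3 show ?case using 6(2) a2 by simp
    next
      case 4 show ?case by simp
    next
      case (5 s3)
      have "gr (wstore ''jj'' 0 (Suc j) s3) = gr s3" "sound (wstore ''jj'' 0 (Suc j) s3) = sound s3" "repr (wstore ''jj'' 0 (Suc j) s3) = repr s3"
        by (rule data_cong; simp)+
      then show ?case using 5(1) by simp
    qed
  next
    case 3 show ?case by simp
  qed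
next
  case 5
  have "gr (wstore ''jj'' 0 0 s) = gr s" "sound (wstore ''jj'' 0 0 s) = sound s" "repr (wstore ''jj'' 0 0 s) = repr s"
    by (rule data_cong; simp)+
  then show ?case using gr so re z by (simp add: numeral_2_eq_2)
next
  case (7 s1) then show ?case using k1 by simp
next
  case 8
  have "(k - 1) * (TST + 31) \<le> k * (TST + 50)" by (intro mult_mono) auto
  then show ?case by (simp add: add.commute)
qed (use Vb in \<open>simp_all\<close>)

end

section \<open>Cycles and the program\<close>

text \<open>If two different positions gave the same edge, each would be the cyclic successor of the
  other, which is impossible with three or more vertices. So the sum over the edge set is a sum over
  positions.\<close>

lemma cycle_edge_inj:
  assumes "distinct xs" "3 \<le> length xs"
  shows "inj_on (\<lambda>i. {xs ! i, xs ! (Suc i mod length xs)}) {..<length xs}"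
proof (rule inj_onI)
  let ?k = "length xs"
  fix i j assume ij: "i \<in> {..<?k}" "j \<in> {..<?k}" and e: "{xs ! i, xs ! (Suc i mod ?k)} = {xs ! j, xs ! (Suc j mod ?k)}"
  have lt: "Suc i mod ?k < ?k" "Suc j mod ?k < ?k" using assms(2) by (metis mod_less_divisor less_le_trans zero_less_numeral)+
  have eq: "xs ! a = xs ! c \<longleftrightarrow> a = c" if "a < ?k" "c < ?k" for a c
    using assms(1) that by (simp add: nth_eq_iff_index_eq)
  show "i = j"
  proof (rule ccontr)
    assume ne: "i \<noteq> j"
    then have "xs ! i \<noteq> xs ! j" using eq[of i j] ij by simp
    then have "xs ! i = xs ! (Suc j mod ?k)" "xs ! j = xs ! (Suc i mod ?k)"
      using e unfolding doubleton_eq_iff by metis+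
    then have "i = Suc j mod ?k" "j = Suc i mod ?k"
      using eq[of i "Suc j mod ?k"] eq[of j "Suc i mod ?k"] ij lt by simp_all
    moreover have "Suc a mod ?k = (if Suc a = ?k then 0 else Suc a)" if "a < ?k" for a using that by auto
    ultimately show False using ij assms(2) by (auto split: if_splits)
  qed
qed

lemma cycle_weight_sum:
  assumes "distinct xs" "3 \<le> length xs"
  shows "cycle_weight w xs = pwt w xs + w {last xs, hd xs}"
proof -
  let ?k = "length xs" let ?f = "\<lambda>i. {xs ! i, xs ! (Suc i mod ?k)}"
  have "cycle_edges xs = ?f ` {..<?k}" by (auto simp: cycle_edges_def)
  then have "cycle_weight w xs = (\<Sum>i<?k. w (?f i))"
    unfolding cycle_weight_def by (simp add: sum.reindex[OF cycle_edge_inj[OF assms]])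
  also obtain l where l: "?k = Suc l" using assms(2) by (cases xs) auto
  have "(\<Sum>i<?k. w (?f i)) = (\<Sum>i<l. w (?f i)) + w (?f l)" by (simp only: l sum.lessThan_Suc)
  also have "(\<Sum>i<l. w (?f i)) = pwt w xs" unfolding pwt_def by (rule sum.cong) (simp_all add: l)
  also have "?f l = {last xs, hd xs}"
  proof -
    have "xs \<noteq> []" using l by auto
    then show ?thesis using l by (simp add: last_conv_nth hd_conv_nth)
  qed
  finally show ?thesis .
qed

text \<open>Cutting a cycle at the edge from its last to its first listed vertex leaves a simple
  path; this reduces cycles to the families with \<open>k\<close> vertices.\<close>

lemma is_cycle_iff:
  assumes "simple_graph n E" "3 \<le> k"
  shows "is_cycle E xs \<and> length xs = k \<longleftrightarrow> (\<exists>u v. isp n E k u v xs \<and> {v, u} \<in> E)"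
proof
  assume c: "is_cycle E xs \<and> length xs = k"
  then have ne: "xs \<noteq> []" using assms by auto
  have f: "{xs ! i, xs ! (Suc i mod k)} \<in> E" if "i < k" for i
  proof -
    have "{xs ! i, xs ! (Suc i mod k)} \<in> cycle_edges xs" unfolding cycle_edges_def using c that by blast
    then show ?thesis using c unfolding is_cycle_def by blast
  qed
  have "set xs \<subseteq> {..<n}"
  proof
    fix x assume "x \<in> set xs"
    then obtain i where i: "i < k" "x = xs ! i" using c by (auto simp: in_set_conv_nth)
    then have "{xs ! i, xs ! (Suc i mod k)} \<subseteq> {..<n}" using bspec[OF assms(1)[unfolded simple_graph_def] f[OF i(1)]] by blast
    then show "x \<in> {..<n}" using i by simp
  qed
  moreover have "{xs ! i, xs ! Suc i} \<in> E" if "Suc i < k" for i using f[of i] that by simp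
  moreover have "{last xs, hd xs} \<in> E"
    using f[of "k - 1"] c ne assms by (simp add: last_conv_nth hd_conv_nth)
  ultimately show "\<exists>u v. isp n E k u v xs \<and> {v, u} \<in> E"
    using c ne unfolding isp_def is_cycle_def by blast
next
  assume "\<exists>u v. isp n E k u v xs \<and> {v, u} \<in> E"
  then obtain u v where i: "isp n E k u v xs" "{v, u} \<in> E" by blast
  then have l: "length xs = k" "distinct xs" "xs \<noteq> []" "{last xs, hd xs} \<in> E" by (auto simp: isp_def)
  have "{xs ! i, xs ! (Suc i mod k)} \<in> E" if "i < k" for i
  proof (cases "Suc i = k")
    case True
    then have "Suc i mod k = 0" "i = length xs - 1" using l by auto
    then have "{xs ! i, xs ! (Suc i mod k)} = {last xs, hd xs}" using l(3) by (simp add: last_conv_nth hd_conv_nth)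
    then show ?thesis using l by simp
  next
    case False
    then show ?thesis using i(1) that unfolding isp_def by simp
  qed
  then show "is_cycle E xs \<and> length xs = k" using l assms by (auto simp: is_cycle_def cycle_edges_def)
qed

section \<open>Initial families, closing the cycle, and output\<close>

definition INIT :: "nat \<Rightarrow> com" where
  "INIT k = For ''u'' (sv ''n'') (
     (''nw'' :== (sv ''S'' [+] sv ''u'') [*] (sv ''S'' [*] Const ((k + 1) ^ k)) [+] sv ''u'' [*] Const ((k + 1) ^ k) ;; WStore ''fv'' (sv ''nw'') (Const 1)) ;;
     For ''p'' (Const k) (WStore ''pth'' (sv ''nw'' [*] Const (k + 1) [+] sv ''p'') (sv ''u'')) ;;
     WStore ''pth'' (sv ''nw'' [*] Const (k + 1) [+] Const k) (sv ''n''))"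

lemma modw_INIT [simp]: "modw (INIT k) = {''u'', ''nw'', ''fv'', ''p'', ''pth''}"
  and modr_INIT [simp]: "modr (INIT k) = {}"
  by (auto simp: INIT_def)

definition BESTT :: bexp where
  "BESTT = Conj (Const 0 [<] WLoad ''fv'' (sv ''fi'')) (Conj (Const 0 [<] WLoad ''aw'' (sv ''v'' [*] sv ''S'' [+] sv ''u''))
     (bor (sv ''found'' [<] Const 1) (RLess (rsv ''bw'') (RAdd (RLoad ''fw'' (sv ''fi'')) (RLoad ''wt'' (sv ''v'' [*] sv ''S'' [+] sv ''u''))))))"

definition BEST :: "nat \<Rightarrow> com" where
  "BEST k = For ''u'' (sv ''n'') (For ''v'' (sv ''n'') (For ''io'' (Const ((k + 1) ^ k)) (
     ''fi'' :== (Const k [*] sv ''S'' [+] sv ''u'') [*] (sv ''S'' [*] Const ((k + 1) ^ k)) [+] sv ''v'' [*] Const ((k + 1) ^ k) [+] sv ''io'' ;;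
     Cond BESTT (''found'' :== Const 1 ;; ''bi'' :== sv ''fi'' ;; RStore ''bw'' (Const 0) (RAdd (RLoad ''fw'' (sv ''fi'')) (RLoad ''wt'' (sv ''v'' [*] sv ''S'' [+] sv ''u''))))
       Skip)))"

lemma modw_BEST [simp]: "modw (BEST k) = {''u'', ''v'', ''io'', ''fi'', ''found'', ''bi''}"
  and modr_BEST [simp]: "modr (BEST k) = {''bw''}"
  by (auto simp: BEST_def)

definition OUTPUT :: "nat \<Rightarrow> com" where
  "OUTPUT k = For ''p'' (Const k) (WStore ''cycle'' (sv ''p'') (WLoad ''pth'' (sv ''bi'' [*] Const (k + 1) [+] sv ''p'')))"

lemma modw_OUTPUT [simp]: "modw (OUTPUT k) = {''p'', ''cycle''}"
  and modr_OUTPUT [simp]: "modr (OUTPUT k) = {}"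
  by (auto simp: OUTPUT_def)

context galgo
begin

lemma eidx_eq: "t < C \<Longrightarrow> x < S \<Longrightarrow> u < S \<Longrightarrow> t' < C \<Longrightarrow> x' < S \<Longrightarrow> u' < S \<Longrightarrow> eidx j u x t = eidx j u' x' t' \<longleftrightarrow> u = u' \<and> x = x' \<and> t = t'"
  unfolding eidx_def add.assoc by (auto simp: mr_eq mr_less)

lemma eidx_V: "u < n \<Longrightarrow> x < n \<Longrightarrow> t < C \<Longrightarrow> j \<le> k \<Longrightarrow> 1 \<le> j \<Longrightarrow> eidx j u x t \<le> V"
  using nwx_V[of u x t "j - 1"] by (simp add: nwx_eidx)

text \<open>The only paths with one vertex run from \<open>u\<close> to \<open>u\<close>, and one
  entry represents them. Their weight 0 is what the real cells contain initially.\<close>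

lemma H_INIT:
  assumes ps: "par2 s" and fv0: "\<And>i. words s ''fv'' i = 0" and fw0: "\<And>i. reals s ''fw'' i = 0" and kn: "n \<le> V"
  shows "H (n * (200 * k + 400) + 100) (INIT k) s (\<lambda>s'. sound s' 1 \<and> repr s' 1 \<and> (\<forall>i\<ge>lvl 2. words s' ''fv'' i = 0))"
proof -
  define ok where "ok s' u \<longleftrightarrow> (\<forall>p<k. posi s' (eidx 1 u u 0) p = u) \<and> posi s' (eidx 1 u u 0) k = n" for s' :: state and u
  have cell: "a * (k + 1) + p = y * (k + 1) + p' \<longleftrightarrow> a = y \<and> p = p'" if "p \<le> k" "p' \<le> k" for a y p p'
    by (rule mr_eq) (use that in auto)
  show ?thesis unfolding INIT_def
  proof (rule H_For_const[where N = n and t = "200 * k + 350" and I = "\<lambda>u s'. words s' ''fv'' = (\<lambda>i. if \<exists>u'<u. i = eidx 1 u' u' 0 then 1 else 0) \<and> (\<forall>u'<u. ok s' u')"], goal_cases)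
    case (6 u s1)
    note a1 = agrw[OF 6(5), simplified] agrr[OF 6(5), simplified] and u = 6(1,3) and I1 = 6(2)
    have p1: "par2 s1" by (rule par2_agr[OF ps 6(5)]) (simp add: parnames_def parnames2_def)
    let ?nw = "eidx 1 u u 0"
    have nw: "wn s1 ((sv ''S'' [+] sv ''u'') [*] (sv ''S'' [*] Const ((k + 1) ^ k)) [+] sv ''u'' [*] Const ((k + 1) ^ k)) = ?nw"
      unfolding eidx_def using u par2D[OF p1] by (simp add: C)
    have nV: "?nw \<le> V" using eidx_V[OF u(1) u(1) C0 k1] by simp
    show ?case
    proof (rule H_slS[where u = "200 * k + 200"], simp, goal_cases)
      case 1 show ?case using nw nV V2 by (simp del: wn.simps add: wn.simps(1,2))
    next
      case (2 s2)
      note a2 = agrw[OF 2(3), simplified] agrr[OF 2(3), simplified]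
      have p2: "par2 s2" by (rule par2_agr[OF p1 2(3)]) (simp add: parnames_def parnames2_def)
      have w2: "words s2 ''nw'' 0 = ?nw" "words s2 ''u'' 0 = u" "words s2 ''pth'' = words s1 ''pth''" "words s2 ''fv'' = (words s1 ''fv'')(?nw := 1)"
        using nw u by (simp_all add: 2(1) del: wn.simps add: wn.simps(1,2))
      show ?case
      proof (rule H_Seq[where t = "100 * k + 50" and u = 100 and R = "\<lambda>s'. (\<forall>p<k. posi s' ?nw p = u) \<and> (\<forall>i p. i \<noteq> ?nw \<longrightarrow> p \<le> k \<longrightarrow> posi s' i p = posi s1 i p)"], goal_cases)
        case 1
        show ?case
        proof (rule H_For_const[where N = k and t = 60 and I = "\<lambda>p s'. (\<forall>p'<p. posi s' ?nw p' = u) \<and> (\<forall>i p. i \<noteq> ?nw \<longrightarrow> p \<le> k \<longrightarrow> posi s' i p = posi s1 i p)"], goal_cases)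
          case (6 p s3)
          note a3 = agrw[OF 6(5), simplified]
          have w3: "words s3 ''nw'' 0 = ?nw" "words s3 ''u'' 0 = u" using a3 w2 by simp_all
          show ?case
          proof (rule H_sl, simp, goal_cases)
            case 1 show ?case using bndD[OF 1] by simp
          next
            case 2
            have "posi (wstore ''p'' 0 (Suc p) (sem (WStore ''pth'' (sv ''nw'' [*] Const (k + 1) [+] sv ''p'') (sv ''u'')) s3)) i p' =
               (if i = ?nw \<and> p' = p then u else posi s3 i p')" if "p' \<le> k" for i p'
              using cell[of p' p i ?nw] that 6(1,3) w3 by (simp add: posi_def)
            then show ?case using 6(1,2) by (simp add: less_Suc_eq)
          next
            case 3 show ?case by simp
          qed
        qed (use Vb w2 in \<open>simp_all add: posi_def\<close>)
      next
        case (2 s3)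
        note a3 = agrw[OF 2(3), simplified]
        have w3: "words s3 ''nw'' 0 = ?nw" "words s3 ''n'' 0 = n" "words s3 ''fv'' = (words s1 ''fv'')(?nw := 1)" using a3 w2 par2D[OF p2] by simp_all
        let ?s = "wstore ''u'' 0 (Suc u) (sem (WStore ''pth'' (sv ''nw'' [*] Const (k + 1) [+] Const k) (sv ''n'')) s3)"
        have pos: "posi ?s i p' = (if i = ?nw \<and> p' = k then n else posi s3 i p')" if "p' \<le> k" for i p'
          using cell[of p' k i ?nw] that w3 by (simp add: posi_def)
        have oks: "ok ?s u'" if "u' < Suc u" for u'
        proof (cases "u' = u")
          case True
          then show ?thesis using pos[of _ ?nw] 2(1) by (simp add: ok_def)
        next
          case False
          then have "eidx 1 u' u' 0 \<noteq> ?nw" using eidx_eq[of 0 u' u' 0 u u 1] that u sz C0 by auto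
          moreover have "ok s1 u'" using I1 that False by simp
          ultimately show ?thesis using pos 2(1) by (simp add: ok_def)
        qed
        have fv: "words ?s ''fv'' = (\<lambda>i. if \<exists>u'<Suc u. i = eidx 1 u' u' 0 then 1 else 0)"
          using I1 w3 by (intro ext) (auto simp: less_Suc_eq)
        show ?case
        proof (rule H_sl, simp, goal_cases)
          case 1 show ?case using bndD[OF 1] by simp
        next
          case 2 show ?case using oks fv by blast
        next
          case 3 show ?case by simp
        qed
      next
        case 3 show ?case by simp
      qed
    next
      case 3 show ?case by simp
    qed
  next
    case (7 s1)
    note a1 = agrw[OF 7(4), simplified] agrr[OF 7(4), simplified] and I1 = 7(1)
    have fw: "reals s1 ''fw'' i = 0" for i using a1 fw0 by simp
    have fv: "words s1 ''fv'' i = (if \<exists>u'<n. i = eidx 1 u' u' 0 then 1 else 0)" for i using I1 by simp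
    have pl1: "pl s1 1 (eidx 1 u u 0) = [u]" "valid s1 1 u u (eidx 1 u u 0)" if "u < n" for u
    proof -
      have o: "ok s1 u" using I1 that by blast
      show p: "pl s1 1 (eidx 1 u u 0) = [u]" using o k1 by (simp add: pl_def ok_def)
      show "valid s1 1 u u (eidx 1 u u 0)" unfolding valid_def p using o that fw by (simp add: isp_def pwt_def ok_def)
    qed
    have fv_le: "words s1 ''fv'' i \<le> 1" for i unfolding fv by (cases "\<exists>u'<n. i = eidx 1 u' u' 0") simp_all
    have "sound s1 1" unfolding sound_def
    proof (intro allI impI)
      fix u x t assume a: "u < n" "x < S" "t < C"
      have "x = u \<and> t = 0" if "words s1 ''fv'' (eidx 1 u x t) = 1"
      proof -
        have "\<exists>u'<n. eidx 1 u x t = eidx 1 u' u' 0"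
        proof (rule ccontr)
          assume "\<not> ?thesis"
          then have "words s1 ''fv'' (eidx 1 u x t) = 0" unfolding fv by (simp only: if_False)
          then show False using that by simp
        qed
        then obtain u' where "u' < n" "eidx 1 u x t = eidx 1 u' u' 0" by blast
        then show ?thesis using eidx_eq[of t x u 0 u' u' 1] a sz C0 by auto
      qed
      then show "words s1 ''fv'' (eidx 1 u x t) \<le> 1 \<and> (words s1 ''fv'' (eidx 1 u x t) = 1 \<longrightarrow> x < n \<and> valid s1 1 u x (eidx 1 u x t))"
        using pl1(2)[OF a(1)] a(1) fv_le[of "eidx 1 u x t"] by blast
    qed
    moreover have "repr s1 1" unfolding repr_def
    proof (intro allI impI)
      fix u x X xs assume a: "u < n" "x < n" "finite X" "card X \<le> k - 1" "isp n E 1 u x xs" "set xs \<inter> X = {}"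
      then obtain y where "xs = [y]" by (auto simp: isp_def length_Suc_conv)
      then have xs: "xs = [u]" "x = u" using a(5) by (auto simp: isp_def)
      show "\<exists>t<C. words s1 ''fv'' (eidx 1 u x t) = 1 \<and> set (pl s1 1 (eidx 1 u x t)) \<inter> X = {} \<and> pwt w xs \<le> reals s1 ''fw'' (eidx 1 u x t)"
        using pl1(1)[OF a(1)] a(1,6) C0 xs fv fw by (intro exI[of _ 0]) (auto simp: pwt_def)
    qed
    moreover have "words s1 ''fv'' i = 0" if "lvl 2 \<le> i" for i
    proof -
      have "eidx 1 u' u' 0 < lvl 2" if "u' < n" for u'
        using nwx_lt[of u' u' 0 0] that C0 by (simp add: nwx_eidx numeral_2_eq_2)
      then have "\<not> (\<exists>u'<n. i = eidx 1 u' u' 0)" using that by (metis not_less)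
      then show ?thesis unfolding fv by (simp only: if_False)
    qed
    ultimately show ?case by blast
  next
    case 8 show ?case by (simp add: algebra_simps)
  next
    case 5
    have "words s ''fv'' = (\<lambda>_. 0)" using fv0 by (simp add: fun_eq_iff)
    then show ?case by simp
  qed (use ps kn in \<open>simp_all add: par2D\<close>)
qed

definition good :: "state \<Rightarrow> nat \<Rightarrow> nat \<Rightarrow> nat \<Rightarrow> bool" where
  "good s u v t \<longleftrightarrow> u < n \<and> v < n \<and> t < C \<and> words s ''fv'' (eidx k u v t) = 1 \<and> {v, u} \<in> E"

definition gval :: "state \<Rightarrow> nat \<Rightarrow> nat \<Rightarrow> nat \<Rightarrow> real" where
  "gval s u v t = reals s ''fw'' (eidx k u v t) + w {v, u}"

definition binv :: "state \<Rightarrow> state \<Rightarrow> nat \<Rightarrow> bool" where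
  "binv s s' T \<longleftrightarrow> (\<forall>u v t. good s u v t \<longrightarrow> eidx k u v t < T \<longrightarrow> 0 < words s' ''found'' 0 \<and> gval s u v t \<le> reals s' ''bw'' 0) \<and>
     (0 < words s' ''found'' 0 \<longrightarrow> (\<exists>u v t. good s u v t \<and> words s' ''bi'' 0 = eidx k u v t \<and> reals s' ''bw'' 0 = gval s u v t))"

lemma binv_cong: "words s2 ''found'' 0 = words s1 ''found'' 0 \<Longrightarrow> words s2 ''bi'' 0 = words s1 ''bi'' 0 \<Longrightarrow> reals s2 ''bw'' 0 = reals s1 ''bw'' 0 \<Longrightarrow> binv s s2 T = binv s s1 T"
  by (simp add: binv_def)

lemma H_BEST:
  assumes ps: "par2 s" and gr: "gr s" and so: "sound s k" and f0: "words s ''found'' 0 = 0"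
  shows "H (n * (n * (C * 300 + 100) + 100) + 100) (BEST k) s (\<lambda>s'. binv s s' (eidx k n 0 0))"
  unfolding BEST_def
proof (rule H_For_const[where N = n and t = "n * (C * 300 + 100) + 80" and I = "\<lambda>u s'. binv s s' (eidx k u 0 0)"], goal_cases)
  case 5
  have "eidx k 0 0 0 \<le> eidx k u v t" for u v t unfolding eidx_def by (intro add_mono mult_right_mono) auto
  then show ?case using f0 by (auto simp: binv_def leD)
next
  case (6 u s1)
  note a1 = agrw[OF 6(5), simplified] agrr[OF 6(5), simplified] and u = 6(1,3) and I1 = 6(2)
  have p1: "par2 s1" by (rule par2_agr[OF ps 6(5)]) (simp add: parnames_def parnames2_def)
  show ?case
  proof (rule H_For_const[where N = n and t = "C * 300 + 80" and I = "\<lambda>v s'. binv s s' (eidx k u v 0)"], goal_cases)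
    case 5 show ?case using I1 by (subst binv_cong[of _ s1]) simp_all
  next
    case (6 v s2)
    note a2 = agrw[OF 6(5), simplified] agrr[OF 6(5), simplified] and v = 6(1,3) and I2 = 6(2)
    have p2: "par2 s2" by (rule par2_agr[OF p1 6(5)]) (simp add: parnames_def parnames2_def)
    show ?case
    proof (rule H_For_const[where N = C and t = "280" and I = "\<lambda>t s'. binv s s' (eidx k u v t)"], goal_cases)
      case 5 show ?case using I2 by (subst binv_cong[of _ s2]) simp_all
    next
      case (6 t s3)
      note a3 = agrw[OF 6(5), simplified] agrr[OF 6(5), simplified] and t = 6(1,3) and I3 = 6(2)
      have p3: "par2 s3" by (rule par2_agr[OF p2 6(5)]) (simp add: parnames_def parnames2_def)
      have w3: "words s3 ''u'' 0 = u" "words s3 ''v'' 0 = v" "words s3 ''io'' 0 = t" using a2 a3 u v t by simp_all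
      let ?i = "eidx k u v t"
      have fi: "wn s3 ((Const k [*] sv ''S'' [+] sv ''u'') [*] (sv ''S'' [*] Const ((k + 1) ^ k)) [+] sv ''v'' [*] Const ((k + 1) ^ k) [+] sv ''io'') = ?i"
        unfolding eidx_def using w3 par2D[OF p3] by (simp add: C)
      have iV: "?i \<le> V" using eidx_V[OF u(1) v(1) t(1) le_refl k1] .
      show ?case
      proof (rule H_slS[where u = 230], simp, goal_cases)
        case 1 show ?case using fi iV by (simp del: wn.simps add: wn.simps(1))
      next
        case (2 s4)
        note a4 = agrw[OF 2(3), simplified] agrr[OF 2(3), simplified]
        have w4: "words s4 ''fi'' 0 = ?i" "words s4 ''u'' 0 = u" "words s4 ''v'' 0 = v" "words s4 ''S'' 0 = S"
          "words s4 ''fv'' = words s ''fv''" "words s4 ''aw'' = words s ''aw''" "reals s4 ''fw'' = reals s ''fw''" "reals s4 ''wt'' = reals s ''wt''"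
          "words s4 ''found'' = words s3 ''found''" "words s4 ''bi'' = words s3 ''bi''" "reals s4 ''bw'' = reals s3 ''bw''"
        proof -
          show "words s4 ''fi'' 0 = ?i" using fi by (simp add: 2(1) del: wn.simps add: wn.simps(1))
        qed (use w3 a1 a2 a3 a4 par2D[OF p3] in simp_all)
        have S: "u < S" "v < S" using u v sz by auto
        have fv1: "words s ''fv'' ?i \<le> 1" by (rule soundD[OF so u(1) S(2) t(1)])
        have gd: "good s u v t \<longleftrightarrow> 0 < words s ''fv'' ?i \<and> 0 < words s ''aw'' (v * S + u)"
          unfolding good_def awD[OF gr S(2,1)] using u v t fv1 by auto
        have gv: "gval s u v t = reals s ''fw'' ?i + reals s ''wt'' (v * S + u)" if "good s u v t"
          using wtD[OF gr S(2,1)] that by (simp add: gval_def good_def)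
        have b: "bn s4 BESTT \<longleftrightarrow> good s u v t \<and> (0 < words s3 ''found'' 0 \<longrightarrow> reals s3 ''bw'' 0 < gval s u v t)"
          unfolding gd using w4 gv gd by (auto simp: BESTT_def)
        have below: "u' = u \<and> v' = v \<and> t' = t \<or> eidx k u' v' t' < ?i" if "good s u' v' t'" "eidx k u' v' t' < Suc ?i" for u' v' t'
        proof (cases "eidx k u' v' t' = ?i")
          case True
          have "t' < C" "v' < S" "u' < S" using that(1) sz unfolding good_def by linarith+
          then show ?thesis using eidx_eq[of t' v' u' t v u k] True t S by blast
        next
          case False then show ?thesis using that by simp
        qed
        have Si: "eidx k u v (Suc t) = Suc ?i" by (simp add: eidx_def)
        have cB: "bcost BESTT \<le> 100" by (simp add: BESTT_def)
        show ?case
        proof (rule H_sl, simp, goal_cases)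
          case 1 show ?case using w4 iV V2 by simp
        next
          case 2
          show ?case
          proof (cases "bn s4 BESTT")
            case True
            then have g: "good s u v t" and lt: "0 < words s3 ''found'' 0 \<Longrightarrow> reals s3 ''bw'' 0 < gval s u v t" using b by auto
            have "gval s u' v' t' \<le> gval s u v t" if "good s u' v' t'" "eidx k u' v' t' < Suc ?i" for u' v' t'
              using below[OF that] I3 that(1) lt unfolding binv_def by (meson le_less order.trans)
            then have "\<forall>u' v' t'. good s u' v' t' \<longrightarrow> eidx k u' v' t' < Suc ?i \<longrightarrow> gval s u' v' t' \<le> gval s u v t" by blast
            moreover have r: "words s' ''found'' 0 = 1" "words s' ''bi'' 0 = ?i" "reals s' ''bw'' 0 = gval s u v t"
              if "s' = wstore ''io'' 0 (Suc t) (sem (Cond BESTT (''found'' :== Const 1 ;; ''bi'' :== sv ''fi'' ;; RStore ''bw'' (Const 0) (RAdd (RLoad ''fw'' (sv ''fi'')) (RLoad ''wt'' (sv ''v'' [*] sv ''S'' [+] sv ''u'')))) Skip) s4)" for s'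
              unfolding that using True w4 gv[OF g] by simp_all
            ultimately show ?thesis unfolding Si binv_def r[OF refl] using g by fastforce
          next
            case False
            have "0 < words s3 ''found'' 0 \<and> gval s u' v' t' \<le> reals s3 ''bw'' 0" if "good s u' v' t'" "eidx k u' v' t' < Suc ?i" for u' v' t'
              using below[OF that] I3 that(1) False b unfolding binv_def by (auto simp: not_less)
            then show ?thesis using False I3 w4 unfolding Si binv_def by simp
          qed
        next
          case 3 show ?case using cB by simp
        qed
      next
        case 3 show ?case by simp
      qed
    next
      case (7 s3)
      have "eidx k u v C = eidx k u (Suc v) 0" by (simp add: eidx_def)
      then show ?case using 7(1) by (subst binv_cong[of _ s3]) simp_all
    next
      case 8 show ?case by simp
    qed (use Vb in \<open>simp_all add: C\<close>)
  next
    case (7 s2)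
    have "eidx k u' v' t < eidx k u n 0" if "good s u' v' t" "eidx k u' v' t < eidx k (Suc u) 0 0" for u' v' t
    proof -
      have vi: "v' * C + t < n * C" using that by (intro mr_less) (auto simp: good_def)
      have "u' \<le> u"
      proof (rule ccontr)
        assume "\<not> u' \<le> u"
        then have "eidx k (Suc u) 0 0 \<le> eidx k u' 0 0" unfolding eidx_def by (intro add_mono mult_right_mono) auto
        also have "\<dots> \<le> eidx k u' v' t" by (simp add: eidx_def)
        finally show False using that by simp
      qed
      then have "(k * S + u') * (S * C) \<le> (k * S + u) * (S * C)" by (intro mult_right_mono) auto
      then show ?thesis using vi unfolding eidx_def add.assoc by linarith
    qed
    then have "binv s s2 (eidx k (Suc u) 0 0)" using 7(1) unfolding binv_def by blast
    then show ?case by (subst binv_cong[of _ s2]) simp_all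
  next
    case 8 show ?case by (simp add: algebra_simps)
  qed (use p1 bounds in \<open>simp_all add: par2D\<close>)
next
  case 8 show ?case by (simp add: algebra_simps)
qed (use ps bounds in \<open>simp_all add: par2D\<close>)

lemma H_OUTPUT:
  "H (100 * k + 100) (OUTPUT k) s (\<lambda>s'. map (words s' ''cycle'') [0..<k] = pl s k (words s ''bi'' 0))"
  unfolding OUTPUT_def
proof (rule H_For_const[where N = k and t = 60 and I = "\<lambda>p s'. \<forall>p'<p. words s' ''cycle'' p' = posi s (words s ''bi'' 0) p'"], goal_cases)
  case (6 p s1)
  note a1 = agrw[OF 6(5), simplified]
  show ?case
  proof (rule H_sl, simp, goal_cases)
    case 1 show ?case using bndD[OF 1] by simp
  next
    case 2 show ?case using 6(2,3) a1 by (simp add: posi_def less_Suc_eq)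
  next
    case 3 show ?case by simp
  qed
next
  case (7 s1) then show ?case by (simp add: pl_def)
qed (use Vb in simp_all)

text \<open>Representation with \<open>X\<close> empty: for all ends \<open>u\<close> and
  \<open>v\<close>, some entry is as heavy as any path with \<open>k\<close> vertices between them,
  and the closing edge adds the same amount to both. Soundness makes the best entry an actual
  cycle.\<close>

lemma best_correct:
  assumes k3: "3 \<le> k" and gr: "gr s" and so: "sound s k" and re: "repr s k" and B: "binv s s' (eidx k n 0 0)"
    and c: "words s' ''found'' 0 \<noteq> 0 \<Longrightarrow> map (words s'' ''cycle'') [0..<k] = pl s k (words s' ''bi'' 0)" "words s'' ''found'' 0 = words s' ''found'' 0"
  shows "correct_answer k E w (answer k s'')"
proof -
  have lt: "eidx k u v t < eidx k n 0 0" if "good s u v t" for u v t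
  proof -
    have "eidx k u v t < (k * S + u + 1) * (S * C)" unfolding eidx_def add.assoc
      by (rule mr_less[OF mr_less]) (use that sz in \<open>auto simp: good_def\<close>)
    also have "\<dots> \<le> (k * S + n) * (S * C)" using that by (intro mult_right_mono) (auto simp: good_def)
    finally show ?thesis by (simp add: eidx_def)
  qed
  have any: "0 < words s' ''found'' 0 \<and> cycle_weight w ys \<le> reals s' ''bw'' 0" if y: "is_cycle E ys" "length ys = k" for ys
  proof -
    obtain u v where uv: "isp n E k u v ys" "{v, u} \<in> E" using is_cycle_iff[OF sg k3] y by blast
    have n: "u < n" "v < n" using edge_n[OF uv(2)] by auto
    obtain t where t: "t < C" "words s ''fv'' (eidx k u v t) = 1" "pwt w ys \<le> reals s ''fw'' (eidx k u v t)"
      using re n uv(1) unfolding repr_def by (metis card.empty finite.emptyI inf_bot_right le0)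
    have g: "good s u v t" using n t uv by (simp add: good_def)
    have "cycle_weight w ys = pwt w ys + w {v, u}"
      using cycle_weight_sum[of ys w] uv(1) k3 by (simp add: isp_def)
    also have "\<dots> \<le> gval s u v t" using t by (simp add: gval_def)
    finally show ?thesis using B g lt[OF g] unfolding binv_def by (meson order.trans)
  qed
  show ?thesis
  proof (cases "words s' ''found'' 0 = 0")
    case True
    then show ?thesis using any c(2) by (auto simp: answer_def)
  next
    case False
    then obtain u v t where g: "good s u v t" "words s' ''bi'' 0 = eidx k u v t" "reals s' ''bw'' 0 = gval s u v t"
      using B unfolding binv_def by auto
    let ?xs = "pl s k (eidx k u v t)"
    have va: "valid s k u v (eidx k u v t)" using soundD'[OF so, of u v t] g(1) sz by (auto simp: good_def)
    have i: "isp n E k u v ?xs" using va by (simp add: valid_def)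
    have cyc: "is_cycle E ?xs \<and> length ?xs = k" using is_cycle_iff[OF sg k3] i g(1) by (auto simp: good_def)
    have "cycle_weight w ?xs = gval s u v t"
      using cycle_weight_sum[of ?xs w] i k3 va by (simp add: isp_def valid_def gval_def)
    then have "max_weight_cycle k E w ?xs" using cyc any g(3) by (simp add: max_weight_cycle_def)
    then show ?thesis using False c g(2) by (simp add: answer_def)
  qed
qed

end

section \<open>Parameters of the algorithm and the complete program\<close>

definition cc :: "nat \<Rightarrow> nat" where "cc k = (k + 1) ^ k"
text \<open>Chosen so that \<open>d = mu div qd k + 1\<close> gives
  \<open>16 * D = qd k * d <= mu + qd k\<close>, the bound needed to count guess words with at most
  \<open>D\<close> ones.\<close>

definition qd :: "nat \<Rightarrow> nat" where "qd k = 16 * (k + 1) * cc k"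

definition LOG :: com where
  "LOG = (''S'' :== Const 2 [*] sv ''n'' [+] Const 1 ;; ''t1'' :== Const 1 ;; ''L'' :== Const 0) ;;
     For ''x'' (sv ''n'') (Cond (Const 2 [*] sv ''t1'' [<] sv ''n'' [+] Const 1)
       (''t1'' :== Const 2 [*] sv ''t1'' ;; ''L'' :== sv ''L'' [+] Const 1) Skip)"

definition PARS :: "nat \<Rightarrow> com" where
  "PARS k = (''mu'' :== sv ''L'' [div] Const 8 ;; ''d'' :== sv ''mu'' [div] Const (qd k) [+] Const 1 ;;
     ''N'' :== sv ''d'' [*] Const (cc k) ;; ''D'' :== Const (k + 1) [*] sv ''N'' ;; ''nb'' :== sv ''n'' [div] sv ''d'' [+] Const 1 ;;
     WStore ''pw'' (Const 0) (Const 1) ;; WStore ''p3'' (Const 0) (Const 1) ;; ''Zc'' :== Const 1 ;; ''JN'' :== Const 0)"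

definition POWS :: com where
  "POWS = For ''h'' (sv ''mu'') (WStore ''pw'' (sv ''h'' [+] Const 1) (WLoad ''pw'' (sv ''h'') [*] Const 2) ;;
     WStore ''p3'' (sv ''h'' [+] Const 1) (WLoad ''p3'' (sv ''h'') [*] Const 3)) ;;
     (''m'' :== WLoad ''pw'' (sv ''mu'') ;; ''P'' :== WLoad ''p3'' (sv ''mu'') ;; ''nc'' :== sv ''n'' [div] sv ''m'' [+] Const 1)"

definition ZCS :: "nat \<Rightarrow> com" where
  "ZCS k = For ''s'' (Const (k + 1)) (''Zc'' :== sv ''Zc'' [*] sv ''N'')"

definition JLS :: com where
  "JLS = For ''x'' (sv ''m'') (WStore ''pc'' (sv ''x'') (WLoad ''pc'' (sv ''x'' [div] Const 2) [+] (sv ''x'' [-] Const 2 [*] (sv ''x'' [div] Const 2))) ;;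
     Cond (WLoad ''pc'' (sv ''x'') [<] sv ''D'' [+] Const 1) (WStore ''jl'' (sv ''JN'') (sv ''x'') ;; ''JN'' :== sv ''JN'' [+] Const 1) Skip)"

definition COPY :: com where
  "COPY = For ''u'' (sv ''n'') (For ''v'' (sv ''n'') (
     WStore ''aw'' (sv ''u'' [*] sv ''S'' [+] sv ''v'') (WLoad ''adj'' (sv ''u'' [*] sv ''n'' [+] sv ''v'')) ;;
     RStore ''wt'' (sv ''u'' [*] sv ''S'' [+] sv ''v'') (RLoad ''weight'' (sv ''u'' [*] sv ''n'' [+] sv ''v''))))"

lemma modw_SETUPs [simp]: "modw LOG = {''S'', ''t1'', ''L'', ''x''}" "modw (PARS k) = {''mu'', ''d'', ''N'', ''D'', ''nb'', ''pw'', ''p3'', ''Zc'', ''JN''}"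
    "modw POWS = {''h'', ''pw'', ''p3'', ''m'', ''P'', ''nc''}" "modw (ZCS k) = {''s'', ''Zc''}" "modw JLS = {''x'', ''pc'', ''jl'', ''JN''}"
    "modw COPY = {''u'', ''v'', ''aw''}"
  and modr_SETUPs [simp]: "modr LOG = {}" "modr (PARS k) = {}" "modr POWS = {}" "modr (ZCS k) = {}" "modr JLS = {}" "modr COPY = {''wt''}"
  by (auto simp: LOG_def PARS_def POWS_def ZCS_def JLS_def COPY_def)

definition MAIN :: "nat \<Rightarrow> com" where
  "MAIN k = LOG ;; PARS k ;; POWS ;; ZCS k ;; JLS ;; COPY ;; INIT k ;; STAGES k ;; BEST k ;;
     Cond (Const 0 [<] sv ''found'') (OUTPUT k) Skip"

text \<open>The recurrence behind the table \<open>pc\<close> in \<open>JLS\<close>. It is stated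
  with a fixed number of bits; since \<open>x < 2 ^ h\<close>, shifting leaves a leading 0.\<close>

lemma popc_half:
  assumes "x < 2 ^ h"
  shows "popc h x = popc h (x div 2) + x mod 2"
proof (cases h)
  case 0
  then show ?thesis using assms by (simp add: popc_def)
next
  case (Suc g)
  have "x div 2 div 2 ^ g = 0" using assms Suc by (simp flip: div_mult2_eq)
  then have "popc h (x div 2) = popc g (x div 2)" unfolding Suc popc_Suc by simp
  then show ?thesis unfolding Suc popc_div2 by (simp add: mod_2_eq_odd)
qed

text \<open>\<open>mu = L div 8\<close> makes \<open>m ^ 8 <= n\<close>, so that building the trees
  is cheap. As \<open>m\<close> and \<open>d\<close> are at most \<open>n\<close>, the padded widths
  \<open>nc * m\<close> and \<open>nb * d\<close> are at most \<open>2 * n\<close>, which explains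
  \<open>S\<close>.\<close>

locale full = galgo +
  fixes L :: nat
  assumes n1: "1 \<le> n" and SS: "S = 2 * n + 1" and L: "2 ^ L \<le> n" "n < 2 ^ Suc L" and mu: "mu = L div 8"
    and d: "d = mu div qd k + 1" and nb: "nb = n div d + 1" and nc: "nc = n div m + 1"
    and jle: "jl = filter (\<lambda>J. popc mu J \<le> D) [0..<m]"
begin

lemma H_LOG:
  assumes "words s ''n'' 0 = n"
  shows "H (n * 100 + 100) LOG s (\<lambda>s'. words s' ''S'' 0 = S \<and> words s' ''L'' 0 = L)"
  unfolding LOG_def
proof (rule H_slS[where u = "n * 80 + 50"], simp, goal_cases)
  case 1 then show ?case using assms bounds V2 SS by simp
next
  case (2 s1)
  note a1 = agrw[OF 2(3), simplified]
  have w1: "words s1 ''n'' 0 = n" "words s1 ''S'' 0 = S" "words s1 ''t1'' 0 = 1" "words s1 ''L'' 0 = 0" using assms SS by (simp_all add: 2(1))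
  show ?case
  \<comment> \<open>As long as doubling is possible, every round doubles, hence \<open>i\<close> is
    at most the exponent. After \<open>n\<close> rounds this is incompatible with
    \<open>2 * 2 ^ L <= n\<close>, so the doubling has come to an end.\<close>
  proof (rule H_For_const[where N = n and t = 50 and I = "\<lambda>i s'. words s' ''t1'' 0 = 2 ^ words s' ''L'' 0 \<and> words s' ''t1'' 0 \<le> n \<and> (2 * words s' ''t1'' 0 \<le> n \<longrightarrow> i \<le> words s' ''L'' 0) \<and> words s' ''L'' 0 \<le> i"], goal_cases)
    case (6 i s2)
    note a2 = agrw[OF 6(5), simplified]
    have w2: "words s2 ''n'' 0 = n" using a2 w1 by simp
    show ?case
    proof (rule H_sl, simp, goal_cases)
      case 1 show ?case using 6(1,2) w2 bounds by auto
    next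
      case 2 show ?case using 6(2) w2 by auto
    next
      case 3 show ?case by simp
    qed
  next
    case (7 s2)
    note a2 = agrw[OF 7(4), simplified] and I = 7(1)
    let ?l = "words s2 ''L'' 0"
    have "\<not> 2 * 2 ^ ?l \<le> n"
    proof
      assume a: "2 * 2 ^ ?l \<le> n"
      then have "n \<le> ?l" using I by auto
      then show False using a less_exp[of ?l] by linarith
    qed
    then have b: "2 ^ ?l \<le> n" "n < 2 ^ Suc ?l" using I by auto
    have "?l < Suc L" "L < Suc ?l"
      using power_less_imp_less_exp[of "2::nat" ?l "Suc L"] power_less_imp_less_exp[of "2::nat" L "Suc ?l"] b L by linarith+
    then have "?l = L" by simp
    then show ?case using a2 w1 by simp
  qed (use w1 n1 bounds in simp_all)
next
  case 3 then show ?case by simp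
qed

lemma nsimp: "L div 8 = mu" "Suc (mu div qd k) = d" "d * cc k = N" "Suc k * N = D" "Suc (n div d) = nb" "Suc (n div m) = nc"
  using mu d N D nb nc by (simp_all add: cc_def C)

lemma pV: "d \<le> V" "nb \<le> V"
proof -
  have "d * 1 \<le> d * C" using C0 by (intro mult_left_mono) auto
  then show "d \<le> V" using N NV by linarith
  have "nb * 1 \<le> nb * C" using C0 by (intro mult_left_mono) auto
  then show "nb \<le> V" using Vb by linarith
qed

lemma H_PARS:
  assumes "words s ''n'' 0 = n" "words s ''L'' 0 = L"
  shows "H 200 (PARS k) s (\<lambda>s'. words s' ''mu'' 0 = mu \<and> words s' ''d'' 0 = d \<and> words s' ''N'' 0 = N \<and> words s' ''D'' 0 = D \<and>
     words s' ''nb'' 0 = nb \<and> words s' ''pw'' 0 = 1 \<and> words s' ''p3'' 0 = 1 \<and> words s' ''Zc'' 0 = 1 \<and> words s' ''JN'' 0 = 0)"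
  unfolding PARS_def
proof (rule H_sl, simp, goal_cases)
  case 1 show ?case using V2 pV NV bounds by (simp add: assms nsimp del: mult_Suc)
next
  case 2 show ?case by (simp add: assms nsimp del: mult_Suc)
next
  case 3 show ?case by simp
qed

lemma H_POWS:
  assumes "words s ''n'' 0 = n" "words s ''mu'' 0 = mu" "words s ''pw'' 0 = 1" "words s ''p3'' 0 = 1"
  shows "H (mu * 100 + 100) POWS s (\<lambda>s'. words s' ''m'' 0 = m \<and> words s' ''P'' 0 = P \<and> words s' ''nc'' 0 = nc \<and>
     (\<forall>h\<le>mu. words s' ''pw'' h = 2 ^ h) \<and> (\<forall>h\<le>mu. words s' ''p3'' h = 3 ^ h))"
  unfolding POWS_def
proof (rule H_Seq[where t = "mu * 70 + 20" and u = 60 and R = "\<lambda>s'. (\<forall>h\<le>mu. words s' ''pw'' h = 2 ^ h) \<and> (\<forall>h\<le>mu. words s' ''p3'' h = 3 ^ h)"], goal_cases)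
  case 1
  show ?case
  proof (rule H_For_const[where N = mu and t = 50 and I = "\<lambda>i s'. (\<forall>h\<le>i. words s' ''pw'' h = 2 ^ h) \<and> (\<forall>h\<le>i. words s' ''p3'' h = 3 ^ h)"], goal_cases)
    case (6 i s1)
    have p: "(2::nat) ^ Suc i \<le> 2 ^ mu" "(3::nat) ^ Suc i \<le> 3 ^ mu" using 6(1) by (intro power_increasing; simp)+
    have "P * 1 \<le> P * (mu + 2)" by (intro mult_left_mono) auto
    then have pV: "2 ^ Suc i \<le> V" "3 ^ Suc i \<le> V" using p bounds m P by linarith+
    show ?case
    proof (rule H_sl, simp, goal_cases)
      case 1 show ?case using 6(2,3) pV by (simp add: mult.commute)
    next
      case 2 show ?case using 6(2,3) by (auto simp: le_Suc_eq)
    next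
      case 3 show ?case by simp
    qed
  next
    case 8 show ?case by simp
  qed (use assms bounds in simp_all)
next
  case (2 s1)
  note a1 = agrw[OF 2(3), simplified]
  have w1: "words s1 ''n'' 0 = n" "words s1 ''mu'' 0 = mu" "words s1 ''pw'' mu = m" "words s1 ''p3'' mu = P" using 2(1) a1 assms m P by simp_all
  show ?case
  proof (rule H_sl, simp, goal_cases)
    case 1 then show ?case using bounds bndD[OF 1, of "''p3''" mu] w1 by (simp add: nsimp)
  next
    case 2 show ?case using \<open>(\<forall>h\<le>mu. words s1 ''pw'' h = 2 ^ h) \<and> (\<forall>h\<le>mu. words s1 ''p3'' h = 3 ^ h)\<close> w1 by (simp add: nsimp)
  next
    case 3 show ?case by simp
  qed
next
  case 3 show ?case by simp
qed

lemma H_ZCS: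
  assumes "words s ''N'' 0 = N" "words s ''Zc'' 0 = 1"
  shows "H (k * 100 + 200) (ZCS k) s (\<lambda>s'. words s' ''Zc'' 0 = Zc)"
  unfolding ZCS_def
proof (rule H_For_const[where N = "k + 1" and t = 50 and I = "\<lambda>i s'. words s' ''Zc'' 0 = N ^ i"], goal_cases)
  case (6 i s1)
  note a1 = agrw[OF 6(5), simplified]
  have w1: "words s1 ''N'' 0 = N" using a1 assms by simp
  have "N ^ Suc i \<le> N ^ (k + 1)" using 6(1) N0 by (intro power_increasing) auto
  then have le: "N ^ Suc i \<le> V" using Vb Zc by linarith
  show ?case
  proof (rule H_sl, simp, goal_cases)
    case 1 show ?case using 6(2) w1 le by (simp add: mult.commute)
  next
    case 2 show ?case using 6(2) w1 by (simp add: mult.commute)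
  next
    case 3 show ?case by simp
  qed
next
  case (7 s1) then show ?case using Zc by simp
next
  case 8 show ?case by simp
qed (use assms Vb in simp_all)

lemma H_JLS:
  assumes "words s ''m'' 0 = m" "words s ''D'' 0 = D" "words s ''JN'' 0 = 0" "words s ''pc'' 0 = 0"
  shows "H (m * 200 + 100) JLS s (\<lambda>s'. words s' ''JN'' 0 = length jl \<and> (\<forall>i<length jl. words s' ''jl'' i = jl ! i))"
  unfolding JLS_def
proof (rule H_For_const[where N = m and t = 150 and I = "\<lambda>x s'. words s' ''pc'' 0 = 0 \<and> (\<forall>y<x. words s' ''pc'' y = popc mu y) \<and>
    (let js = filter (\<lambda>J. popc mu J \<le> D) [0..<x] in words s' ''JN'' 0 = length js \<and> (\<forall>i<length js. words s' ''jl'' i = js ! i))"], goal_cases)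
  case (6 x s1)
  note a1 = agrw[OF 6(5), simplified] and I = 6(2)
  let ?js = "filter (\<lambda>J. popc mu J \<le> D) [0..<x]"
  have w1: "words s1 ''D'' 0 = D" "words s1 ''x'' 0 = x" using a1 assms 6(3) by simp_all
  have p0: "popc mu 0 = 0" by (simp add: popc_def)
  \<comment> \<open>For \<open>x = 0\<close> the cell read is the one about to be written; the
    initial value 0 is the correct bit count.\<close>
  have "words s1 ''pc'' (x div 2) = popc mu (x div 2)" using I p0 by (cases "x = 0") simp_all
  moreover have "x - 2 * (x div 2) = x mod 2" by (simp add: modulo_nat_def mult.commute)
  ultimately have pc: "words s1 ''pc'' (x div 2) + (x - 2 * (x div 2)) = popc mu x" using popc_half[of x mu] 6(1) m by simp
  have pm: "popc mu x \<le> mu" unfolding popc_def using sum_bounded_above[of "{..<mu}" "\<lambda>i. of_bool (odd (x div 2 ^ i))" "1::nat"] by simp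
  have "length (filter (\<lambda>J. popc mu J \<le> D) [0..<Suc x]) \<le> length [0..<Suc x]" by (rule length_filter_le)
  then have l: "length ?js \<le> x" and xm: "Suc x \<le> V" "x \<le> V" using 6(1) bounds by (auto intro: order.trans[OF length_filter_le])
  show ?case
  proof (rule H_sl, simp, goal_cases)
    case 1 show ?case using I w1 pc pm bounds l xm by (simp add: Let_def)
  next
    case 2
    have pcx: "popc mu x = 0" if "x = 0" using that p0 by simp
    show ?case using I w1 pc pcx by (auto simp: Let_def less_Suc_eq nth_append)
  next
    case 3 show ?case by simp
  qed
next
  case (7 s1) then show ?case by (simp add: jle Let_def)
next
  case 8 show ?case by simp
qed (use assms bounds in simp_all)

lemma H_COPY:
  assumes "words s ''n'' 0 = n" "words s ''S'' 0 = S"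
    and i: "\<forall>u<n. \<forall>v<n. words s ''adj'' (u * n + v) = (if {u, v} \<in> E then 1 else 0)" "\<forall>u<n. \<forall>v<n. {u, v} \<in> E \<longrightarrow> reals s ''weight'' (u * n + v) = w {u, v}"
    and z: "\<And>i. words s ''aw'' i = 0"
  shows "H (n * (n * 100 + 100) + 100) COPY s gr"
proof -
  define I where "I u v s' \<longleftrightarrow> (\<forall>a<S. \<forall>c<S. words s' ''aw'' (a * S + c) = (if (a < u \<or> a = u \<and> c < v) \<and> a < n \<and> c < n \<and> {a, c} \<in> E then 1 else 0)) \<and>
     (\<forall>a<n. \<forall>c<n. (a < u \<or> a = u \<and> c < v) \<longrightarrow> {a, c} \<in> E \<longrightarrow> reals s' ''wt'' (a * S + c) = w {a, c})" for u v and s' :: state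
  have Icong: "I u v s' = I u' v' s''" if "\<And>a c. c < n \<Longrightarrow> (a < u \<or> a = u \<and> c < v) = (a < u' \<or> a = u' \<and> c < v')" "words s' ''aw'' = words s'' ''aw''" "reals s' ''wt'' = reals s'' ''wt''" for u v u' v' s' s''
  proof -
    have e1: "((a < u \<or> a = u \<and> c < v) \<and> a < n \<and> c < n \<and> R) = ((a < u' \<or> a = u' \<and> c < v') \<and> a < n \<and> c < n \<and> R)" for a c R
      using that(1)[of c a] by (cases "c < n") simp_all
    have e2: "(\<forall>a<n. \<forall>c<n. (a < u \<or> a = u \<and> c < v) \<longrightarrow> R a c) = (\<forall>a<n. \<forall>c<n. (a < u' \<or> a = u' \<and> c < v') \<longrightarrow> R a c)" for R
      using that(1) by simp
    show ?thesis unfolding I_def that(2,3) e1 e2 by (rule refl)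
  qed
  have cell: "a * S + c = a' * S + c' \<longleftrightarrow> a = a' \<and> c = c'" if "c < S" "c' < S" for a a' c c'
    by (rule mr_eq) (use that in auto)
  have "H (n * (n * 100 + 100) + 100) COPY s (I n 0)"
    unfolding COPY_def
  proof (rule H_For_const[where N = n and t = "n * 100 + 50" and I = "\<lambda>u. I u 0"], goal_cases)
    case 5 then show ?case using z by (simp add: I_def)
  next
    case (6 u s1)
    note a1 = agrw[OF 6(5), simplified] agrr[OF 6(5), simplified] and u = 6(1,3) and I1 = 6(2)
    show ?case
    proof (rule H_For_const[where N = n and t = 80 and I = "\<lambda>v. I u v"], goal_cases)
      case 5 then show ?case using I1 by (subst Icong[where u' = u and v' = 0 and s'' = s1]) simp_all
    next
      case (6 v s2)
      note a2 = agrw[OF 6(5), simplified] agrr[OF 6(5), simplified] and v = 6(1,3) and I2 = 6(2)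
      have w2: "words s2 ''n'' 0 = n" "words s2 ''S'' 0 = S" "words s2 ''u'' 0 = u" "words s2 ''v'' 0 = v" using a1 a2 u v assms by simp_all
      have adj: "words s2 ''adj'' (u * n + v) = (if {u, v} \<in> E then 1 else 0)" "{u, v} \<in> E \<Longrightarrow> reals s2 ''weight'' (u * n + v) = w {u, v}"
        using i u v a1 a2 by simp_all
      have S: "u < S" "v < S" using u v SS by simp_all
      show ?case
      proof (rule H_sl, simp, goal_cases)
        case 1 show ?case using w2 adj V2 by simp
      next
        case 2
        let ?s = "wstore ''v'' 0 (Suc v) (sem (WStore ''aw'' (sv ''u'' [*] sv ''S'' [+] sv ''v'') (WLoad ''adj'' (sv ''u'' [*] sv ''n'' [+] sv ''v'')) ;;
     RStore ''wt'' (sv ''u'' [*] sv ''S'' [+] sv ''v'') (RLoad ''weight'' (sv ''u'' [*] sv ''n'' [+] sv ''v''))) s2)"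
        have aw: "words ?s ''aw'' (a * S + c) = (if a = u \<and> c = v then (if {u, v} \<in> E then 1 else 0) else words s2 ''aw'' (a * S + c))" if "c < S" for a c
          using cell[OF that S(2)] w2 adj by simp
        have wt: "reals ?s ''wt'' (a * S + c) = (if a = u \<and> c = v then reals s2 ''weight'' (u * n + v) else reals s2 ''wt'' (a * S + c))" if "c < S" for a c
          using cell[OF that S(2)] w2 by simp
        have less: "(a < u \<or> a = u \<and> c < Suc v) \<longleftrightarrow> (a = u \<and> c = v) \<or> (a < u \<or> a = u \<and> c < v)" for a c by auto
        have nS: "c < n \<Longrightarrow> c < S" for c using SS by simp
        show ?case unfolding I_def
        proof (intro conjI allI impI, goal_cases)
          case (1 a c)
          show ?case
          proof (cases "a = u \<and> c = v")
            case True then show ?thesis unfolding aw[OF 1(2)] using u v by simp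
          next
            case False
            then have "words ?s ''aw'' (a * S + c) = words s2 ''aw'' (a * S + c)" unfolding aw[OF 1(2)] by (rule if_not_P)
            then show ?thesis using I2 1 False less[of a c] unfolding I_def by metis
          qed
        next
          case (2 a c)
          show ?case
          proof (cases "a = u \<and> c = v")
            case True then show ?thesis unfolding wt[OF nS[OF 2(2)]] using adj 2 by simp
          next
            case False
            then have "reals ?s ''wt'' (a * S + c) = reals s2 ''wt'' (a * S + c)" unfolding wt[OF nS[OF 2(2)]] by (rule if_not_P)
            then show ?thesis using I2 2 False less[of a c] unfolding I_def by metis
          qed
        qed
      next
        case 3 show ?case by simp
      qed
    next
      case (7 s2) then show ?case by (subst Icong[where u' = u and v' = n and s'' = s2]) (auto simp: less_Suc_eq)
    next
      case 8 show ?case by simp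
    qed (use u a1 assms bounds in simp_all)
  next
    case (7 s1) then show ?case by simp
  next
    case 8 show ?case by (simp add: algebra_simps)
  qed (use assms bounds in simp_all)
  then show ?thesis
  proof (rule H_conseq, goal_cases)
    case (2 s')
    then show ?case using edge_n unfolding gr_def I_def by (metis (no_types, lifting))
  qed simp
qed

definition TT :: nat where
  "TT = (n * 100 + 100) + (200 + ((mu * 100 + 100) + ((k * 100 + 200) + ((m * 200 + 100) + ((n * (n * 100 + 100) + 100) +
     ((n * (200 * k + 400) + 100) + ((k * (TST + 50) + 100) + ((n * (n * (C * 300 + 100) + 100) + 100) + (100 * k + 200)))))))))"

lemma H_MAIN:
  assumes k3: "3 \<le> k" and s: "s = input n E w \<omega>"
  shows "H TT (MAIN k) s (\<lambda>s'. correct_answer k E w (answer k s'))"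
proof -
  have z: "words s x i = 0" if "x \<noteq> ''n''" "x \<noteq> ''adj''" for x i using that by (simp add: s input_def)
  have zr: "reals s x i = 0" if "x \<noteq> ''weight''" for x i using that by (simp add: s input_def)
  have n0: "words s ''n'' 0 = n" by (simp add: s input_def)
  have ix: "u * n + v < n * n" "(u * n + v) div n = u" "(u * n + v) mod n = v" if "u < n" "v < n" for u v
    using mr_less[OF that(2,1)] that by simp_all
  have adj: "words s ''adj'' (u * n + v) = (if {u, v} \<in> E then 1 else 0)" "{u, v} \<in> E \<Longrightarrow> reals s ''weight'' (u * n + v) = w {u, v}" if "u < n" "v < n" for u v
    using ix[OF that] by (simp_all add: s input_def)
  show ?thesis
    unfolding MAIN_def TT_def
  proof (rule H_Seq[OF H_LOG[OF n0] _ le_refl], goal_cases)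
    case (1 s1)
    note a1 = agrw[OF 1(3), simplified] agrr[OF 1(3), simplified]
    have w1: "words s1 ''n'' 0 = n" using a1 n0 by simp
    show ?case
    proof (rule H_Seq[OF H_PARS _ le_refl], goal_cases)
      case (3 s2)
      note a2 = agrw[OF 3(3), simplified] agrr[OF 3(3), simplified]
      have w2: "words s2 ''n'' 0 = n" "words s2 ''S'' 0 = S" using a2 w1 1 by simp_all
      show ?case
      proof (rule H_Seq[OF H_POWS _ le_refl], goal_cases)
        case (5 s3)
        note a3 = agrw[OF 5(3), simplified] agrr[OF 5(3), simplified]
        show ?case
        proof (rule H_Seq[OF H_ZCS _ le_refl], goal_cases)
          case (3 s4)
          note a4 = agrw[OF 3(3), simplified] agrr[OF 3(3), simplified]
          show ?case
          proof (rule H_Seq[OF H_JLS _ le_refl], goal_cases)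
            case (5 s5)
            note a5 = agrw[OF 5(3), simplified] agrr[OF 5(3), simplified]
            have p5: "par2 s5" unfolding par2_def par_def
              using a3 a4 a5 w2 3(1) 5(1) \<open>words s2 ''mu'' 0 = mu \<and> _\<close> \<open>words s3 ''m'' 0 = m \<and> _\<close> by simp
            show ?case
            proof (rule H_Seq[OF H_COPY _ le_refl], goal_cases)
              case (6 s6)
              note a6 = agrw[OF 6(3), simplified] agrr[OF 6(3), simplified] and g6 = 6(1)
              have p6: "par2 s6" by (rule par2_agr[OF p5 6(3)]) (simp add: parnames_def parnames2_def)
              show ?case
              proof (rule H_Seq[OF H_INIT _ le_refl], goal_cases)
                case (5 s7)
                note a7 = agrw[OF 5(3), simplified] agrr[OF 5(3), simplified] and r7 = 5(1)
                have p7: "par2 s7" by (rule par2_agr[OF p6 5(3)]) (simp add: parnames_def parnames2_def)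
                have g7: "gr s7" using g6 unfolding gr_def by (simp add: a7)
                show ?case
                proof (rule H_Seq[OF H_STAGES[OF p7 g7] _ le_refl], goal_cases)
                  case (4 s8)
                  note a8 = agrw[OF 4(3), simplified] agrr[OF 4(3), simplified] and r8 = 4(1)
                  have p8: "par2 s8" by (rule par2_agr[OF p7 4(3)]) (simp add: parnames_def parnames2_def)
                  have f8: "words s8 ''found'' 0 = 0" using a1 a2 a3 a4 a5 a6 a7 a8 z by simp
                  show ?case
                  proof (rule H_Seq[OF H_BEST[OF p8 _ _ f8] _ le_refl], goal_cases)
                    case (3 s9)
                    note a9 = agrw[OF 3(3), simplified] and r9 = 3(1)
                    have pl: "pl s9 k i = pl s8 k i" for i by (simp add: pl_def posi_def a9)
                    show ?case
                    proof (rule H_Cond[where t = "100 * k + 100"], goal_cases)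
                      case 1
                      show ?case
                      proof (rule H_conseq[OF H_OUTPUT], goal_cases)
                        case (2 s') 
                        show ?case by (rule best_correct[OF k3 _ _ _ r9]) (use r8 2(1) agrw[OF 2(3), simplified] pl in simp_all)
                      qed simp
                    next
                      case 2
                      show ?case
                      proof (rule H_sl, simp, goal_cases)
                        case 2 show ?case by (simp, rule best_correct[OF k3 _ _ _ r9]) (use r8 \<open>\<not> bn s9 _\<close> in simp_all)
                      qed simp_all
                    next
                      case 3 show ?case by simp
                    qed
                  qed (use r8 in simp_all)
                qed (use r7 in simp_all)
              qed (use p6 bounds a1 a2 a3 a4 a5 a6 z zr in simp_all)
            qed (use a1 a2 a3 a4 a5 w2 adj z in simp_all)
          qed (use a1 a2 a3 a4 z 5(1) \<open>words s2 ''mu'' 0 = mu \<and> _\<close> in simp_all)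
        qed (use a3 3(1) in simp_all)
      qed (use w2 3(1) in simp_all)
    qed (use w1 1 in simp_all)
  qed
qed

end

section \<open>Running time\<close>

text \<open>A single term of the exponential series is bounded by the whole series.\<close>

lemma power_le_fact_exp:
  assumes "0 \<le> (x::real)"
  shows "x ^ e \<le> fact e * exp x"
proof -
  have "(\<Sum>n\<in>{e}. x ^ n /\<^sub>R fact n) \<le> (\<Sum>n. x ^ n /\<^sub>R fact n)"
    by (rule sum_le_suminf[OF summable_exp_generic]) (use assms in auto)
  then show ?thesis by (simp add: exp_def field_simps)
qed

text \<open>The base 4/3 is the room left by the guess words: \<open>(3 / 2) * (4 / 3) = 2\<close>,
  so a polynomial in \<open>mu\<close> times \<open>(3 / 2) ^ mu\<close> is
  \<open>O(m)\<close>.\<close>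

lemma poly_le_exp: "\<exists>K\<ge>1. \<forall>h::nat. real (h + 1) ^ e \<le> K * (4 / 3) ^ h"
proof -
  obtain l :: real where l: "0 < l" "exp l = 4 / 3"
    by (rule that[of "ln (4 / 3)"]) simp_all
  define K where "K = fact e / l ^ e * (4 / 3)"
  have K: "real (h + 1) ^ e \<le> K * (4 / 3) ^ h" for h :: nat
  proof -
    have "(real (h + 1) * l) ^ e \<le> fact e * exp (real (h + 1) * l)"
      using l by (intro power_le_fact_exp) auto
    then have "real (h + 1) ^ e * l ^ e \<le> fact e * (4 / 3) ^ (h + 1)"
      by (simp only: power_mult_distrib exp_of_nat_mult l)
    then have "real (h + 1) ^ e \<le> fact e * (4 / 3) ^ (h + 1) / l ^ e"
      using l by (simp only: pos_le_divide_eq zero_less_power)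
    then show ?thesis unfolding K_def by simp
  qed
  have "real (h + 1) ^ e \<le> max 1 K * (4 / 3) ^ h" for h :: nat
    by (rule order.trans[OF K]) (intro mult_right_mono, auto)
  then show ?thesis by (intro exI[of _ "max 1 K"]) auto
qed

text \<open>Absorbs every polylogarithmic factor into \<open>m = 2 ^ mu\<close>, a small power of \<open>n\<close>.\<close>

definition Ke :: "nat \<Rightarrow> real" where
  "Ke k = (SOME K. 1 \<le> K \<and> (\<forall>h::nat. real (h + 1) ^ (k + 2) \<le> K * (4 / 3) ^ h))"

lemma Ke: "1 \<le> Ke k" "real (h + 1) ^ (k + 2) \<le> Ke k * (4 / 3) ^ h"
  using someI_ex[of "\<lambda>K. 1 \<le> K \<and> (\<forall>h::nat. real (h + 1) ^ (k + 2) \<le> K * (4 / 3) ^ h)"] poly_le_exp[of "k + 2"]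
  unfolding Ke_def by blast+

text \<open>The generating function of the number of ones, a product of one factor
  \<open>1 + 1 / 8\<close> per bit.\<close>

lemma sum_popc: "(\<Sum>J<2 ^ h. (1 / 8 :: real) ^ popc h J) = (9 / 8) ^ h"
proof (induction h)
  case 0 then show ?case by (simp add: popc_def)
next
  case (Suc h)
  have "(\<Sum>J<2 ^ Suc h. (1 / 8 :: real) ^ popc (Suc h) J) = (\<Sum>J<2 ^ h. \<Sum>i\<in>{J * 2..<J * 2 + 2}. (1 / 8) ^ popc (Suc h) i)"
    by (subst sum.nat_group) (simp add: mult.commute)
  also have "\<dots> = (\<Sum>J<2 ^ h. (1 / 8) ^ popc h J * (9 / 8))"
  proof (rule sum.cong[OF refl])
    fix J :: nat
    have i: "{J * 2..<J * 2 + 2} = {J * 2, Suc (J * 2)}" by auto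
    show "(\<Sum>i\<in>{J * 2..<J * 2 + 2}. (1 / 8 :: real) ^ popc (Suc h) i) = (1 / 8) ^ popc h J * (9 / 8)"
      unfolding i by (simp add: popc_div2)
  qed
  also have "\<dots> = (9 / 8) ^ h * (9 / 8)" by (simp only: Suc sum_distrib_right[symmetric])
  finally show ?case by simp
qed

definition cA1 :: "nat \<Rightarrow> nat" where
  "cA1 k = 200 * (k + 1) + (k + 1) * cc k * 500 + ((k + 1) * (cc k * ((k + 1) * (100 * k + 100) + 500) + 300) + 100) + 500"
definition cA2 :: "nat \<Rightarrow> nat" where "cA2 k = 800 + 400 * ((k + 1) * cc k)"
definition cA3 :: "nat \<Rightarrow> real" where
  "cA3 k = real (cc k ^ (k + 1)) * (Ke k * (real (cA1 k) + 8000 + 2 * (real (cA2 k) + 300) * (4 / 3) ^ qd k + 120))"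
definition cA4 :: "nat \<Rightarrow> real" where "cA4 k = real (cc k) * (cA3 k + 900) + 100"
definition cA5 :: "nat \<Rightarrow> nat" where
  "cA5 k = (k + 1) * (cc k * ((k + 1) * (100 * k + 100) + 100 + 500) + 400) + 200 * (k + 1) + 600"
definition cA7 :: "nat \<Rightarrow> real" where "cA7 k = cA4 k + 30 + real (cc k * cA5 k + 300) + 100"
definition cA8 :: "nat \<Rightarrow> nat" where "cA8 k = 3000 + 500 * k + 300 * cc k"
definition AA :: "nat \<Rightarrow> real" where "AA k = (real (cA8 k) + real k * cA7 k) * real (8 * qd k + 1)"

context full
begin

lemma Cc: "C = cc k" by (simp add: C cc_def)

lemma d_le: "d \<le> mu + 1" unfolding d by simp

lemma m8: "m ^ 8 \<le> n"
proof -
  have "m ^ 8 = 2 ^ (mu * 8)" unfolding m by (rule power_mult[symmetric])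
  also have "\<dots> \<le> 2 ^ L" unfolding mu by (intro power_increasing) auto
  finally show ?thesis using L by simp
qed

lemma m1: "1 \<le> m" unfolding m by simp

lemma mn: "m \<le> n" and m4n: "m ^ 4 \<le> n"
proof -
  have "m ^ 1 \<le> m ^ 8" "m ^ 4 \<le> m ^ 8" using m1 by (intro power_increasing; simp)+
  then show "m \<le> n" "m ^ 4 \<le> n" using m8 by simp_all
qed

lemma ncm: "nc * m \<le> 2 * n"
proof -
  have "nc * m = n div m * m + m" unfolding nc by simp
  also have "\<dots> \<le> n + m" by simp
  finally show ?thesis using mn by simp
qed

lemma P_le: "P \<le> m * m"
proof -
  have "(3::nat) ^ mu \<le> 4 ^ mu" by (rule power_mono) auto
  also have "(4::nat) ^ mu = 2 ^ mu * 2 ^ mu" by (simp flip: power_mult_distrib)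
  finally show ?thesis unfolding P m .
qed

lemma ND: "N \<le> cc k * (mu + 1)" "D \<le> (k + 1) * cc k * (mu + 1)"
proof -
  show n: "N \<le> cc k * (mu + 1)" unfolding N Cc using mult_le_mono1[OF d_le, of "cc k"] by (simp add: mult.commute)
  show "D \<le> (k + 1) * cc k * (mu + 1)" unfolding D using mult_le_mono2[OF n, of "k + 1"] by (simp only: mult.assoc)
qed

lemma D16: "16 * D \<le> mu + qd k"
proof -
  have "16 * D = qd k * d" unfolding D N Cc qd_def by (simp add: algebra_simps)
  also have "\<dots> = qd k * (mu div qd k) + qd k" unfolding d by simp
  also have "\<dots> \<le> mu + qd k" by simp
  finally show ?thesis .
qed

text \<open>An exponential-moment bound: a word with at most \<open>D\<close> ones contributes at
  least 1 to the sum of \<open>8 ^ D * (1 / 8) ^ popc mu J\<close>, so there are at most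
  \<open>8 ^ D * (9 / 8) ^ mu\<close> of them. From \<open>8 <= (4 / 3) ^ 16\<close> and
  \<open>D16\<close> follows \<open>8 ^ D <= (4 / 3) ^ (mu + qd k)\<close>, and
  \<open>(4 / 3) * (9 / 8) = 3 / 2\<close>.\<close>

lemma jl_le: "real (length jl) \<le> (4 / 3) ^ qd k * (3 / 2) ^ mu"
proof -
  have "length jl = card (set jl)" using jl(1) by (simp add: distinct_card)
  then have "real (length jl) = (\<Sum>J\<in>{J. J < 2 ^ mu \<and> popc mu J \<le> D}. 1)" using jl(2) by simp
  also have "\<dots> \<le> (\<Sum>J\<in>{J. J < 2 ^ mu \<and> popc mu J \<le> D}. 8 ^ D * (1 / 8) ^ popc mu J)"
  proof (rule sum_mono)
    fix J assume "J \<in> {J. J < 2 ^ mu \<and> popc mu J \<le> D}"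
    then have "(8::real) ^ popc mu J \<le> 8 ^ D" by (intro power_increasing) auto
    then show "(1::real) \<le> 8 ^ D * (1 / 8) ^ popc mu J" by (simp add: power_divide)
  qed
  also have "\<dots> \<le> (\<Sum>J<2 ^ mu. 8 ^ D * (1 / 8) ^ popc mu J)" by (intro sum_mono2) auto
  also have "\<dots> = 8 ^ D * (9 / 8) ^ mu" by (simp add: sum_popc flip: sum_distrib_left)
  also have "\<dots> \<le> (4 / 3) ^ (mu + qd k) * (9 / 8) ^ mu"
  proof (intro mult_right_mono)
    have "(8::real) \<le> (4 / 3) ^ 16" by (simp add: power_divide)
    then have "(8::real) ^ D \<le> ((4 / 3) ^ 16) ^ D" by (intro power_mono) auto
    also have "\<dots> = (4 / 3) ^ (16 * D)" by (simp only: power_mult)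
    also have "\<dots> \<le> (4 / 3) ^ (mu + qd k)" using D16 by (intro power_increasing) auto
    finally show "(8::real) ^ D \<le> (4 / 3) ^ (mu + qd k)" .
  qed simp
  also have "\<dots> = (4 / 3) ^ qd k * ((4 / 3) * (9 / 8)) ^ mu" by (simp only: power_add power_mult_distrib mult_ac)
  finally show ?thesis by simp
qed

lemma TP_le: "TP \<le> cA1 k * (n * (mu + 1))"
proof -
  let ?y = "mu + 1" and ?b = "(k + 1) * (100 * k + 100) + 500"
  let ?c = "cc k * ?b + 300"
  have y: "1 \<le> ?y" "n \<le> n * ?y" "1 \<le> n * ?y" using n1 by (auto simp: Suc_le_eq)
  have "D * (100 * S + 200) \<le> ((k + 1) * cc k * ?y) * (500 * n)"
    using ND(2) n1 SS by (intro mult_le_mono) auto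
  also have "\<dots> = (k + 1) * cc k * 500 * (n * ?y)" by (simp only: mult_ac)
  finally have 1: "D * (100 * S + 200) \<le> (k + 1) * cc k * 500 * (n * ?y)" .
  have "N * ?b + 300 \<le> cc k * ?y * ?b + 300 * ?y" using ND(1) by (intro add_mono mult_le_mono1) auto
  also have "\<dots> = ?c * ?y" by (simp only: algebra_simps)
  finally have "(k + 1) * (N * ?b + 300) + 100 \<le> (k + 1) * (?c * ?y) + 100 * ?y"
    by (intro add_mono mult_le_mono2) auto
  also have "\<dots> = ((k + 1) * ?c + 100) * ?y" by (simp only: algebra_simps)
  finally have "n * ((k + 1) * (N * ?b + 300) + 100) \<le> n * (((k + 1) * ?c + 100) * ?y)" by (rule mult_le_mono2)
  then have 2: "n * ((k + 1) * (N * ?b + 300) + 100) \<le> ((k + 1) * ?c + 100) * (n * ?y)" by (simp only: mult_ac)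
  have 3: "200 * (k + 1) \<le> 200 * (k + 1) * (n * ?y)" "500 \<le> 500 * (n * ?y)" using y(3) mult_le_mono2[OF y(3), of "200 * (k + 1)"] by simp_all
  have "TP \<le> 200 * (k + 1) * (n * ?y) + (k + 1) * cc k * 500 * (n * ?y) + ((k + 1) * ?c + 100) * (n * ?y) + 500 * (n * ?y)"
    unfolding TP_def by (intro add_mono 1 2 3)
  also have "\<dots> = cA1 k * (n * ?y)" unfolding cA1_def by (simp only: add_mult_distrib)
  finally show ?thesis .
qed

text \<open>The first term is for building the trees, using \<open>P <= m * m\<close>, the second
  for the walks. Rewriting \<open>(3 / 2) ^ mu\<close> as \<open>m * (3 / 4) ^ mu\<close> cancels
  \<open>m\<close> against the number of chunks and leaves a decaying factor.\<close>

lemma TD_le: "real TD \<le> 8000 * (real n * real m ^ 3 * real (mu + 1)) +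
    2 * (real (cA2 k) + 300) * (4 / 3) ^ qd k * (real n ^ 2 * (real (mu + 1) * (3 / 4) ^ mu)) + 100"
proof -
  let ?y = "mu + 1" and ?J = "(4 / 3) ^ qd k * (3 / 2) ^ mu :: real"
  have J1: "1 \<le> ?J" using mult_mono[of 1 "(4 / 3 :: real) ^ qd k" 1 "(3 / 2) ^ mu"] by simp
  have Jy: "1 \<le> ?J * real ?y" using mult_mono[OF J1, of 1 "real ?y"] by simp
  have a: "4000 * (mu + 1) * P * m * m \<le> 4000 * (?y * m ^ 4)"
    using mult_le_mono2[OF P_le, of "4000 * ?y * m * m"] by (simp only: power4_eq_xxxx mult_ac)
  have A: "700 * mu + 800 + 400 * D \<le> cA2 k * ?y" 
  proof -
    have "700 * mu + 800 \<le> 800 * ?y" "400 * D \<le> 400 * ((k + 1) * cc k * ?y)" using ND(2) by simp_all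
    moreover have "cA2 k * ?y = 800 * ?y + 400 * ((k + 1) * cc k * ?y)" unfolding cA2_def by (simp only: add_mult_distrib mult.assoc)
    ultimately show ?thesis by linarith
  qed
  have "real (length jl) * real (700 * mu + 800 + 400 * D) \<le> ?J * real (cA2 k * ?y)"
    by (rule mult_mono[OF jl_le of_nat_mono[OF A]]) simp_all
  then have b: "real (length jl * (700 * mu + 800 + 400 * D) + 150) \<le> (real (cA2 k) + 150) * (?J * real ?y)"
    using Jy by (simp only: of_nat_add of_nat_mult) (simp add: algebra_simps)
  have nJ: "1 \<le> real n * (?J * real ?y)" using mult_mono[of 1 "real n", OF _ Jy] n1 by simp
  have "real (n * (length jl * (700 * mu + 800 + 400 * D) + 150) + 150) \<le> real n * ((real (cA2 k) + 150) * (?J * real ?y)) + 150 * (real n * (?J * real ?y))"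
    using mult_left_mono[OF b, of "real n"] nJ by (simp only: of_nat_add of_nat_mult of_nat_numeral) linarith
  also have "\<dots> = (real (cA2 k) + 300) * (real n * (?J * real ?y))" by (simp add: algebra_simps)
  finally have c: "real (n * (length jl * (700 * mu + 800 + 400 * D) + 150) + 150) \<le> (real (cA2 k) + 300) * (real n * (?J * real ?y))" .
  have "real TD \<le> real nc * (4000 * (real ?y * real m ^ 4) + (real (cA2 k) + 300) * (real n * (?J * real ?y))) + 100"
  proof -
    have "real (4000 * (mu + 1) * P * m * m) \<le> 4000 * (real ?y * real m ^ 4)"
      using a by (metis of_nat_le_iff of_nat_mult of_nat_numeral of_nat_power)
    then have "real (4000 * (mu + 1) * P * m * m + (n * (length jl * (700 * mu + 800 + 400 * D) + 150) + 150)) \<le> 4000 * (real ?y * real m ^ 4) + (real (cA2 k) + 300) * (real n * (?J * real ?y))"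
      using c unfolding of_nat_add[of "4000 * (mu + 1) * P * m * m"] by linarith
    from mult_left_mono[OF this, of "real nc"] show ?thesis unfolding TD_def by (simp add: add.assoc)
  qed
  also have "real nc * (4000 * (real ?y * real m ^ 4) + (real (cA2 k) + 300) * (real n * (?J * real ?y))) =
     real (nc * m) * (4000 * (real ?y * real m ^ 3) + (real (cA2 k) + 300) * (4 / 3) ^ qd k * (real n * (real ?y * (3 / 4) ^ mu)))"
  proof -
    have "(3 / 2 :: real) ^ mu = real m * (3 / 4) ^ mu" unfolding m by (simp flip: power_mult_distrib)
    then show ?thesis by (simp add: algebra_simps eval_nat_numeral)
  qed
  also have "\<dots> \<le> (2 * real n) * (4000 * (real ?y * real m ^ 3) + (real (cA2 k) + 300) * (4 / 3) ^ qd k * (real n * (real ?y * (3 / 4) ^ mu)))"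
    using ncm by (intro mult_right_mono) (simp_all flip: of_nat_mult)
  also have "\<dots> = 8000 * (real n * real m ^ 3 * real (mu + 1)) +
    2 * (real (cA2 k) + 300) * (4 / 3) ^ qd k * (real n ^ 2 * (real (mu + 1) * (3 / 4) ^ mu))"
    by (simp only: algebra_simps power2_eq_square)
  finally show ?thesis by simp
qed

text \<open>The number of claims contributes \<open>(mu + 1) ^ (k + 1)\<close> and a single run
  another factor \<open>mu + 1\<close>; this is the exponent \<open>k + 2\<close> in
  \<open>Ke\<close>. The resulting \<open>(4 / 3) ^ mu\<close> is cancelled by
  \<open>(3 / 4) ^ mu\<close> in the walks and bounded by \<open>m\<close> elsewhere, where
  \<open>m ^ 4 <= n\<close> takes care of the trees.\<close>

lemma Zc_TD: "real Zc * real (TP + TD + 20) \<le> cA3 k * real n ^ 2"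
proof -
  let ?y = "real (mu + 1)"
  let ?z = "?y ^ (k + 1)"
  have Z: "real Zc \<le> real (cc k ^ (k + 1)) * ?z"
  proof -
    have "Zc \<le> (cc k * (mu + 1)) ^ (k + 1)" unfolding Zc using ND(1) by (intro power_mono) auto
    then show ?thesis by (metis of_nat_le_iff of_nat_mult of_nat_power power_mult_distrib)
  qed
  have zy: "?z * ?y \<le> Ke k * (4 / 3) ^ mu" using Ke(2)[of mu k] by (simp add: mult.commute)
  have y1: "1 \<le> ?y" "1 \<le> ?z" by (simp, intro one_le_power, simp)
  have "(4 / 3 :: real) ^ mu \<le> 2 ^ mu" by (intro power_mono) auto
  then have "Ke k * (4 / 3) ^ mu \<le> Ke k * real m" unfolding m using Ke(1)[of k] by (intro mult_left_mono) auto
  then have zm: "?z * ?y \<le> Ke k * real m" using zy by simp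
  have rm: "1 \<le> real m" "real m \<le> real n" "real m ^ 4 \<le> real n" "1 \<le> real n" using m1 mn m4n n1 by (simp_all flip: of_nat_power)
  have K: "0 \<le> Ke k" "1 \<le> Ke k" using Ke(1)[of k] by simp_all
  have 1: "?z * (real (cA1 k) * (real n * ?y)) \<le> real (cA1 k) * (Ke k * real n ^ 2)"
  proof -
    have "?z * ?y * real n \<le> Ke k * real n * real n" using order.trans[OF zm mult_left_mono[OF rm(2) K(1)]] by (intro mult_right_mono) auto
    from mult_left_mono[OF this, of "real (cA1 k)"] show ?thesis by (simp add: power2_eq_square mult_ac)
  qed
  have 2: "?z * (8000 * (real n * real m ^ 3 * ?y)) \<le> 8000 * (Ke k * real n ^ 2)"
  proof -
    have "?z * ?y * real m ^ 3 \<le> Ke k * real m * real m ^ 3" using zm by (intro mult_right_mono) auto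
    also have "\<dots> = Ke k * real m ^ 4" by (simp add: eval_nat_numeral)
    also have "\<dots> \<le> Ke k * real n" using rm(3) K by (intro mult_left_mono) auto
    finally have "real n * (?z * ?y * real m ^ 3) \<le> real n * (Ke k * real n)" by (intro mult_left_mono) auto
    then show ?thesis by (simp add: power2_eq_square mult_ac)
  qed
  let ?q = "2 * (real (cA2 k) + 300) * (4 / 3) ^ qd k :: real"
  have 3: "?z * (?q * (real n ^ 2 * (?y * (3 / 4) ^ mu))) \<le> ?q * (Ke k * real n ^ 2)"
  proof -
    have "?z * ?y * (3 / 4) ^ mu \<le> Ke k * (4 / 3) ^ mu * (3 / 4) ^ mu" using zy by (intro mult_right_mono) auto
    also have "\<dots> = Ke k * ((4 / 3) * (3 / 4)) ^ mu" by (simp only: power_mult_distrib mult_ac)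
    finally have "?z * ?y * (3 / 4) ^ mu \<le> Ke k" by simp
    then have "(?q * real n ^ 2) * (?z * ?y * (3 / 4) ^ mu) \<le> (?q * real n ^ 2) * Ke k" by (intro mult_left_mono) auto
    then show ?thesis by (simp only: mult_ac)
  qed
  have 4: "?z * 120 \<le> 120 * (Ke k * real n ^ 2)"
  proof -
    have "?z * 1 \<le> ?z * ?y" using y1 by (intro mult_left_mono) auto
    also have "\<dots> \<le> Ke k * real n" using order.trans[OF zm mult_left_mono[OF rm(2) K(1)]] .
    also have "\<dots> \<le> Ke k * (real n * real n)" using K rm(4) by (intro mult_left_mono) auto
    finally show ?thesis by (simp add: power2_eq_square)
  qed
  have TP: "real TP \<le> real (cA1 k) * (real n * ?y)" using TP_le by (metis of_nat_le_iff of_nat_mult)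
  have "real (TP + TD + 20) \<le> real (cA1 k) * (real n * ?y) + (8000 * (real n * real m ^ 3 * ?y) + ?q * (real n ^ 2 * (?y * (3 / 4) ^ mu))) + 120"
    using TP TD_le by simp
  from mult_left_mono[OF this, of ?z]
  have "?z * real (TP + TD + 20) \<le> ?z * (real (cA1 k) * (real n * ?y)) + (?z * (8000 * (real n * real m ^ 3 * ?y)) + ?z * (?q * (real n ^ 2 * (?y * (3 / 4) ^ mu)))) + ?z * 120"
    by (simp only: distrib_left) simp
  also have "\<dots> \<le> real (cA1 k) * (Ke k * real n ^ 2) + (8000 * (Ke k * real n ^ 2) + ?q * (Ke k * real n ^ 2)) + 120 * (Ke k * real n ^ 2)"
    by (intro add_mono 1 2 3 4)
  also have "\<dots> = Ke k * (real (cA1 k) + 8000 + ?q + 120) * real n ^ 2" by (simp only: algebra_simps)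
  finally have *: "?z * real (TP + TD + 20) \<le> Ke k * (real (cA1 k) + 8000 + ?q + 120) * real n ^ 2" .
  have "real Zc * real (TP + TD + 20) \<le> real (cc k ^ (k + 1)) * ?z * real (TP + TD + 20)"
    using Z by (intro mult_right_mono) auto
  also have "\<dots> = real (cc k ^ (k + 1)) * (?z * real (TP + TD + 20))" by (simp only: mult.assoc)
  also have "\<dots> \<le> real (cc k ^ (k + 1)) * (Ke k * (real (cA1 k) + 8000 + ?q + 120) * real n ^ 2)"
    using * by (intro mult_left_mono) auto
  finally show ?thesis unfolding cA3_def by (simp only: mult.assoc)
qed

lemma TB_le: "real TB \<le> cA4 k * real n ^ 2"
proof -
  have n2: "1 \<le> real n ^ 2" using n1 by simp
  have "real (n * (nc * m)) \<le> 2 * real n ^ 2"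
    using mult_le_mono2[OF ncm, of n] by (metis mult.left_commute of_nat_le_iff of_nat_mult of_nat_numeral of_nat_power power2_eq_square)
  then have "real (Zc * (TP + TD + 20) + 400 * (n * (nc * m)) + 100) \<le> (cA3 k + 900) * real n ^ 2"
    using Zc_TD n2 by (simp only: of_nat_add[of _ 100] of_nat_add[of "Zc * _"] of_nat_mult[of Zc] of_nat_mult[of 400] of_nat_numeral distrib_right)
  from mult_left_mono[OF this, of "real C"]
  have "real TB \<le> real C * ((cA3 k + 900) * real n ^ 2) + 100"
    unfolding TB_def by simp
  also have "\<dots> \<le> real C * ((cA3 k + 900) * real n ^ 2) + 100 * real n ^ 2" using n2 by simp
  finally show ?thesis unfolding cA4_def Cc by (simp only: distrib_right mult.assoc)
qed

lemma nb1: "1 \<le> nb" unfolding nb by simp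

text \<open>For each pair and guess word the merge scans a constant number of champions per block.
  This is the dominant \<open>n ^ 2 * nb\<close> term of a level.\<close>

lemma TL_le: "TL \<le> (cc k * cA5 k + 300) * (n ^ 2 * nb)"
proof -
  have TE: "TE \<le> cA5 k * nb"
  proof -
    let ?t = "TH + 500"
    have "nb * C * ?t + 400 \<le> (C * ?t + 400) * nb" using nb1 by (simp add: algebra_simps)
    from mult_le_mono2[OF this, of "k + 1"]
    have "(k + 1) * (nb * C * ?t + 400) \<le> (k + 1) * (C * ?t + 400) * nb" by (simp only: mult.assoc)
    moreover have "200 * (k + 1) \<le> 200 * (k + 1) * nb" "600 \<le> 600 * nb" using mult_le_mono2[OF nb1, of "200 * (k + 1)"] nb1 by simp_all
    ultimately have "TE \<le> (k + 1) * (C * ?t + 400) * nb + 200 * (k + 1) * nb + 600 * nb" unfolding TE_def by linarith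
    also have "\<dots> = cA5 k * nb" unfolding cA5_def TH_def Cc by (simp only: add_mult_distrib add.assoc)
    finally show ?thesis .
  qed
  have nn: "n \<le> n * n" "1 \<le> n * n" using n1 by (auto simp: Suc_le_eq)
  have M: "n * n * 1 \<le> n * n * nb" by (rule mult_le_mono2[OF nb1])
  have "n * (n * (C * TE)) \<le> n * (n * (C * (cA5 k * nb)))" using TE by (intro mult_le_mono2)
  moreover have "TL = n * (n * (C * TE)) + 100 * (n * n) + 100 * n + 100" unfolding TL_def by (simp add: algebra_simps)
  ultimately have "TL \<le> n * (n * (C * (cA5 k * nb))) + 300 * (n * n * nb)" using nn M by linarith
  then show ?thesis unfolding Cc by (simp add: power2_eq_square algebra_simps)
qed

lemma TST_le: "real TST \<le> cA7 k * (real n ^ 2 * real nb)"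
proof -
  have M: "real nb \<le> real n ^ 2 * real nb" "1 \<le> real n ^ 2 * real nb"
    using n1 nb1 mult_mono[of 1 "real n ^ 2" 1 "real nb"] by (auto intro: mult_right_mono[of 1 "real n ^ 2" "real nb", simplified])
  have "real TL \<le> real (cc k * cA5 k + 300) * (real n ^ 2 * real nb)" using TL_le by (metis of_nat_le_iff of_nat_mult of_nat_power)
  moreover have "real nb * real TB \<le> real nb * (cA4 k * real n ^ 2)" using TB_le by (intro mult_left_mono) auto
  moreover have "real TST = real nb * real TB + 30 * real nb + real TL + 100" unfolding TST_def by (simp add: algebra_simps)
  moreover have "cA7 k * (real n ^ 2 * real nb) = real nb * (cA4 k * real n ^ 2) + 30 * (real n ^ 2 * real nb) + real (cc k * cA5 k + 300) * (real n ^ 2 * real nb) + 100 * (real n ^ 2 * real nb)"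
    unfolding cA7_def by (simp only: distrib_left distrib_right mult_ac)
  ultimately show ?thesis using M by linarith
qed

text \<open>Here the logarithm is gained: the block size \<open>d\<close> is at least a constant
  fraction of \<open>L + 1\<close>, because
  \<open>L + 1 <= 8 * (mu + 1) <= 8 * qd k * d\<close>.\<close>

lemma nb_le: "real nb \<le> real (8 * qd k + 1) * (real n / real (L + 1))"
proof -
  have qd: "1 \<le> qd k" unfolding qd_def cc_def by (simp add: Suc_le_eq)
  have 8: "L + 1 \<le> 8 * (mu + 1)" unfolding mu by simp
  have q: "mu + 1 \<le> qd k * d"
    using mod_less_divisor[of "qd k" mu] qd mult_div_mod_eq[of "qd k" mu] unfolding d distrib_left by linarith
  have Ld: "L + 1 \<le> 8 * qd k * d" using order.trans[OF 8 mult_le_mono2[OF q, of 8]] by (simp only: mult.assoc)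
  have "L < 2 ^ L" by (rule less_exp)
  then have Ln: "L + 1 \<le> n" using L(1) by linarith
  have "n div d * (L + 1) \<le> n div d * (8 * qd k * d)" using Ld by (rule mult_le_mono2)
  also have "\<dots> = 8 * qd k * (n div d * d)" by (simp only: mult_ac)
  also have "\<dots> \<le> 8 * qd k * n" by (intro mult_le_mono2) simp
  finally have "nb * (L + 1) \<le> (8 * qd k + 1) * n" using Ln unfolding nb by (simp add: algebra_simps)
  then have "real nb * real (L + 1) \<le> real (8 * qd k + 1) * real n" by (metis of_nat_le_iff of_nat_mult)
  then show ?thesis by (simp add: field_simps)
qed

lemma TT_le: "real TT \<le> AA k * (real n ^ 3 / real (L + 1))"
proof -
  let ?M = "n ^ 2 * nb"
  have nn: "n \<le> n ^ 2" "1 \<le> n ^ 2" using n1 by (auto simp: power2_eq_square Suc_le_eq)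
  have M2: "n ^ 2 \<le> ?M" using mult_le_mono2[OF nb1, of "n ^ 2"] by simp
  then have M: "n \<le> ?M" "1 \<le> ?M" "m \<le> ?M" "mu \<le> ?M" using nn mn less_exp[of mu] m by linarith+
  have kM: "k * n \<le> k * ?M" "k * 1 \<le> k * ?M" "cc k * n ^ 2 \<le> cc k * ?M" using mult_le_mono2[OF M(1), of k] mult_le_mono2[OF M(2), of k] mult_le_mono2[OF M2, of "cc k"] by blast+
  have "TT = 100 * n + 100 + 200 + 100 * mu + 100 + 100 * k + 200 + 200 * m + 100 + 100 * n ^ 2 + 100 * n + 100 + 200 * (k * n) + 400 * n + 100
      + k * TST + 50 * k + 100 + 300 * (cc k * n ^ 2) + 100 * n ^ 2 + 100 * n + 100 + 100 * k + 200"
    unfolding TT_def unfolding Cc by (simp add: algebra_simps power2_eq_square)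
  also have "\<dots> \<le> k * TST + 3000 * ?M + 500 * (k * ?M) + 300 * (cc k * ?M)" using M M2 kM by linarith
  also have "\<dots> = k * TST + cA8 k * ?M" unfolding cA8_def by (simp add: algebra_simps)
  finally have "real TT \<le> real k * real TST + real (cA8 k) * real ?M" by (metis of_nat_add of_nat_le_iff of_nat_mult)
  also have "\<dots> \<le> real k * (cA7 k * real ?M) + real (cA8 k) * real ?M"
    using mult_left_mono[OF TST_le, of "real k"] by simp
  also have "\<dots> = (real (cA8 k) + real k * cA7 k) * real n ^ 2 * real nb" by (simp add: algebra_simps)
  also have "\<dots> \<le> (real (cA8 k) + real k * cA7 k) * real n ^ 2 * (real (8 * qd k + 1) * (real n / real (L + 1)))"
  proof (rule mult_left_mono[OF nb_le])
    have "0 \<le> cA7 k" using Ke(1)[of k] unfolding cA7_def cA4_def cA3_def by (intro add_nonneg_nonneg mult_nonneg_nonneg) auto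
    then show "0 \<le> (real (cA8 k) + real k * cA7 k) * real n ^ 2" by simp
  qed
  finally show ?thesis unfolding AA_def by (simp only: power3_eq_cube power2_eq_square times_divide_eq_right times_divide_eq_left mult_ac)
qed

lemma run:
  assumes "3 \<le> k" "cdeg (MAIN k) \<le> G"
  shows "\<exists>t s. exec b (MAIN k) (input n E w \<omega>) t s \<and> real t \<le> AA k * (real n ^ 3 / real (L + 1)) \<and> correct_answer k E w (answer k s)"
proof -
  have "bnd (input n E w \<omega>)" using V2 bounds by (auto simp: bnd_def input_def)
  then obtain t s where "exec b (MAIN k) (input n E w \<omega>) t s" "t \<le> TT" "correct_answer k E w (answer k s)"
    using H_MAIN[OF assms(1) refl, of \<omega>] assms(2) unfolding H_def by blast
  then show ?thesis using TT_le by (meson of_nat_le_iff order.trans)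
qed

end

text \<open>The rounded-down binary logarithm, with value 0 at 0.\<close>

definition lg :: "nat \<Rightarrow> nat" where "lg n = (LEAST l. n < 2 ^ Suc l)"

lemma lg: "n < 2 ^ Suc (lg n)" "1 \<le> n \<Longrightarrow> 2 ^ lg n \<le> n"
proof -
  have "n < 2 ^ Suc n" using less_exp[of "Suc n"] by linarith
  then show "n < 2 ^ Suc (lg n)" unfolding lg_def by (rule LeastI)
  show "2 ^ lg n \<le> n" if "1 \<le> n"
  proof (cases "lg n")
    case 0 then show ?thesis using that by simp
  next
    case (Suc l)
    then have "\<not> n < 2 ^ Suc l" unfolding lg_def by (intro not_less_Least) simp
    then show ?thesis using Suc by simp
  qed
qed

text \<open>All stored words are at most \<open>(n + 2) ^ hh k\<close>.\<close>

definition hh :: "nat \<Rightarrow> nat" where "hh k = (cc k + 1) * (k + 1) + k + cc k + 20"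

text \<open>Every parameter and every address stored is bounded by a fixed power of
  \<open>n + 2\<close>; a constant \<open>x\<close> is treated as at most
  \<open>(n + 2) ^ x\<close>, so that all exponents add up to at most \<open>hh k\<close>.\<close>

lemma full_ex:
  assumes k: "1 \<le> k" and n: "1 \<le> n" and sg: "simple_graph n E" and V: "V = (n + 2) ^ hh k" and VG: "V ^ G < 2 ^ b"
  shows "\<exists>S mu m D P nc jl d N C Zc nb. full b V G n S mu m D P nc jl k d N C Zc nb E (lg n)"
proof -
  define S mu where "S = 2 * n + 1" and "mu = lg n div 8"
  define m P where "m = (2::nat) ^ mu" and "P = (3::nat) ^ mu"
  define C d where "C = (k + 1) ^ k" and "d = mu div qd k + 1"
  define N where "N = d * C"
  define D Zc nb nc where "D = (k + 1) * N" and "Zc = N ^ (k + 1)" and "nb = n div d + 1" and "nc = n div m + 1"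
  define jl where "jl = filter (\<lambda>J. popc mu J \<le> D) [0..<m]"
  let ?W = "n + 2"
  have C: "C = cc k" by (simp add: C_def cc_def)
  have le: "x \<le> V" if "x \<le> ?W ^ e" "e \<le> hh k" for x e
    using order.trans[OF that(1) power_increasing[OF that(2)]] V by simp
  have mul: "x * y \<le> ?W ^ (i + j)" if "x \<le> ?W ^ i" "y \<le> ?W ^ j" for x y i j
    unfolding power_add using that by (rule mult_le_mono)
  have cst: "x \<le> ?W ^ x" for x
  proof -
    have "x \<le> 2 ^ x" using less_exp[of x] by simp
    also have "\<dots> \<le> ?W ^ x" by (intro power_mono) auto
    finally show ?thesis .
  qed
  have mun: "mu < n" using less_exp[of "lg n"] lg(2)[OF n] unfolding mu_def by linarith
  have "m \<le> 2 ^ lg n" unfolding m_def mu_def by (intro power_increasing) auto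
  then have mn: "m \<le> n" using lg(2)[OF n] by simp
  have m0: "0 < m" "0 < d" "0 < C" by (simp_all add: m_def d_def C_def)
  have dmu: "d \<le> mu + 1" by (simp add: d_def)
  have "P \<le> 4 ^ mu" unfolding P_def by (intro power_mono) auto
  also have "(4::nat) ^ mu = m * m" unfolding m_def by (simp flip: power_mult_distrib)
  also have "m * m \<le> ?W ^ (1 + 1)" using mn by (intro mul) auto
  finally have PW: "P \<le> ?W ^ 2" by (simp add: numeral_2_eq_2)
  have w1: "x \<le> ?W ^ 1" if "x \<le> n + 2" for x using that by simp
  have nbW: "nb \<le> n + 1" "nc \<le> n + 1" unfolding nb_def nc_def by simp_all
  have SW: "S \<le> ?W ^ 2" unfolding S_def by (simp add: power2_eq_square)
  have NW: "N \<le> ?W ^ (1 + C)" unfolding N_def using dmu mun by (intro mul w1 cst) auto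
  have DW: "D \<le> ?W ^ (k + 1 + (1 + C))" unfolding D_def by (intro mul NW cst)
  have ZW: "Zc \<le> ?W ^ ((1 + C) * (k + 1))" unfolding Zc_def power_mult using NW by (rule power_mono) simp
  have jlm: "length jl \<le> m" unfolding jl_def using length_filter_le[of _ "[0..<m]"] by (metis length_upt minus_nat.diff_0)
  have ncm: "nc * m \<le> n + m" "n \<le> nc * m"
    using div_mult_mod_eq[of n m] mod_less_divisor[OF m0(1), of n] unfolding nc_def add_mult_distrib by linarith+
  have nbd: "nb * d \<le> n + d" "n \<le> nb * d"
    using div_mult_mod_eq[of n d] mod_less_divisor[OF m0(2), of n] unfolding nb_def add_mult_distrib by linarith+
  have h: "2 \<le> hh k" "1 \<le> hh k" "3 \<le> hh k" "k + 1 + (1 + C) \<le> hh k" "(1 + C) * (k + 1) \<le> hh k" "C \<le> hh k" "k + 1 \<le> hh k" "1 + C \<le> hh k"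
      "k + 2 + 2 + 2 + 2 + C \<le> hh k"
    unfolding hh_def C by (simp_all add: algebra_simps)
  have "P * (mu + 2) \<le> ?W ^ (2 + 1)" using mun by (intro mul PW w1) auto
  then have PV: "P * (mu + 2) \<le> V" using le[of _ "2 + 1"] h by simp
  have V1: "x \<le> V" if "x \<le> n + 2" for x using le[OF w1[OF that]] h by simp
  have nbV: "nb * C \<le> V" by (rule le[OF mul[OF w1 cst]]) (use nbW h in simp_all)
  have big: "(k + 2) * S * S * S * C \<le> V" by (rule le[OF mul[OF mul[OF mul[OF mul[OF cst SW] SW] SW] cst] h(9)])
  have V2: "2 \<le> V" using V1[of 2] by simp
  have word: "word b V G" using V2 VG by unfold_locales
  have dom: "dompar b V G n S mu m D P nc jl"
  proof -
    have "distinct jl" "set jl = {J. J < 2 ^ mu \<and> popc mu J \<le> D}" unfolding jl_def by (auto simp: m_def)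
    moreover have "nc * m \<le> S" using ncm mn unfolding S_def by linarith
    ultimately show ?thesis
      unfolding dompar_def dompar_axioms_def using word m_def P_def V1[of n] le[OF SW h(1)] le[OF DW h(4)] PV V1[of m] V1[of nc] V1[of "mu + 2"] V1[of "length jl"]
         mn nbW mun jlm by auto
  qed
  have alg: "algo b V G n S mu m D P nc jl k d N C Zc nb"
    unfolding algo_def algo_axioms_def
    using dom k C_def N_def D_def Zc_def m0 le[OF ZW h(5)] le[OF cst h(6)] le[OF cst h(7)] nbV big nbd ncm dmu mun S_def by auto
  have "galgo b V G n S mu m D P nc jl k d N C Zc nb E"
    unfolding galgo_def galgo_axioms_def using alg sg by blast
  then have "full b V G n S mu m D P nc jl k d N C Zc nb E (lg n)"
    unfolding full_def full_axioms_def using n S_def lg[of n] mu_def d_def nb_def nc_def jl_def by blast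
  then show ?thesis by blast
qed

lemma run_MAIN:
  assumes "3 \<le> k" "1 \<le> n" "simple_graph n E" and q: "q = hh k * cdeg (MAIN k) + 1"
  shows "\<exists>t s. exec (word_length q n) (MAIN k) (input n E w \<omega>) t s \<and> real t \<le> AA k * (real n ^ 3 / real (lg n + 1)) \<and> correct_answer k E w (answer k s)"
proof -
  have "n + 2 \<le> 2 ^ ceillog2 (n + 2)" by (rule le_two_power_ceillog2)
  then have "(n + 2) ^ q \<le> (2 ^ ceillog2 (n + 2)) ^ q" by (intro power_mono) auto
  \<comment> \<open>The \<open>+ 1\<close> in \<open>q\<close> makes this inequality strict.\<close>
  moreover have "((n + 2) ^ hh k) ^ cdeg (MAIN k) < (n + 2) ^ q"
    unfolding q power_mult[symmetric] by (intro power_strict_increasing) auto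
  ultimately have "((n + 2) ^ hh k) ^ cdeg (MAIN k) < 2 ^ word_length q n"
    unfolding word_length_def power_mult[symmetric] mult.commute[of q "ceillog2 (n + 2)"] by linarith
  from full_ex[OF _ assms(2,3) refl this] assms(1) obtain S mu m D P nc jl d N C Zc nb where
    "full (word_length q n) ((n + 2) ^ hh k) (cdeg (MAIN k)) n S mu m D P nc jl k d N C Zc nb E (lg n)"
    by (elim meta_impE exE) simp_all
  then show ?thesis by (rule full.run) (use assms in simp_all)
qed

lemma success_probability_eq_1:
  assumes "\<And>\<omega>. \<exists>t s. exec (word_length q n) c (input n E w \<omega>) t s \<and> correct_answer k E w (answer k s)"
  shows "success_probability c q k n E w = 1"
proof -
  have "prob_space fair_coins"
    unfolding fair_coins_def by (intro prob_space.prob_space_stream_space prob_space_measure_pmf)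
  then show ?thesis using assms by (simp add: success_probability_def prob_space.prob_space)
qed

theorem theorem1p5:
  fixes k :: nat
  assumes "k \<ge> 1"
  shows "\<forall>a::real. a > 0 \<longrightarrow>
    (\<exists>c q T.
       runs_in_time c q T \<and>
       (\<lambda>n. real (T n)) \<in> O(\<lambda>n. real n ^ 3 / ln (real n)) \<and>
       (\<forall>n\<ge>1. \<forall>E w. simple_graph n E \<longrightarrow>
          success_probability c q k n E w \<ge> 1 - 1 / real n powr a))"
proof (intro allI impI)
  fix a :: real
  show "\<exists>c q T. runs_in_time c q T \<and> (\<lambda>n. real (T n)) \<in> O(\<lambda>n. real n ^ 3 / ln (real n)) \<and>
       (\<forall>n\<ge>1. \<forall>E w. simple_graph n E \<longrightarrow> success_probability c q k n E w \<ge> 1 - 1 / real n powr a)"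
  proof (cases "3 \<le> k")
    case True
    define q where "q = hh k * cdeg (MAIN k) + 1"
    \<comment> \<open>Running times are natural numbers, so the real bound may be rounded
      down.\<close>
    define T where "T n = nat \<lfloor>AA k * (real n ^ 3 / real (lg n + 1))\<rfloor>" for n
    note run = run_MAIN[OF True _ _ q_def]
    have "runs_in_time (MAIN k) q T" unfolding runs_in_time_def T_def using run by (meson le_nat_floor)
    moreover have "(\<lambda>n. real (T n)) \<in> O(\<lambda>n. real n ^ 3 / ln (real n))"
    \<comment> \<open>The comparison starts at 2 because \<open>ln 1 = 0\<close>.\<close>
    proof (rule bigoI[of _ "\<bar>AA k\<bar>"], rule eventually_mono[OF eventually_ge_at_top[of 2]])
      fix n :: nat assume n: "2 \<le> n"
      have "real n \<le> real (2 ^ Suc (lg n))" using lg(1)[of n] by (intro of_nat_mono) linarith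
      then have "ln (real n) \<le> ln (2 ^ Suc (lg n))" using n by (intro ln_mono) simp_all
      also have "\<dots> = real (lg n + 1) * ln 2" by (simp only: ln_realpow) simp
      also have "\<dots> \<le> real (lg n + 1) * 1" using ln_2_less_1 by (intro mult_left_mono) auto
      finally have ln: "ln (real n) \<le> real (lg n + 1)" by simp
      have "real (T n) \<le> \<bar>AA k * (real n ^ 3 / real (lg n + 1))\<bar>" unfolding T_def by linarith
      also have "\<dots> = \<bar>AA k\<bar> * (real n ^ 3 / real (lg n + 1))" by (simp add: abs_mult)
      also have "\<dots> \<le> \<bar>AA k\<bar> * (real n ^ 3 / ln (real n))" using ln n by (intro mult_left_mono divide_left_mono) auto
      finally show "norm (real (T n)) \<le> \<bar>AA k\<bar> * norm (real n ^ 3 / ln (real n))" using n by simp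
    qed
    moreover have "success_probability (MAIN k) q k n E w = 1" if "1 \<le> n" "simple_graph n E" for n E w
      by (rule success_probability_eq_1) (use run[OF that] in blast)
    ultimately show ?thesis by (intro exI[of _ "MAIN k"] exI[of _ q] exI[of _ T]) simp
  next
    case False
    \<comment> \<open>No cycle has fewer than three vertices, and the untouched cell
      \<open>found\<close> is 0, so doing nothing already answers \<open>None\<close>.\<close>
    have skip: "exec b Skip s 1 s" for b s by (rule exec.Skip)
    have "runs_in_time Skip 1 (\<lambda>_. 1)" unfolding runs_in_time_def using skip by blast
    moreover have "(\<lambda>n. real 1) \<in> O(\<lambda>n. real n ^ 3 / ln (real n))" by simp real_asymp
    moreover have "correct_answer k E w (answer k (input n E w \<omega>))" for n E w \<omega>
      using False by (auto simp: answer_def input_def is_cycle_def)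
    then have "success_probability Skip 1 k n E w = 1" for n E w
      by (intro success_probability_eq_1) (use skip in blast)
    ultimately show ?thesis by (intro exI[of _ Skip] exI[of _ 1] exI[of _ "\<lambda>_. 1"]) simp
  qed
qed

end
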